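(* Let $0<p,l<\infty$ and let $\mu$ be a positive Borel measure on $\mathbb C_0$. If the embedding $I_\mu:H^p_{\mathrm i}(\mathbb C_0)\to L^p(\mathbb C_0,\mu)$, $I_\mu f=f$, is compact, then $\mathbb A_{\mu,l}:\mathscr H^p\to L^p_{\mathrm i}(\mathbb T^\infty\times\mathbb R)$ is compact.
   Context: Half-plane: $\mathbb C_0=\{s\in\mathbb C:\operatorname{Re}s>0\}$, $s=\sigma+it$. The space $H^p_{\mathrm i}(\mathbb C_0)$ consists of analytic $f$ on $\mathbb C_0$ with $\|f\|^p_{H^p_{\mathrm i}(\mathbb C_0)}=\sup_{\sigma>0}\frac1\pi\int_{\mathbb R}|f(\sigma+it)|^p\frac{dt}{1+t^2}<\infty$. Hardy spaces of Dirichlet series: $\mathbb T^\infty$ is the countably infinite torus with normalized Haar measure $m_\infty$. Each $\chi=(\chi_1,\chi_2,\dots)\in\mathbb T^\infty$ is identified with the completely multiplicative function $\chi:\mathbb N\to\mathbb T$ with $\chi(\mathfrak p_j)=\chi_j$, where $\mathfrak p_j$ is the $j$-th prime. For $0<p<\infty$, $\mathscr H^p$ is the completion of the Dirichlet polynomials $P(s)=\sum_{n\le N}a_nn^{-s}$ in the (quasi-)norm $\|P\|_{\mathscr H^p}=\big(\int_{\mathbb T^\infty}|\sum_{n\le N}a_n\chi(n)|^p\,dm_\infty(\chi)\big)^{1/p}$; its elements are identified with Dirichlet series $f(s)=\sum_{n\ge1}a_nn^{-s}$. The vertical limit of $f$ is $f_\chi(s)=\sum_{n\ge1}a_n\chi(n)n^{-s}$;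 for $f\in\mathscr H^p$ it is known that for $m_\infty$-almost every $\chi$ it extends analytically to $\mathbb C_0$, and $f_\chi$ denotes this extension. Area operator: for $\tau\in\mathbb R$, $\Gamma_\tau=\{\sigma+it\in\mathbb C_0:|t-\tau|<\sigma\}$. For $0<l<\infty$ and a positive Borel measure $\mu$ on $\mathbb C_0$, $$\mathbb A_{\mu,l}f(\chi,\tau)=\Big(\int_{\Gamma_\tau}|f_\chi(s)|^l\frac{d\mu(s)}{\operatorname{Re}s}\Big)^{1/l},\quad \chi\in\mathbb T^\infty,\ \tau\in\mathbb R.$$ $L^p_{\mathrm i}=L^p_{\mathrm i}(\mathbb T^\infty\times\mathbb R)$ is the space of measurable $F$ on $\mathbb T^\infty\times\mathbb R$ with $\|F\|_{L^p_{\mathrm i}}^p=\int_{\mathbb T^\infty}\int_{\mathbb R}|F(\chi,\tau)|^p\frac{d\tau}{1+\tau^2}\,dm_\infty(\chi)<\infty$. A (possibly nonlinear) map is compact if it maps bounded sets to relatively compact sets. *)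

theory Defs
  imports "HOL-Complex_Analysis.Complex_Analysis" "HOL-Probability.Probability"
begin

section \<open>Lebesgue spaces and compact maps\<close>

text \<open>
  Functions are not quotiented by almost everywhere equality: \<open>lp_norm\<close> is a quasi-seminorm on
  \<open>lp_space\<close>, for every exponent \<open>p > 0\<close>. The \<open>p\<close>-th power (if \<open>p < 1\<close>) or the first power
  (if \<open>p \<ge> 1\<close>) of \<open>lp_norm\<close> of a difference is a pseudometric, so the balls below are a base of
  its topology. A set is relatively compact there iff its image in the quotient is.
\<close>

definition lp_space :: "'a measure \<Rightarrow> real \<Rightarrow> ('a \<Rightarrow> complex) set" where
  "lp_space M p = {F \<in> borel_measurable M. (\<integral>\<^sup>+ x. ennreal (cmod (F x) powr p) \<partial>M) < \<infinity>}"

definition lp_norm :: "'a measure \<Rightarrow> real \<Rightarrow> ('a \<Rightarrow> complex) \<Rightarrow> real" where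
  "lp_norm M p F = enn2real (\<integral>\<^sup>+ x. ennreal (cmod (F x) powr p) \<partial>M) powr (1 / p)"

definition lp_ball :: "'a measure \<Rightarrow> real \<Rightarrow> ('a \<Rightarrow> complex) \<Rightarrow> real \<Rightarrow> ('a \<Rightarrow> complex) set" where
  "lp_ball M p F e = {G \<in> lp_space M p. lp_norm M p (\<lambda>x. G x - F x) < e}"

definition lp_topology :: "'a measure \<Rightarrow> real \<Rightarrow> ('a \<Rightarrow> complex) topology" where
  "lp_topology M p = topology_generated_by {lp_ball M p F e | F e. F \<in> lp_space M p \<and> 0 < e}"

lemma topspace_lp_topology [simp]: "topspace (lp_topology M p) = lp_space M p"
proof -
  have "F \<in> lp_ball M p F 1" if "F \<in> lp_space M p" for F
    using that by (simp add: lp_ball_def lp_norm_def)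
  then have "lp_space M p \<subseteq> \<Union> {lp_ball M p F e | F e. F \<in> lp_space M p \<and> 0 < e}"
    using zero_less_one by blast
  moreover have "\<Union> {lp_ball M p F e | F e. F \<in> lp_space M p \<and> 0 < e} \<subseteq> lp_space M p"
    unfolding lp_ball_def by blast
  ultimately show ?thesis
    unfolding lp_topology_def topology_generated_by_topspace by (rule equalityI[rotated])
qed

definition relatively_compact_in :: "'a topology \<Rightarrow> 'a set \<Rightarrow> bool" where
  "relatively_compact_in X S \<longleftrightarrow> S \<subseteq> topspace X \<and> compactin X (X closure_of S)"

text \<open>
  \<open>T\<close> is a possibly nonlinear map from the space \<open>D\<close> with (quasi-)norm \<open>N\<close>. Taking \<open>B\<close> to be a
  singleton shows that \<open>T\<close> maps \<open>D\<close> into \<open>X\<close>.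
\<close>

definition compact_map :: "'a set \<Rightarrow> ('a \<Rightarrow> real) \<Rightarrow> 'b topology \<Rightarrow> ('a \<Rightarrow> 'b) \<Rightarrow> bool" where
  "compact_map D N X T \<longleftrightarrow>
     (\<forall>B \<subseteq> D. (\<exists>C. \<forall>f\<in>B. N f \<le> C) \<longrightarrow> relatively_compact_in X (T ` B))"


section \<open>The conformally invariant Hardy space of the half-plane\<close>

definition half_plane :: "complex set" where
  "half_plane = {s. 0 < Re s}"

definition hpi_integral :: "real \<Rightarrow> (complex \<Rightarrow> complex) \<Rightarrow> ennreal" where
  "hpi_integral p f =
     (SUP \<sigma>\<in>{0<..}. ennreal (1 / pi) *
        (\<integral>\<^sup>+ t. ennreal (cmod (f (Complex \<sigma> t)) powr p / (1 + t\<^sup>2)) \<partial>lborel))"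

definition hpi_space :: "real \<Rightarrow> (complex \<Rightarrow> complex) set" where
  "hpi_space p = {f. f holomorphic_on half_plane \<and> hpi_integral p f < \<infinity>}"

definition hpi_norm :: "real \<Rightarrow> (complex \<Rightarrow> complex) \<Rightarrow> real" where
  "hpi_norm p f = enn2real (hpi_integral p f) powr (1 / p)"


section \<open>The infinite torus and multiplicative characters\<close>

definition circle_measure :: "complex measure" where
  "circle_measure =
     distr (uniform_measure lborel {0..2 * pi}) (restrict_space borel (sphere 0 1)) cis"

definition torus_measure :: "(nat \<Rightarrow> complex) measure" where
  "torus_measure = (\<Pi>\<^sub>M j\<in>UNIV. circle_measure)"

text \<open>Coordinates of the torus and primes are indexed from \<open>0\<close>.\<close>

definition nth_prime :: "nat \<Rightarrow> nat" where
  "nth_prime j = enumerate {q. prime q} j"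

definition torus_char :: "(nat \<Rightarrow> complex) \<Rightarrow> nat \<Rightarrow> complex" where
  "torus_char \<omega> n = (\<Prod>j | nth_prime j dvd n. \<omega> j ^ multiplicity (nth_prime j) n)"


section \<open>Hardy spaces of Dirichlet series\<close>

text \<open>
  A Dirichlet series \<open>\<Sum>n\<ge>1. a n * n powr (-s)\<close> is represented by its coefficient sequence, with
  \<open>a 0 = 0\<close>.
\<close>

definition dirichlet_polys :: "(nat \<Rightarrow> complex) set" where
  "dirichlet_polys = {a. a 0 = 0 \<and> finite {n. a n \<noteq> 0}}"

definition dirichlet_poly_norm :: "real \<Rightarrow> (nat \<Rightarrow> complex) \<Rightarrow> real" where
  "dirichlet_poly_norm p a =
     lp_norm torus_measure p (\<lambda>\<omega>. \<Sum>n | a n \<noteq> 0. a n * torus_char \<omega> n)"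

text \<open>
  The coefficient functionals are bounded on Dirichlet polynomials, so the coefficients of a Cauchy
  sequence \<open>P\<close> converge. Their limits \<open>a\<close> are the coefficients of the element of the completion
  that \<open>P\<close> defines.
\<close>

definition completion_repr :: "real \<Rightarrow> (nat \<Rightarrow> nat \<Rightarrow> complex) \<Rightarrow> (nat \<Rightarrow> complex) \<Rightarrow> bool" where
  "completion_repr p P a \<longleftrightarrow>
     (\<forall>k. P k \<in> dirichlet_polys) \<and>
     (\<forall>e>0. \<exists>K. \<forall>j\<ge>K. \<forall>k\<ge>K. dirichlet_poly_norm p (\<lambda>n. P j n - P k n) < e) \<and>
     (\<forall>n. (\<lambda>k. P k n) \<longlonglongrightarrow> a n)"

definition dirichlet_hardy :: "real \<Rightarrow> (nat \<Rightarrow> complex) set" where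
  "dirichlet_hardy p = {a. \<exists>P. completion_repr p P a}"

text \<open>
  An element of the completion is determined by its coefficients, so for \<open>a\<close> in the space the set
  below has exactly one element, the norm in the completion; \<open>Inf\<close> merely extracts it.
\<close>

definition dirichlet_hardy_norm :: "real \<Rightarrow> (nat \<Rightarrow> complex) \<Rightarrow> real" where
  "dirichlet_hardy_norm p a =
     Inf {r. \<exists>P. completion_repr p P a \<and> (\<lambda>k. dirichlet_poly_norm p (P k)) \<longlonglongrightarrow> r}"

definition is_vertical_limit ::
    "(nat \<Rightarrow> complex) \<Rightarrow> (nat \<Rightarrow> complex) \<Rightarrow> (complex \<Rightarrow> complex) \<Rightarrow> bool" where
  "is_vertical_limit a \<omega> g \<longleftrightarrow>
     g holomorphic_on half_plane \<and>
     (\<exists>\<sigma>\<^sub>0>0. \<forall>s. Re s > \<sigma>\<^sub>0 \<longrightarrow>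
        (\<lambda>n. a n * torus_char \<omega> n * of_nat n powr (- s)) sums g s)"

text \<open>
  The extension is unique on the half-plane. For the null set of \<open>\<omega>\<close> without an extension the
  value is \<open>0\<close>.
\<close>

definition vertical_limit ::
    "(nat \<Rightarrow> complex) \<Rightarrow> (nat \<Rightarrow> complex) \<Rightarrow> complex \<Rightarrow> complex" where
  "vertical_limit a \<omega> s =
     (if \<exists>g. is_vertical_limit a \<omega> g then (SOME g. is_vertical_limit a \<omega> g) s else 0)"


section \<open>The area operator\<close>

definition cone :: "real \<Rightarrow> complex set" where
  "cone \<tau> = {s \<in> half_plane. \<bar>Im s - \<tau>\<bar> < Re s}"

definition area_integral ::
    "complex measure \<Rightarrow> real \<Rightarrow> (nat \<Rightarrow> complex) \<Rightarrow> (nat \<Rightarrow> complex) \<times> real \<Rightarrow> ennreal" where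
  "area_integral \<mu> l a = (\<lambda>(\<omega>, \<tau>).
     \<integral>\<^sup>+ s\<in>cone \<tau>. ennreal (cmod (vertical_limit a \<omega> s) powr l / Re s) \<partial>\<mu>)"

text \<open>
  \<open>enn2real\<close> maps \<open>\<infinity>\<close> to \<open>0\<close>, so that this function lies in an \<open>L\<^sup>p\<close> space does not imply that
  \<open>area_integral\<close> is finite almost everywhere; that has to be stated separately.
\<close>

definition area_operator ::
    "complex measure \<Rightarrow> real \<Rightarrow> (nat \<Rightarrow> complex) \<Rightarrow> (nat \<Rightarrow> complex) \<times> real \<Rightarrow> complex" where
  "area_operator \<mu> l a x = complex_of_real (enn2real (area_integral \<mu> l a x) powr (1 / l))"

text \<open>
  The measure is completed because vertical limits are only defined for almost every \<open>\<omega>\<close>.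
\<close>

definition torus_line_measure :: "((nat \<Rightarrow> complex) \<times> real) measure" where
  "torus_line_measure =
     completion (torus_measure \<Otimes>\<^sub>M density lborel (\<lambda>\<tau>. ennreal (1 / (1 + \<tau>\<^sup>2))))"

end

theory Submission
  imports Defs "HOL-Computational_Algebra.Fundamental_Theorem_Algebra"
begin

text \<open>
  The key estimate, for Dirichlet polynomials \<open>P\<close> and every \<open>\<kappa> > 0\<close>, is
  \<open>\<parallel>A P\<parallel>\<^sup>p \<le> \<kappa> \<parallel>P\<parallel>\<^sup>p + K \<integral> \<parallel>P (\<cdot> + Re s)\<parallel>\<^sup>p d\<mu>\<close> with \<open>K\<close> depending on \<open>\<kappa>\<close>.
  Testing the embedding on powers of analytic completions of \<open>g \<ge> 0\<close> and dualizing bounds the area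
  function with a small exponent \<open>l\<^sub>0 \<le> p/2\<close> in place of \<open>l\<close>, even by \<open>L\<^sup>p(\<mu>)\<close>-norms. The remaining power
  \<open>l - l\<^sub>0\<close> of \<open>|P|\<close> is replaced by its supremum over the cone, which is controlled by an
  \<open>L\<^sup>2\<close>-bounded maximal function along the flow \<open>\<chi> \<mapsto> (n \<mapsto> \<chi>(n) n\<^sup>-\<^sup>i\<^sup>\<tau>)\<close> of the torus, and Young's
  inequality separates the two factors.

  The integral against \<open>\<mu>\<close> is a compact perturbation: \<open>\<mu>\<close> is finite, so the strip \<open>Re s < \<delta>\<close> contributes
  little, and on \<open>Re s \<ge> \<delta>\<close> the unit ball is totally bounded by Montel's theorem. The maximal
  function also gives convergence of a fast Cauchy sequence of polynomials to the vertical limit,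
  locally uniformly for almost every character, and Fatou's lemma then extends the estimate to the
  completion.
\<close>

section \<open>Powers of extended nonnegative reals and \<open>L\<^sup>p\<close> spaces\<close>

text \<open>The area operator is nonlinear, and \<open>p\<close> and \<open>l\<close> may lie below
  1, so no triangle inequality is at hand. It is replaced by bounds (x + y)^r \<le> (1 + k)^r x^r +
  (1 + 1/k)^r y^r, whose first constant can be brought close to 1. The small exponent is at most p/2
  because then r = p/l0 \<ge> 2 has its conjugate q in (1, 2], the range in which |z|^q can be
  compared with (Re z)^q and Re (z^q) on the right half-plane. An analytic completion h of g has
  positive real part, so h^(q/p) is analytic for every p, and testing on it turns an embedding with
  exponent p into an estimate with exponent q > 1, where duality is available. The complementary
  factor is measured through |P|^(p/2): it has the sub-mean value property for every p, and its
  square is |P|^p, so an L^2 maximal theorem suffices. That theorem is proved on the torus because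
  the flow preserves Haar measure: its bound is the same at every vertex of a cone, and the weight
  1/(1 + \<tau>^2) contributes only its mass pi. The free factor \<kappa> is what makes the estimate
  usable for compactness: the maximal term sees the boundary norm, which stays bounded but does not
  become small when two functions are close inside the half-plane.\<close>

definition epow :: "ennreal \<Rightarrow> real \<Rightarrow> ennreal" where
  "epow x r = (if x = \<top> then \<top> else ennreal (enn2real x powr r))"

lemma epow_ennreal [simp]: "0 \<le> x \<Longrightarrow> epow (ennreal x) r = ennreal (x powr r)"
  by (simp add: epow_def)

lemma epow_top [simp]: "epow \<top> r = \<top>"
  by (simp add: epow_def)

lemma epow_0 [simp]: "epow 0 r = 0"
  by (simp add: epow_def)

lemma epow_mono:
  assumes "0 \<le> r" "x \<le> y" shows "epow x r \<le> epow y r"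
proof (cases "y = \<top>")
  case False
  then have "x \<noteq> \<top>" using assms(2) by (auto simp: top_unique)
  then show ?thesis using False assms
    by (auto simp: epow_def less_top intro!: ennreal_leI powr_mono2 enn2real_mono)
qed simp

lemma epow_epow:
  assumes "0 < a" shows "epow (epow x a) b = epow x (a * b)"
  by (cases x) (auto simp: powr_powr)

lemma epow_1 [simp]: "epow x 1 = x"
  by (cases x) auto

text \<open>A monotone map onto the whole ordered space has no jumps; the power with exponent
  \<open>1 / r\<close> supplies the preimages.\<close>

lemma continuous_epow:
  assumes "0 < r" shows "continuous_on UNIV (\<lambda>x. epow x r)"
proof (rule continuous_onI_mono)
  have "epow (epow y (1/r)) r = y" for y using assms by (subst epow_epow) auto
  then have "range (\<lambda>x. epow x r) = UNIV" by (metis surjI)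
  then show "open (range (\<lambda>x. epow x r))" by simp
qed (use assms epow_mono in auto)

lemma tendsto_epow:
  assumes "0 < r" "(f \<longlongrightarrow> x) F" shows "((\<lambda>n. epow (f n) r) \<longlongrightarrow> epow x r) F"
  using continuous_on_tendsto_compose[OF continuous_epow[OF assms(1)] assms(2)] by auto

lemma epow_measurable [measurable]:
  assumes f [measurable]: "f \<in> borel_measurable M"
  shows "(\<lambda>x. epow (f x) r) \<in> borel_measurable M"
proof -
  have "f -` {\<top>} \<inter> space M \<in> sets M" using f by (rule measurable_sets) simp
  then have [measurable]: "{x \<in> space M. f x = \<top>} \<in> sets M" by (simp add: vimage_def Int_def conj_commute)
  show ?thesis unfolding epow_def by measurable
qed

lemma epow_mult:
  assumes "0 < r" shows "epow (x * y) r = epow x r * epow y r"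
proof (cases "x = \<top> \<or> y = \<top>")
  case True
  then show ?thesis using assms
    by (auto simp: ennreal_top_mult ennreal_mult_top epow_def)
       (auto simp: enn2real_eq_0_iff)
next
  case False
  then show ?thesis
    by (cases x; cases y) (auto simp: ennreal_mult[symmetric] powr_mult)
qed

text \<open>Either \<open>y \<le> k * x\<close> or \<open>x \<le> y / k\<close>, and one of the two
  summands controls the sum. The bound serves all exponents, below and above 1. Letting
  \<open>k\<close> tend to 0 brings the first constant to 1 at the price of the second.\<close>

lemma epow_add_le:
  assumes r: "0 < r" and k: "0 < k"
  shows "epow (x + y) r \<le> ennreal ((1 + k) powr r) * epow x r + ennreal ((1 + 1/k) powr r) * epow y r"
proof (cases "y \<le> ennreal k * x")
  case True
  then have "x + y \<le> ennreal 1 * x + ennreal k * x" by (simp add: add_left_mono)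
  also have "\<dots> = ennreal (1 + k) * x" using k by (simp add: distrib_right)
  finally have "x + y \<le> ennreal (1 + k) * x" .
  then have "epow (x + y) r \<le> epow (ennreal (1 + k) * x) r" using r by (intro epow_mono) auto
  also have "\<dots> = ennreal ((1 + k) powr r) * epow x r" using r k by (simp add: epow_mult del: ennreal_plus)
  finally show ?thesis by (simp add: add_increasing2)
next
  case False
  have "ennreal (1/k) * (ennreal k * x) = x" using k by (simp add: mult.assoc[symmetric] ennreal_mult[symmetric])
  then have "x \<le> ennreal (1/k) * y" using False by (metis less_imp_le linorder_not_le mult_left_mono zero_le)
  then have "x + y \<le> ennreal (1/k) * y + ennreal 1 * y" by (simp add: add_right_mono)
  also have "\<dots> = ennreal (1 + 1/k) * y" using k by (simp add: distrib_right add.commute)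
  finally have "x + y \<le> ennreal (1 + 1/k) * y" .
  then have "epow (x + y) r \<le> epow (ennreal (1 + 1/k) * y) r" using r by (intro epow_mono) auto
  also have "\<dots> = ennreal ((1 + 1/k) powr r) * epow y r" using r k by (simp add: epow_mult del: ennreal_plus)
  finally show ?thesis by (simp add: add_increasing)
qed

text \<open>A weighted Young inequality, from the same case distinction on
  \<open>y \<le> k * x\<close>. A small \<open>k\<close> gives \<open>x\<close> a small coefficient
  and \<open>y\<close> a large one.\<close>

lemma epow_interpolation:
  assumes \<theta>: "0 < \<theta>" "\<theta> < 1" and k: "0 < k"
  shows "epow x \<theta> * epow y (1 - \<theta>) \<le> ennreal (k powr (1 - \<theta>)) * x + ennreal (k powr (- \<theta>)) * y"
proof (cases "y \<le> ennreal k * x")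
  case True
  have "epow x \<theta> * epow y (1 - \<theta>) \<le> epow x \<theta> * epow (ennreal k * x) (1 - \<theta>)"
    using True \<theta> by (intro mult_left_mono epow_mono) auto
  also have "\<dots> = ennreal (k powr (1 - \<theta>)) * (epow x \<theta> * epow x (1 - \<theta>))"
    using \<theta> k by (simp add: epow_mult mult_ac)
  also have "epow x \<theta> * epow x (1 - \<theta>) = x"
    using \<theta> by (cases x) (auto simp: ennreal_mult[symmetric] powr_add[symmetric] ennreal_top_mult)
  finally show ?thesis by (simp add: add_increasing2)
next
  case False
  have "ennreal (1/k) * (ennreal k * x) = x" using k by (simp add: mult.assoc[symmetric] ennreal_mult[symmetric])
  then have "x \<le> ennreal (1/k) * y" using False by (metis less_imp_le linorder_not_le mult_left_mono zero_le)
  then have "epow x \<theta> * epow y (1 - \<theta>) \<le> epow (ennreal (1/k) * y) \<theta> * epow y (1 - \<theta>)"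
    using \<theta> by (intro mult_right_mono epow_mono) auto
  also have "\<dots> = ennreal ((1/k) powr \<theta>) * (epow y \<theta> * epow y (1 - \<theta>))"
    using \<theta> k by (simp add: epow_mult mult_ac)
  also have "epow y \<theta> * epow y (1 - \<theta>) = y"
    using \<theta> by (cases y) (auto simp: ennreal_mult[symmetric] powr_add[symmetric] ennreal_top_mult)
  also have "(1/k) powr \<theta> = k powr (- \<theta>)" using k powr_divide[of 1 k \<theta>] by (simp add: powr_minus_divide)
  finally show ?thesis by (simp add: add_increasing)
qed

section \<open>Quasi-norms for all positive exponents and their topology\<close>

definition lp_pow :: "'a measure \<Rightarrow> real \<Rightarrow> ('a \<Rightarrow> complex) \<Rightarrow> ennreal" where
  "lp_pow M p F = (\<integral>\<^sup>+x. ennreal (cmod (F x) powr p) \<partial>M)"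

context
  fixes M :: "'a measure" and p :: real
  assumes p: "0 < p"
begin

lemma lp_pow_add_le:
  assumes [measurable]: "F \<in> borel_measurable M" "G \<in> borel_measurable M" and k: "0 < k"
  shows "lp_pow M p (\<lambda>x. F x + G x) \<le> ennreal ((1 + k) powr p) * lp_pow M p F + ennreal ((1 + 1/k) powr p) * lp_pow M p G"
proof -
  have "lp_pow M p (\<lambda>x. F x + G x) \<le> (\<integral>\<^sup>+x. ennreal ((1 + k) powr p) * ennreal (cmod (F x) powr p) + ennreal ((1 + 1/k) powr p) * ennreal (cmod (G x) powr p) \<partial>M)"
    unfolding lp_pow_def
  proof (rule nn_integral_mono)
    fix x
    have "ennreal (cmod (F x + G x) powr p) \<le> epow (ennreal (cmod (F x)) + ennreal (cmod (G x))) p"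
      using p norm_triangle_ineq[of "F x" "G x"] by (simp add: ennreal_plus[symmetric] del: ennreal_plus) (intro ennreal_leI powr_mono2, auto)
    also have "\<dots> \<le> ennreal ((1 + k) powr p) * epow (ennreal (cmod (F x))) p + ennreal ((1 + 1/k) powr p) * epow (ennreal (cmod (G x))) p"
      by (rule epow_add_le[OF p k])
    finally show "ennreal (cmod (F x + G x) powr p) \<le> ennreal ((1 + k) powr p) * ennreal (cmod (F x) powr p) + ennreal ((1 + 1/k) powr p) * ennreal (cmod (G x) powr p)"
      by simp
  qed
  also have "\<dots> = ennreal ((1 + k) powr p) * lp_pow M p F + ennreal ((1 + 1/k) powr p) * lp_pow M p G"
    unfolding lp_pow_def by (subst nn_integral_add) (auto simp: nn_integral_cmult)
  finally show ?thesis .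
qed

lemma lp_pow_minus: "lp_pow M p (\<lambda>x. F x - G x) = lp_pow M p (\<lambda>x. G x - F x)"
  by (simp add: lp_pow_def norm_minus_commute)

lemma lp_pow_triangle:
  assumes m: "F \<in> borel_measurable M" "G \<in> borel_measurable M" "H \<in> borel_measurable M"
  shows "lp_pow M p (\<lambda>x. F x - H x) \<le> ennreal (2 powr p) * (lp_pow M p (\<lambda>x. F x - G x) + lp_pow M p (\<lambda>x. G x - H x))"
proof -
  note m [measurable]
  have "lp_pow M p (\<lambda>x. (F x - G x) + (G x - H x)) \<le> ennreal ((1 + 1) powr p) * lp_pow M p (\<lambda>x. F x - G x) + ennreal ((1 + 1/1) powr p) * lp_pow M p (\<lambda>x. G x - H x)"
    by (rule lp_pow_add_le) auto
  then show ?thesis by (simp add: distrib_left)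
qed

lemma lp_space_measurable: "F \<in> lp_space M p \<Longrightarrow> F \<in> borel_measurable M"
  by (simp add: lp_space_def)

lemma lp_space_iff: "F \<in> lp_space M p \<longleftrightarrow> F \<in> borel_measurable M \<and> lp_pow M p F < \<infinity>"
  by (simp add: lp_space_def lp_pow_def)

lemma lp_space_diff:
  assumes "F \<in> lp_space M p" "G \<in> lp_space M p"
  shows "(\<lambda>x. F x - G x) \<in> lp_space M p"
proof -
  have "lp_pow M p (\<lambda>x. F x - G x) \<le> ennreal (2 powr p) * (lp_pow M p (\<lambda>x. F x - 0) + lp_pow M p (\<lambda>x. 0 - G x))"
    using assms by (intro lp_pow_triangle) (auto simp: lp_space_iff)
  also have "\<dots> < \<infinity>" using assms lp_pow_minus[of "\<lambda>_. 0" G]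
    by (simp add: lp_space_iff ennreal_mult_less_top)
  finally show ?thesis using assms by (simp add: lp_space_iff borel_measurable_diff)
qed

lemma lp_norm_less_iff:
  assumes "F \<in> lp_space M p" and e: "0 < e"
  shows "lp_norm M p F < e \<longleftrightarrow> lp_pow M p F < ennreal (e powr p)"
proof -
  obtain y where y: "0 \<le> y" "lp_pow M p F = ennreal y" using assms by (cases "lp_pow M p F") (auto simp: lp_space_iff)
  have "lp_norm M p F = y powr (1/p)" using y by (simp add: lp_norm_def lp_pow_def[symmetric])
  moreover have "y powr (1/p) < e \<longleftrightarrow> y < e powr p"
  proof -
    have "(y powr (1/p)) powr p = y" using y p by (simp add: powr_powr)
    then show ?thesis using powr_less_mono2[of p "y powr (1/p)" e] powr_mono2[of p e "y powr (1/p)"] p e y by (smt (verit) powr_ge_zero)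
  qed
  ultimately show ?thesis using y by (simp add: ennreal_less_iff)
qed

lemma lp_ball_iff:
  assumes "F \<in> lp_space M p" "0 < e"
  shows "G \<in> lp_ball M p F e \<longleftrightarrow> G \<in> lp_space M p \<and> lp_pow M p (\<lambda>x. G x - F x) < ennreal (e powr p)"
  using lp_norm_less_iff[OF lp_space_diff[of G F] assms(2)] assms by (auto simp: lp_ball_def)

lemma openin_lp_ball: "F \<in> lp_space M p \<Longrightarrow> 0 < e \<Longrightarrow> openin (lp_topology M p) (lp_ball M p F e)"
  unfolding lp_topology_def by (rule topology_generated_by_Basis) blast

text \<open>The constant \<open>2 powr p\<close> of the quasi-triangle inequality would be too large
  here. Since \<open>G\<close> lies strictly inside the ball, there is room for the factor
  \<open>(1 + k) powr p\<close> with small \<open>k\<close>, and the other constant only shrinks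
  \<open>\<delta>\<close>.\<close>

lemma lp_ball_absorbs:
  assumes F: "F \<in> lp_space M p" and e: "0 < e" and G: "G \<in> lp_ball M p F e"
  obtains \<delta> where "0 < \<delta>" "\<And>H. H \<in> lp_space M p \<Longrightarrow> lp_pow M p (\<lambda>x. H x - G x) < ennreal \<delta> \<Longrightarrow> H \<in> lp_ball M p F e"
proof -
  have G': "G \<in> lp_space M p" "lp_pow M p (\<lambda>x. G x - F x) < ennreal (e powr p)" using G lp_ball_iff[OF F e] by auto
  obtain y where y: "0 \<le> y" "lp_pow M p (\<lambda>x. G x - F x) = ennreal y" using lp_space_diff[OF G'(1) F]
    by (cases "lp_pow M p (\<lambda>x. G x - F x)") (auto simp: lp_space_iff)
  have ye: "y < e powr p" using G' y by (simp add: ennreal_less_iff)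
  have "((\<lambda>k. (1 + k) powr p * y) \<longlongrightarrow> (1 + 0) powr p * y) (at_right 0)"
    by (intro tendsto_intros) auto
  then have "\<forall>\<^sub>F k in at_right 0. (1 + k) powr p * y < e powr p"
    using ye by (intro order_tendstoD(2)) auto
  then have "\<forall>\<^sub>F k in at_right 0. (1 + k) powr p * y < e powr p \<and> (0::real) < k"
    by (intro eventually_conj eventually_at_right_less)
  then obtain k where k: "(1 + k) powr p * y < e powr p" "0 < k"
    using eventually_happens'[OF trivial_limit_at_right_real[of 0]] by blast
  define c where "c = (1 + 1/k) powr p"
  have "0 < 1 / k" using k by simp
  then have "1 + 1 / k \<noteq> 0" by linarith
  then have c: "0 < c" by (simp add: c_def)
  define \<delta> where "\<delta> = (e powr p - (1 + k) powr p * y) / c"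
  have \<delta>: "0 < \<delta>" using k c by (simp add: \<delta>_def)
  show ?thesis
  proof (rule that[OF \<delta>])
    fix H assume H: "H \<in> lp_space M p" "lp_pow M p (\<lambda>x. H x - G x) < ennreal \<delta>"
    then obtain h where h: "0 \<le> h" "lp_pow M p (\<lambda>x. H x - G x) = ennreal h" by (cases "lp_pow M p (\<lambda>x. H x - G x)") auto
    have hd: "h < \<delta>" using H h by (simp add: ennreal_less_iff)
    have [measurable]: "F \<in> borel_measurable M" "G \<in> borel_measurable M" "H \<in> borel_measurable M"
      using F G' H by (auto intro: lp_space_measurable)
    have "lp_pow M p (\<lambda>x. (G x - F x) + (H x - G x)) \<le> ennreal ((1 + k) powr p) * lp_pow M p (\<lambda>x. G x - F x) + ennreal ((1 + 1/k) powr p) * lp_pow M p (\<lambda>x. H x - G x)"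
      by (rule lp_pow_add_le) (auto simp: k)
    also have "\<dots> = ennreal ((1 + k) powr p * y + c * h)"
      unfolding y h using y h by (simp add: c_def ennreal_mult' ennreal_plus)
    also have "\<dots> < ennreal (e powr p)"
    proof (rule ennreal_lessI)
      have "c * h < c * \<delta>" using hd c by simp
      then show "(1 + k) powr p * y + c * h < e powr p" using c by (simp add: \<delta>_def)
      show "0 < e powr p" using e by simp
    qed
    finally show "H \<in> lp_ball M p F e" using H lp_ball_iff[OF F e] by simp
  qed
qed

text \<open>Induction over the generation of the topology from balls. It recovers the description of
  neighbourhoods by \<open>lp_pow\<close>, the property of open sets on which the compactness proof
  rests.\<close>

lemma openin_lp_absorbs:
  assumes "openin (lp_topology M p) U" "G \<in> U"
  shows "\<exists>\<delta>>0. \<forall>H. H \<in> lp_space M p \<longrightarrow> lp_pow M p (\<lambda>x. H x - G x) < ennreal \<delta> \<longrightarrow> H \<in> U"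
proof -
  have "generate_topology_on {lp_ball M p F e | F e. F \<in> lp_space M p \<and> 0 < e} U"
    using assms(1) unfolding lp_topology_def openin_topology_generated_by_iff .
  then show ?thesis using assms(2)
  proof (induction arbitrary: G)
    case Empty
    then show ?case by simp
  next
    case (Int a b)
    obtain d1 where d1: "0 < d1" "\<And>H. H \<in> lp_space M p \<Longrightarrow> lp_pow M p (\<lambda>x. H x - G x) < ennreal d1 \<Longrightarrow> H \<in> a"
      using Int.IH(1)[of G] Int.prems by blast
    obtain d2 where d2: "0 < d2" "\<And>H. H \<in> lp_space M p \<Longrightarrow> lp_pow M p (\<lambda>x. H x - G x) < ennreal d2 \<Longrightarrow> H \<in> b"
      using Int.IH(2)[of G] Int.prems by blast
    have "ennreal (min d1 d2) \<le> ennreal d1" "ennreal (min d1 d2) \<le> ennreal d2" by (auto intro: ennreal_leI)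
    then have "H \<in> a \<inter> b" if "H \<in> lp_space M p" "lp_pow M p (\<lambda>x. H x - G x) < ennreal (min d1 d2)" for H
      using d1(2)[OF that(1)] d2(2)[OF that(1)] less_le_trans[OF that(2)] by blast
    then show ?case using d1(1) d2(1) by (intro exI[of _ "min d1 d2"]) simp
  next
    case (UN K)
    then obtain A where A: "A \<in> K" "G \<in> A" by blast
    then show ?case using UN.IH[OF A] by blast
  next
    case (Basis s)
    then obtain F e where F: "F \<in> lp_space M p" "0 < e" "s = lp_ball M p F e" by blast
    obtain \<delta> where "0 < \<delta>" "\<And>H. H \<in> lp_space M p \<Longrightarrow> lp_pow M p (\<lambda>x. H x - G x) < ennreal \<delta> \<Longrightarrow> H \<in> lp_ball M p F e"
      using lp_ball_absorbs[OF F(1,2)] Basis.prems F(3) by metis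
    then show ?case using F(3) by blast
  qed
qed

text \<open>Weighted by \<open>2 ^ k\<close>, the integrals still form a convergent geometric
  series. Hence for almost every point the weighted values have a finite sum, which serves as
  \<open>B\<close>.\<close>

lemma geometric_AE_bound:
  fixes f :: "nat \<Rightarrow> 'a \<Rightarrow> ennreal"
  assumes [measurable]: "\<And>k. f k \<in> borel_measurable M" and le: "\<And>k. (\<integral>\<^sup>+x. f k x \<partial>M) \<le> ennreal (C * (1/4) ^ k)" and C: "0 \<le> C"
  shows "AE x in M. \<exists>B\<ge>0. \<forall>k. f k x \<le> ennreal (B * (1/2) ^ k)"
proof -
  have "(\<integral>\<^sup>+x. (\<Sum>k. ennreal (2 ^ k) * f k x) \<partial>M) = (\<Sum>k. \<integral>\<^sup>+x. ennreal (2 ^ k) * f k x \<partial>M)"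
    by (rule nn_integral_suminf) measurable
  also have "\<dots> \<le> (\<Sum>k. ennreal (C * (1/2) ^ k))"
  proof (rule suminf_le)
    fix k
    have "(\<integral>\<^sup>+x. ennreal (2 ^ k) * f k x \<partial>M) = ennreal (2 ^ k) * (\<integral>\<^sup>+x. f k x \<partial>M)" by (rule nn_integral_cmult) measurable
    also have "\<dots> \<le> ennreal (2 ^ k) * ennreal (C * (1/4) ^ k)" by (intro mult_left_mono le) auto
    also have "\<dots> = ennreal (C * (1/2) ^ k)"
    proof -
      have "(2::real) ^ k * (1/4) ^ k = (1/2) ^ k" by (simp add: power_mult_distrib[symmetric])
      then have "2 ^ k * (C * (1/4) ^ k) = C * (1/2) ^ k" by (simp add: mult.left_commute)
      then show ?thesis by (simp only: ennreal_mult'[symmetric] zero_le_power zero_le_numeral)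
    qed
    finally show "(\<integral>\<^sup>+x. ennreal (2 ^ k) * f k x \<partial>M) \<le> ennreal (C * (1/2) ^ k)" .
  qed auto
  also have "\<dots> < \<infinity>"
  proof -
    have "summable (\<lambda>k. C * (1/2::real) ^ k)" by (intro summable_mult summable_geometric) auto
    then show ?thesis using C by (subst suminf_ennreal2) auto
  qed
  finally have "AE x in M. (\<Sum>k. ennreal (2 ^ k) * f k x) \<noteq> \<infinity>"
    by (intro nn_integral_noteq_infinite) auto
  then show ?thesis
  proof eventually_elim
    case (elim x)
    define B where "B = enn2real (\<Sum>k. ennreal (2 ^ k) * f k x)"
    have B: "ennreal B = (\<Sum>k. ennreal (2 ^ k) * f k x)" unfolding B_def using elim by (simp add: less_top)
    have "f k x \<le> ennreal (B * (1/2) ^ k)" for k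
    proof -
      have "ennreal (2 ^ k) * f k x \<le> ennreal B" unfolding B
        using sum_le_suminf[of "\<lambda>k. ennreal (2 ^ k) * f k x" "{k}"] by simp
      then have "ennreal ((1/2) ^ k) * (ennreal (2 ^ k) * f k x) \<le> ennreal ((1/2) ^ k) * ennreal B" by (intro mult_left_mono) auto
      moreover have "ennreal ((1/2) ^ k) * (ennreal (2 ^ k) * f k x) = f k x"
      proof -
        have "(1/2::real) ^ k * 2 ^ k = 1" by (simp add: power_mult_distrib[symmetric])
        then have "ennreal ((1/2) ^ k) * ennreal (2 ^ k) = 1" by (simp only: ennreal_mult'[symmetric] zero_le_power ennreal_1)
        then show ?thesis by (simp add: mult.assoc[symmetric])
      qed
      moreover have "ennreal ((1/2) ^ k) * ennreal B = ennreal (B * (1/2) ^ k)"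
        by (subst mult.commute) (rule ennreal_mult''[symmetric], simp)
      ultimately show ?thesis by (simp only:)
    qed
    then show ?case by (intro exI[of _ B]) (auto simp: B_def)
  qed
qed

text \<open>The rate \<open>(1/4) ^ j\<close> makes the increments summable almost everywhere even
  after p-th roots, so pointwise convergence does not depend on a triangle inequality for the norm.
  Fatou's lemma passes the Cauchy bounds on to the limit.\<close>

lemma riesz_fischer:
  assumes F: "\<And>k. F k \<in> lp_space M p"
    and cauchy: "\<And>j k. j \<le> k \<Longrightarrow> lp_pow M p (\<lambda>x. F k x - F j x) \<le> ennreal ((1/4) ^ j)"
  obtains G where "G \<in> lp_space M p" "\<And>j. lp_pow M p (\<lambda>x. G x - F j x) \<le> ennreal ((1/4) ^ j)"
proof -
  have Fm [measurable]: "F k \<in> borel_measurable M" for k using F by (rule lp_space_measurable)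
  have "AE x in M. \<exists>B\<ge>0. \<forall>k. ennreal (cmod (F (Suc k) x - F k x) powr p) \<le> ennreal (B * (1/2) ^ k)"
    using cauchy[of _ "Suc _"] by (intro geometric_AE_bound[of _ 1]) (auto simp: lp_pow_def)
  then have conv: "AE x in M. convergent (\<lambda>k. F k x)"
  proof eventually_elim
    case (elim x)
    then obtain B where B: "0 \<le> B" "\<And>k. ennreal (cmod (F (Suc k) x - F k x) powr p) \<le> ennreal (B * (1/2) ^ k)" by blast
    \<comment> \<open>Taking p-th roots turns the ratio 1/2 into this one, which is still below
      1.\<close>
    define \<rho> where "\<rho> = (1/2::real) powr (1/p)"
    have "1 / p * ln (1/2::real) < 0" using p by (intro mult_pos_neg) auto
    then have \<rho>: "0 < \<rho>" "\<rho> < 1" by (simp_all add: \<rho>_def powr_def)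
    have le: "cmod (F (Suc k) x - F k x) \<le> B powr (1/p) * \<rho> ^ k" for k
    proof -
      have "cmod (F (Suc k) x - F k x) powr p \<le> B * (1/2) ^ k"
        using B(2)[of k] B(1) by (subst (asm) ennreal_le_iff) auto
      then have "(cmod (F (Suc k) x - F k x) powr p) powr (1/p) \<le> (B * (1/2) ^ k) powr (1/p)"
        using p by (intro powr_mono2) auto
      moreover have "((1/2::real) ^ k) powr (1/p) = \<rho> ^ k"
        by (simp add: \<rho>_def powr_realpow[symmetric] powr_powr mult.commute del: powr_realpow)
      ultimately show ?thesis using p B by (simp add: powr_powr powr_mult)
    qed
    have "summable (\<lambda>k. B powr (1/p) * \<rho> ^ k)" using \<rho> by (intro summable_mult summable_geometric) auto
    then have "summable (\<lambda>k. F (Suc k) x - F k x)" 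
      by (rule summable_comparison_test'[where N = 0]) (rule le)
    then have "convergent (\<lambda>n. \<Sum>k<n. F (Suc k) x - F k x)" by (simp add: summable_iff_convergent)
    moreover have "(\<Sum>k<n. F (Suc k) x - F k x) = F n x - F 0 x" for n
      by (rule sum_lessThan_telescope[of "\<lambda>k. F k x"])
    ultimately have "convergent (\<lambda>n. F n x - F 0 x)" by simp
    then show ?case by (simp add: convergent_diff_const_right_iff)
  qed
  define G where "G x = lim (\<lambda>k. F k x)" for x
  have Gm [measurable]: "G \<in> borel_measurable M" unfolding G_def[abs_def] by measurable
  have lim: "AE x in M. (\<lambda>k. F k x) \<longlonglongrightarrow> G x"
    using conv by eventually_elim (simp add: G_def convergent_LIMSEQ_iff)
  have le: "lp_pow M p (\<lambda>x. G x - F j x) \<le> ennreal ((1/4) ^ j)" for j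
  proof -
    have "lp_pow M p (\<lambda>x. G x - F j x) = (\<integral>\<^sup>+x. liminf (\<lambda>k. ennreal (cmod (F k x - F j x) powr p)) \<partial>M)"
      unfolding lp_pow_def
    proof (rule nn_integral_cong_AE)
      show "AE x in M. ennreal (cmod (G x - F j x) powr p) = liminf (\<lambda>k. ennreal (cmod (F k x - F j x) powr p))"
        using lim
      proof eventually_elim
        case (elim x)
        have "(\<lambda>k. ennreal (cmod (F k x - F j x) powr p)) \<longlonglongrightarrow> ennreal (cmod (G x - F j x) powr p)"
          using p by (intro tendsto_intros tendsto_powr' elim) auto
        then show ?case by (rule lim_imp_Liminf[OF trivial_limit_sequentially, symmetric])
      qed
    qed
    also have "\<dots> \<le> liminf (\<lambda>k. lp_pow M p (\<lambda>x. F k x - F j x))"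
      unfolding lp_pow_def by (rule nn_integral_liminf) measurable
    also have "\<dots> \<le> ennreal ((1/4) ^ j)"
      using cauchy[of j] by (intro Liminf_le) (auto simp: eventually_sequentially)
    finally show ?thesis .
  qed
  have "G \<in> lp_space M p"
  proof -
    have "lp_pow M p (\<lambda>x. G x - 0) \<le> ennreal (2 powr p) * (lp_pow M p (\<lambda>x. G x - F 0 x) + lp_pow M p (\<lambda>x. F 0 x - 0))"
      by (rule lp_pow_triangle) auto
    also have "\<dots> < \<infinity>" using le_less_trans[OF le[of 0]] F[of 0] by (simp add: lp_space_iff ennreal_mult_less_top)
    finally show ?thesis by (simp add: lp_space_iff)
  qed
  then show ?thesis using le that by blast
qed

text \<open>Total boundedness and completeness give compactness of the closure. As the topology
  comes from a quasi-seminorm, the classical argument is carried out directly: a set without a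
  finite subcover contains such subsets of arbitrarily small diameter, and these shrink to a point
  with a whole neighbourhood inside one member of the cover.\<close>

theorem lp_relatively_compact:
  assumes S: "S \<subseteq> lp_space M p"
    and net: "\<And>\<epsilon>. 0 < \<epsilon> \<Longrightarrow> \<exists>Y. finite Y \<and> Y \<subseteq> lp_space M p \<and> (\<forall>F\<in>S. \<exists>G\<in>Y. lp_pow M p (\<lambda>x. F x - G x) \<le> ennreal \<epsilon>)"
  shows "relatively_compact_in (lp_topology M p) S"
proof -
  let ?X = "lp_topology M p"
  define C where "C = ?X closure_of S"
  define c where "c = 2 powr p"
  have c: "0 < c" by (simp add: c_def)
  have tri: "lp_pow M p (\<lambda>x. F x - H x) \<le> ennreal (c * (a + b))"
    if "lp_pow M p (\<lambda>x. F x - G x) \<le> ennreal a" "lp_pow M p (\<lambda>x. G x - H x) \<le> ennreal b" "0 \<le> a" "0 \<le> b"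
      "F \<in> lp_space M p" "G \<in> lp_space M p" "H \<in> lp_space M p" for F G H a b
  proof -
    have "lp_pow M p (\<lambda>x. F x - H x) \<le> ennreal c * (lp_pow M p (\<lambda>x. F x - G x) + lp_pow M p (\<lambda>x. G x - H x))"
      unfolding c_def using that by (intro lp_pow_triangle lp_space_measurable)
    also have "\<dots> \<le> ennreal c * (ennreal a + ennreal b)" using that by (intro mult_left_mono add_mono) auto
    also have "\<dots> = ennreal (c * (a + b))" using that c by (simp add: ennreal_mult ennreal_plus)
    finally show ?thesis .
  qed
  have CS: "C \<subseteq> lp_space M p" unfolding C_def using closure_of_subset_topspace[of ?X S] by simp
  have near: "\<exists>F'\<in>S. lp_pow M p (\<lambda>x. F x - F' x) \<le> ennreal \<epsilon>" if F: "F \<in> C" and \<epsilon>: "0 < \<epsilon>" for F \<epsilon>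
  proof -
    define e where "e = \<epsilon> powr (1/p)"
    have e: "0 < e" "e powr p = \<epsilon>" using \<epsilon> p by (auto simp: e_def powr_powr)
    have F': "F \<in> lp_space M p" using F CS by auto
    have "F \<in> lp_ball M p F e" using F' e by (simp add: lp_ball_def lp_norm_def)
    then obtain F1 where F1: "F1 \<in> S" "F1 \<in> lp_ball M p F e"
      using F openin_lp_ball[OF F' e(1)] unfolding C_def in_closure_of by blast
    then have "lp_pow M p (\<lambda>x. F1 x - F x) < ennreal \<epsilon>" using lp_ball_iff[OF F' e(1)] e by simp
    then show ?thesis using F1(1) unfolding lp_pow_minus[of F1 F] by (blast intro: less_imp_le)
  qed
  have "compactin ?X C"
    unfolding compactin_def
  proof (intro conjI allI impI)
    show "C \<subseteq> topspace ?X" using CS by simp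
    fix \<U> assume \<U>: "Ball \<U> (openin ?X) \<and> C \<subseteq> \<Union>\<U>"
    define bad where "bad A \<longleftrightarrow> A \<subseteq> C \<and> \<not> (\<exists>\<F>. finite \<F> \<and> \<F> \<subseteq> \<U> \<and> A \<subseteq> \<Union>\<F>)" for A
    have shrink: "\<exists>B. B \<subseteq> A \<and> bad B \<and> (\<forall>F\<in>B. \<forall>G\<in>B. lp_pow M p (\<lambda>x. F x - G x) \<le> ennreal \<epsilon>)"
      if A: "bad A" and \<epsilon>: "0 < \<epsilon>" for A \<epsilon>
    proof -
      \<comment> \<open>The quasi-triangle inequality is used twice, once to get from a point of the
        closure to a centre of the net and once to compare two points near the same centre;
        \<open>4 * c * c\<close> pays for both.\<close>
      define \<epsilon>' where "\<epsilon>' = \<epsilon> / (4 * c * c)"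
      have \<epsilon>': "0 < \<epsilon>'" using \<epsilon> c by (simp add: \<epsilon>'_def)
      obtain Y where Y: "finite Y" "Y \<subseteq> lp_space M p" "\<And>F. F \<in> S \<Longrightarrow> \<exists>G\<in>Y. lp_pow M p (\<lambda>x. F x - G x) \<le> ennreal \<epsilon>'"
        using net[OF \<epsilon>'] by blast
      define P where "P G = {F \<in> A. lp_pow M p (\<lambda>x. F x - G x) \<le> ennreal (c * (\<epsilon>' + \<epsilon>'))}" for G
      have AP: "A \<subseteq> (\<Union>G\<in>Y. P G)"
      proof
        fix F assume F: "F \<in> A"
        then have FC: "F \<in> C" using A by (auto simp: bad_def)
        obtain F' where F': "F' \<in> S" "lp_pow M p (\<lambda>x. F x - F' x) \<le> ennreal \<epsilon>'" using near[OF FC \<epsilon>'] by blast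
        obtain G where G: "G \<in> Y" "lp_pow M p (\<lambda>x. F' x - G x) \<le> ennreal \<epsilon>'" using Y(3)[OF F'(1)] by blast
        have "lp_pow M p (\<lambda>x. F x - G x) \<le> ennreal (c * (\<epsilon>' + \<epsilon>'))"
          using F' G FC CS S Y(2) \<epsilon>' by (intro tri[of F F' \<epsilon>' G \<epsilon>']) auto
        then show "F \<in> (\<Union>G\<in>Y. P G)" using F G by (auto simp: P_def)
      qed
      have "\<exists>G\<in>Y. bad (P G)"
      proof (rule ccontr)
        assume "\<not> (\<exists>G\<in>Y. bad (P G))"
        then have "\<forall>G\<in>Y. \<exists>\<F>. finite \<F> \<and> \<F> \<subseteq> \<U> \<and> P G \<subseteq> \<Union>\<F>"
          using A by (auto simp: bad_def P_def)
        then obtain \<F> where \<F>: "\<And>G. G \<in> Y \<Longrightarrow> finite (\<F> G) \<and> \<F> G \<subseteq> \<U> \<and> P G \<subseteq> \<Union>(\<F> G)" by metis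
        have "A \<subseteq> \<Union>(\<Union>G\<in>Y. \<F> G)"
        proof
          fix F assume "F \<in> A"
          then obtain G where G: "G \<in> Y" "F \<in> P G" using AP by blast
          then have "F \<in> \<Union>(\<F> G)" using \<F>[OF G(1)] by blast
          then show "F \<in> \<Union>(\<Union>G\<in>Y. \<F> G)" using G by blast
        qed
        moreover have "finite (\<Union>G\<in>Y. \<F> G)" "(\<Union>G\<in>Y. \<F> G) \<subseteq> \<U>" using Y(1) \<F> by auto
        ultimately show False using A by (auto simp: bad_def)
      qed
      then obtain G where G: "G \<in> Y" "bad (P G)" by blast
      have "lp_pow M p (\<lambda>x. F x - H x) \<le> ennreal \<epsilon>" if "F \<in> P G" "H \<in> P G" for F H
      proof -
        have "F \<in> lp_space M p" "H \<in> lp_space M p" "G \<in> lp_space M p"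
          using that A CS G Y(2) by (auto simp: P_def bad_def)
        then have "lp_pow M p (\<lambda>x. F x - H x) \<le> ennreal (c * (c * (\<epsilon>' + \<epsilon>') + c * (\<epsilon>' + \<epsilon>')))"
          using that c \<epsilon>' lp_pow_minus[of G H] by (intro tri[of F G _ H]) (auto simp: P_def)
        also have "c * (c * (\<epsilon>' + \<epsilon>') + c * (\<epsilon>' + \<epsilon>')) = 4 * c * c * \<epsilon>'" by (simp add: algebra_simps)
        also have "\<dots> = \<epsilon>" using c by (simp add: \<epsilon>'_def)
        finally show ?thesis .
      qed
      then show ?thesis using G by (intro exI[of _ "P G"]) (auto simp: P_def)
    qed
    show "\<exists>\<F>. finite \<F> \<and> \<F> \<subseteq> \<U> \<and> C \<subseteq> \<Union>\<F>"
    proof (rule ccontr)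
      assume "\<not> (\<exists>\<F>. finite \<F> \<and> \<F> \<subseteq> \<U> \<and> C \<subseteq> \<Union>\<F>)"
      then have badC: "bad C" by (simp add: bad_def)
      \<comment> \<open>A bad subset whose diameter decays at the rate that
        \<open>riesz_fischer\<close> requires.\<close>
      define nxt where "nxt k A = (SOME B. B \<subseteq> A \<and> bad B \<and> (\<forall>F\<in>B. \<forall>G\<in>B. lp_pow M p (\<lambda>x. F x - G x) \<le> ennreal ((1/4)^k)))" for k :: nat and A
      have nxt: "nxt k A \<subseteq> A \<and> bad (nxt k A) \<and> (\<forall>F\<in>nxt k A. \<forall>G\<in>nxt k A. lp_pow M p (\<lambda>x. F x - G x) \<le> ennreal ((1/4)^k))" if "bad A" for k A
        unfolding nxt_def by (rule someI_ex[OF shrink[OF that]]) simp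
      define A where "A k = rec_nat (nxt 0 C) (\<lambda>k B. nxt (Suc k) B) k" for k
      have A0: "A 0 = nxt 0 C" and AS: "A (Suc k) = nxt (Suc k) (A k)" for k by (simp_all add: A_def)
      have badA: "bad (A k)" for k by (induction k) (use nxt badC in \<open>auto simp: A0 AS\<close>)
      have diam: "lp_pow M p (\<lambda>x. F x - G x) \<le> ennreal ((1/4)^k)" if "F \<in> A k" "G \<in> A k" for F G k
        using that nxt[OF badC, of 0] nxt[OF badA, of "Suc _"] by (cases k) (auto simp: A0 AS)
      have "A (Suc k) \<subseteq> A k" for k using nxt[OF badA, of "Suc k" k] by (simp add: AS)
      then have anti: "A k \<subseteq> A j" if "j \<le> k" for j k using that by (rule lift_Suc_antimono_le)
      have AC: "A k \<subseteq> C" for k using badA by (simp add: bad_def)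
      have "A k \<noteq> {}" for k
      proof
        assume "A k = {}"
        then have "finite {} \<and> {} \<subseteq> \<U> \<and> A k \<subseteq> \<Union>{}" by simp
        then show False using badA[of k] unfolding bad_def by blast
      qed
      then have "\<forall>k. \<exists>x. x \<in> A k" by blast
      then obtain f where f: "\<And>k. f k \<in> A k" using choice[of "\<lambda>k x. x \<in> A k"] by blast
      have fL: "f k \<in> lp_space M p" for k using f AC CS by blast
      have cauchy: "lp_pow M p (\<lambda>x. f k x - f j x) \<le> ennreal ((1/4)^j)" if "j \<le> k" for j k
        using f[of j] f[of k] anti[OF that] by (intro diam) auto
      obtain G where G: "G \<in> lp_space M p" "\<And>j. lp_pow M p (\<lambda>x. G x - f j x) \<le> ennreal ((1/4)^j)"
        using riesz_fischer[of f, OF fL cauchy] by blast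
      \<comment> \<open>Not just the points \<open>f k\<close> but the entire sets
        \<open>A k\<close> approach \<open>G\<close>; this will put one of them inside a single
        member of the cover.\<close>
      have small: "\<exists>k. \<forall>F\<in>A k. lp_pow M p (\<lambda>x. F x - G x) < ennreal \<delta>" if \<delta>: "0 < \<delta>" for \<delta>
      proof -
        have "(\<lambda>k. c * ((1/4)^k + (1/4)^k)) \<longlonglongrightarrow> c * (0 + 0)"
          by (intro tendsto_intros LIMSEQ_realpow_zero) auto
        then have "\<forall>\<^sub>F k in sequentially. c * ((1/4)^k + (1/4)^k) < \<delta>" using \<delta> by (intro order_tendstoD(2)) auto
        then obtain k where k: "c * ((1/4)^k + (1/4)^k) < \<delta>" by (auto simp: eventually_sequentially)
        have "lp_pow M p (\<lambda>x. F x - G x) < ennreal \<delta>" if "F \<in> A k" for F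
        proof -
          have d1: "lp_pow M p (\<lambda>x. F x - f k x) \<le> ennreal ((1/4)^k)" by (rule diam[OF that f])
          have d2: "lp_pow M p (\<lambda>x. f k x - G x) \<le> ennreal ((1/4)^k)"
            using G(2)[of k] lp_pow_minus[of "f k" G] by simp
          have "lp_pow M p (\<lambda>x. F x - G x) \<le> ennreal (c * ((1/4)^k + (1/4)^k))"
            by (rule tri[OF d1 d2]) (use that AC CS fL G in auto)
          also have "\<dots> < ennreal \<delta>" using k \<delta> by (intro ennreal_lessI)
          finally show ?thesis .
        qed
        then show ?thesis by blast
      qed
      \<comment> \<open>The points \<open>f k\<close> lie only in the closure of \<open>S\<close>,
        but an open set that contains one of them also meets \<open>S\<close>.\<close>
      have "G \<in> C" unfolding C_def in_closure_of
      proof (intro conjI allI impI)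
        show "G \<in> topspace ?X" using G by simp
        fix T assume T: "G \<in> T \<and> openin ?X T"
        obtain \<delta> where \<delta>: "0 < \<delta>" "\<And>H. H \<in> lp_space M p \<Longrightarrow> lp_pow M p (\<lambda>x. H x - G x) < ennreal \<delta> \<Longrightarrow> H \<in> T"
          using openin_lp_absorbs[of T G] T by blast
        obtain k where k: "\<forall>F\<in>A k. lp_pow M p (\<lambda>x. F x - G x) < ennreal \<delta>" using small[OF \<delta>(1)] by blast
        have "f k \<in> T" using k f[of k] fL \<delta>(2) by blast
        moreover have "f k \<in> ?X closure_of S" using f[of k] AC by (auto simp: C_def)
        ultimately show "\<exists>y. y \<in> S \<and> y \<in> T" using T by (auto simp: in_closure_of)
      qed
      then obtain U where U: "U \<in> \<U>" "G \<in> U" using \<U> by blast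
      obtain \<delta> where \<delta>: "0 < \<delta>" "\<And>H. H \<in> lp_space M p \<Longrightarrow> lp_pow M p (\<lambda>x. H x - G x) < ennreal \<delta> \<Longrightarrow> H \<in> U"
        using openin_lp_absorbs[of U G] U \<U> by blast
      obtain k where k: "\<forall>F\<in>A k. lp_pow M p (\<lambda>x. F x - G x) < ennreal \<delta>" using small[OF \<delta>(1)] by blast
      have "A k \<subseteq> U" using k \<delta>(2) AC CS by blast
      then have "finite {U} \<and> {U} \<subseteq> \<U> \<and> A k \<subseteq> \<Union>{U}" using U by auto
      then show False using badA[of k] unfolding bad_def by blast
    qed
  qed
  then show ?thesis using S by (simp add: relatively_compact_in_def C_def)
qed

end


section \<open>Powers of moduli of holomorphic functions\<close>

text \<open>The identity behind the Blaschke factor: the right side vanishes on the unit circle and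
  is nonnegative when both points are in the disc.\<close>

lemma cmod_blaschke:
  fixes a w :: complex
  shows "(cmod (1 - cnj a * w))\<^sup>2 - (cmod (w - a))\<^sup>2 = (1 - (cmod a)\<^sup>2) * (1 - (cmod w)\<^sup>2)"
  unfolding cmod_power2 by (simp add: algebra_simps power2_eq_square)

lemma cmod_blaschke_le:
  fixes a w :: complex
  assumes "cmod a \<le> 1" "cmod w \<le> 1"
  shows "cmod (w - a) \<le> cmod (1 - cnj a * w)"
proof -
  have "(1 - (cmod a)\<^sup>2) * (1 - (cmod w)\<^sup>2) \<ge> 0"
    using assms by (intro mult_nonneg_nonneg) (simp_all add: power_le_one)
  then have "(cmod (w - a))\<^sup>2 \<le> (cmod (1 - cnj a * w))\<^sup>2"
    using cmod_blaschke[of a w] by linarith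
  then show ?thesis by (rule power2_le_imp_le) simp
qed

lemma cmod_blaschke_eq:
  fixes a w :: complex
  assumes "cmod w = 1"
  shows "cmod (1 - cnj a * w) = cmod (w - a)"
proof -
  have "(cmod (1 - cnj a * w))\<^sup>2 = (cmod (w - a))\<^sup>2"
    using cmod_blaschke[of a w] assms by simp
  then show ?thesis by (simp only: power2_eq_iff_nonneg norm_ge_zero)
qed

text \<open>Each zero \<open>a\<close> in the open disc is reflected: \<open>1 - cnj a * w\<close>
  has the modulus of \<open>w - a\<close> on the circle, dominates it inside and does not vanish
  there. The other zeros keep their factor, which has no zero in the open disc.\<close>

lemma zero_free_majorant:
  fixes A :: "complex multiset" and c :: complex
  assumes "c \<noteq> 0"
  shows "\<exists>G. G holomorphic_on UNIV \<and> (\<forall>w\<in>ball 0 1. G w \<noteq> 0) \<and>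
      (\<forall>w\<in>sphere 0 1. cmod (G w) = cmod (c * (\<Prod>a\<in>#A. w - a))) \<and>
      (\<forall>w\<in>cball 0 1. cmod (c * (\<Prod>a\<in>#A. w - a)) \<le> cmod (G w))"
proof (induction A)
  case empty
  show ?case using assms by (intro exI[of _ "\<lambda>_. c"]) auto
next
  case (add a A)
  then obtain G where G: "G holomorphic_on UNIV" "\<And>w. w \<in> ball 0 1 \<Longrightarrow> G w \<noteq> 0"
    "\<And>w. w \<in> sphere 0 1 \<Longrightarrow> cmod (G w) = cmod (c * (\<Prod>a\<in>#A. w - a))"
    "\<And>w. w \<in> cball 0 1 \<Longrightarrow> cmod (c * (\<Prod>a\<in>#A. w - a)) \<le> cmod (G w)"
    by blast
  define g where "g = (\<lambda>w. if cmod a < 1 then 1 - cnj a * w else w - a)"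
  have g1: "g holomorphic_on UNIV"
    unfolding g_def by (cases "cmod a < 1") (auto intro!: holomorphic_intros)
  have g2: "g w \<noteq> 0" if "w \<in> ball 0 1" for w
  proof (cases "cmod a < 1")
    case True
    have "cmod (cnj a * w) \<le> cmod a * 1"
      using that unfolding norm_mult complex_mod_cnj by (intro mult_left_mono) auto
    then have "cmod (cnj a * w) < 1" using True by simp
    then show ?thesis unfolding g_def using True by auto
  qed (use that in \<open>auto simp: g_def\<close>)
  have g3: "cmod (g w) = cmod (w - a)" if "w \<in> sphere 0 1" for w
    using that unfolding g_def by (auto simp: cmod_blaschke_eq)
  have g4: "cmod (w - a) \<le> cmod (g w)" if "w \<in> cball 0 1" for w
    using that unfolding g_def by (auto simp: cmod_blaschke_le)
  show ?case
  proof (intro exI[of _ "\<lambda>w. G w * g w"] conjI ballI)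
    show "(\<lambda>w. G w * g w) holomorphic_on UNIV"
      using G(1) g1 by (intro holomorphic_intros)
    fix w assume "w \<in> ball (0::complex) 1" then show "G w * g w \<noteq> 0" using G(2) g2 by auto
  next
    fix w assume "w \<in> sphere (0::complex) 1"
    then show "cmod (G w * g w) = cmod (c * (\<Prod>a\<in>#add_mset a A. w - a))"
      using G(3)[of w] g3[of w] by (simp add: norm_mult)
  next
    fix w assume "w \<in> cball (0::complex) 1"
    then show "cmod (c * (\<Prod>a\<in>#add_mset a A. w - a)) \<le> cmod (G w * g w)"
      using mult_mono[OF G(4)[of w] g4[of w]] by (simp add: norm_mult mult_ac)
  qed
qed

section \<open>Sub-mean value inequalities on the circle for every exponent\<close>

lemma circle_mean_Cauchy:
  assumes "F holomorphic_on cball 0 \<rho>" "cmod z < \<rho>"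
  shows "F z = integral {0..1} (\<lambda>t. F (\<rho> * cis (2*pi*t)) * (\<rho> * cis (2*pi*t)) / (\<rho> * cis (2*pi*t) - z))"
    (is "_ = integral _ ?f")
proof -
  have "((\<lambda>u. F u / (u - z)) has_contour_integral 2 * complex_of_real pi * \<i> * F z) (circlepath 0 \<rho>)"
    using assms by (intro Cauchy_integral_circlepath_simple) auto
  then have "((\<lambda>t. F (circlepath 0 \<rho> t) / (circlepath 0 \<rho> t - z) *
      vector_derivative (circlepath 0 \<rho>) (at t within {0..1})) has_integral 2 * complex_of_real pi * \<i> * F z) {0..1}"
    by (simp add: has_contour_integral_def)
  then have "((\<lambda>t. (2 * complex_of_real pi * \<i>) * ?f t) has_integral (2 * complex_of_real pi * \<i>) * F z) {0..1}"
  proof (rule has_integral_eq[rotated])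
    fix t :: real assume t: "t \<in> {0..1}"
    have *: "circlepath 0 \<rho> t = \<rho> * cis (2*pi*t)"
      by (simp add: circlepath cis_conv_exp mult_ac)
    have "vector_derivative (circlepath 0 \<rho>) (at t within {0..1}) = 2 * pi * \<i> * \<rho> * exp (2 * pi * \<i> * t)"
      using t by (subst vector_derivative_circlepath01) auto
    also have "\<dots> = 2 * pi * \<i> * (\<rho> * cis (2*pi*t))"
      by (simp add: cis_conv_exp mult_ac)
    finally show "F (circlepath 0 \<rho> t) / (circlepath 0 \<rho> t - z) *
      vector_derivative (circlepath 0 \<rho>) (at t within {0..1}) = (2 * complex_of_real pi * \<i>) * ?f t"
      unfolding * by (simp add: mult_ac)
  qed
  then have "((\<lambda>t. (1/(2 * complex_of_real pi * \<i>)) * ((2 * complex_of_real pi * \<i>) * ?f t)) has_integral (1/(2 * complex_of_real pi * \<i>)) * ((2 * complex_of_real pi * \<i>) * F z)) {0..1}"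
    by (rule has_integral_mult_right)
  then have "(?f has_integral F z) {0..1}" by simp
  then show ?thesis by (simp add: integral_unique)
qed

text \<open>A function without zeros has a logarithm on the disc, so
  \<open>cmod (G w) powr q\<close> is the modulus of the analytic function \<open>H\<close>.
  Cauchy's formula on a circle of radius \<open>\<rho> < 1\<close>, with the kernel estimated by
  \<open>\<rho> / (\<rho> - cmod z)\<close>, bounds \<open>H z\<close>; then \<open>\<rho>\<close>
  tends to 1.\<close>

lemma circle_submean_zero_free:
  assumes hol: "G holomorphic_on UNIV" and nz: "\<And>w. w \<in> ball 0 1 \<Longrightarrow> G w \<noteq> 0" and q: "0 < q" and z: "cmod z < 1"
  shows "(1 - cmod z) * cmod (G z) powr q \<le> integral {0..1} (\<lambda>t. cmod (G (cis (2*pi*t))) powr q)"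
proof -
  have "G holomorphic_on ball 0 1" using hol by (rule holomorphic_on_subset) simp
  then obtain g where g: "g holomorphic_on ball 0 1" and g': "\<And>w. w \<in> ball 0 1 \<Longrightarrow> exp (g w) = G w"
    using holomorphic_logarithm_exists[of "ball 0 1" G 0] nz by auto
  define H where "H = (\<lambda>w. exp (complex_of_real q * g w))"
  have H: "H holomorphic_on ball 0 1" unfolding H_def using g by (intro holomorphic_intros)
  have Hn: "cmod (H w) = cmod (G w) powr q" if "w \<in> ball 0 1" for w
    
  proof -
    have "cmod (G w) = exp (Re (g w))" using g'[OF that] by (metis norm_exp_eq_Re)
    then show ?thesis by (simp add: H_def powr_def)
  qed
  have contG: "continuous_on A G" for A
    using holomorphic_on_imp_continuous_on[OF hol] continuous_on_subset by blast
  have cont: "continuous_on A (\<lambda>w. cmod (G w) powr q)" for A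
    using contG q by (intro continuous_intros continuous_on_powr') auto
  define I where "I = (\<lambda>\<rho>::real. integral {0..1} (\<lambda>t. cmod (G (\<rho> * cis (2*pi*t))) powr q))"
  have ineq: "(\<rho> - cmod z) * cmod (G z) powr q \<le> \<rho> * I \<rho>" if \<rho>: "cmod z < \<rho>" "\<rho> < 1" for \<rho>
  proof -
    have \<rho>0: "0 < \<rho>" using \<rho>(1) norm_ge_zero[of z] by linarith
    define f where "f = (\<lambda>t. H (\<rho> * cis (2*pi*t)) * (\<rho> * cis (2*pi*t)) / (\<rho> * cis (2*pi*t) - z))"
    have Hz: "H z = integral {0..1} f" unfolding f_def
      using \<rho> by (intro circle_mean_Cauchy holomorphic_on_subset[OF H]) auto
    have inb: "\<rho> * cis (2*pi*t) \<in> ball 0 1" for t using \<rho> \<rho>0 by (simp add: norm_mult)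
    have ne: "\<rho> * cis (2*pi*t) - z \<noteq> 0" for t
    proof
      assume "\<rho> * cis (2*pi*t) - z = 0"
      then have "cmod z = cmod (\<rho> * cis (2*pi*t))" by simp
      then show False using \<rho> \<rho>0 by (simp add: norm_mult)
    qed
    have contH: "continuous_on {0..1} (\<lambda>t. H (\<rho> * cis (2*pi*t)))"
      by (rule continuous_on_compose2[OF holomorphic_on_imp_continuous_on[OF H]])
         (use inb in \<open>auto intro!: continuous_intros\<close>)
    have "cmod (H z) \<le> integral {0..1} (\<lambda>t. \<rho> / (\<rho> - cmod z) * cmod (G (\<rho> * cis (2*pi*t))) powr q)"
      unfolding Hz
    proof (rule integral_norm_bound_integral)
      show "f integrable_on {0..1}" unfolding f_def
        by (rule integrable_continuous_real) (use ne contH in \<open>auto intro!: continuous_intros\<close>)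
      show "(\<lambda>t. \<rho> / (\<rho> - cmod z) * cmod (G (\<rho> * cis (2*pi*t))) powr q) integrable_on {0..1}"
        by (intro integrable_continuous_real continuous_intros continuous_on_compose2[OF cont])
           (auto intro!: continuous_intros)
      fix t :: real
      have "\<rho> - cmod z \<le> cmod (\<rho> * cis (2*pi*t) - z)"
        using norm_triangle_ineq2[of "\<rho> * cis (2*pi*t)" z] \<rho>0 by (simp add: norm_mult)
      then have "\<rho> / cmod (\<rho> * cis (2*pi*t) - z) \<le> \<rho> / (\<rho> - cmod z)"
        using \<rho> \<rho>0 by (intro divide_left_mono mult_pos_pos) auto
      then have "cmod (G (\<rho> * cis (2*pi*t))) powr q * (\<rho> / cmod (\<rho> * cis (2*pi*t) - z)) \<le> cmod (G (\<rho> * cis (2*pi*t))) powr q * (\<rho> / (\<rho> - cmod z))"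
        by (intro mult_left_mono) auto
      then show "cmod (f t) \<le> \<rho> / (\<rho> - cmod z) * cmod (G (\<rho> * cis (2*pi*t))) powr q"
        unfolding f_def norm_mult norm_divide Hn[OF inb] using \<rho>0 by (simp add: norm_mult mult_ac)
    qed
    also have "\<dots> = \<rho> / (\<rho> - cmod z) * I \<rho>" unfolding I_def by simp
    finally have "cmod (G z) powr q \<le> \<rho> / (\<rho> - cmod z) * I \<rho>" using Hn[of z] z by simp
    then show ?thesis using \<rho> by (simp add: field_simps)
  qed
  have contI: "continuous_on {0..1} I"
  proof -
    have "continuous_on ({0..1} \<times> cbox 0 1) (\<lambda>x::real \<times> real. complex_of_real (fst x) * cis (2*pi*(snd x)))"
      by (intro continuous_intros)
    then have "continuous_on ({0..1} \<times> cbox 0 1) (\<lambda>(\<rho>::real, t::real). cmod (G (complex_of_real \<rho> * cis (2*pi*t))) powr q)"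
      unfolding case_prod_unfold by (rule continuous_on_compose2[OF cont[of UNIV]]) auto
    from integral_continuous_on_param[OF this] show ?thesis by (simp add: I_def)
  qed
  have lim: "(I \<longlongrightarrow> I 1) (at_left 1)"
    using contI unfolding continuous_on by (auto dest!: bspec[of _ _ 1] simp: at_within_Icc_at_left)
  have "(1 - cmod z) * cmod (G z) powr q \<le> 1 * I 1"
  proof (rule tendsto_le)
    show "((\<lambda>\<rho>. \<rho> * I \<rho>) \<longlongrightarrow> 1 * I 1) (at_left 1)" by (intro tendsto_intros lim)
    show "((\<lambda>\<rho>. (\<rho> - cmod z) * cmod (G z) powr q) \<longlongrightarrow> (1 - cmod z) * cmod (G z) powr q) (at_left 1)"
      by (intro tendsto_intros)
    show "\<forall>\<^sub>F \<rho> in at_left 1. (\<rho> - cmod z) * cmod (G z) powr q \<le> \<rho> * I \<rho>"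
      using eventually_at_left_real[OF z] by eventually_elim (use ineq in auto)
  qed auto
  then show ?thesis by (simp add: I_def)
qed

lemma circle_submean_poly:
  fixes P :: "complex poly"
  assumes q: "0 < q" and z: "cmod z < 1"
  shows "(1 - cmod z) * cmod (poly P z) powr q \<le> integral {0..1} (\<lambda>t. cmod (poly P (cis (2*pi*t))) powr q)"
proof (cases "P = 0")
  case False
  then obtain A where A: "P = smult (lead_coeff P) (\<Prod>a\<in>#A. [:-a, 1:])"
    using alg_closed_imp_factorization[OF False] by blast
  have P: "poly P w = lead_coeff P * (\<Prod>a\<in>#A. w - a)" for w
    
  proof -
    have "poly P w = poly (smult (lead_coeff P) (\<Prod>a\<in>#A. [:-a, 1:])) w" using A by (rule arg_cong)
    then show ?thesis by (simp add: poly_prod_mset image_mset.compositionality o_def)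
  qed
  obtain G where G: "G holomorphic_on UNIV" "\<And>w. w \<in> ball 0 1 \<Longrightarrow> G w \<noteq> 0"
    "\<And>w. w \<in> sphere 0 1 \<Longrightarrow> cmod (G w) = cmod (poly P w)"
    "\<And>w. w \<in> cball 0 1 \<Longrightarrow> cmod (poly P w) \<le> cmod (G w)"
    using zero_free_majorant[of "lead_coeff P" A] False unfolding P[symmetric] leading_coeff_0_iff by blast
  have "(1 - cmod z) * cmod (poly P z) powr q \<le> (1 - cmod z) * cmod (G z) powr q"
    using z q G(4)[of z] by (intro mult_left_mono powr_mono2) auto
  also have "\<dots> \<le> integral {0..1} (\<lambda>t. cmod (G (cis (2*pi*t))) powr q)"
    using G(1,2) q z by (intro circle_submean_zero_free) auto
  also have "\<dots> = integral {0..1} (\<lambda>t. cmod (poly P (cis (2*pi*t))) powr q)"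
    using G(3) by simp
  finally show ?thesis .
qed (use q in auto)

text \<open>Subharmonicity of \<open>cmod (F z) powr q\<close> for all \<open>q > 0\<close>, with
  the Poisson kernel coarsened to \<open>1 / (1 - cmod z)\<close>. Taylor polynomials have finitely
  many zeros, so the reflection argument applies to them, and the sum of the moduli of the
  coefficients dominates them all on the circle.\<close>

theorem circle_submean:
  assumes hol: "F holomorphic_on ball 0 R" and R: "1 < R" and q: "0 < q" and z: "cmod z < 1"
  shows "(1 - cmod z) * cmod (F z) powr q \<le> integral {0..1} (\<lambda>t. cmod (F (cis (2*pi*t))) powr q)"
proof -
  define c where "c n = (deriv ^^ n) F 0 / fact n" for n
  have sums: "(\<lambda>n. c n * w ^ n) sums F w" if "w \<in> ball 0 R" for w
    using holomorphic_power_series[OF hol that] by (simp add: c_def)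
  \<comment> \<open>Convergence of the power series at a point beyond the unit circle gives absolute
    convergence on the circle.\<close>
  define R' where "R' = (1 + R) / 2"
  have R': "1 < R'" "R' < R" using R by (auto simp: R'_def)
  have summ: "summable (\<lambda>n. norm (c n * 1 ^ n))"
    by (rule powser_insidea[of _ "of_real R'"]) (use sums[of "of_real R'"] R' in \<open>auto simp: sums_iff\<close>)
  define S where "S = (\<Sum>n. cmod (c n))"
  define T where "T N = (\<Sum>n<N. monom (c n) n)" for N
  have T: "poly (T N) w = (\<Sum>n<N. c n * w ^ n)" for N w by (simp add: T_def poly_sum poly_monom)
  have lim: "(\<lambda>N. poly (T N) w) \<longlonglongrightarrow> F w" if "w \<in> ball 0 R" for w
    using sums[OF that] unfolding T sums_def .
  have bd: "cmod (poly (T N) w) \<le> S" if "cmod w = 1" for N w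
  proof -
    have "cmod (poly (T N) w) \<le> (\<Sum>n<N. cmod (c n))"
      unfolding T by (rule sum_norm_le) (simp add: norm_mult norm_power that)
    also have "\<dots> \<le> S" unfolding S_def by (rule sum_le_suminf) (use summ in auto)
    finally show ?thesis .
  qed
  have "(\<lambda>N. integral {0..1} (\<lambda>t. cmod (poly (T N) (cis (2*pi*t))) powr q)) \<longlonglongrightarrow>
      integral {0..1} (\<lambda>t. cmod (F (cis (2*pi*t))) powr q)"
  proof (rule dominated_convergence(2))
    show "(\<lambda>t. cmod (poly (T N) (cis (2*pi*t))) powr q) integrable_on {0..1}" for N
      using q by (intro integrable_continuous_real continuous_on_powr') (auto intro!: continuous_intros)
    show "(\<lambda>t. S powr q) integrable_on {0..1::real}" by auto
    show "norm (cmod (poly (T N) (cis (2*pi*t))) powr q) \<le> S powr q" for N and t :: real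
      using bd[of "cis (2*pi*t)" N] q by (auto intro!: powr_mono2)
    show "(\<lambda>N. cmod (poly (T N) (cis (2*pi*t))) powr q) \<longlonglongrightarrow> cmod (F (cis (2*pi*t))) powr q" for t
      using R q by (intro tendsto_powr' tendsto_norm lim tendsto_const) auto
  qed
  moreover have "(\<lambda>N. (1 - cmod z) * cmod (poly (T N) z) powr q) \<longlonglongrightarrow> (1 - cmod z) * cmod (F z) powr q"
    using R q z by (intro tendsto_intros tendsto_powr' lim) auto
  ultimately show ?thesis
    using circle_submean_poly[OF q z] by (intro LIMSEQ_le) auto
qed


section \<open>Poisson integrals on the half-plane\<close>

definition poisson :: "real \<Rightarrow> real \<Rightarrow> real" where
  "poisson \<sigma> x = \<sigma> / (pi * (\<sigma>\<^sup>2 + x\<^sup>2))"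

lemma poisson_measurable [measurable]: "poisson \<sigma> \<in> borel_measurable borel"
  unfolding poisson_def by measurable

lemma poisson_nonneg: "0 \<le> \<sigma> \<Longrightarrow> 0 \<le> poisson \<sigma> x"
  unfolding poisson_def by (intro divide_nonneg_nonneg mult_nonneg_nonneg) auto

lemma poisson_pos: "0 < \<sigma> \<Longrightarrow> 0 < poisson \<sigma> x"
  unfolding poisson_def by (intro divide_pos_pos mult_pos_pos add_pos_nonneg) auto

lemma poisson_minus [simp]: "poisson \<sigma> (- x) = poisson \<sigma> x"
  by (simp add: poisson_def)

text \<open>The substitution \<open>x = t + \<sigma> * tan u\<close> turns the Poisson kernel into
  the uniform density on an interval of length pi. It is made on the compact intervals between
  \<open>- arctan n\<close> and \<open>arctan n\<close>, where the derivative of the tangent is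
  continuous, and extended by monotone convergence.\<close>

lemma nn_integral_tan:
  fixes f :: "real \<Rightarrow> real"
  assumes f [measurable]: "f \<in> borel_measurable borel" and f0: "\<And>x. 0 \<le> f x" and \<sigma>: "0 < \<sigma>"
  shows "(\<integral>\<^sup>+u. ennreal (f (t + \<sigma> * tan u) * (indicator {-pi/2<..<pi/2} u / pi)) \<partial>lborel) =
         (\<integral>\<^sup>+x. ennreal (f x * poisson \<sigma> (x - t)) \<partial>lborel)"
proof -
  define L where "L = (\<lambda>n::nat. \<lambda>x. ennreal (f x * poisson \<sigma> (x - t) * indicator {t - \<sigma> * n..t + \<sigma> * n} x))"
  define R where "R = (\<lambda>n::nat. \<lambda>u. ennreal (f (t + \<sigma> * tan u) / pi * indicator {- arctan n..arctan n} u))"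
  have cos_pos: "0 < cos u" if "u \<in> {- arctan n..arctan n}" for u and n :: nat
  proof -
    have "- (pi/2) < u" "u < pi/2" using that arctan_lbound[of n] arctan_ubound[of n] by auto
    then show ?thesis by (intro cos_gt_zero_pi) auto
  qed
  have eq: "integral\<^sup>N lborel (L n) = integral\<^sup>N lborel (R n)" for n
  proof -
    define g where "g = (\<lambda>u. t + \<sigma> * tan u)"
    define g' where "g' = (\<lambda>u. \<sigma> * inverse ((cos u)\<^sup>2))"
    have ga: "g (- arctan n) = t - \<sigma> * n" "g (arctan n) = t + \<sigma> * n"
      by (simp_all add: g_def tan_arctan)
    have "(\<integral>\<^sup>+x. ennreal (f x * poisson \<sigma> (x - t) * indicator {g (- arctan n)..g (arctan n)} x) \<partial>lborel) =
      (\<integral>\<^sup>+x. ennreal (f (g x) * poisson \<sigma> (g x - t) * g' x * indicator {- arctan n..arctan n} x) \<partial>lborel)"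
    proof (rule nn_integral_substitution)
      show "set_borel_measurable borel {g (- arctan (real n))..g (arctan (real n))} (\<lambda>x. f x * poisson \<sigma> (x - t))"
        unfolding set_borel_measurable_def by measurable
      show "(g has_real_derivative g' x) (at x)" if "x \<in> {- arctan (real n)..arctan (real n)}" for x
        unfolding g_def g'_def using cos_pos[OF that] by (auto intro!: derivative_eq_intros)
      show "continuous_on {- arctan (real n)..arctan (real n)} g'"
        unfolding g'_def using cos_pos by (intro continuous_intros) force
      show "g' x \<ge> 0" for x unfolding g'_def using \<sigma> by auto
    qed auto
    also have "\<dots> = integral\<^sup>N lborel (R n)"
    proof (rule nn_integral_cong)
      fix u :: real
      have "poisson \<sigma> (g u - t) * g' u = 1 / pi" if "u \<in> {- arctan n..arctan n}"
      proof -
        have "(cos u)\<^sup>2 * (\<sigma>\<^sup>2 + (\<sigma> * tan u)\<^sup>2) = \<sigma>\<^sup>2 * ((cos u)\<^sup>2 + (cos u * tan u)\<^sup>2)"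
          by (simp add: power_mult_distrib algebra_simps)
        also have "cos u * tan u = sin u" using cos_pos[OF that] by (simp add: tan_def)
        finally have *: "(cos u)\<^sup>2 * (\<sigma>\<^sup>2 + (\<sigma> * tan u)\<^sup>2) = \<sigma>\<^sup>2" by simp
        have "poisson \<sigma> (g u - t) * g' u = \<sigma>\<^sup>2 / (pi * ((cos u)\<^sup>2 * (\<sigma>\<^sup>2 + (\<sigma> * tan u)\<^sup>2)))"
          by (simp add: poisson_def g_def g'_def divide_inverse mult_ac power2_eq_square)
        then show ?thesis using \<sigma> by (simp add: *)
      qed
      then show "ennreal (f (g u) * poisson \<sigma> (g u - t) * g' u * indicator {- arctan n..arctan n} u) = R n u"
        unfolding R_def by (auto simp: indicator_def g_def mult.assoc divide_inverse)
    qed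
    finally show ?thesis by (simp add: L_def ga)
  qed
  have "(\<lambda>n. integral\<^sup>N lborel (L n)) \<longlonglongrightarrow> (\<integral>\<^sup>+x. ennreal (f x * poisson \<sigma> (x - t)) \<partial>lborel)"
  proof (rule nn_integral_LIMSEQ)
    show "incseq L" unfolding L_def
    proof (intro incseq_SucI le_funI ennreal_leI mult_left_mono)
      fix n :: nat and x :: real
      have "\<sigma> * real n \<le> \<sigma> * real (Suc n)" using \<sigma> by (intro mult_left_mono) auto
      then show "indicat_real {t - \<sigma> * real n..t + \<sigma> * real n} x \<le> indicator {t - \<sigma> * real (Suc n)..t + \<sigma> * real (Suc n)} x"
        by (auto simp: indicator_def simp del: of_nat_Suc)
      show "0 \<le> f x * poisson \<sigma> (x - t)" using f0 poisson_nonneg[of \<sigma>] \<sigma> by auto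
    qed
    show "L n \<in> borel_measurable lborel" for n unfolding L_def by measurable
    fix x :: real
    obtain N :: nat where N: "\<bar>x - t\<bar> / \<sigma> \<le> N" using real_arch_simple by blast
    have "x \<in> {t - \<sigma> * n..t + \<sigma> * n}" if "n \<ge> N" for n
    proof -
      have "\<bar>x - t\<bar> / \<sigma> \<le> n" using N that by linarith
      then have "\<bar>x - t\<bar> \<le> \<sigma> * n" using \<sigma> by (simp add: field_simps)
      then show ?thesis by auto
    qed
    then show "(\<lambda>n. L n x) \<longlonglongrightarrow> ennreal (f x * poisson \<sigma> (x - t))"
      unfolding L_def by (intro tendsto_eventually eventually_sequentiallyI[of N]) auto
  qed
  moreover have "(\<lambda>n. integral\<^sup>N lborel (R n)) \<longlonglongrightarrow> (\<integral>\<^sup>+u. ennreal (f (t + \<sigma> * tan u) * (indicator {-pi/2<..<pi/2} u / pi)) \<partial>lborel)"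
  proof (rule nn_integral_LIMSEQ)
    show "incseq R" unfolding R_def
    proof (intro incseq_SucI le_funI ennreal_leI mult_left_mono)
      fix n :: nat and x :: real
      have "arctan (real n) \<le> arctan (real (Suc n))" by (subst arctan_le_iff) auto
      then show "indicat_real {- arctan (real n)..arctan (real n)} x \<le> indicator {- arctan (real (Suc n))..arctan (real (Suc n))} x"
        by (auto simp: indicator_def simp del: of_nat_Suc)
      show "0 \<le> f (t + \<sigma> * tan x) / pi" using f0 by auto
    qed
    show "R n \<in> borel_measurable lborel" for n unfolding R_def tan_def by measurable
    fix u :: real
    show "(\<lambda>n. R n u) \<longlonglongrightarrow> ennreal (f (t + \<sigma> * tan u) * (indicator {-pi/2<..<pi/2} u / pi))"
    proof (cases "u \<in> {-pi/2<..<pi/2}")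
      case True
      obtain N :: nat where N: "\<bar>tan u\<bar> \<le> N" using real_arch_simple by blast
      have "u \<in> {- arctan n..arctan n}" if "n \<ge> N" for n
      proof -
        have "\<bar>tan u\<bar> \<le> n" using N that by linarith
        then have "arctan (tan u) \<le> arctan n" "arctan (- real n) \<le> arctan (tan u)"
          by (subst arctan_le_iff, linarith)+
        moreover have "arctan (tan u) = u" using True by (intro arctan_tan) auto
        ultimately show ?thesis by (auto simp: arctan_minus)
      qed
      then show ?thesis using True
        unfolding R_def by (intro tendsto_eventually eventually_sequentiallyI[of N]) auto
    next
      case False
      have "u \<notin> {- arctan n..arctan n}" for n :: nat
        using False arctan_lbound[of n] arctan_ubound[of n] by auto
      then show ?thesis using False unfolding R_def by auto
    qed
  qed
  ultimately show ?thesis using eq LIMSEQ_unique by simp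
qed

lemma distr_tan:
  assumes \<sigma>: "0 < \<sigma>"
  shows "distr (density lborel (\<lambda>u. ennreal (indicator {-pi/2<..<pi/2} u / pi))) borel (\<lambda>u. t + \<sigma> * tan u) =
    density lborel (\<lambda>x. ennreal (poisson \<sigma> (x - t)))"
proof (rule measure_eqI)
  fix A :: "real set"
  assume "A \<in> sets (distr (density lborel (\<lambda>u. ennreal (indicator {-pi/2<..<pi/2} u / pi))) borel (\<lambda>u. t + \<sigma> * tan u))"
  then have A [measurable]: "A \<in> sets borel" by simp
  have m [measurable]: "tan \<in> borel_measurable (borel :: real measure)" unfolding tan_def by measurable
  have "emeasure (distr (density lborel (\<lambda>u. ennreal (indicator {-pi/2<..<pi/2} u / pi))) borel (\<lambda>u. t + \<sigma> * tan u)) A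
    = (\<integral>\<^sup>+u. ennreal (indicator {-pi/2<..<pi/2} u / pi) * indicator ((\<lambda>u. t + \<sigma> * tan u) -` A) u \<partial>lborel)"
    by (subst emeasure_distr, measurable)
       (subst emeasure_density, auto intro!: measurable_sets_borel[OF _ A] nn_integral_cong)
  also have "\<dots> = (\<integral>\<^sup>+u. ennreal (indicator A (t + \<sigma> * tan u) * (indicator {-pi/2<..<pi/2} u / pi)) \<partial>lborel)"
    by (intro nn_integral_cong) (auto simp: indicator_def)
  also have "\<dots> = (\<integral>\<^sup>+x. ennreal (indicator A x * poisson \<sigma> (x - t)) \<partial>lborel)"
    by (rule nn_integral_tan) (use \<sigma> in auto)
  also have "\<dots> = emeasure (density lborel (\<lambda>x. ennreal (poisson \<sigma> (x - t)))) A"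
    by (subst emeasure_density) (auto intro!: nn_integral_cong simp: indicator_def)
  finally show "emeasure (distr (density lborel (\<lambda>u. ennreal (indicator {-pi/2<..<pi/2} u / pi))) borel (\<lambda>u. t + \<sigma> * tan u)) A
    = emeasure (density lborel (\<lambda>x. ennreal (poisson \<sigma> (x - t)))) A" .
qed simp

lemma nn_integral_poisson: 
  assumes "0 < \<sigma>" shows "(\<integral>\<^sup>+x. ennreal (poisson \<sigma> (x - t)) \<partial>lborel) = 1"
proof -
  have "(\<integral>\<^sup>+x. ennreal (1 * poisson \<sigma> (x - t)) \<partial>lborel) = (\<integral>\<^sup>+u. ennreal (1 * (indicator {-pi/2<..<pi/2} u / pi)) \<partial>lborel)"
    using nn_integral_tan[of "\<lambda>_. 1" \<sigma> t] assms by simp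
  also have "\<dots> = (\<integral>\<^sup>+u. ennreal (1/pi) * indicator {-pi/2<..<pi/2} u \<partial>lborel)"
    by (intro nn_integral_cong) (auto simp: indicator_def)
  also have "\<dots> = ennreal (1/pi) * ennreal pi"
    by (subst nn_integral_cmult) auto
  also have "\<dots> = 1" by (simp add: ennreal_mult[symmetric])
  finally show ?thesis by simp
qed

section \<open>Transfer from the disc by the conformal map that sends 0 to a given point\<close>

definition moebius :: "real \<Rightarrow> real \<Rightarrow> complex \<Rightarrow> complex" where
  "moebius \<sigma> t w = Complex 0 t + of_real \<sigma> * ((1 + w) / (1 - w))"

lemma moebius_0 [simp]: "moebius \<sigma> t 0 = Complex \<sigma> t"
  by (simp add: moebius_def complex_eq_iff)

lemma Re_moebius: "Re (moebius \<sigma> t w) = \<sigma> * (1 - (cmod w)\<^sup>2) / (cmod (1 - w))\<^sup>2"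
proof -
  have "Re ((1 + w) / (1 - w)) = (1 - (cmod w)\<^sup>2) / (cmod (1 - w))\<^sup>2"
    unfolding Re_divide cmod_power2 by (simp add: algebra_simps power2_eq_square)
  then show ?thesis by (simp add: moebius_def del: times_divide_eq_right) simp
qed

lemma Re_moebius_pos:
  assumes "0 < \<sigma>" "cmod w < 1" shows "0 < Re (moebius \<sigma> t w)"
proof -
  have "w \<noteq> 1" using assms by auto
  moreover have "(cmod w)\<^sup>2 < 1" using assms by (simp add: power_less_one_iff abs_square_less_1)
  ultimately show ?thesis unfolding Re_moebius using assms by (intro divide_pos_pos mult_pos_pos) auto
qed

lemma holomorphic_moebius: "moebius \<sigma> t holomorphic_on ball 0 1"
  unfolding moebius_def by (intro holomorphic_intros) auto

text \<open>The angle is \<open>pi - 2 * u\<close>, for which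
  \<open>(1 + w) / (1 - w) = \<i> * tan u\<close>. Thus uniform measure on the circle corresponds to
  the tangent parametrization of the Poisson kernel.\<close>

lemma moebius_cis:
  assumes u: "u \<in> {-pi/2<..<pi/2}"
  shows "moebius \<sigma> t (cis (2*pi*(1/2 - u/pi))) = Complex 0 (t + \<sigma> * tan u)"
proof -
  have c: "cos u \<noteq> 0" using u cos_gt_zero_pi[of u] by auto
  have 1: "cis (2*pi*(1/2 - u/pi)) = - cis (- (2 * u))"
  proof -
    have "2*pi*(1/2 - u/pi) = pi - 2 * u" by (simp add: right_diff_distrib)
    then show ?thesis by (simp add: complex_eq_iff)
  qed
  have 2: "cis (-(2*u)) = cis (-u) / cis u" by (simp add: cis_divide)
  have 3: "cis u + cis (-u) = 2 * cos u" "cis u - cis (-u) = 2 * \<i> * sin u"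
    by (simp_all add: complex_eq_iff)
  have "(1 - cis (-(2*u))) / (1 + cis (-(2*u))) = (cis u - cis (-u)) / (cis u + cis (-u))"
    unfolding 2 by (simp add: divide_simps)
  also have "\<dots> = \<i> * of_real (tan u)"
    unfolding 3 using c by (simp add: tan_def)
  finally have "(1 + - cis (-(2*u))) / (1 - - cis (-(2*u))) = \<i> * of_real (tan u)" by simp
  then have "moebius \<sigma> t (cis (2*pi*(1/2 - u/pi))) = Complex 0 t + of_real \<sigma> * (\<i> * of_real (tan u))"
    unfolding moebius_def 1 by (simp only:)
  then show ?thesis by (simp add: complex_eq_iff)
qed

text \<open>Circle means on radii tending to 1 converge by dominated convergence: the only boundary
  point without a limit is \<open>w = 1\<close>, which is sent to infinity, and boundedness of
  \<open>K\<close> makes it harmless. The values are vectors because the result serves analytic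
  functions as well as powers of their moduli.\<close>

lemma poisson_boundary_limit:
  fixes K :: "complex \<Rightarrow> 'b :: euclidean_space"
  assumes \<sigma>: "0 < \<sigma>" and cont: "continuous_on {s. 0 \<le> Re s} K" and bd: "\<And>s. 0 \<le> Re s \<Longrightarrow> norm (K s) \<le> M"
  shows "integrable lborel (\<lambda>x. poisson \<sigma> (x - t) *\<^sub>R K (Complex 0 x))"
    and "(\<lambda>n. integral {0..1} (\<lambda>\<theta>. K (moebius \<sigma> t (of_real (1 - 1 / real (n+2)) * cis (2*pi*\<theta>))))) \<longlonglongrightarrow>
      (LINT x|lborel. poisson \<sigma> (x - t) *\<^sub>R K (Complex 0 x))"
proof -
  have M0: "0 \<le> M" using order_trans[OF norm_ge_zero bd[of 0]] by simp
  have contK: "continuous_on UNIV (\<lambda>x. K (Complex 0 x))"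
    by (rule continuous_on_compose2[OF cont]) (auto simp: Complex_eq intro!: continuous_intros)
  then have mK [measurable]: "(\<lambda>x. K (Complex 0 x)) \<in> borel_measurable borel"
    by (rule borel_measurable_continuous_onI)
  have "integrable lborel (poisson \<sigma>)"
    by (rule integrableI_nonneg) (use nn_integral_poisson[OF \<sigma>, of 0] poisson_nonneg[of \<sigma>] \<sigma> in auto)
  then have intP: "integrable lborel (\<lambda>x. poisson \<sigma> (x - t))"
    using lborel_integrable_real_affine[of "poisson \<sigma>" 1 "-t"] by simp
  show "integrable lborel (\<lambda>x. poisson \<sigma> (x - t) *\<^sub>R K (Complex 0 x))"
  proof (rule Bochner_Integration.integrable_bound)
    show "integrable lborel (\<lambda>x. M * poisson \<sigma> (x - t))" using intP by simp
    show "AE x in lborel. norm (poisson \<sigma> (x - t) *\<^sub>R K (Complex 0 x)) \<le> norm (M * poisson \<sigma> (x - t))"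
    proof (rule AE_I2)
      fix x show "norm (poisson \<sigma> (x - t) *\<^sub>R K (Complex 0 x)) \<le> norm (M * poisson \<sigma> (x - t))"
        using mult_left_mono[OF bd[of "Complex 0 x"], of "poisson \<sigma> (x - t)"] poisson_nonneg[of \<sigma> "x - t"] \<sigma> M0
        by (simp add: abs_mult mult_ac)
    qed
  qed measurable
  define r where "r n = 1 - 1 / real (n+2)" for n :: nat
  have r: "0 < r n" "r n < 1" for n by (auto simp: r_def)
  have rlim: "r \<longlonglongrightarrow> 1" unfolding r_def by real_asymp
  define W where "W n \<theta> = of_real (r n) * cis (2*pi*\<theta>)" for n \<theta>
  have W: "cmod (W n \<theta>) < 1" for n \<theta> using r[of n] by (simp add: W_def norm_mult)
  have contKm: "continuous_on A (\<lambda>\<theta>. K (moebius \<sigma> t (W n \<theta>)))" for n A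
  proof (rule continuous_on_compose2[OF cont])
    show "continuous_on A (\<lambda>\<theta>. moebius \<sigma> t (W n \<theta>))"
      by (rule continuous_on_compose2[OF holomorphic_on_imp_continuous_on[OF holomorphic_moebius]])
         (use W in \<open>auto simp: W_def intro!: continuous_intros\<close>)
    show "(\<lambda>\<theta>. moebius \<sigma> t (W n \<theta>)) ` A \<subseteq> {s. 0 \<le> Re s}"
      using Re_moebius_pos[OF \<sigma> W] less_imp_le by blast
  qed
  have mKm [measurable]: "(\<lambda>\<theta>. K (moebius \<sigma> t (W n \<theta>))) \<in> borel_measurable borel" for n
    by (rule borel_measurable_continuous_onI) (rule contKm)
  have bdKm: "norm (K (moebius \<sigma> t (W n \<theta>))) \<le> M" for n \<theta>
    using bd Re_moebius_pos[OF \<sigma> W] less_imp_le by blast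
  have HK: "integral {0..1} (\<lambda>\<theta>. K (moebius \<sigma> t (W n \<theta>))) =
     (LINT u|lborel. (indicator {-pi/2..pi/2} u / pi) *\<^sub>R K (moebius \<sigma> t (W n (1/2 - u/pi))))" for n
  proof -
    have "integral {0..1} (\<lambda>\<theta>. K (moebius \<sigma> t (W n \<theta>))) = (LINT \<theta>|lborel. indicator {0..1} \<theta> *\<^sub>R K (moebius \<sigma> t (W n \<theta>)))"
      using set_borel_integral_eq_integral(2)[OF borel_integrable_atLeastAtMost'[OF contKm]]
      unfolding set_lebesgue_integral_def by simp
    also have "\<dots> = \<bar>- 1/pi\<bar> *\<^sub>R (LINT u|lborel. indicator {0..1} (1/2 + (-1/pi) * u) *\<^sub>R K (moebius \<sigma> t (W n (1/2 + (-1/pi) * u))))"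
      by (rule lborel_integral_real_affine) auto
    also have "\<dots> = (LINT u|lborel. (1/pi) *\<^sub>R (indicator {0..1} (1/2 + (-1/pi) * u) *\<^sub>R K (moebius \<sigma> t (W n (1/2 + (-1/pi) * u)))))"
      by (simp only: integral_scaleR_right) simp
    also have "\<dots> = (LINT u|lborel. (indicator {-pi/2..pi/2} u / pi) *\<^sub>R K (moebius \<sigma> t (W n (1/2 - u/pi))))"
      by (intro Bochner_Integration.integral_cong) (auto simp: indicator_def field_simps)
    finally show ?thesis .
  qed
  have tanm [measurable]: "tan \<in> borel_measurable (borel :: real measure)" unfolding tan_def by measurable
  have "(\<lambda>n. LINT u|lborel. (indicator {-pi/2..pi/2} u / pi) *\<^sub>R K (moebius \<sigma> t (W n (1/2 - u/pi)))) \<longlonglongrightarrow>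
     (LINT u|lborel. (indicator {-pi/2<..<pi/2} u / pi) *\<^sub>R K (Complex 0 (t + \<sigma> * tan u)))"
  proof (rule integral_dominated_convergence)
    show "integrable lborel (\<lambda>u. indicator {-pi/2..pi/2} u * (M / pi))" by simp
    show "AE u in lborel. norm ((indicator {-pi/2..pi/2} u / pi) *\<^sub>R K (moebius \<sigma> t (W n (1/2 - u/pi)))) \<le>
       indicator {-pi/2..pi/2} u * (M / pi)" for n
      using bdKm by (intro AE_I2) (auto simp: indicator_def divide_right_mono)
    \<comment> \<open>Both end points correspond to the boundary point \<open>w = 1\<close>.\<close>
    have "AE u in lborel. u \<noteq> - pi/2 \<and> u \<noteq> pi/2"
      by (intro AE_conjI AE_lborel_singleton)
    then show "AE u in lborel. (\<lambda>n. (indicator {-pi/2..pi/2} u / pi) *\<^sub>R K (moebius \<sigma> t (W n (1/2 - u/pi)))) \<longlonglongrightarrow>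
       (indicator {-pi/2<..<pi/2} u / pi) *\<^sub>R K (Complex 0 (t + \<sigma> * tan u))"
    proof eventually_elim
      case (elim u)
      show ?case
      proof (cases "u \<in> {-pi/2<..<pi/2}")
        case True
        have ne: "cis (2*pi*(1/2 - u/pi)) \<noteq> 1"
        proof
          assume "cis (2*pi*(1/2 - u/pi)) = 1"
          then have "cos (pi - 2*u) = 1" by (simp add: complex_eq_iff right_diff_distrib)
          then have "cos (2*u) = -1" by simp
          then have "cos u = 0" by (simp add: cos_double_cos)
          then show False using True cos_gt_zero_pi[of u] by auto
        qed
        have "(\<lambda>n. moebius \<sigma> t (W n (1/2 - u/pi))) \<longlonglongrightarrow> moebius \<sigma> t (of_real 1 * cis (2*pi*(1/2 - u/pi)))"
          unfolding moebius_def W_def using ne by (intro tendsto_intros rlim) auto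
        then have "(\<lambda>n. moebius \<sigma> t (W n (1/2 - u/pi))) \<longlonglongrightarrow> Complex 0 (t + \<sigma> * tan u)"
          unfolding of_real_1 mult_1 moebius_cis[OF True] .
        then have "(\<lambda>n. K (moebius \<sigma> t (W n (1/2 - u/pi)))) \<longlonglongrightarrow> K (Complex 0 (t + \<sigma> * tan u))"
          using Re_moebius_pos[OF \<sigma> W, THEN less_imp_le]
          by (intro continuous_on_tendsto_compose[OF cont]) auto
        moreover have "u \<in> {-pi/2..pi/2}" using True by auto
        ultimately show ?thesis using True by (auto intro!: tendsto_intros)
      next
        case False
        then have "u \<notin> {-pi/2..pi/2}" using elim by auto
        then show ?thesis using False by simp
      qed
    qed
  qed (measurable)
  also have "(LINT u|lborel. (indicator {-pi/2<..<pi/2} u / pi) *\<^sub>R K (Complex 0 (t + \<sigma> * tan u))) =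
    (LINT u|density lborel (\<lambda>u. ennreal (indicator {-pi/2<..<pi/2} u / pi)). K (Complex 0 (t + \<sigma> * tan u)))"
    by (subst integral_density) auto
  also have "\<dots> = (LINT x|distr (density lborel (\<lambda>u. ennreal (indicator {-pi/2<..<pi/2} u / pi))) borel (\<lambda>u. t + \<sigma> * tan u). K (Complex 0 x))"
    by (subst integral_distr) auto
  also have "\<dots> = (LINT x|lborel. poisson \<sigma> (x - t) *\<^sub>R K (Complex 0 x))"
    unfolding distr_tan[OF \<sigma>] using \<sigma> by (subst integral_density) (auto simp: poisson_nonneg)
  finally show "(\<lambda>n. integral {0..1} (\<lambda>\<theta>. K (moebius \<sigma> t (of_real (1 - 1 / real (n+2)) * cis (2*pi*\<theta>))))) \<longlonglongrightarrow>
      (LINT x|lborel. poisson \<sigma> (x - t) *\<^sub>R K (Complex 0 x))"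
    unfolding HK[symmetric] unfolding W_def r_def .
qed

context
  fixes f :: "complex \<Rightarrow> complex" and M :: real and \<sigma> t :: real
  assumes hol: "f holomorphic_on half_plane" and cont: "continuous_on {s. 0 \<le> Re s} f"
    and bd: "\<And>s. 0 \<le> Re s \<Longrightarrow> cmod (f s) \<le> M" and \<sigma>: "0 < \<sigma>"
begin

lemma holomorphic_compose_moebius: "(\<lambda>w. f (moebius \<sigma> t w)) holomorphic_on ball 0 1"
  by (rule holomorphic_on_compose_gen[OF holomorphic_moebius hol, unfolded o_def])
     (use Re_moebius_pos[OF \<sigma>] in \<open>auto simp: half_plane_def\<close>)

theorem half_plane_mean: "f (Complex \<sigma> t) = (LINT x|lborel. poisson \<sigma> (x - t) *\<^sub>R f (Complex 0 x))"
proof -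
  have "integral {0..1} (\<lambda>\<theta>. f (moebius \<sigma> t (of_real (1 - 1 / real (n+2)) * cis (2*pi*\<theta>)))) = f (Complex \<sigma> t)" for n
  proof -
    define r where "r = 1 - 1 / real (n+2)"
    have r: "0 < r" "r < 1" by (auto simp: r_def)
    have "f (moebius \<sigma> t 0) = integral {0..1} (\<lambda>\<theta>. f (moebius \<sigma> t (r * cis (2*pi*\<theta>))) * (r * cis (2*pi*\<theta>)) / (r * cis (2*pi*\<theta>) - 0))"
      by (rule circle_mean_Cauchy) (use r in \<open>auto intro!: holomorphic_on_subset[OF holomorphic_compose_moebius]\<close>)
    then show ?thesis using r unfolding r_def[symmetric] by simp
  qed
  then show ?thesis
    using poisson_boundary_limit(2)[OF \<sigma> cont bd, of t] LIMSEQ_unique[OF tendsto_const] by simp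
qed

theorem half_plane_submean:
  assumes q: "0 < q"
  shows "cmod (f (Complex \<sigma> t)) powr q \<le> (LINT x|lborel. poisson \<sigma> (x - t) * cmod (f (Complex 0 x)) powr q)"
proof -
  have *: "cmod (f (Complex \<sigma> t)) powr q \<le> integral {0..1} (\<lambda>\<theta>. cmod (f (moebius \<sigma> t (of_real (1 - 1 / real (n+2)) * cis (2*pi*\<theta>)))) powr q)" for n
  proof -
    define r where "r = 1 - 1 / real (n+2)"
    have r: "0 < r" "r < 1" by (auto simp: r_def)
    \<comment> \<open>Rescaling by \<open>r < 1\<close> gives a function analytic on a disc of
      radius larger than 1, as \<open>circle_submean\<close> demands.\<close>
    have "(\<lambda>w. f (moebius \<sigma> t (r * w))) holomorphic_on ball 0 (1/r)"
      by (rule holomorphic_on_compose_gen[OF _ holomorphic_compose_moebius, unfolded o_def])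
         (use r in \<open>auto intro!: holomorphic_intros simp: norm_mult field_simps\<close>)
    from circle_submean[OF this _ q, of 0] show ?thesis using r by (simp add: r_def)
  qed
  have "(\<lambda>n. integral {0..1} (\<lambda>\<theta>. cmod (f (moebius \<sigma> t (of_real (1 - 1 / real (n+2)) * cis (2*pi*\<theta>)))) powr q)) \<longlonglongrightarrow>
    (LINT x|lborel. poisson \<sigma> (x - t) *\<^sub>R (cmod (f (Complex 0 x)) powr q))"
  proof (rule poisson_boundary_limit(2)[OF \<sigma>])
    show "continuous_on {s. 0 \<le> Re s} (\<lambda>s. cmod (f s) powr q)"
      using q cont by (intro continuous_on_powr' continuous_intros) auto
    show "norm (cmod (f s) powr q) \<le> M powr q" if "0 \<le> Re s" for s
      using bd[OF that] q by (auto intro!: powr_mono2)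
  qed
  then show ?thesis using * by (intro LIMSEQ_le_const) auto
qed

end


section \<open>Analytic completions and the dual Carleson estimate\<close>

text \<open>In the sector where the argument is at most \<open>\<phi> < pi/2\<close> in modulus, the
  real part is comparable to the modulus. Outside it, \<open>q\<close> times the argument lies
  between \<open>q * \<phi> > pi/2\<close> and pi, so \<open>Re (z powr q)\<close> is negative and
  comparable in size to \<open>cmod z powr q\<close>. The bound \<open>q \<le> 2\<close> keeps this
  angle in the range where the cosine decreases.\<close>

lemma stein_inequality:
  assumes q: "1 < q" "q \<le> 2"
  obtains A B where "0 \<le> A" "0 \<le> B"
    "\<And>z::complex. 0 < Re z \<Longrightarrow> cmod z powr q \<le> A * Re z powr q - B * Re (z powr q)"
proof -
  \<comment> \<open>The midpoint of \<open>pi / (2 * q)\<close> and \<open>pi / 2\<close>, so that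
    \<open>\<phi>\<close> is below a right angle while \<open>q * \<phi>\<close> is above
    one.\<close>
  define \<phi> where "\<phi> = pi / 4 * (1 + 1 / q)"
  have \<phi>: "0 < \<phi>" "\<phi> < pi/2" "pi/2 < q * \<phi>" "q * \<phi> \<le> pi"
  proof -
    have "1 / q < 1" using q by simp
    then have "pi / 4 * (1 + 1/q) < pi / 4 * 2" by (intro mult_strict_left_mono) auto
    then show "\<phi> < pi/2" by (simp add: \<phi>_def)
    have e: "q * \<phi> = pi / 4 * (q + 1)" using q by (simp add: \<phi>_def field_simps)
    have "pi / 4 * 2 < pi / 4 * (q + 1)" using q by (intro mult_strict_left_mono) auto
    then show "pi/2 < q * \<phi>" by (simp add: e)
    have "pi / 4 * (q + 1) \<le> pi / 4 * 4" using q by (intro mult_left_mono) auto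
    then show "q * \<phi> \<le> pi" by (simp add: e)
    show "0 < \<phi>" using q by (auto simp: \<phi>_def intro!: mult_pos_pos add_pos_pos)
  qed
  define c where "c = - cos (q * \<phi>)"
  define d where "d = cos \<phi>"
  have c: "0 < c"
  proof -
    have "cos (q * \<phi>) < cos (pi/2)" using \<phi> by (intro cos_monotone_0_pi) auto
    then show ?thesis by (simp add: c_def)
  qed
  have d: "0 < d" using \<phi> unfolding d_def by (intro cos_gt_zero) auto
  define A where "A = (1 + 1/c) / d powr q"
  have A: "0 \<le> A" using c d by (simp add: A_def)
  show ?thesis
  proof (rule that[of A "1/c"])
    show "0 \<le> A" "0 \<le> 1/c" using A c by auto
    fix z :: complex assume z: "0 < Re z"
    define \<theta> where "\<theta> = \<bar>Arg z\<bar>"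
    have z0: "z \<noteq> 0" using z by auto
    have \<theta>: "0 \<le> \<theta>" "\<theta> < pi/2" using Arg_Re_pos z by (auto simp: \<theta>_def)
    have "Re z = cmod z * cos (Arg z)" using arg_cong[OF rcis_cmod_Arg[of z], of Re] by simp
    then have Rez: "Re z = cmod z * cos \<theta>" by (simp add: \<theta>_def abs_if)
    have "z powr q = exp (q * Ln z)" using z0 by (simp add: powr_def)
    then have "Re (z powr q) = exp (q * ln (cmod z)) * cos (q * Arg z)"
      using z0 by (simp add: Re_exp Arg_eq_Im_Ln)
    also have "cos (q * Arg z) = cos (q * \<theta>)"
      by (cases "Arg z \<ge> 0") (auto simp: \<theta>_def)
    finally have Rezq: "Re (z powr q) = cmod z powr q * cos (q * \<theta>)" using z0 by (simp add: powr_def)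
    have cp: "0 \<le> cos \<theta>" using \<theta> by (intro cos_ge_zero) auto
    have "1 \<le> A * cos \<theta> powr q - 1/c * cos (q * \<theta>)"
    proof (cases "\<theta> \<le> \<phi>")
      case True
      have "d \<le> cos \<theta>" unfolding d_def using True \<theta> \<phi> by (intro cos_monotone_0_pi_le) auto
      then have "A * d powr q \<le> A * cos \<theta> powr q" using d q A by (intro mult_left_mono powr_mono2) auto
      moreover have "A * d powr q = 1 + 1/c" using d by (simp add: A_def)
      moreover have "1/c * cos (q * \<theta>) \<le> 1/c" using c by (simp add: field_simps)
      ultimately show ?thesis by linarith
    next
      case False
      have "q * \<theta> \<le> 2 * (pi/2)" using q \<theta> by (intro mult_mono) auto
      then have "cos (q * \<theta>) \<le> cos (q * \<phi>)" using False q \<phi> by (intro cos_monotone_0_pi_le) auto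
      then have "1/c * cos (q * \<theta>) \<le> 1/c * (- c)" using c unfolding c_def by (intro mult_left_mono) auto
      moreover have "0 \<le> A * cos \<theta> powr q" using A by simp
      ultimately show ?thesis using c by auto
    qed
    then have "cmod z powr q * 1 \<le> cmod z powr q * (A * cos \<theta> powr q - 1/c * cos (q * \<theta>))"
      by (intro mult_left_mono) auto
    also have "\<dots> = A * (cmod z * cos \<theta>) powr q - 1/c * (cmod z powr q * cos (q * \<theta>))"
      using cp by (simp add: powr_mult algebra_simps)
    finally show "cmod z powr q \<le> A * Re z powr q - 1/c * Re (z powr q)"
      by (simp only: Rez[symmetric] Rezq[symmetric])
  qed
qed

text \<open>A Cauchy integral whose real part is the Poisson integral of \<open>g\<close>. Up to an
  imaginary constant it is the only analytic function with that real part.\<close>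

definition szego :: "(real \<Rightarrow> real) \<Rightarrow> complex \<Rightarrow> complex" where
  "szego g s = (LINT \<tau>|lborel. of_real (g \<tau>) / (s - \<i> * of_real \<tau>)) / of_real pi"

context
  fixes g :: "real \<Rightarrow> real"
  assumes g [measurable]: "integrable lborel g" and g0: "\<And>\<tau>. 0 \<le> g \<tau>"
begin

lemma cmod_diff_imag_ge: "Re s \<le> cmod (s - \<i> * of_real \<tau>)"
  using complex_Re_le_cmod[of "s - \<i> * of_real \<tau>"] by simp

lemma szego_integrable:
  assumes "0 < Re s" shows "integrable lborel (\<lambda>\<tau>. of_real (g \<tau>) / (s - \<i> * of_real \<tau>) :: complex)"
proof (rule Bochner_Integration.integrable_bound)
  show "integrable lborel (\<lambda>\<tau>. g \<tau> / Re s)" using g by simp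
  show "AE \<tau> in lborel. cmod (of_real (g \<tau>) / (s - \<i> * of_real \<tau>)) \<le> norm (g \<tau> / Re s)"
  proof (rule AE_I2)
    fix \<tau> show "cmod (of_real (g \<tau>) / (s - \<i> * of_real \<tau>)) \<le> norm (g \<tau> / Re s)"
      using assms cmod_diff_imag_ge[of s \<tau>] g0[of \<tau>] by (auto simp: norm_divide intro!: divide_left_mono mult_pos_pos)
  qed
qed measurable

text \<open>Difference quotients converge by dominated convergence. Points near \<open>s\<close> are
  kept in the half-plane \<open>Re w > Re s / 2\<close>, where the kernels are uniformly
  bounded.\<close>

lemma szego_holomorphic: "szego g holomorphic_on half_plane"
proof -
  define k where "k = (\<lambda>s. LINT \<tau>|lborel. of_real (g \<tau>) / (s - \<i> * of_real \<tau>) :: complex)"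
  have alg: "x / (a - c) - x / (b - c) = - (a - b) * (x / ((a - c) * (b - c)))"
    if "a - c \<noteq> 0" "b - c \<noteq> 0" for x a b c :: complex
  proof -
    have "x / (a - c) - x / (b - c) = (x * (b - c) - x * (a - c)) / ((a - c) * (b - c))"
      using that by (simp add: diff_frac_eq)
    also have "x * (b - c) - x * (a - c) = - (a - b) * x" by (simp add: algebra_simps)
    finally show ?thesis by simp
  qed
  have "\<exists>D. (k has_field_derivative D) (at s)" if s: "0 < Re s" for s
  proof -
    define S where "S = {w::complex. Re s / 2 < Re w}"
    have S: "open S" "s \<in> S" using s open_halfspace_Re_gt[of "Re s / 2"] by (auto simp: S_def)
    define D where "D = - (LINT \<tau>|lborel. of_real (g \<tau>) / ((s - \<i> * of_real \<tau>) * (s - \<i> * of_real \<tau>)) :: complex)"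
    have "((\<lambda>w. (k w - k s) / (w - s)) \<longlongrightarrow> D) (at s within S)"
      unfolding tendsto_at_iff_sequentially o_def
    proof (intro allI impI)
      fix X :: "nat \<Rightarrow> complex" assume X: "\<forall>i. X i \<in> S - {s}" "X \<longlonglongrightarrow> s"
      have ReX: "Re s / 2 < Re (X i)" for i using X by (auto simp: S_def)
      have nz: "X i - \<i> * of_real \<tau> \<noteq> 0" "s - \<i> * of_real \<tau> \<noteq> 0" for i \<tau>
        using ReX[of i] s by (auto simp: complex_eq_iff)
      have "(k (X i) - k s) / (X i - s) = - (LINT \<tau>|lborel. of_real (g \<tau>) / ((X i - \<i> * of_real \<tau>) * (s - \<i> * of_real \<tau>)))" for i
      proof -
        have "k (X i) - k s = (LINT \<tau>|lborel. of_real (g \<tau>) / (X i - \<i> * of_real \<tau>) - of_real (g \<tau>) / (s - \<i> * of_real \<tau>))"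
          unfolding k_def using ReX[of i] s by (intro Bochner_Integration.integral_diff[symmetric] szego_integrable) auto
        also have "\<dots> = (LINT \<tau>|lborel. - (X i - s) * (of_real (g \<tau>) / ((X i - \<i> * of_real \<tau>) * (s - \<i> * of_real \<tau>))))"
          by (intro Bochner_Integration.integral_cong refl) (simp only: alg[OF nz])
        also have "\<dots> = - (X i - s) * (LINT \<tau>|lborel. of_real (g \<tau>) / ((X i - \<i> * of_real \<tau>) * (s - \<i> * of_real \<tau>)))"
          by (rule integral_mult_right_zero)
        finally have e: "k (X i) - k s = - (X i - s) * (LINT \<tau>|lborel. of_real (g \<tau>) / ((X i - \<i> * of_real \<tau>) * (s - \<i> * of_real \<tau>)))" .
        have nz': "X i - s \<noteq> 0" using X by auto
        have aux: "(- a * x) / a = - x" if "a \<noteq> 0" for a x :: complex using that by simp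
        show ?thesis unfolding e by (rule aux[OF nz'])
      qed
      moreover have "(\<lambda>i. LINT \<tau>|lborel. of_real (g \<tau>) / ((X i - \<i> * of_real \<tau>) * (s - \<i> * of_real \<tau>))) \<longlonglongrightarrow>
          (LINT \<tau>|lborel. of_real (g \<tau>) / ((s - \<i> * of_real \<tau>) * (s - \<i> * of_real \<tau>)))"
      proof (rule integral_dominated_convergence)
        show "integrable lborel (\<lambda>\<tau>. g \<tau> / ((Re s / 2) * Re s))" using g by simp
        show "AE \<tau> in lborel. (\<lambda>i. of_real (g \<tau>) / ((X i - \<i> * of_real \<tau>) * (s - \<i> * of_real \<tau>)))
           \<longlonglongrightarrow> of_real (g \<tau>) / ((s - \<i> * of_real \<tau>) * (s - \<i> * of_real \<tau>))"
          using nz by (intro AE_I2 tendsto_intros X(2)) auto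
        fix i show "AE \<tau> in lborel. norm (of_real (g \<tau>) / ((X i - \<i> * of_real \<tau>) * (s - \<i> * of_real \<tau>))) \<le> g \<tau> / ((Re s / 2) * Re s)"
        proof (rule AE_I2)
          fix \<tau>
          have "(Re s / 2) * Re s \<le> cmod (X i - \<i> * of_real \<tau>) * cmod (s - \<i> * of_real \<tau>)"
            using s ReX[of i] cmod_diff_imag_ge[of "X i" \<tau>] cmod_diff_imag_ge[of s \<tau>] by (intro mult_mono) auto
          then have "g \<tau> / (cmod (X i - \<i> * of_real \<tau>) * cmod (s - \<i> * of_real \<tau>)) \<le> g \<tau> / ((Re s / 2) * Re s)"
            using s g0 nz by (intro divide_left_mono mult_pos_pos) auto
          then show "norm (of_real (g \<tau>) / ((X i - \<i> * of_real \<tau>) * (s - \<i> * of_real \<tau>))) \<le> g \<tau> / ((Re s / 2) * Re s)"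
            using g0[of \<tau>] by (simp add: norm_divide norm_mult)
        qed
      qed measurable
      ultimately show "(\<lambda>i. (k (X i) - k s) / (X i - s)) \<longlonglongrightarrow> D"
        unfolding D_def by (auto intro!: tendsto_minus)
    qed
    then have "(k has_field_derivative D) (at s)"
      unfolding has_field_derivative_iff at_within_open[OF S(2,1)] .
    then show ?thesis by blast
  qed
  then have "k holomorphic_on half_plane"
    unfolding holomorphic_on_def field_differentiable_def half_plane_def
    using has_field_derivative_at_within by blast
  then have "(\<lambda>s. k s / of_real pi) holomorphic_on half_plane" by (intro holomorphic_intros) auto
  then show ?thesis unfolding k_def szego_def .
qed

lemma Re_szego:
  assumes "0 < Re s"
  shows "integrable lborel (\<lambda>\<tau>. g \<tau> * poisson (Re s) (Im s - \<tau>))"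
    and "Re (szego g s) = (LINT \<tau>|lborel. g \<tau> * poisson (Re s) (Im s - \<tau>))"
proof -
  have *: "Re (of_real (g \<tau>) / (s - \<i> * of_real \<tau>)) / pi = g \<tau> * poisson (Re s) (Im s - \<tau>)" for \<tau>
    by (simp add: Re_divide poisson_def power2_eq_square)
  have "integrable lborel (\<lambda>\<tau>. Re (of_real (g \<tau>) / (s - \<i> * of_real \<tau>)) / pi)"
    using szego_integrable[OF assms] by simp
  then show "integrable lborel (\<lambda>\<tau>. g \<tau> * poisson (Re s) (Im s - \<tau>))" unfolding * .
  have "Re (szego g s) = (LINT \<tau>|lborel. Re (of_real (g \<tau>) / (s - \<i> * of_real \<tau>))) / pi"
    unfolding szego_def using szego_integrable[OF assms] by (simp add: Re_divide_of_real)
  also have "\<dots> = (LINT \<tau>|lborel. Re (of_real (g \<tau>) / (s - \<i> * of_real \<tau>)) / pi)" by simp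
  finally show "Re (szego g s) = (LINT \<tau>|lborel. g \<tau> * poisson (Re s) (Im s - \<tau>))" unfolding * .
qed

text \<open>Strict positivity keeps the values off the negative axis, so that every real power of
  \<open>szego g\<close> is analytic.\<close>

lemma Re_szego_pos:
  assumes s: "0 < Re s" and pos: "0 < (LINT \<tau>|lborel. g \<tau>)"
  shows "0 < Re (szego g s)"
proof -
  have nn: "0 \<le> g \<tau> * poisson (Re s) (Im s - \<tau>)" for \<tau>
    using g0 poisson_nonneg s by (intro mult_nonneg_nonneg) auto
  have "(LINT \<tau>|lborel. g \<tau> * poisson (Re s) (Im s - \<tau>)) \<noteq> 0"
  proof
    assume "(LINT \<tau>|lborel. g \<tau> * poisson (Re s) (Im s - \<tau>)) = 0"
    then have "AE \<tau> in lborel. g \<tau> * poisson (Re s) (Im s - \<tau>) = 0"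
      using integral_nonneg_eq_0_iff_AE[OF Re_szego(1)[OF s]] nn by auto
    then have "AE \<tau> in lborel. g \<tau> = 0"
      by eventually_elim (use poisson_pos[OF s] in \<open>auto simp: less_imp_neq[THEN not_sym]\<close>)
    then have "(LINT \<tau>|lborel. g \<tau>) = 0" by (rule integral_eq_zero_AE)
    then show False using pos by simp
  qed
  moreover have "0 \<le> (LINT \<tau>|lborel. g \<tau> * poisson (Re s) (Im s - \<tau>))" by (intro Bochner_Integration.integral_nonneg nn)
  ultimately show ?thesis unfolding Re_szego(2)[OF s] by linarith
qed

lemma cmod_szego_le:
  assumes s: "0 < Re s" shows "cmod (szego g s) \<le> (LINT \<tau>|lborel. g \<tau>) / (pi * Re s)"
proof -
  have "cmod (LINT \<tau>|lborel. of_real (g \<tau>) / (s - \<i> * of_real \<tau>)) \<le> (LINT \<tau>|lborel. g \<tau> / Re s)"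
  proof (rule Bochner_Integration.integral_norm_bound_integral)
    show "cmod (of_real (g \<tau>) / (s - \<i> * of_real \<tau>)) \<le> g \<tau> / Re s" for \<tau>
      using s cmod_diff_imag_ge[of s \<tau>] g0[of \<tau>] by (auto simp: norm_divide intro!: divide_left_mono mult_pos_pos)
  qed (use szego_integrable[OF s] g in auto)
  then have "cmod (LINT \<tau>|lborel. of_real (g \<tau>) / (s - \<i> * of_real \<tau>)) / pi \<le> (LINT \<tau>|lborel. g \<tau>) / Re s / pi"
    by (intro divide_right_mono) auto
  then show ?thesis by (simp add: szego_def norm_divide mult.commute)
qed

text \<open>On the window the Poisson kernel is at least \<open>1 / (2 * pi * Re s)\<close>. The
  window consists of the vertices of all cones that contain \<open>s\<close>; this is how an area
  function tested against \<open>g\<close> becomes an integral against \<open>\<mu>\<close>.\<close>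

lemma Re_szego_ge_average:
  assumes s: "0 < Re s"
  shows "(LINT \<tau>|lborel. g \<tau> * indicator {\<tau>. \<bar>Im s - \<tau>\<bar> < Re s} \<tau>) \<le> 2 * pi * Re s * Re (szego g s)"
proof -
  have m [measurable]: "{\<tau>. \<bar>Im s - \<tau>\<bar> < Re s} \<in> sets borel" by measurable
  have "(LINT \<tau>|lborel. g \<tau> * indicator {\<tau>. \<bar>Im s - \<tau>\<bar> < Re s} \<tau>) \<le> (LINT \<tau>|lborel. 2 * pi * Re s * (g \<tau> * poisson (Re s) (Im s - \<tau>)))"
  proof (rule integral_mono)
    show "integrable lborel (\<lambda>\<tau>. g \<tau> * indicator {\<tau>. \<bar>Im s - \<tau>\<bar> < Re s} \<tau>)"
      using integrable_mult_indicator[OF _ g, of "{\<tau>. \<bar>Im s - \<tau>\<bar> < Re s}"] by (simp add: mult.commute)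
    show "integrable lborel (\<lambda>\<tau>. 2 * pi * Re s * (g \<tau> * poisson (Re s) (Im s - \<tau>)))"
      using Re_szego(1)[OF s] by simp
    fix \<tau> :: real
    have "1 \<le> 2 * pi * Re s * poisson (Re s) (Im s - \<tau>)" if "\<bar>Im s - \<tau>\<bar> < Re s"
    proof -
      have "(Im s - \<tau>)\<^sup>2 \<le> (Re s)\<^sup>2" using that abs_le_square_iff[of "Im s - \<tau>" "Re s"] by auto
      then have "1 \<le> 2 * (Re s)\<^sup>2 / ((Re s)\<^sup>2 + (Im s - \<tau>)\<^sup>2)"
        using s by (simp add: le_divide_eq add_pos_nonneg)
      then show ?thesis by (simp add: poisson_def power2_eq_square mult_ac)
    qed
    then have "g \<tau> * 1 \<le> g \<tau> * (2 * pi * Re s * poisson (Re s) (Im s - \<tau>))" if "\<bar>Im s - \<tau>\<bar> < Re s"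
      using that g0 by (intro mult_left_mono) auto
    moreover have "0 \<le> g \<tau> * poisson (Re s) (Im s - \<tau>)" using g0 s by (intro mult_nonneg_nonneg poisson_nonneg) auto
    ultimately show "g \<tau> * indicator {\<tau>. \<bar>Im s - \<tau>\<bar> < Re s} \<tau> \<le> 2 * pi * Re s * (g \<tau> * poisson (Re s) (Im s - \<tau>))"
      using s by (auto simp: indicator_def mult_ac)
  qed
  then show ?thesis by (simp add: Re_szego(2)[OF s])
qed

text \<open>Jensen's inequality for the Poisson probability measure, by way of Young: with
  \<open>m = Re (szego g s)\<close> one integrates g m^(q-1) \<le> g^q / q + m^q / q' against the
  kernel and absorbs the last term on the left.\<close>

lemma Re_szego_powr_le:
  assumes s: "0 < Re s" and q: "1 < q"
  shows "ennreal (Re (szego g s) powr q) \<le> (\<integral>\<^sup>+\<tau>. ennreal (g \<tau> powr q * poisson (Re s) (Im s - \<tau>)) \<partial>lborel)"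
    (is "_ \<le> ?J")
proof (cases "?J = \<infinity>")
  case False
  define m where "m = Re (szego g s)"
  define q' where "q' = q / (q - 1)"
  have q': "1 < q'" "1 / q + 1 / q' = 1" "(q - 1) * q' = q" using q by (auto simp: q'_def field_simps)
  have m0: "0 \<le> m" unfolding m_def Re_szego(2)[OF s] using g0 s
    by (intro Bochner_Integration.integral_nonneg mult_nonneg_nonneg poisson_nonneg) auto
  have intP: "integrable lborel (\<lambda>\<tau>. poisson (Re s) (Im s - \<tau>))" and P1: "(LINT \<tau>|lborel. poisson (Re s) (Im s - \<tau>)) = 1"
  proof -
    have eq: "poisson (Re s) (Im s - \<tau>) = poisson (Re s) (\<tau> - Im s)" for \<tau>
      using poisson_minus[of "Re s" "\<tau> - Im s"] by simp
    show i: "integrable lborel (\<lambda>\<tau>. poisson (Re s) (Im s - \<tau>))" unfolding eq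
      by (rule integrableI_nonneg) (use nn_integral_poisson[OF s, of "Im s"] poisson_nonneg[of "Re s"] s in auto)
    show "(LINT \<tau>|lborel. poisson (Re s) (Im s - \<tau>)) = 1" unfolding eq
      by (subst integral_eq_nn_integral) (use nn_integral_poisson[OF s, of "Im s"] poisson_nonneg[of "Re s"] s in auto)
  qed
  have nn: "0 \<le> g \<tau> powr q * poisson (Re s) (Im s - \<tau>)" for \<tau>
    using s poisson_nonneg by (intro mult_nonneg_nonneg) auto
  have intq: "integrable lborel (\<lambda>\<tau>. g \<tau> powr q * poisson (Re s) (Im s - \<tau>))"
    by (rule integrableI_nonneg) (use False nn in \<open>auto simp: top.not_eq_extremum\<close>)
  define J where "J = (LINT \<tau>|lborel. g \<tau> powr q * poisson (Re s) (Im s - \<tau>))"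
  have J: "?J = ennreal J" unfolding J_def using nn by (intro nn_integral_eq_integral intq) auto
  have "m powr q = m powr (q - 1) * m"
    using m0 q by (cases "m = 0") (auto simp: powr_diff)
  also have "\<dots> = (LINT \<tau>|lborel. m powr (q - 1) * (g \<tau> * poisson (Re s) (Im s - \<tau>)))"
    using Re_szego(2)[OF s] by (simp add: m_def)
  also have "\<dots> \<le> (LINT \<tau>|lborel. (1/q) * (g \<tau> powr q * poisson (Re s) (Im s - \<tau>)) + (m powr q / q') * poisson (Re s) (Im s - \<tau>))"
  proof (rule integral_mono)
    fix \<tau>
    have "g \<tau> * m powr (q - 1) \<le> g \<tau> powr q / q + (m powr (q - 1)) powr q' / q'"
      using q q' g0 by (intro Youngs_inequality) auto
    then have "g \<tau> * m powr (q - 1) \<le> g \<tau> powr q / q + m powr q / q'" by (simp add: powr_powr q')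
    then have "(g \<tau> * m powr (q - 1)) * poisson (Re s) (Im s - \<tau>) \<le> (g \<tau> powr q / q + m powr q / q') * poisson (Re s) (Im s - \<tau>)"
      using s poisson_nonneg by (intro mult_right_mono) auto
    then show "m powr (q - 1) * (g \<tau> * poisson (Re s) (Im s - \<tau>)) \<le> (1/q) * (g \<tau> powr q * poisson (Re s) (Im s - \<tau>)) + (m powr q / q') * poisson (Re s) (Im s - \<tau>)"
      by (simp add: algebra_simps)
  qed (use Re_szego(1)[OF s] intq intP in auto)
  also have "\<dots> = J / q + m powr q / q'"
    using intq intP by (simp add: J_def P1)
  finally have "m powr q * (1 - 1 / q') \<le> J / q" by (simp add: algebra_simps)
  moreover have "1 - 1 / q' = 1 / q" using q' by simp
  ultimately have "m powr q \<le> J" using q by (simp add: divide_right_mono field_simps)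
  then show ?thesis unfolding J m_def by (rule ennreal_leI)
qed simp

end

section \<open>The M. Riesz inequality and the testing of the embedding\<close>

lemma poisson_scaled_le: "0 < R \<Longrightarrow> pi * R * poisson R x \<le> 1"
  by (simp add: poisson_def power2_eq_square divide_le_eq add_pos_nonneg)

context
  fixes g :: "real \<Rightarrow> real"
  assumes g [measurable]: "integrable lborel g" and g0: "\<And>\<tau>. 0 \<le> g \<tau>" and gpos: "0 < (LINT \<tau>|lborel. g \<tau>)"
begin

text \<open>
  M. Riesz' theorem by Stein's argument: the mean value property turns \<open>Re (h\<^sup>q)\<close> into a term
  that vanishes as the pole of the Poisson kernel goes to infinity.
\<close>

lemma szego_Lq_bound:
  assumes q: "1 < q" and A: "0 \<le> A" and B: "0 \<le> B"
    and stein: "\<And>z::complex. 0 < Re z \<Longrightarrow> cmod z powr q \<le> A * Re z powr q - B * Re (z powr q)"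
    and \<sigma>: "0 < \<sigma>"
  shows "(\<integral>\<^sup>+t. ennreal (cmod (szego g (Complex \<sigma> t)) powr q) \<partial>lborel) \<le> ennreal A * (\<integral>\<^sup>+\<tau>. ennreal (g \<tau> powr q) \<partial>lborel)"
proof -
  define I where "I = (LINT \<tau>|lborel. g \<tau>)"
  have I0: "0 \<le> I" using gpos by (simp add: I_def)
  have gm [measurable]: "g \<in> borel_measurable borel" using g by (simp add: borel_measurable_integrable)
  define h where "h = szego g"
  have hpos: "0 < Re (h s)" if "0 < Re s" for s
    unfolding h_def by (rule Re_szego_pos[OF g g0 that gpos])
  have hbd: "cmod (h s) \<le> I / (pi * Re s)" if "0 < Re s" for s
    unfolding h_def I_def by (rule cmod_szego_le[OF g g0 that])
  have hhol: "h holomorphic_on half_plane" unfolding h_def by (rule szego_holomorphic[OF g g0])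
  \<comment> \<open>Translation by \<open>\<sigma>\<close> makes the power of \<open>h\<close>
    analytic across the imaginary axis and bounded to its right, so the mean value property holds
    with boundary values on the axis.\<close>
  define f where "f = (\<lambda>s. h (s + of_real \<sigma>) powr of_real q)"
  have f_hol: "f holomorphic_on {s. - \<sigma> < Re s}"
  proof -
    have "(\<lambda>s. h (s + of_real \<sigma>)) holomorphic_on {s. - \<sigma> < Re s}"
      by (rule holomorphic_on_compose_gen[OF _ hhol, unfolded o_def])
         (auto intro!: holomorphic_intros simp: half_plane_def)
    moreover have "h (s + of_real \<sigma>) \<notin> \<real>\<^sub>\<le>\<^sub>0" if "s \<in> {s. - \<sigma> < Re s}" for s
      using hpos[of "s + of_real \<sigma>"] that by (auto simp: complex_nonpos_Reals_iff)
    ultimately show ?thesis unfolding f_def by (intro holomorphic_intros)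
  qed
  have f_norm: "cmod (f s) = cmod (h (s + of_real \<sigma>)) powr q" for s
    by (simp add: f_def norm_powr_real_powr')
  have f_bd: "cmod (f s) \<le> (I / (pi * \<sigma>)) powr q" if "0 \<le> Re s" for s
  proof -
    have "cmod (h (s + of_real \<sigma>)) \<le> I / (pi * Re (s + of_real \<sigma>))" using that \<sigma> by (intro hbd) auto
    also have "\<dots> \<le> I / (pi * \<sigma>)" using that \<sigma> I0 by (intro divide_left_mono mult_left_mono mult_pos_pos) auto
    finally show ?thesis unfolding f_norm using q by (intro powr_mono2) auto
  qed
  have f_hol': "f holomorphic_on half_plane" by (rule holomorphic_on_subset[OF f_hol]) (use \<sigma> in \<open>auto simp: half_plane_def\<close>)
  have f_cont: "continuous_on {s. 0 \<le> Re s} f"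
    by (rule holomorphic_on_imp_continuous_on[OF holomorphic_on_subset[OF f_hol]]) (use \<sigma> in auto)
  have meas_f [measurable]: "(\<lambda>x. f (Complex 0 x)) \<in> borel_measurable borel"
    by (intro borel_measurable_continuous_onI continuous_on_compose2[OF f_cont]) (auto simp: Complex_eq intro!: continuous_intros)
  define v where "v x = cmod (h (Complex \<sigma> x)) powr q" for x
  have v: "v x = cmod (f (Complex 0 x))" for x
    by (simp add: v_def f_norm Complex_eq add.commute)
  define u where "u x = Re (h (Complex \<sigma> x)) powr q" for x
  have u_le: "u x \<le> v x" for x unfolding u_def v_def
    using hpos[of "Complex \<sigma> x"] \<sigma> q complex_Re_le_cmod by (intro powr_mono2) auto
  have vm [measurable]: "v \<in> borel_measurable borel" unfolding v by measurable
  have um [measurable]: "u \<in> borel_measurable borel"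
  proof -
    have "continuous_on UNIV (\<lambda>x. h (Complex \<sigma> x))"
      by (intro continuous_on_compose2[OF holomorphic_on_imp_continuous_on[OF hhol]])
         (use \<sigma> in \<open>auto simp: Complex_eq half_plane_def intro!: continuous_intros\<close>)
    then have "(\<lambda>x. h (Complex \<sigma> x)) \<in> borel_measurable borel" by (rule borel_measurable_continuous_onI)
    then show ?thesis unfolding u_def by measurable
  qed
  define Q where "Q = (\<integral>\<^sup>+\<tau>. ennreal (g \<tau> powr q) \<partial>lborel)"
  \<comment> \<open>Jensen's inequality at every point of the line, then Fubini: integrated over
    \<open>x\<close>, the kernel has mass 1.\<close>
  have u_int: "(\<integral>\<^sup>+x. ennreal (u x) \<partial>lborel) \<le> Q"
  proof -
    have "(\<integral>\<^sup>+x. ennreal (u x) \<partial>lborel) \<le> (\<integral>\<^sup>+x. (\<integral>\<^sup>+\<tau>. ennreal (g \<tau> powr q * poisson \<sigma> (x - \<tau>)) \<partial>lborel) \<partial>lborel)"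
      unfolding u_def h_def using Re_szego_powr_le[OF g g0 _ q, of "Complex \<sigma> _"] \<sigma> by (intro nn_integral_mono) auto
    also have "\<dots> = (\<integral>\<^sup>+\<tau>. (\<integral>\<^sup>+x. ennreal (g \<tau> powr q * poisson \<sigma> (x - \<tau>)) \<partial>lborel) \<partial>lborel)"
      by (rule lborel_pair.Fubini') (simp add: poisson_def)
    also have "\<dots> = (\<integral>\<^sup>+\<tau>. ennreal (g \<tau> powr q) * 1 \<partial>lborel)"
    proof (rule nn_integral_cong)
      fix \<tau>
      have "(\<integral>\<^sup>+x. ennreal (g \<tau> powr q * poisson \<sigma> (x - \<tau>)) \<partial>lborel) = ennreal (g \<tau> powr q) * (\<integral>\<^sup>+x. ennreal (poisson \<sigma> (x - \<tau>)) \<partial>lborel)"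
        by (subst nn_integral_cmult[symmetric]) (auto simp: ennreal_mult' intro!: nn_integral_cong)
      then show "(\<integral>\<^sup>+x. ennreal (g \<tau> powr q * poisson \<sigma> (x - \<tau>)) \<partial>lborel) = ennreal (g \<tau> powr q) * 1"
        by (simp only: nn_integral_poisson[OF \<sigma>])
    qed
    finally show ?thesis by (simp add: Q_def)
  qed
  \<comment> \<open>The factor \<open>pi * R * poisson R x\<close> is at most 1 and tends to 1 as
    \<open>R\<close> grows, so the left side is the desired integral with a soft cutoff. Against the
    same kernel the term with \<open>Re (f s)\<close> integrates to its value at the point
    \<open>R\<close>.\<close>
  have key: "(\<integral>\<^sup>+x. ennreal (pi * R * poisson R x * v x) \<partial>lborel) \<le> ennreal A * Q + ennreal (B * (pi * R * (I / (pi * R)) powr q))"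
    if R: "0 < R" for R
  proof -
    have P0: "0 \<le> poisson R x" for x using R by (simp add: poisson_nonneg)
    have bdv: "v x \<le> (I / (pi * \<sigma>)) powr q" for x unfolding v using f_bd by auto
    have int_f: "integrable lborel (\<lambda>x. poisson R x *\<^sub>R f (Complex 0 x))"
      using poisson_boundary_limit(1)[OF R f_cont f_bd, of 0] by simp
    have int_v: "integrable lborel (\<lambda>x. poisson R x * v x)"
      using integrable_norm[OF int_f] P0 by (simp add: v)
    have int_u: "integrable lborel (\<lambda>x. poisson R x * u x)"
    proof (rule Bochner_Integration.integrable_bound[OF int_v])
      show "(\<lambda>x. poisson R x * u x) \<in> borel_measurable lborel" by measurable
      have "norm (poisson R x * u x) \<le> norm (poisson R x * v x)" for x
      proof -
        have "0 \<le> u x" by (simp add: u_def)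
        then show ?thesis using mult_left_mono[OF u_le[of x] P0[of x]] P0[of x] u_le[of x] by (simp add: abs_mult)
      qed
      then show "AE x in lborel. norm (poisson R x * u x) \<le> norm (poisson R x * v x)" by simp
    qed
    have "f (Complex R 0) = (LINT x|lborel. poisson R (x - 0) *\<^sub>R f (Complex 0 x))"
      by (rule half_plane_mean[OF f_hol' f_cont f_bd R])
    then have mean: "Re (f (Complex R 0)) = (LINT x|lborel. poisson R x * Re (f (Complex 0 x)))"
      using int_f by (simp add: integral_Re[symmetric])
    have int_R: "integrable lborel (\<lambda>x. poisson R x * Re (f (Complex 0 x)))"
      using integrable_Re[OF int_f] by simp
    have "(LINT x|lborel. poisson R x * v x) \<le> (LINT x|lborel. A * (poisson R x * u x) - B * (poisson R x * Re (f (Complex 0 x))))"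
    proof (rule integral_mono)
      fix x
      have "v x \<le> A * u x - B * Re (f (Complex 0 x))"
        unfolding v_def u_def f_def using stein[OF hpos[of "Complex \<sigma> x"]] \<sigma> by (simp add: Complex_eq add.commute)
      then have "poisson R x * v x \<le> poisson R x * (A * u x - B * Re (f (Complex 0 x)))"
        using P0 by (intro mult_left_mono)
      then show "poisson R x * v x \<le> A * (poisson R x * u x) - B * (poisson R x * Re (f (Complex 0 x)))"
        by (simp add: algebra_simps)
    qed (use int_u int_v int_R in auto)
    also have "\<dots> = A * (LINT x|lborel. poisson R x * u x) - B * Re (f (Complex R 0))"
      using int_u int_R by (simp add: mean)
    also have "\<dots> \<le> A * (LINT x|lborel. poisson R x * u x) + B * (I / (pi * R)) powr q"
    proof -
      have "- Re (f (Complex R 0)) \<le> cmod (f (Complex R 0))" using abs_Re_le_cmod[of "f (Complex R 0)"] by linarith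
      also have "\<dots> \<le> (I / (pi * R)) powr q"
      proof -
        have "cmod (h (Complex R 0 + of_real \<sigma>)) \<le> I / (pi * (R + \<sigma>))" using hbd[of "Complex R 0 + of_real \<sigma>"] R \<sigma> by simp
        also have "\<dots> \<le> I / (pi * R)" using R \<sigma> I0 by (intro divide_left_mono mult_left_mono mult_pos_pos) auto
        finally show ?thesis unfolding f_norm using q by (intro powr_mono2) auto
      qed
      finally have "B * - Re (f (Complex R 0)) \<le> B * (I / (pi * R)) powr q" using B by (intro mult_left_mono)
      then show ?thesis by simp
    qed
    finally have real_ineq: "(LINT x|lborel. poisson R x * v x) \<le> A * (LINT x|lborel. poisson R x * u x) + B * (I / (pi * R)) powr q" .
    have "(\<integral>\<^sup>+x. ennreal (pi * R * poisson R x * v x) \<partial>lborel) = ennreal (LINT x|lborel. pi * R * (poisson R x * v x))"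
      by (subst nn_integral_eq_integral[symmetric])
         (use int_v P0 R in \<open>auto simp: v_def mult.assoc intro!: nn_integral_cong AE_I2 mult_nonneg_nonneg\<close>)
    also have "(LINT x|lborel. pi * R * (poisson R x * v x)) = pi * R * (LINT x|lborel. poisson R x * v x)" by simp
    also have "ennreal \<dots> \<le> ennreal (pi * R * (A * (LINT x|lborel. poisson R x * u x) + B * (I / (pi * R)) powr q))"
      using R real_ineq by (intro ennreal_leI mult_left_mono) auto
    also have "\<dots> = ennreal (A * (LINT x|lborel. pi * R * (poisson R x * u x)) + B * (pi * R * (I / (pi * R)) powr q))"
      by (simp add: algebra_simps)
    also have "\<dots> = ennreal A * ennreal (LINT x|lborel. pi * R * (poisson R x * u x)) + ennreal (B * (pi * R * (I / (pi * R)) powr q))"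
    proof -
      have "0 \<le> (LINT x|lborel. pi * R * (poisson R x * u x))"
        using P0 R by (intro Bochner_Integration.integral_nonneg) (auto simp: u_def)
      then show ?thesis using A B R by (subst ennreal_plus) (auto simp: ennreal_mult')
    qed
    also have "ennreal (LINT x|lborel. pi * R * (poisson R x * u x)) = (\<integral>\<^sup>+x. ennreal (pi * R * (poisson R x * u x)) \<partial>lborel)"
      by (rule nn_integral_eq_integral[symmetric])
         (use int_u P0 R in \<open>auto simp: u_def intro!: AE_I2 mult_nonneg_nonneg\<close>)
    also have "\<dots> \<le> (\<integral>\<^sup>+x. ennreal (u x) \<partial>lborel)"
    proof (intro nn_integral_mono ennreal_leI)
      fix x show "pi * R * (poisson R x * u x) \<le> u x"
        using mult_right_mono[OF poisson_scaled_le[OF R, of x], of "u x"] by (simp add: u_def mult_ac)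
    qed
    also have "\<dots> \<le> Q" by (rule u_int)
    finally show ?thesis by (simp add: add_mono mult_left_mono)
  qed
  define E where "E n = ennreal A * Q + ennreal (B * (pi * real (Suc n) * (I / (pi * real (Suc n))) powr q))" for n
  \<comment> \<open>The value at \<open>R\<close> is of order R^(-q) and is multiplied by
    \<open>pi * R\<close>; the product vanishes in the limit because \<open>q > 1\<close>.\<close>
  have lim: "(\<lambda>n. B * (pi * real (Suc n) * (I / (pi * real (Suc n))) powr q)) \<longlonglongrightarrow> 0"
  proof -
    have "(\<lambda>n. B * pi * (I / pi) powr q * (real (Suc n) * (real (Suc n)) powr (-q))) \<longlonglongrightarrow> B * pi * (I / pi) powr q * 0"
      by (intro tendsto_mult tendsto_const) (use q in real_asymp)
    moreover have e: "B * (pi * real (Suc n) * (I / (pi * real (Suc n))) powr q) = B * pi * (I / pi) powr q * (real (Suc n) * (real (Suc n)) powr (-q))" for n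
    proof -
      have "(I / (pi * real (Suc n))) powr q = (I / pi) powr q * (real (Suc n)) powr (-q)"
        using I0 by (simp only: divide_divide_eq_left[symmetric]) (subst powr_divide, auto simp: powr_minus divide_inverse)
      then show ?thesis by (simp only: mult_ac)
    qed
    ultimately show ?thesis unfolding e mult_zero_right by simp
  qed
  have "(\<integral>\<^sup>+x. ennreal (v x) \<partial>lborel) = (\<integral>\<^sup>+x. liminf (\<lambda>n. ennreal (pi * real (Suc n) * poisson (real (Suc n)) x * v x)) \<partial>lborel)"
  proof (rule nn_integral_cong)
    fix x
    have "(\<lambda>n. pi * real (Suc n) * poisson (real (Suc n)) x) \<longlonglongrightarrow> 1"
      unfolding poisson_def by real_asymp
    then have "(\<lambda>n. ennreal (pi * real (Suc n) * poisson (real (Suc n)) x * v x)) \<longlonglongrightarrow> ennreal (1 * v x)"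
      by (intro tendsto_intros)
    then show "ennreal (v x) = liminf (\<lambda>n. ennreal (pi * real (Suc n) * poisson (real (Suc n)) x * v x))"
      by (simp add: lim_imp_Liminf)
  qed
  also have "\<dots> \<le> liminf (\<lambda>n. \<integral>\<^sup>+x. ennreal (pi * real (Suc n) * poisson (real (Suc n)) x * v x) \<partial>lborel)"
    by (rule nn_integral_liminf) measurable
  also have "\<dots> \<le> liminf E"
    unfolding E_def by (intro Liminf_mono always_eventually allI key) simp
  also have "E \<longlonglongrightarrow> ennreal A * Q + ennreal 0"
    unfolding E_def by (intro tendsto_intros lim)
  then have "liminf E = ennreal A * Q" by (simp add: lim_imp_Liminf)
  finally show ?thesis by (simp add: v_def h_def Q_def)
qed

end

lemma szego_eq_0:
  assumes g: "integrable lborel g" "\<And>\<tau>. 0 \<le> g \<tau>" "\<not> 0 < (LINT \<tau>|lborel. g \<tau>)"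
  shows "szego g s = 0"
proof -
  have [measurable]: "g \<in> borel_measurable borel" using g by (simp add: borel_measurable_integrable)
  have "(LINT \<tau>|lborel. g \<tau>) = 0" using g Bochner_Integration.integral_nonneg[of lborel g] by (simp add: not_less antisym)
  then have "AE \<tau> in lborel. g \<tau> = 0" using integral_nonneg_eq_0_iff_AE[OF g(1)] g(2) by auto
  then have "AE \<tau> in lborel. of_real (g \<tau>) / (s - \<i> * of_real \<tau>) = (0::complex)" by eventually_elim auto
  then have "(LINT \<tau>|lborel. of_real (g \<tau>) / (s - \<i> * of_real \<tau>)) = (0::complex)" by (rule integral_eq_zero_AE)
  then show ?thesis by (simp add: szego_def)
qed

text \<open>The test function is \<open>szego g\<close> to the power \<open>q / p\<close>: its
  modulus to the power \<open>p\<close> is \<open>cmod (szego g s) powr q\<close>, so an embedding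
  for the given \<open>p\<close> yields an estimate with exponent \<open>q\<close>. Its size in
  \<open>hpi_space p\<close> follows from the M. Riesz inequality, as the weight on vertical lines
  is at most 1.\<close>

lemma szego_carleson:
  assumes sets: "sets \<mu> = sets (restrict_space borel half_plane)" and p: "0 < p" and C: "0 \<le> C"
    and carleson: "\<And>f. f \<in> hpi_space p \<Longrightarrow> (\<integral>\<^sup>+s. ennreal (cmod (f s) powr p) \<partial>\<mu>) \<le> ennreal C * hpi_integral p f"
    and q: "1 < q" "q \<le> 2"
  obtains K where "0 < K" "\<And>g. integrable lborel g \<Longrightarrow> (\<And>\<tau>. 0 \<le> g \<tau>) \<Longrightarrow>
    (\<integral>\<^sup>+s. ennreal (cmod (szego g s) powr q) \<partial>\<mu>) \<le> ennreal K * (\<integral>\<^sup>+\<tau>. ennreal (g \<tau> powr q) \<partial>lborel)"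
proof -
  obtain A B where AB: "0 \<le> A" "0 \<le> B"
    "\<And>z::complex. 0 < Re z \<Longrightarrow> cmod z powr q \<le> A * Re z powr q - B * Re (z powr q)"
    using stein_inequality[OF q] by metis
  \<comment> \<open>The summand 1 makes \<open>K\<close> positive, so that the claim also holds when
    the integral on its right is infinite.\<close>
  define K where "K = C * (1/pi) * A + 1"
  have K: "0 < K" using C AB by (auto simp: K_def add_nonneg_pos)
  have "(\<integral>\<^sup>+s. ennreal (cmod (szego g s) powr q) \<partial>\<mu>) \<le> ennreal K * (\<integral>\<^sup>+\<tau>. ennreal (g \<tau> powr q) \<partial>lborel)"
    if g: "integrable lborel g" "\<And>\<tau>. 0 \<le> g \<tau>" for g
  proof (cases "0 < (LINT \<tau>|lborel. g \<tau>)")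
    case False
    then show ?thesis using szego_eq_0[OF g False] q by simp
  next
    case pos: True
    define Q where "Q = (\<integral>\<^sup>+\<tau>. ennreal (g \<tau> powr q) \<partial>lborel)"
    show ?thesis
    proof (cases "Q = \<top>")
      case True
      then show ?thesis using K by (simp add: Q_def ennreal_mult_top)
    next
      case False
      define f where "f = (\<lambda>s. szego g s powr of_real (q / p))"
      have Re_pos: "0 < Re (szego g s)" if "s \<in> half_plane" for s
        using that by (intro Re_szego_pos[OF g _ pos]) (auto simp: half_plane_def)
      have f_norm: "cmod (f s) powr p = cmod (szego g s) powr q" for s
        using p by (simp add: f_def norm_powr_real_powr' powr_powr)
      have f_hol: "f holomorphic_on half_plane" unfolding f_def
        using Re_pos by (intro holomorphic_intros szego_holomorphic[OF g]) (force simp: complex_nonpos_Reals_iff)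
      have hpi: "hpi_integral p f \<le> ennreal (1/pi) * (ennreal A * Q)"
        unfolding hpi_integral_def
      proof (intro SUP_least mult_left_mono)
        fix \<sigma> :: real assume "\<sigma> \<in> {0<..}"
        then have \<sigma>: "0 < \<sigma>" by simp
        have "(\<integral>\<^sup>+t. ennreal (cmod (f (Complex \<sigma> t)) powr p / (1 + t\<^sup>2)) \<partial>lborel) \<le> (\<integral>\<^sup>+t. ennreal (cmod (szego g (Complex \<sigma> t)) powr q) \<partial>lborel)"
          unfolding f_norm by (intro nn_integral_mono ennreal_leI) (simp add: divide_le_eq add_pos_nonneg mult_left_le_one_le  mult_ge1_I algebra_simps)
        also have "\<dots> \<le> ennreal A * Q" unfolding Q_def
          by (rule szego_Lq_bound[OF g pos q(1) AB \<sigma>])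
        finally show "(\<integral>\<^sup>+t. ennreal (cmod (f (Complex \<sigma> t)) powr p / (1 + t\<^sup>2)) \<partial>lborel) \<le> ennreal A * Q" .
      qed simp
      also have "ennreal (1/pi) * (ennreal A * Q) < \<infinity>" using False
        by (simp add: ennreal_mult_less_top top.not_eq_extremum)
      finally have "f \<in> hpi_space p" using f_hol by (simp add: hpi_space_def)
      from carleson[OF this] have "(\<integral>\<^sup>+s. ennreal (cmod (szego g s) powr q) \<partial>\<mu>) \<le> ennreal C * hpi_integral p f"
        unfolding f_norm .
      also have "\<dots> \<le> ennreal C * (ennreal (1/pi) * (ennreal A * Q))" using hpi by (intro mult_left_mono) auto
      also have "\<dots> = ennreal (C * (1/pi) * A) * Q"
        using C AB by (simp add: ennreal_mult'[symmetric] ennreal_mult''[symmetric] mult_ac mult.assoc[symmetric])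
      also have "\<dots> \<le> ennreal K * Q" unfolding K_def by (intro mult_right_mono ennreal_leI) auto
      finally show ?thesis by (simp add: Q_def)
    qed
  qed
  with K show ?thesis by (rule that)
qed

lemma young_scaled:
  fixes r q :: real
  assumes r: "1 < r" "1 < q" "1/r + 1/q = 1" and \<eta>: "0 < \<eta>"
  obtains K where "0 \<le> K" "\<And>a b. 0 \<le> a \<Longrightarrow> 0 \<le> b \<Longrightarrow> a * b \<le> K * a powr r + \<eta> * b powr q"
proof -
  define k where "k = (q * \<eta>) powr (1/q)"
  have k: "0 < k" "k powr q = q * \<eta>" using r \<eta> by (auto simp: k_def powr_powr)
  show ?thesis
  proof (rule that[of "(1/k) powr r / r"])
    fix a b :: real assume ab: "0 \<le> a" "0 \<le> b"
    have "a * b = (a * (1/k)) * (k * b)" using k by simp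
    also have "\<dots> \<le> (a * (1/k)) powr r / r + (k * b) powr q / q"
      using ab k r by (intro Youngs_inequality) auto
    also have "\<dots> = (1/k) powr r / r * a powr r + \<eta> * b powr q"
      using ab k r by (simp only: powr_mult) (simp add: powr_mult k(2))
    finally show "a * b \<le> (1/k) powr r / r * a powr r + \<eta> * b powr q" .
  qed (use r k in auto)
qed

text \<open>
  Dual form of the Carleson embedding: the area function is tested against \<open>g\<close>, whose averages are
  dominated by the Poisson integral of \<open>g\<close>, hence by the modulus of its analytic completion.
\<close>

theorem dual_carleson:
  assumes fin: "finite_measure \<mu>" and sets: "sets \<mu> = sets (restrict_space borel half_plane)"
    and p: "0 < p" and C: "0 \<le> C"
    and carleson: "\<And>f. f \<in> hpi_space p \<Longrightarrow> (\<integral>\<^sup>+s. ennreal (cmod (f s) powr p) \<partial>\<mu>) \<le> ennreal C * hpi_integral p f"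
    and r: "2 \<le> r"
  obtains C' where "0 \<le> C'" "\<And>F. F \<in> borel_measurable \<mu> \<Longrightarrow> (\<And>s. 0 \<le> F s) \<Longrightarrow>
    (\<integral>\<^sup>+\<tau>. epow (\<integral>\<^sup>+s\<in>cone \<tau>. ennreal (F s / Re s) \<partial>\<mu>) r * ennreal (1 / (1 + \<tau>\<^sup>2)) \<partial>lborel)
      \<le> ennreal C' * (\<integral>\<^sup>+s. ennreal (F s powr r) \<partial>\<mu>)"
proof -
  interpret finite_measure \<mu> by fact
  interpret P: pair_sigma_finite lborel \<mu> ..
  have space: "space \<mu> = half_plane" using sets_eq_imp_space_eq[OF sets] by (simp add: space_restrict_space)
  have Re_m: "Re \<in> borel_measurable \<mu>" and Im_m: "Im \<in> borel_measurable \<mu>"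
    unfolding measurable_cong_sets[OF sets refl] by (auto intro: measurable_restrict_space1)
  note Re_m [measurable] Im_m [measurable]
  define q where "q = r / (r - 1)"
  have q: "1 < q" "q \<le> 2" "1/r + 1/q = 1" "(r - 1) * q = r" using r by (auto simp: q_def field_simps)
  obtain K where K: "0 < K" "\<And>g. integrable lborel g \<Longrightarrow> (\<And>\<tau>. 0 \<le> g \<tau>) \<Longrightarrow>
    (\<integral>\<^sup>+s. ennreal (cmod (szego g s) powr q) \<partial>\<mu>) \<le> ennreal K * (\<integral>\<^sup>+\<tau>. ennreal (g \<tau> powr q) \<partial>lborel)"
    using szego_carleson[OF sets p C carleson q(1,2)] by blast
  \<comment> \<open>With \<open>\<eta> * K = 1/2\<close> the term with the analytic completion
    becomes half of the left side and can be absorbed.\<close>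
  define \<eta> where "\<eta> = 1 / (2 * K)"
  have \<eta>: "0 < \<eta>" "\<eta> * K = 1/2" using K by (auto simp: \<eta>_def)
  obtain Y where Y: "0 \<le> Y" "\<And>a b. 0 \<le> a \<Longrightarrow> 0 \<le> b \<Longrightarrow> a * b \<le> Y * a powr r + \<eta> * b powr q"
    using young_scaled[of r q \<eta>] r q \<eta> by (metis less_le_trans one_less_numeral_iff semiring_norm(76))
  define C' where "C' = 2 * (Y * (2 * pi) powr r)"
  have "(\<integral>\<^sup>+\<tau>. epow (\<integral>\<^sup>+s\<in>cone \<tau>. ennreal (F s / Re s) \<partial>\<mu>) r * ennreal (1 / (1 + \<tau>\<^sup>2)) \<partial>lborel)
      \<le> ennreal C' * (\<integral>\<^sup>+s. ennreal (F s powr r) \<partial>\<mu>)"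
    if F [measurable]: "F \<in> borel_measurable \<mu>" and F0: "\<And>s. 0 \<le> F s" for F
  proof -
    define cone' where "cone' = (\<lambda>\<tau> s. (indicator {x. \<bar>Im s - x\<bar> < Re s} \<tau> :: real))"
    have cone'_m [measurable]: "(\<lambda>x. cone' (fst x) (snd x)) \<in> borel_measurable (lborel \<Otimes>\<^sub>M \<mu>)"
      unfolding cone'_def indicator_def by measurable
    have cone'_m2 [measurable]: "cone' \<tau> \<in> borel_measurable \<mu>" for \<tau>
      unfolding cone'_def indicator_def by measurable
    have cone'_m3 [measurable]: "(\<lambda>\<tau>. cone' \<tau> s) \<in> borel_measurable borel" for s
      unfolding cone'_def indicator_def by measurable
    have cone': "indicator (cone \<tau>) s = ennreal (cone' \<tau> s)" if "s \<in> space \<mu>" for s \<tau>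
      using that by (auto simp: cone'_def cone_def indicator_def space)
    have cone'0: "0 \<le> cone' \<tau> s" "cone' \<tau> s \<le> 1" for \<tau> s by (auto simp: cone'_def)
    \<comment> \<open>Truncation in height and away from the boundary line makes every quantity
      finite, which the absorption demands.\<close>
    define Fn where "Fn = (\<lambda>n s. if 1 / real (Suc n) \<le> Re s then min (F s) (real n) else 0)"
    have Fn_m [measurable]: "Fn n \<in> borel_measurable \<mu>" for n unfolding Fn_def by measurable
    have Fn0: "0 \<le> Fn n s" "Fn n s \<le> F s" "Fn n s \<le> real n" for n s using F0 by (auto simp: Fn_def)
    have FnRe: "Fn n s / Re s \<le> real n * real (Suc n)" for n s
    proof (cases "1 / real (Suc n) \<le> Re s")
      case True
      then have "0 < Re s" by (smt (verit) divide_pos_pos of_nat_0_less_iff zero_less_Suc)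
      then have "1 / Re s \<le> real (Suc n)" using True by (simp add: field_simps)
      then have "Fn n s * (1 / Re s) \<le> real n * real (Suc n)"
        using Fn0 \<open>0 < Re s\<close> by (intro mult_mono) auto
      then show ?thesis by simp
    qed (auto simp: Fn_def)
    define B where "B = (\<lambda>n \<tau>. \<integral>\<^sup>+s. ennreal (Fn n s / Re s * cone' \<tau> s) \<partial>\<mu>)"
    have B_m [measurable]: "B n \<in> borel_measurable borel" for n
    proof -
      have "(\<lambda>\<tau>. \<integral>\<^sup>+s. ennreal (Fn n s / Re s * cone' \<tau> s) \<partial>\<mu>) \<in> borel_measurable lborel" by measurable
      then show ?thesis unfolding B_def by simp
    qed
    have Bfin: "B n \<tau> \<le> ennreal (real n * real (Suc n)) * emeasure \<mu> (space \<mu>)" for n \<tau>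
    proof -
      have "B n \<tau> \<le> (\<integral>\<^sup>+s. ennreal (real n * real (Suc n)) \<partial>\<mu>)"
        unfolding B_def
      proof (intro nn_integral_mono ennreal_leI)
        fix s show "Fn n s / Re s * cone' \<tau> s \<le> real n * real (Suc n)"
          using FnRe[of n s] by (auto simp: cone'_def indicator_def)
      qed
      then show ?thesis by simp
    qed
    define bd where "bd n = enn2real (ennreal (real n * real (Suc n)) * emeasure \<mu> (space \<mu>))" for n
    have bdt: "ennreal (real n * real (Suc n)) * emeasure \<mu> (space \<mu>) < \<top>" for n
    proof -
      have "emeasure \<mu> (space \<mu>) < \<top>"
        using emeasure_finite[of "space \<mu>"] unfolding infinity_ennreal_def less_top .
      then show ?thesis by (simp add: ennreal_mult_less_top)
    qed
    define b where "b = (\<lambda>n \<tau>. enn2real (B n \<tau>))"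
    have b_m [measurable]: "b n \<in> borel_measurable borel" for n unfolding b_def by measurable
    have B_eq: "B n \<tau> = ennreal (b n \<tau>)" for n \<tau>
      using le_less_trans[OF Bfin bdt, of n \<tau>] by (simp add: b_def)
    have b0: "0 \<le> b n \<tau>" and b_le: "b n \<tau> \<le> bd n" for n \<tau>
      unfolding b_def bd_def using Bfin bdt by (auto intro: enn2real_mono)
    define w where "w \<tau> = 1 / (1 + \<tau>\<^sup>2)" for \<tau> :: real
    have w: "0 < w \<tau>" "w \<tau> \<le> 1" for \<tau> by (auto simp: w_def add_pos_nonneg)
    have w_m [measurable]: "w \<in> borel_measurable borel" unfolding w_def by measurable
    have main: "(\<integral>\<^sup>+\<tau>. ennreal (b n \<tau> powr r * w \<tau> * indicator {-real n..real n} \<tau>) \<partial>lborel) \<le> ennreal C' * (\<integral>\<^sup>+s. ennreal (F s powr r) \<partial>\<mu>)"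
      (is "?X \<le> _") for n
    proof -
      \<comment> \<open>The extremal function of the duality: as \<open>(r - 1) * q = r\<close>, its
        q-th power is exactly the integrand on the left.\<close>
      define g where "g \<tau> = b n \<tau> powr (r - 1) * w \<tau> powr (1/q) * indicator {-real n..real n} \<tau>" for \<tau>
      have g_m [measurable]: "g \<in> borel_measurable borel" unfolding g_def by measurable
      have g0: "0 \<le> g \<tau>" for \<tau> by (simp add: g_def)
      have bpow: "b n \<tau> powr (r - 1) \<le> bd n powr (r - 1)" for \<tau>
        using b0 b_le r by (intro powr_mono2) auto
      have wpow: "w \<tau> powr (1/q) \<le> 1" for \<tau>
        using w[of \<tau>] q by (intro powr_le1) auto
      have g_int: "integrable lborel g"
      proof (rule Bochner_Integration.integrable_bound)
        show "integrable lborel (\<lambda>\<tau>. bd n powr (r - 1) * indicator {-real n..real n} \<tau>)" by simp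
        have "norm (g \<tau>) \<le> norm (bd n powr (r - 1) * indicator {-real n..real n} \<tau> :: real)" for \<tau>
          using mult_mono[OF bpow wpow, of \<tau> \<tau>] by (auto simp: g_def indicator_def)
        then show "AE \<tau> in lborel. norm (g \<tau>) \<le> norm (bd n powr (r - 1) * indicator {-real n..real n} \<tau> :: real)" by simp
      qed simp
      have gq: "g \<tau> powr q = b n \<tau> powr r * w \<tau> * indicator {-real n..real n} \<tau>" for \<tau>
        using w[of \<tau>] q by (auto simp: g_def indicator_def powr_mult powr_powr)
      have Xfin: "?X < \<top>"
      proof -
        have "?X \<le> (\<integral>\<^sup>+\<tau>. ennreal (bd n powr r) * indicator {-real n..real n} \<tau> \<partial>lborel)"
        proof (rule nn_integral_mono)
          fix \<tau>
          have "b n \<tau> powr r * w \<tau> \<le> bd n powr r * 1" using b0 b_le r w[of \<tau>] by (intro mult_mono powr_mono2) (auto intro: less_imp_le)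
          then show "ennreal (b n \<tau> powr r * w \<tau> * indicator {-real n..real n} \<tau>) \<le> ennreal (bd n powr r) * indicator {-real n..real n} \<tau>"
            by (auto simp: indicator_def intro!: ennreal_leI)
        qed
        also have "\<dots> < \<top>" by (subst nn_integral_cmult_indicator) (auto simp: ennreal_mult_less_top)
        finally show ?thesis .
      qed
      have "?X \<le> (\<integral>\<^sup>+\<tau>. ennreal (g \<tau>) * B n \<tau> \<partial>lborel)"
      proof (rule nn_integral_mono)
        fix \<tau>
        \<comment> \<open>As \<open>w \<tau> \<le> 1\<close>, its power \<open>1/q\<close> dominates
          it. The weight is thus carried by \<open>g\<close> alone and leaves no trace in the
          integral against \<open>\<mu>\<close>.\<close>
        have "w \<tau> powr 1 \<le> w \<tau> powr (1/q)" using w[of \<tau>] q by (intro powr_mono') auto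
        then have ww: "w \<tau> \<le> w \<tau> powr (1/q)" using w[of \<tau>] by simp
        have bb: "b n \<tau> powr r = b n \<tau> powr (r - 1) * b n \<tau>" using b0[of n \<tau>] r by (cases "b n \<tau> = 0") (auto simp: powr_diff)
        have "b n \<tau> powr r * w \<tau> \<le> b n \<tau> powr r * w \<tau> powr (1/q)" using ww by (intro mult_left_mono) auto
        then have "b n \<tau> powr r * w \<tau> * indicator {-real n..real n} \<tau> \<le> g \<tau> * b n \<tau>"
          by (auto simp: g_def bb indicator_def mult_ac)
        then show "ennreal (b n \<tau> powr r * w \<tau> * indicator {-real n..real n} \<tau>) \<le> ennreal (g \<tau>) * B n \<tau>"
          unfolding B_eq using g0 b0 by (simp add: ennreal_mult'[symmetric] ennreal_leI)
      qed
      also have "\<dots> = (\<integral>\<^sup>+\<tau>. (\<integral>\<^sup>+s. ennreal (g \<tau> * (Fn n s / Re s * cone' \<tau> s)) \<partial>\<mu>) \<partial>lborel)"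
        unfolding B_def
      proof (rule nn_integral_cong)
        fix \<tau>
        have "(\<lambda>s. ennreal (Fn n s / Re s * cone' \<tau> s)) \<in> borel_measurable \<mu>" by measurable
        from nn_integral_cmult[OF this, of "ennreal (g \<tau>)"]
        show "ennreal (g \<tau>) * (\<integral>\<^sup>+s. ennreal (Fn n s / Re s * cone' \<tau> s) \<partial>\<mu>) = (\<integral>\<^sup>+s. ennreal (g \<tau> * (Fn n s / Re s * cone' \<tau> s)) \<partial>\<mu>)"
          unfolding ennreal_mult'[OF g0] by (rule sym)
      qed
      also have "\<dots> = (\<integral>\<^sup>+s. (\<integral>\<^sup>+\<tau>. ennreal (g \<tau> * (Fn n s / Re s * cone' \<tau> s)) \<partial>lborel) \<partial>\<mu>)"
        by (rule P.Fubini'[symmetric]) measurable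
      \<comment> \<open>After Fubini the cone condition restricts \<open>\<tau>\<close> for fixed
        \<open>s\<close>, to the window of \<open>Re_szego_ge_average\<close>; the factor
        \<open>Re s\<close> gained there cancels the division by \<open>Re s\<close>.\<close>
      also have "\<dots> \<le> (\<integral>\<^sup>+s. ennreal (2 * pi * Fn n s * cmod (szego g s)) \<partial>\<mu>)"
      proof (rule nn_integral_mono)
        fix s assume "s \<in> space \<mu>"
        then have s: "0 < Re s" by (simp add: space half_plane_def)
        have i: "integrable lborel (\<lambda>\<tau>. g \<tau> * cone' \<tau> s)"
          unfolding cone'_def using integrable_mult_indicator[OF _ g_int, of "{\<tau>. \<bar>Im s - \<tau>\<bar> < Re s}"] by (simp add: mult.commute)
        have i2: "integrable lborel (\<lambda>\<tau>. Fn n s / Re s * (g \<tau> * cone' \<tau> s))" using i by (intro integrable_mult_right)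
        have "(\<integral>\<^sup>+\<tau>. ennreal (g \<tau> * (Fn n s / Re s * cone' \<tau> s)) \<partial>lborel) = (\<integral>\<^sup>+\<tau>. ennreal (Fn n s / Re s * (g \<tau> * cone' \<tau> s)) \<partial>lborel)"
          by (intro nn_integral_cong) (simp add: mult_ac)
        also have "\<dots> = ennreal (LINT \<tau>|lborel. Fn n s / Re s * (g \<tau> * cone' \<tau> s))"
          using g0 Fn0 s cone'0 by (intro nn_integral_eq_integral[OF i2] AE_I2 mult_nonneg_nonneg divide_nonneg_pos) auto
        also have "(LINT \<tau>|lborel. Fn n s / Re s * (g \<tau> * cone' \<tau> s)) = Fn n s / Re s * (LINT \<tau>|lborel. g \<tau> * cone' \<tau> s)" by simp
        also have "ennreal \<dots> \<le> ennreal (Fn n s / Re s * (2 * pi * Re s * Re (szego g s)))"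
          using Re_szego_ge_average[OF g_int g0 s] Fn0 s unfolding cone'_def by (intro ennreal_leI mult_left_mono) auto
        also have "\<dots> \<le> ennreal (2 * pi * Fn n s * cmod (szego g s))"
        proof (rule ennreal_leI)
          have "2 * pi * Fn n s * Re (szego g s) \<le> 2 * pi * Fn n s * cmod (szego g s)"
            using Fn0 complex_Re_le_cmod by (intro mult_left_mono) auto
          then show "Fn n s / Re s * (2 * pi * Re s * Re (szego g s)) \<le> 2 * pi * Fn n s * cmod (szego g s)"
            using s by (simp add: mult_ac)
        qed
        finally show "(\<integral>\<^sup>+\<tau>. ennreal (g \<tau> * (Fn n s / Re s * cone' \<tau> s)) \<partial>lborel) \<le> ennreal (2 * pi * Fn n s * cmod (szego g s))" .
      qed
      also have "\<dots> \<le> (\<integral>\<^sup>+s. ennreal (Y * (2 * pi) powr r) * ennreal (F s powr r) + ennreal \<eta> * ennreal (cmod (szego g s) powr q) \<partial>\<mu>)"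
      proof (rule nn_integral_mono)
        fix s
        have "(2 * pi * Fn n s) * cmod (szego g s) \<le> Y * (2 * pi * Fn n s) powr r + \<eta> * cmod (szego g s) powr q"
          using Fn0 by (intro Y) auto
        also have "(2 * pi * Fn n s) powr r = (2 * pi) powr r * Fn n s powr r"
          using Fn0 by (simp add: powr_mult)
        also have "Y * ((2 * pi) powr r * Fn n s powr r) \<le> Y * ((2 * pi) powr r * F s powr r)"
          using Fn0 F0 Y r by (intro mult_left_mono powr_mono2) auto
        finally have "ennreal (2 * pi * Fn n s * cmod (szego g s)) \<le> ennreal (Y * (2 * pi) powr r * F s powr r + \<eta> * cmod (szego g s) powr q)"
          by (intro ennreal_leI) (simp add: mult_ac)
        also have "\<dots> = ennreal (Y * (2 * pi) powr r) * ennreal (F s powr r) + ennreal \<eta> * ennreal (cmod (szego g s) powr q)"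
          using Y \<eta> by (subst ennreal_plus) (auto simp: ennreal_mult')
        finally show "ennreal (2 * pi * Fn n s * cmod (szego g s)) \<le> ennreal (Y * (2 * pi) powr r) * ennreal (F s powr r) + ennreal \<eta> * ennreal (cmod (szego g s) powr q)" .
      qed
      also have "\<dots> = ennreal (Y * (2 * pi) powr r) * (\<integral>\<^sup>+s. ennreal (F s powr r) \<partial>\<mu>) + ennreal \<eta> * (\<integral>\<^sup>+s. ennreal (cmod (szego g s) powr q) \<partial>\<mu>)"
      proof -
        have "continuous_on half_plane (szego g)" by (rule holomorphic_on_imp_continuous_on[OF szego_holomorphic[OF g_int g0]])
        then have [measurable]: "szego g \<in> borel_measurable \<mu>"
          unfolding measurable_cong_sets[OF sets refl] by (rule borel_measurable_continuous_on_restrict)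
        show ?thesis by (subst nn_integral_add) (auto simp: nn_integral_cmult)
      qed
      also have "\<dots> \<le> ennreal (Y * (2 * pi) powr r) * (\<integral>\<^sup>+s. ennreal (F s powr r) \<partial>\<mu>) + ennreal \<eta> * (ennreal K * ?X)"
        using K(2)[OF g_int g0] unfolding gq by (intro add_left_mono mult_left_mono) auto
      also have "ennreal \<eta> * (ennreal K * ?X) = ennreal (1/2) * ?X"
        by (simp only: mult.assoc[symmetric] ennreal_mult'[OF less_imp_le[OF \<eta>(1)], symmetric] \<eta>(2))
      finally have *: "?X \<le> ennreal (Y * (2 * pi) powr r) * (\<integral>\<^sup>+s. ennreal (F s powr r) \<partial>\<mu>) + ennreal (1/2) * ?X" .
      obtain x where x: "0 \<le> x" "?X = ennreal x" using Xfin by (cases ?X) auto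
      show ?thesis
      proof (cases "(\<integral>\<^sup>+s. ennreal (F s powr r) \<partial>\<mu>)")
        case (real y)
        have e1: "ennreal (Y * (2 * pi) powr r) * ennreal y = ennreal (Y * (2 * pi) powr r * y)"
          using Y by (intro ennreal_mult'[symmetric]) auto
        have e2: "ennreal (1/2) * ennreal x = ennreal (1/2 * x)" by (intro ennreal_mult'[symmetric]) auto
        have e3: "ennreal (Y * (2 * pi) powr r * y) + ennreal (1/2 * x) = ennreal (Y * (2 * pi) powr r * y + 1/2 * x)"
          using Y x real by (intro ennreal_plus[symmetric]) auto
        have "ennreal x \<le> ennreal (Y * (2 * pi) powr r * y + 1/2 * x)"
          using * unfolding x real e1 e2 e3 .
        then have "x \<le> Y * (2 * pi) powr r * y + 1/2 * x"
          using x Y real by (subst (asm) ennreal_le_iff) (auto intro!: add_nonneg_nonneg)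
        then have "x \<le> C' * y" by (simp add: C'_def)
        then show ?thesis unfolding x real using real Y by (simp add: ennreal_mult'[symmetric] ennreal_leI C'_def)
      next
        case top
        show ?thesis
        proof (cases "C' = 0")
          case True
          then have "Y = 0" by (simp add: C'_def)
          have e2: "ennreal (1/2) * ennreal x = ennreal (1/2 * x)" by (intro ennreal_mult'[symmetric]) auto
          have "ennreal x \<le> ennreal (1/2 * x)"
            using * unfolding \<open>Y = 0\<close> x mult_zero_left ennreal_0 add_0 e2 .
          then have "x = 0" using x by (subst (asm) ennreal_le_iff) auto
          then show ?thesis by (simp add: x)
        next
          case False
          then have "0 < C'" using Y by (auto simp: C'_def)
          then show ?thesis unfolding top by (simp add: ennreal_mult_top)
        qed
      qed
    qed
    define Bt where "Bt = (\<lambda>\<tau>. \<integral>\<^sup>+s. ennreal (F s / Re s * cone' \<tau> s) \<partial>\<mu>)"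
    have Bt: "(\<integral>\<^sup>+s\<in>cone \<tau>. ennreal (F s / Re s) \<partial>\<mu>) = Bt \<tau>" for \<tau>
      unfolding Bt_def
    proof (rule nn_integral_cong)
      fix s assume s: "s \<in> space \<mu>"
      then have "0 \<le> F s / Re s" using F0 by (simp add: space half_plane_def)
      then show "ennreal (F s / Re s) * indicator (cone \<tau>) s = ennreal (F s / Re s * cone' \<tau> s)"
        unfolding cone'[OF s] by (rule ennreal_mult'[symmetric])
    qed
    have Blim: "(\<lambda>n. B n \<tau>) \<longlonglongrightarrow> Bt \<tau>" for \<tau>
      unfolding B_def Bt_def
    proof (rule nn_integral_LIMSEQ)
      show "incseq (\<lambda>n s. ennreal (Fn n s / Re s * cone' \<tau> s))"
      proof (intro incseq_SucI le_funI ennreal_leI mult_right_mono)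
        fix n s
        have "1 / real (Suc (Suc n)) \<le> 1 / real (Suc n)" by (intro divide_left_mono) auto
        then have le: "Fn n s \<le> Fn (Suc n) s" using F0 by (auto simp: Fn_def simp del: of_nat_Suc)
        show "Fn n s / Re s \<le> Fn (Suc n) s / Re s"
        proof (cases "0 < Re s")
          case True then show ?thesis using le by (intro divide_right_mono) auto
        next
          case False
          then have "\<not> 1 / real (Suc m) \<le> Re s" for m by (smt (verit) divide_pos_pos of_nat_0_less_iff zero_less_Suc)
          then show ?thesis by (simp add: Fn_def del: of_nat_Suc)
        qed
      qed (use cone'0 in auto)
      show "(\<lambda>s. ennreal (Fn n s / Re s * cone' \<tau> s)) \<in> borel_measurable \<mu>" for n by measurable
      fix s
      show "(\<lambda>n. ennreal (Fn n s / Re s * cone' \<tau> s)) \<longlonglongrightarrow> ennreal (F s / Re s * cone' \<tau> s)"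
      proof (cases "0 < Re s")
        case False
        then have "cone' \<tau> s = 0" by (auto simp: cone'_def indicator_def)
        then show ?thesis by simp
      next
        case s: True
      obtain N1 :: nat where N1: "F s \<le> N1" using real_arch_simple by blast
      obtain N2 where N2: "1 / real (Suc N2) < Re s" using s nat_approx_posE by blast
      have "Fn n s = F s" if "n \<ge> max N1 N2" for n
      proof -
        have "1 / real (Suc n) \<le> 1 / real (Suc N2)" using that by (intro divide_left_mono) auto
        then show ?thesis using N1 N2 that by (auto simp: Fn_def simp del: of_nat_Suc)
      qed
      then show ?thesis
        by (intro tendsto_eventually eventually_sequentiallyI[of "max N1 N2"]) auto
      qed
    qed
    have "(\<integral>\<^sup>+\<tau>. epow (Bt \<tau>) r * ennreal (w \<tau>) \<partial>lborel) =
      (\<integral>\<^sup>+\<tau>. liminf (\<lambda>n. ennreal (b n \<tau> powr r * w \<tau> * indicator {-real n..real n} \<tau>)) \<partial>lborel)"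
    proof (rule nn_integral_cong)
      fix \<tau> :: real
      obtain N :: nat where N: "\<bar>\<tau>\<bar> \<le> N" using real_arch_simple by blast
      have "(\<lambda>n. epow (B n \<tau>) r * ennreal (w \<tau>)) \<longlonglongrightarrow> epow (Bt \<tau>) r * ennreal (w \<tau>)"
        using r w(1)[of \<tau>] by (intro tendsto_mult_ennreal tendsto_epow Blim tendsto_const) auto
      moreover have "\<forall>\<^sub>F n in sequentially. epow (B n \<tau>) r * ennreal (w \<tau>) = ennreal (b n \<tau> powr r * w \<tau> * indicator {-real n..real n} \<tau>)"
      proof (rule eventually_sequentiallyI[of N])
        fix n assume "N \<le> n"
        then have "indicator {-real n..real n} \<tau> = (1::real)" using N by (auto simp: indicator_def)
        then show "epow (B n \<tau>) r * ennreal (w \<tau>) = ennreal (b n \<tau> powr r * w \<tau> * indicator {-real n..real n} \<tau>)"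
          using b0[of n \<tau>] by (simp add: B_eq ennreal_mult')
      qed
      ultimately have "(\<lambda>n. ennreal (b n \<tau> powr r * w \<tau> * indicator {-real n..real n} \<tau>)) \<longlonglongrightarrow> epow (Bt \<tau>) r * ennreal (w \<tau>)"
        by (rule Lim_transform_eventually)
      then show "epow (Bt \<tau>) r * ennreal (w \<tau>) = liminf (\<lambda>n. ennreal (b n \<tau> powr r * w \<tau> * indicator {-real n..real n} \<tau>))"
        by (simp add: lim_imp_Liminf)
    qed
    also have "\<dots> \<le> liminf (\<lambda>n. \<integral>\<^sup>+\<tau>. ennreal (b n \<tau> powr r * w \<tau> * indicator {-real n..real n} \<tau>) \<partial>lborel)"
      by (rule nn_integral_liminf) measurable
    also have "\<dots> \<le> ennreal C' * (\<integral>\<^sup>+s. ennreal (F s powr r) \<partial>\<mu>)"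
      using main by (intro Liminf_le) (auto simp: eventually_sequentially)
    finally show ?thesis by (simp add: Bt w_def)
  qed
  then show ?thesis using that[of C'] Y by (auto simp: C'_def)
qed


section \<open>The infinite torus\<close>

lemma sets_circle [measurable_cong]: "sets circle_measure = sets (restrict_space borel (sphere 0 1))"
  by (simp add: circle_measure_def)

lemma space_circle: "space circle_measure = sphere 0 1"
  by (simp add: circle_measure_def space_restrict_space)

lemma cis_measurable_circle [measurable]: "cis \<in> borel \<rightarrow>\<^sub>M restrict_space borel (sphere 0 1)"
proof (rule measurable_restrict_space2)
  show "cis \<in> borel_measurable borel"
    by (intro borel_measurable_continuous_onI continuous_intros)
qed auto

lemma nn_integral_circle:
  assumes [measurable]: "F \<in> borel_measurable (restrict_space borel (sphere 0 1))"
  shows "(\<integral>\<^sup>+z. F z \<partial>circle_measure) = (\<integral>\<^sup>+t. F (cis t) * indicator {0..2*pi} t \<partial>lborel) / ennreal (2*pi)"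
  unfolding circle_measure_def
  by (subst nn_integral_distr) (auto simp: nn_integral_uniform_measure)

lemma prob_space_circle: "prob_space circle_measure"
  unfolding circle_measure_def
proof (rule prob_space.prob_space_distr)
  show "prob_space (uniform_measure lborel {0..2 * pi})"
    by (rule prob_space_uniform_measure) auto
qed simp

text \<open>After full periods are removed from \<open>a\<close>, the part of the window beyond
  \<open>2 * pi\<close> is moved back by one period.\<close>

lemma nn_integral_periodic:
  fixes G :: "real \<Rightarrow> ennreal"
  assumes [measurable]: "G \<in> borel_measurable borel" and per: "\<And>t. G (t + 2*pi) = G t"
  shows "(\<integral>\<^sup>+t. G (a + t) * indicator {0..2*pi} t \<partial>lborel) = (\<integral>\<^sup>+t. G t * indicator {0..2*pi} t \<partial>lborel)"
proof -
  define k where "k = \<lfloor>a / (2*pi)\<rfloor>"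
  define b where "b = a - 2 * pi * k"
  have "real_of_int k \<le> a / (2*pi)" "a / (2*pi) < real_of_int k + 1" unfolding k_def by linarith+
  then have b: "0 \<le> b" "b < 2*pi" by (auto simp: b_def field_simps)
  have per_nat: "G (t + 2 * pi * real n) = G t" for t and n :: nat
  proof (induction n)
    case (Suc n)
    have "t + 2 * pi * real (Suc n) = (t + 2 * pi * real n) + 2*pi" by (simp add: algebra_simps)
    then have "G (t + 2 * pi * real (Suc n)) = G ((t + 2 * pi * real n) + 2*pi)" by (simp only:)
    also have "\<dots> = G t" unfolding per by (rule Suc.IH)
    finally show ?case .
  qed simp
  have per_int: "G (t + 2 * pi * of_int m) = G t" for t and m :: int
  proof (cases "0 \<le> m")
    case True
    then show ?thesis using per_nat[of t "nat m"] by simp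
  next
    case False
    then show ?thesis using per_nat[of "t + 2 * pi * of_int m" "nat (-m)"] by simp
  qed
  have Ga: "G (a + t) = G (b + t)" for t
    using per_int[of "b + t" k] by (simp add: b_def algebra_simps)
  have "(\<integral>\<^sup>+t. G (a + t) * indicator {0..2*pi} t \<partial>lborel) = (\<integral>\<^sup>+t. G (b + t) * indicator {b..b + 2*pi} (b + t) \<partial>lborel)"
    unfolding Ga by (intro nn_integral_cong) (auto simp: indicator_def)
  also have "\<dots> = (\<integral>\<^sup>+t. G t * indicator {b..b + 2*pi} t \<partial>lborel)"
    using nn_integral_real_affine[of "\<lambda>t. G t * indicator {b..b + 2*pi} t" 1 b] by simp
  also have "\<dots> = (\<integral>\<^sup>+t. G t * indicator {b..2*pi} t + G t * indicator {2*pi<..b + 2*pi} t \<partial>lborel)"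
    using b by (intro nn_integral_cong) (auto simp: indicator_def)
  also have "\<dots> = (\<integral>\<^sup>+t. G t * indicator {b..2*pi} t \<partial>lborel) + (\<integral>\<^sup>+t. G t * indicator {2*pi<..b + 2*pi} t \<partial>lborel)"
    by (rule nn_integral_add) auto
  also have "(\<integral>\<^sup>+t. G t * indicator {2*pi<..b + 2*pi} t \<partial>lborel) = (\<integral>\<^sup>+t. G (2*pi + 1 * t) * indicator {2*pi<..b + 2*pi} (2*pi + 1 * t) \<partial>lborel)"
    using nn_integral_real_affine[of "\<lambda>t. G t * indicator {2*pi<..b + 2*pi} t" 1 "2*pi"] by simp
  also have "\<dots> = (\<integral>\<^sup>+t. G t * indicator {0<..b} t \<partial>lborel)"
  proof (rule nn_integral_cong)
    fix t
    have "G (2*pi + 1 * t) = G t" using per[of t] by (simp only: add.commute mult_1)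
    moreover have "indicator {2*pi<..b + 2*pi} (2*pi + 1 * t) = (indicator {0<..b} t :: ennreal)" by (auto simp: indicator_def)
    ultimately show "G (2*pi + 1 * t) * indicator {2*pi<..b + 2*pi} (2*pi + 1 * t) = G t * indicator {0<..b} t" by (simp only:)
  qed
  also have "\<dots> = (\<integral>\<^sup>+t. G t * indicator {0..<b} t \<partial>lborel)"
  proof (rule nn_integral_cong_AE)
    have "AE t in lborel. t \<noteq> 0 \<and> t \<noteq> b" by (intro AE_conjI AE_lborel_singleton)
    then show "AE t in lborel. G t * indicator {0<..b} t = G t * indicator {0..<b} t"
      by eventually_elim (auto simp: indicator_def)
  qed
  also have "(\<integral>\<^sup>+t. G t * indicator {b..2*pi} t \<partial>lborel) + (\<integral>\<^sup>+t. G t * indicator {0..<b} t \<partial>lborel) =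
     (\<integral>\<^sup>+t. G t * indicator {b..2*pi} t + G t * indicator {0..<b} t \<partial>lborel)"
    by (rule nn_integral_add[symmetric]) auto
  also have "\<dots> = (\<integral>\<^sup>+t. G t * indicator {0..2*pi} t \<partial>lborel)"
    using b by (intro nn_integral_cong) (auto simp: indicator_def)
  finally show ?thesis .
qed

lemma rotation_measurable:
  assumes "cmod c = 1"
  shows "(\<lambda>z. c * z) \<in> circle_measure \<rightarrow>\<^sub>M circle_measure"
proof -
  have "(\<lambda>z. c * z) \<in> restrict_space borel (sphere 0 1) \<rightarrow>\<^sub>M restrict_space borel (sphere 0 1)"
    by (intro measurable_restrict_space2 measurable_restrict_space1) (auto simp: space_restrict_space norm_mult assms)
  then show ?thesis by (simp cong: measurable_cong_sets add: sets_circle)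
qed

lemma circle_rotation:
  assumes c: "cmod c = 1"
  shows "distr circle_measure circle_measure (\<lambda>z. c * z) = circle_measure"
proof (rule measure_eqI)
  fix A assume A: "A \<in> sets (distr circle_measure circle_measure (\<lambda>z. c * z))"
  then have A': "A \<in> sets (restrict_space borel (sphere 0 1))" by (simp add: sets_circle)
  then have Am [measurable]: "A \<in> sets borel" by (auto simp: sets_restrict_space)
  obtain a where a: "c = cis a" using c by (metis complex_norm_eq_1_exp_eq cis_conv_exp)
  have ind [measurable]: "indicator A \<in> borel_measurable (restrict_space borel (sphere 0 1))"
    using A' by (rule borel_measurable_indicator)
  have mrot [measurable]: "(\<lambda>z. c * z) \<in> restrict_space borel (sphere 0 1) \<rightarrow>\<^sub>M restrict_space borel (sphere 0 1)"
    using rotation_measurable[OF c] by (simp cong: measurable_cong_sets add: sets_circle)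
  have "emeasure (distr circle_measure circle_measure (\<lambda>z. c * z)) A = (\<integral>\<^sup>+z. indicator A z \<partial>distr circle_measure circle_measure (\<lambda>z. c * z))"
    using A by simp
  also have "\<dots> = (\<integral>\<^sup>+z. indicator A (c * z) \<partial>circle_measure)"
    using A by (intro nn_integral_distr rotation_measurable c) simp
  also have "\<dots> = (\<integral>\<^sup>+t. indicator A (cis (a + t)) * indicator {0..2*pi} t \<partial>lborel) / ennreal (2*pi)"
    by (subst nn_integral_circle) (measurable, simp add: a cis_mult)
  also have "(\<integral>\<^sup>+t. indicator A (cis (a + t)) * indicator {0..2*pi} t \<partial>lborel) = (\<integral>\<^sup>+t. indicator A (cis t) * indicator {0..2*pi} t \<partial>lborel)"
    using nn_integral_periodic[of "\<lambda>t. indicator A (cis t)" a] by (simp add: cis_mult[symmetric])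
  also have "\<dots> / ennreal (2*pi) = (\<integral>\<^sup>+z. indicator A z \<partial>circle_measure)"
    by (rule nn_integral_circle[symmetric]) measurable
  also have "\<dots> = emeasure circle_measure A" using A by simp
  finally show "emeasure (distr circle_measure circle_measure (\<lambda>z. c * z)) A = emeasure circle_measure A" .
qed simp

lemma prob_space_torus: "prob_space torus_measure"
  unfolding torus_measure_def by (intro prob_space_PiM prob_space_circle)

lemma sets_torus [measurable_cong]: "sets torus_measure = sets (\<Pi>\<^sub>M j\<in>UNIV. circle_measure)"
  by (simp add: torus_measure_def)

lemma space_torus: "space torus_measure = {\<omega>. \<forall>j. cmod (\<omega> j) = 1}"
  by (auto simp: torus_measure_def space_PiM space_circle PiE_UNIV_domain Pi_iff)

lemma component_measurable [measurable]: "(\<lambda>\<omega>. \<omega> j) \<in> torus_measure \<rightarrow>\<^sub>M circle_measure"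
  unfolding torus_measure_def by (rule measurable_component_singleton) simp

lemma circle_borel: "(\<lambda>z. z) \<in> circle_measure \<rightarrow>\<^sub>M borel"
  by (simp cong: measurable_cong_sets add: sets_circle measurable_restrict_space1)

lemma component_borel [measurable]: "(\<lambda>\<omega>. \<omega> j) \<in> borel_measurable torus_measure"
  using measurable_compose[OF component_measurable circle_borel] .

lemma rotate_torus_measurable:
  assumes "\<And>j x. x \<in> space M \<Longrightarrow> cmod (c j x) = 1" "\<And>j. c j \<in> borel_measurable M"
    and f: "f \<in> M \<rightarrow>\<^sub>M torus_measure"
  shows "(\<lambda>x j. c j x * f x j) \<in> M \<rightarrow>\<^sub>M torus_measure"
proof -
  have m: "(\<lambda>x. c j x * f x j) \<in> M \<rightarrow>\<^sub>M circle_measure" for j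
  proof -
    have fx: "cmod (f x j) = 1" if "x \<in> space M" for x
      using measurable_space[OF f that] by (simp add: space_torus)
    have [measurable]: "(\<lambda>x. f x j) \<in> borel_measurable M"
      using measurable_compose[OF f component_borel] .
    have "(\<lambda>x. c j x * f x j) \<in> M \<rightarrow>\<^sub>M restrict_space borel (sphere 0 1)"
      using assms(1,2) fx by (intro measurable_restrict_space2) (auto simp: norm_mult)
    then show ?thesis by (simp cong: measurable_cong_sets add: sets_circle)
  qed
  have n: "cmod (c j x * f x j) = 1" if "x \<in> space M" for j x
    using measurable_space[OF m that] by (simp add: space_circle)
  show ?thesis unfolding torus_measure_def
    by (intro measurable_PiM_single' m) (auto simp: space_circle n)
qed

text \<open>Rotation carries cylinder sets to cylinder sets with rotated bases of equal measure, and
  these determine a finite measure on the product.\<close>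

lemma torus_rotation:
  assumes c: "\<And>j. cmod (c j) = 1"
  shows "distr torus_measure torus_measure (\<lambda>\<omega> j. c j * \<omega> j) = torus_measure"
  unfolding torus_measure_def
proof (rule measure_eqI_PiM_infinite)
  let ?M = "\<lambda>_::nat. circle_measure"
  have m: "(\<lambda>\<omega> j. c j * \<omega> j) \<in> PiM UNIV ?M \<rightarrow>\<^sub>M PiM UNIV ?M"
    using rotate_torus_measurable[of torus_measure "\<lambda>j _. c j" "\<lambda>\<omega>. \<omega>"] c by (simp add: torus_measure_def)
  interpret prob_space "PiM UNIV ?M" using prob_space_torus by (simp add: torus_measure_def)
  show "finite_measure (distr (PiM UNIV ?M) (PiM UNIV ?M) (\<lambda>\<omega> j. c j * \<omega> j))"
    using prob_space_distr[OF m] prob_space.finite_measure by blast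
  fix A :: "nat \<Rightarrow> complex set" and J :: "nat set"
  assume J: "finite J" and A: "\<And>i. i \<in> J \<Longrightarrow> A i \<in> sets circle_measure"
  define A' where "A' i = (\<lambda>z. c i * z) -` A i \<inter> space circle_measure" for i
  have A': "A' i \<in> sets circle_measure" if "i \<in> J" for i
    unfolding A'_def by (rule measurable_sets[OF rotation_measurable[OF c] A[OF that]])
  have eqA: "emeasure circle_measure (A' i) = emeasure circle_measure (A i)" if "i \<in> J" for i
    using emeasure_distr[OF rotation_measurable[OF c] A[OF that], of i] unfolding circle_rotation[OF c] A'_def by simp
  have "emeasure (distr (PiM UNIV ?M) (PiM UNIV ?M) (\<lambda>\<omega> j. c j * \<omega> j)) (prod_emb UNIV ?M J (Pi\<^sub>E J A)) =
    emeasure (PiM UNIV ?M) ((\<lambda>\<omega> j. c j * \<omega> j) -` prod_emb UNIV ?M J (Pi\<^sub>E J A) \<inter> space (PiM UNIV ?M))"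
    using J A by (intro emeasure_distr m sets_PiM_I) auto
  also have "(\<lambda>\<omega> j. c j * \<omega> j) -` prod_emb UNIV ?M J (Pi\<^sub>E J A) \<inter> space (PiM UNIV ?M) = prod_emb UNIV ?M J (Pi\<^sub>E J A')"
    using c by (auto simp: prod_emb_def space_PiM PiE_iff A'_def space_circle norm_mult)
  also have "emeasure (PiM UNIV ?M) (prod_emb UNIV ?M J (Pi\<^sub>E J A')) = (\<Prod>i\<in>J. emeasure circle_measure (A' i))"
    using J A' by (intro emeasure_PiM_emb prob_space_circle) auto
  also have "\<dots> = (\<Prod>i\<in>J. emeasure circle_measure (A i))" using eqA by (intro prod.cong) auto
  also have "\<dots> = emeasure (PiM UNIV ?M) (prod_emb UNIV ?M J (Pi\<^sub>E J A))"
    using J A by (intro emeasure_PiM_emb[symmetric] prob_space_circle) auto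
  finally show "emeasure (distr (PiM UNIV ?M) (PiM UNIV ?M) (\<lambda>\<omega> j. c j * \<omega> j)) (prod_emb UNIV ?M J (Pi\<^sub>E J A)) =
    emeasure (PiM UNIV ?M) (prod_emb UNIV ?M J (Pi\<^sub>E J A))" .
qed auto

lemma update_measurable:
  assumes "G \<in> borel_measurable torus_measure"
  shows "(\<lambda>x. G ((snd x)(j := fst x))) \<in> borel_measurable (circle_measure \<Otimes>\<^sub>M torus_measure)"
proof -
  have "(\<lambda>x. (snd x)(j := fst x)) \<in> circle_measure \<Otimes>\<^sub>M torus_measure \<rightarrow>\<^sub>M torus_measure"
    unfolding torus_measure_def
    by (rule measurable_PiM_single') (auto simp: space_pair_measure space_PiM PiE_iff split: if_splits)
  then show ?thesis using assms by (rule measurable_compose)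
qed

text \<open>Overwriting one coordinate by an independent copy does not change the product measure;
  the rest is Fubini.\<close>

lemma nn_integral_torus_coordinate:
  assumes G: "G \<in> borel_measurable torus_measure"
  shows "(\<integral>\<^sup>+\<omega>. G \<omega> \<partial>torus_measure) = (\<integral>\<^sup>+\<omega>. (\<integral>\<^sup>+z. G (fun_upd \<omega> j z) \<partial>circle_measure) \<partial>torus_measure)"
proof -
  interpret C: prob_space circle_measure by (rule prob_space_circle)
  interpret T: prob_space torus_measure by (rule prob_space_torus)
  interpret P: pair_sigma_finite circle_measure torus_measure ..
  have m: "(\<lambda>(x, X). X(j := x)) \<in> circle_measure \<Otimes>\<^sub>M torus_measure \<rightarrow>\<^sub>M torus_measure"
    unfolding torus_measure_def case_prod_unfold
    by (rule measurable_PiM_single') (auto simp: space_pair_measure space_PiM PiE_iff split: if_splits)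
  have "distr (circle_measure \<Otimes>\<^sub>M torus_measure) torus_measure (\<lambda>(x, X). X(j := x)) = torus_measure"
    using distr_pair_PiM_eq_PiM[of UNIV "\<lambda>_. circle_measure" j] prob_space_circle by (simp add: torus_measure_def)
  then have "(\<integral>\<^sup>+\<omega>. G \<omega> \<partial>torus_measure) = (\<integral>\<^sup>+\<omega>. G \<omega> \<partial>distr (circle_measure \<Otimes>\<^sub>M torus_measure) torus_measure (\<lambda>(x, X). X(j := x)))"
    by simp
  also have "\<dots> = (\<integral>\<^sup>+x. G (case x of (x, X) \<Rightarrow> X(j := x)) \<partial>(circle_measure \<Otimes>\<^sub>M torus_measure))"
    by (rule nn_integral_distr[OF m]) (simp add: G)
  also have "\<dots> = (\<integral>\<^sup>+\<omega>. (\<integral>\<^sup>+z. G (fun_upd \<omega> j z) \<partial>circle_measure) \<partial>torus_measure)"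
    using update_measurable[OF G, of j] by (subst P.nn_integral_snd[symmetric]) (auto simp: case_prod_unfold)
  finally show ?thesis .
qed

section \<open>Primes, characters and the Kronecker flow\<close>

lemma nth_prime_prime: "prime (nth_prime j)"
  using enumerate_in_set[OF primes_infinite, of j] by (simp add: nth_prime_def)

lemma inj_nth_prime: "inj nth_prime"
  using strict_mono_enumerate[OF primes_infinite] unfolding nth_prime_def[abs_def] by (rule strict_mono_imp_inj_on)

lemma nth_prime_surj: "prime q \<Longrightarrow> \<exists>j. q = nth_prime j"
  using range_enumerate[OF primes_infinite] unfolding nth_prime_def[abs_def] by (metis mem_Collect_eq rangeE)

lemma nth_prime_ge: "j + 2 \<le> nth_prime j"
proof (induction j)
  case 0
  show ?case using prime_ge_2_nat[OF nth_prime_prime[of 0]] by simp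
next
  case (Suc j)
  have "nth_prime j < nth_prime (Suc j)"
    using strict_mono_enumerate[OF primes_infinite] by (simp add: nth_prime_def strict_mono_def)
  then show ?case using Suc by linarith
qed

lemma nth_prime_pos: "0 < nth_prime j"
  using nth_prime_ge[of j] by linarith

lemma bij_betw_nth_prime: "n \<noteq> 0 \<Longrightarrow> bij_betw nth_prime {j. nth_prime j dvd n} (prime_factors n)"
  by (rule bij_betw_imageI[OF inj_on_subset[OF inj_nth_prime]])
     (auto simp: prime_factors_dvd nth_prime_prime dest: nth_prime_surj)

lemma finite_prime_indices: "n \<noteq> 0 \<Longrightarrow> finite {j. nth_prime j dvd n}"
  using bij_betw_finite[OF bij_betw_nth_prime] by simp

text \<open>For imaginary \<open>s\<close> this is the Kronecker flow, a rotation of the torus. For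
  \<open>Re s > 0\<close> it moves a character off the torus into the product of open discs, so that
  vertical and horizontal translation of a Dirichlet polynomial are one operation on its
  coordinates.\<close>

definition shift :: "complex \<Rightarrow> (nat \<Rightarrow> complex) \<Rightarrow> nat \<Rightarrow> complex" where
  "shift s \<omega> = (\<lambda>j. of_nat (nth_prime j) powr (- s) * \<omega> j)"

lemma shift_0 [simp]: "shift 0 \<omega> = \<omega>"
proof
  fix j show "shift 0 \<omega> j = \<omega> j"
    using nth_prime_pos[of j] by (simp add: shift_def)
qed

lemma shift_add: "shift (s + s') \<omega> = shift s (shift s' \<omega>)"
  by (simp add: shift_def fun_eq_iff powr_add[symmetric] mult.assoc[symmetric])

text \<open>Unique factorization in logarithmic form: \<open>ln n\<close> is the sum of the
  logarithms of its primes with multiplicity, so the factors picked up by the coordinates multiply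
  to a power of \<open>n\<close>.\<close>

lemma torus_char_shift:
  assumes "n \<noteq> 0"
  shows "torus_char (shift s \<omega>) n = torus_char \<omega> n * of_nat n powr (- s)"
proof -
  let ?J = "{j. nth_prime j dvd n}"
  have "of_nat n = (of_nat (\<Prod>j\<in>?J. nth_prime j ^ multiplicity (nth_prime j) n) :: real)"
    using prime_factorization_nat[of n] assms
    by (subst prod.reindex_bij_betw[OF bij_betw_nth_prime[OF assms], of "\<lambda>q. q ^ multiplicity q n"]) auto
  then have "ln (real n) = (\<Sum>j\<in>?J. multiplicity (nth_prime j) n * ln (real (nth_prime j)))"
    using finite_prime_indices[OF assms] nth_prime_pos
    by (simp add: ln_prod ln_realpow)
  then have "of_nat n powr (- s) = exp (- s * (\<Sum>j\<in>?J. of_nat (multiplicity (nth_prime j) n) * of_real (ln (real (nth_prime j)))))"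
    using assms by (simp add: powr_def Ln_of_nat)
  also have "\<dots> = (\<Prod>j\<in>?J. exp (of_nat (multiplicity (nth_prime j) n) * (- s * of_real (ln (real (nth_prime j))))))"
    using finite_prime_indices[OF assms] by (simp add: exp_sum[symmetric] sum_distrib_left mult_ac sum_negf)
  also have "\<dots> = (\<Prod>j\<in>?J. (of_nat (nth_prime j) powr (- s)) ^ multiplicity (nth_prime j) n)"
    using nth_prime_pos by (intro prod.cong) (auto simp: powr_def Ln_of_nat exp_of_nat_mult[symmetric])
  finally show ?thesis
    unfolding torus_char_def shift_def by (simp add: power_mult_distrib prod.distrib mult.commute)
qed

lemma torus_char_measurable [measurable]: "(\<lambda>\<omega>. torus_char \<omega> n) \<in> borel_measurable torus_measure"
  unfolding torus_char_def by measurable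

lemma cmod_torus_char: "\<omega> \<in> space torus_measure \<Longrightarrow> cmod (torus_char \<omega> n) = 1"
  by (simp add: torus_char_def prod_norm[symmetric] norm_power space_torus)

lemma cmod_shift: "cmod (shift s \<omega> j) = real (nth_prime j) powr (- Re s) * cmod (\<omega> j)"
  by (simp add: shift_def norm_mult norm_powr_real_powr)

lemma shift_measurable:
  assumes "f \<in> M \<rightarrow>\<^sub>M torus_measure" "t \<in> borel_measurable M"
  shows "(\<lambda>x. shift (\<i> * of_real (t x)) (f x)) \<in> M \<rightarrow>\<^sub>M torus_measure"
  unfolding shift_def
proof (rule rotate_torus_measurable)
  show "cmod (of_nat (nth_prime j) powr (- (\<i> * of_real (t x)))) = 1" for j x
    using nth_prime_pos[of j] by (subst norm_powr_real_powr) auto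
  show "(\<lambda>x. of_nat (nth_prime j) powr (- (\<i> * of_real (t x)))) \<in> borel_measurable M" for j
  proof -
    have "(\<lambda>y::real. of_nat (nth_prime j) powr (- (\<i> * of_real y)) :: complex) \<in> borel_measurable borel"
      by (intro borel_measurable_continuous_onI continuous_intros) (use nth_prime_pos[of j] in auto)
    then show ?thesis using measurable_compose[OF assms(2)] by blast
  qed
qed fact

lemma nn_integral_torus_shift:
  assumes "G \<in> borel_measurable torus_measure"
  shows "(\<integral>\<^sup>+\<omega>. G (shift (\<i> * of_real t) \<omega>) \<partial>torus_measure) = (\<integral>\<^sup>+\<omega>. G \<omega> \<partial>torus_measure)"
proof -
  have "distr torus_measure torus_measure (shift (\<i> * of_real t)) = torus_measure"
    unfolding shift_def[abs_def] using nth_prime_pos by (intro torus_rotation) (auto simp: norm_powr_real_powr)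
  then show ?thesis
    using nn_integral_distr[OF shift_measurable[of "\<lambda>\<omega>. \<omega>" torus_measure "\<lambda>_. t"], of G] assms by simp
qed


section \<open>Dirichlet polynomials\<close>

definition dsum :: "(nat \<Rightarrow> complex) \<Rightarrow> (nat \<Rightarrow> complex) \<Rightarrow> complex" where
  "dsum P \<omega> = (\<Sum>n | P n \<noteq> 0. P n * torus_char \<omega> n)"

text \<open>The vertical limit of a Dirichlet polynomial, written through its Bohr lift
  \<open>dsum\<close> so that translation in \<open>s\<close> turns into \<open>shift\<close> of the
  character.\<close>

definition dpoly :: "(nat \<Rightarrow> complex) \<Rightarrow> (nat \<Rightarrow> complex) \<Rightarrow> complex \<Rightarrow> complex" where
  "dpoly P \<omega> s = dsum P (shift s \<omega>)"

text \<open>The p-th power of the norm of the horizontal translate by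
  \<open>\<sigma>\<close>.\<close>

definition hmean :: "real \<Rightarrow> (nat \<Rightarrow> complex) \<Rightarrow> real \<Rightarrow> real" where
  "hmean p P \<sigma> = (LINT \<omega>|torus_measure. cmod (dpoly P \<omega> (of_real \<sigma>)) powr p)"

interpretation torus: prob_space torus_measure
  by (rule prob_space_torus)

interpretation circle: prob_space circle_measure
  by (rule prob_space_circle)

lemma dpoly_0: "dpoly P \<omega> 0 = dsum P \<omega>"
  by (simp add: dpoly_def)

lemma dpoly_shift: "dpoly P (shift s' \<omega>) s = dpoly P \<omega> (s + s')"
  by (simp add: dpoly_def shift_add)

lemma dirichlet_polys_diff:
  assumes "P \<in> dirichlet_polys" "Q \<in> dirichlet_polys"
  shows "(\<lambda>n. P n - Q n) \<in> dirichlet_polys"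
proof -
  have "{n. P n - Q n \<noteq> 0} \<subseteq> {n. P n \<noteq> 0} \<union> {n. Q n \<noteq> 0}" by auto
  then show ?thesis using assms finite_subset by (auto simp: dirichlet_polys_def)
qed

lemma dsum_superset:
  assumes "finite S" "{n. P n \<noteq> 0} \<subseteq> S"
  shows "dsum P \<omega> = (\<Sum>n\<in>S. P n * torus_char \<omega> n)"
  unfolding dsum_def using assms by (intro sum.mono_neutral_left) auto

lemma dsum_diff:
  assumes "P \<in> dirichlet_polys" "Q \<in> dirichlet_polys"
  shows "dsum (\<lambda>n. P n - Q n) \<omega> = dsum P \<omega> - dsum Q \<omega>"
proof -
  let ?S = "{n. P n \<noteq> 0} \<union> {n. Q n \<noteq> 0}"
  have S: "finite ?S" using assms by (auto simp: dirichlet_polys_def)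
  show ?thesis
    using S by (subst (1 2 3) dsum_superset[of ?S]) (auto simp: sum_subtractf algebra_simps)
qed

lemma dpoly_diff:
  assumes "P \<in> dirichlet_polys" "Q \<in> dirichlet_polys"
  shows "dpoly (\<lambda>n. P n - Q n) \<omega> s = dpoly P \<omega> s - dpoly Q \<omega> s"
  unfolding dpoly_def by (rule dsum_diff[OF assms])

context
  fixes P :: "nat \<Rightarrow> complex"
  assumes P: "P \<in> dirichlet_polys"
begin

lemma support: "finite {n. P n \<noteq> 0}" "P n \<noteq> 0 \<Longrightarrow> n \<noteq> 0"
  using P by (auto simp: dirichlet_polys_def intro: gr0I)

lemma dpoly_eq: "dpoly P \<omega> s = (\<Sum>n | P n \<noteq> 0. P n * torus_char \<omega> n * of_nat n powr (- s))"
  unfolding dpoly_def dsum_def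
  by (intro sum.cong) (auto simp: torus_char_shift[OF support(2)] mult_ac)

lemma dpoly_holomorphic: "dpoly P \<omega> holomorphic_on A"
  unfolding dpoly_eq[abs_def] using support(2) by (intro holomorphic_intros) auto

lemma dpoly_continuous: "continuous_on A (dpoly P \<omega>)"
  by (rule holomorphic_on_imp_continuous_on[OF dpoly_holomorphic])

lemma dpoly_bound:
  assumes \<omega>: "\<omega> \<in> space torus_measure" and s: "0 \<le> Re s"
  shows "cmod (dpoly P \<omega> s) \<le> (\<Sum>n | P n \<noteq> 0. cmod (P n))"
  unfolding dpoly_eq
proof (rule sum_norm_le)
  fix n assume "n \<in> {n. P n \<noteq> 0}"
  then have n: "1 \<le> real n" using support(2)[of n] by (auto simp: Suc_le_eq)
  have "real n powr (- Re s) \<le> 1" using n s by (simp add: powr_minus_divide ge_one_powr_ge_zero)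
  then have "cmod (P n) * real n powr (- Re s) \<le> cmod (P n) * 1" by (intro mult_left_mono) auto
  then show "cmod (P n * torus_char \<omega> n * of_nat n powr (- s)) \<le> cmod (P n)"
    by (simp add: norm_mult cmod_torus_char[OF \<omega>] norm_powr_real_powr)
qed

lemma dpoly_measurable_pair [measurable]: "(\<lambda>x. dpoly P (fst x) (snd x)) \<in> borel_measurable (torus_measure \<Otimes>\<^sub>M borel)"
proof -
  have m: "(\<lambda>s. of_nat n powr (- s) :: complex) \<in> borel_measurable borel" if "n \<in> {n. P n \<noteq> 0}" for n
    by (intro borel_measurable_continuous_onI continuous_intros) (use support(2)[of n] that in auto)
  have "(\<lambda>x. P n * torus_char (fst x) n * of_nat n powr (- snd x)) \<in> borel_measurable (torus_measure \<Otimes>\<^sub>M borel)"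
    if "n \<in> {n. P n \<noteq> 0}" for n
    by (intro borel_measurable_times measurable_compose[OF measurable_fst torus_char_measurable]
        measurable_compose[OF measurable_snd m] borel_measurable_const that)
  then show ?thesis unfolding dpoly_eq by (rule borel_measurable_sum)
qed

lemma dpoly_measurable [measurable]:
  assumes [measurable]: "f \<in> M \<rightarrow>\<^sub>M torus_measure" "g \<in> borel_measurable M"
  shows "(\<lambda>x. dpoly P (f x) (g x)) \<in> borel_measurable M"
  using measurable_compose[OF measurable_Pair[OF assms] dpoly_measurable_pair] by simp

lemma dsum_measurable [measurable]:
  assumes [measurable]: "f \<in> M \<rightarrow>\<^sub>M torus_measure"
  shows "(\<lambda>x. dsum P (f x)) \<in> borel_measurable M"
  using dpoly_measurable[OF assms, of "\<lambda>_. 0"] by (simp add: dpoly_0)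

lemma dpoly_integrable:
  assumes p: "0 \<le> p" and s: "0 \<le> Re s"
  shows "integrable torus_measure (\<lambda>\<omega>. cmod (dpoly P \<omega> s) powr p)"
proof (rule torus.integrable_const_bound[of _ "(\<Sum>n | P n \<noteq> 0. cmod (P n)) powr p"])
  show "AE \<omega> in torus_measure. norm (cmod (dpoly P \<omega> s) powr p) \<le> (\<Sum>n | P n \<noteq> 0. cmod (P n)) powr p"
    using dpoly_bound s p by (intro AE_I2) (auto intro!: powr_mono2)
qed measurable

text \<open>The imaginary part of \<open>s\<close> acts as a rotation of the torus and drops out of
  the mean.\<close>

lemma nn_integral_dpoly:
  assumes p: "0 < p" and s: "0 \<le> Re s"
  shows "(\<integral>\<^sup>+\<omega>. ennreal (cmod (dpoly P \<omega> s) powr p) \<partial>torus_measure) = ennreal (hmean p P (Re s))"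
proof -
  have s_eq: "s = of_real (Re s) + \<i> * of_real (Im s)" by (simp add: complex_eq)
  have "(\<integral>\<^sup>+\<omega>. ennreal (cmod (dpoly P \<omega> s) powr p) \<partial>torus_measure) =
    (\<integral>\<^sup>+\<omega>. ennreal (cmod (dpoly P (shift (\<i> * of_real (Im s)) \<omega>) (of_real (Re s))) powr p) \<partial>torus_measure)"
    by (subst s_eq) (simp add: dpoly_shift)
  also have "\<dots> = (\<integral>\<^sup>+\<omega>. ennreal (cmod (dpoly P \<omega> (of_real (Re s))) powr p) \<partial>torus_measure)"
    by (rule nn_integral_torus_shift) measurable
  also have "\<dots> = ennreal (hmean p P (Re s))"
    unfolding hmean_def using p s by (intro nn_integral_eq_integral dpoly_integrable) auto
  finally show ?thesis .
qed

lemma hmean_nonneg: "0 \<le> hmean p P \<sigma>"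
  unfolding hmean_def by (intro Bochner_Integration.integral_nonneg) auto

lemma dirichlet_poly_norm_powr:
  assumes p: "0 < p" shows "dirichlet_poly_norm p P powr p = hmean p P 0"
proof -
  have "(\<integral>\<^sup>+\<omega>. ennreal (cmod (dsum P \<omega>) powr p) \<partial>torus_measure) = ennreal (hmean p P 0)"
    using nn_integral_dpoly[OF p, of 0] by (simp add: dpoly_0)
  then have "dirichlet_poly_norm p P = hmean p P 0 powr (1/p)"
    by (simp add: dirichlet_poly_norm_def lp_norm_def dsum_def hmean_nonneg)
  then show ?thesis using p hmean_nonneg[of p 0] by (simp add: powr_powr)
qed

text \<open>A vertical limit is bounded and continuous up to the imaginary axis, and its boundary
  values run along an orbit of the flow. A sub-mean value inequality in the half-plane thereby
  becomes one on the torus.\<close>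

lemma dpoly_submean:
  assumes \<omega>: "\<omega> \<in> space torus_measure" and q: "0 < q" and \<sigma>: "0 < \<sigma>"
  shows "ennreal (cmod (dpoly P \<omega> (Complex \<sigma> t)) powr q) \<le>
    (\<integral>\<^sup>+x. ennreal (poisson \<sigma> (x - t)) * ennreal (cmod (dsum P (shift (\<i> * of_real x) \<omega>)) powr q) \<partial>lborel)"
proof -
  define M where "M = (\<Sum>n | P n \<noteq> 0. cmod (P n))"
  have eq: "dpoly P \<omega> (Complex 0 x) = dsum P (shift (\<i> * of_real x) \<omega>)" for x
    by (simp add: dpoly_def Complex_eq)
  have "cmod (dpoly P \<omega> (Complex \<sigma> t)) powr q \<le> (LINT x|lborel. poisson \<sigma> (x - t) * cmod (dpoly P \<omega> (Complex 0 x)) powr q)"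
    using dpoly_bound[OF \<omega>] by (intro half_plane_submean[OF dpoly_holomorphic dpoly_continuous _ \<sigma> q])
  also have "ennreal \<dots> = (\<integral>\<^sup>+x. ennreal (poisson \<sigma> (x - t) * cmod (dpoly P \<omega> (Complex 0 x)) powr q) \<partial>lborel)"
  proof (rule nn_integral_eq_integral[symmetric])
    have "integrable lborel (\<lambda>x. poisson \<sigma> (x - t) *\<^sub>R (cmod (dpoly P \<omega> (Complex 0 x)) powr q))"
    proof (rule poisson_boundary_limit(1)[OF \<sigma>])
      show "continuous_on {s. 0 \<le> Re s} (\<lambda>s. cmod (dpoly P \<omega> s) powr q)"
        using q by (intro continuous_on_powr' continuous_intros dpoly_continuous) auto
      show "norm (cmod (dpoly P \<omega> s) powr q) \<le> M powr q" if "0 \<le> Re s" for s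
        using dpoly_bound[OF \<omega> that] q by (auto intro!: powr_mono2 simp: M_def)
    qed
    then show "integrable lborel (\<lambda>x. poisson \<sigma> (x - t) * cmod (dpoly P \<omega> (Complex 0 x)) powr q)" by simp
  qed (use \<sigma> in \<open>auto simp: poisson_nonneg\<close>)
  also have "\<dots> = (\<integral>\<^sup>+x. ennreal (poisson \<sigma> (x - t)) * ennreal (cmod (dsum P (shift (\<i> * of_real x) \<omega>)) powr q) \<partial>lborel)"
    unfolding eq using \<sigma> by (intro nn_integral_cong ennreal_mult) (auto simp: poisson_nonneg)
  finally show ?thesis by (simp add: ennreal_leI)
qed

text \<open>When the sub-mean value inequality is integrated over the torus, every point of the
  orbit contributes the same mean, and the Poisson kernel has mass 1.\<close>

lemma hmean_le:
  assumes p: "0 < p" and \<sigma>: "0 \<le> \<sigma>"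
  shows "hmean p P \<sigma> \<le> hmean p P 0"
proof (cases "\<sigma> = 0")
  case False
  then have \<sigma>: "0 < \<sigma>" using assms by simp
  have m: "(\<lambda>x. shift (\<i> * of_real (fst x)) (snd x)) \<in> lborel \<Otimes>\<^sub>M torus_measure \<rightarrow>\<^sub>M torus_measure"
    by (rule shift_measurable) measurable
  have m': "(\<lambda>x. shift (\<i> * of_real (snd x)) (fst x)) \<in> torus_measure \<Otimes>\<^sub>M lborel \<rightarrow>\<^sub>M torus_measure"
    by (rule shift_measurable) measurable
  note m [measurable] m' [measurable]
  have m2 [measurable]: "(\<lambda>\<omega>. shift (\<i> * of_real x) \<omega>) \<in> torus_measure \<rightarrow>\<^sub>M torus_measure" for x
    by (rule shift_measurable) measurable
  interpret PS: pair_sigma_finite torus_measure "lborel :: real measure" ..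
  have "ennreal (hmean p P \<sigma>) = (\<integral>\<^sup>+\<omega>. ennreal (cmod (dpoly P \<omega> (Complex \<sigma> 0)) powr p) \<partial>torus_measure)"
    using nn_integral_dpoly[OF p, of "Complex \<sigma> 0"] \<sigma> by simp
  also have "\<dots> \<le> (\<integral>\<^sup>+\<omega>. (\<integral>\<^sup>+x. ennreal (poisson \<sigma> (x - 0)) * ennreal (cmod (dsum P (shift (\<i> * of_real x) \<omega>)) powr p) \<partial>lborel) \<partial>torus_measure)"
    by (intro nn_integral_mono dpoly_submean p \<sigma>)
  also have "\<dots> = (\<integral>\<^sup>+x. (\<integral>\<^sup>+\<omega>. ennreal (poisson \<sigma> (x - 0)) * ennreal (cmod (dsum P (shift (\<i> * of_real x) \<omega>)) powr p) \<partial>torus_measure) \<partial>lborel)"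
    unfolding case_prod_unfold
  proof (rule PS.Fubini'[symmetric])
    note dsum_measurable[OF m', measurable]
    show "(\<lambda>(\<omega>, x). ennreal (poisson \<sigma> (x - 0)) * ennreal (cmod (dsum P (shift (\<i> * of_real x) \<omega>)) powr p)) \<in> borel_measurable (torus_measure \<Otimes>\<^sub>M lborel)"
      unfolding case_prod_unfold by measurable
  qed
  also have "\<dots> = (\<integral>\<^sup>+x. ennreal (poisson \<sigma> (x - 0)) * ennreal (hmean p P 0) \<partial>lborel)"
  proof (rule nn_integral_cong)
    fix x :: real
    have "(\<integral>\<^sup>+\<omega>. ennreal (cmod (dsum P (shift (\<i> * of_real x) \<omega>)) powr p) \<partial>torus_measure) = ennreal (hmean p P 0)"
      using nn_integral_dpoly[OF p, of "\<i> * of_real x"] by (simp add: dpoly_def)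
    then show "(\<integral>\<^sup>+\<omega>. ennreal (poisson \<sigma> (x - 0)) * ennreal (cmod (dsum P (shift (\<i> * of_real x) \<omega>)) powr p) \<partial>torus_measure) = ennreal (poisson \<sigma> (x - 0)) * ennreal (hmean p P 0)"
      by (subst nn_integral_cmult) auto
  qed
  also have "\<dots> = ennreal (hmean p P 0)"
    using nn_integral_poisson[OF \<sigma>, of 0] by (subst nn_integral_multc) auto
  finally show ?thesis by (simp add: hmean_nonneg)
qed simp

end

section \<open>Point evaluation and bounds for coefficients\<close>

lemma integral_circle:
  fixes G :: "complex \<Rightarrow> real"
  assumes G: "continuous_on (sphere 0 1) G" and G0: "\<And>z. 0 \<le> G z"
  shows "ennreal (integral {0..1} (\<lambda>t. G (cis (2*pi*t)))) = (\<integral>\<^sup>+z. ennreal (G z) \<partial>circle_measure)"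
proof -
  have pi0: "\<not> pi \<le> 0" using pi_gt_zero by linarith
  have cont: "continuous_on {0..1} (\<lambda>t. G (cis (2*pi*t)))"
    by (rule continuous_on_compose2[OF G]) (auto intro!: continuous_intros)
  have contU: "continuous_on UNIV (\<lambda>t. G (cis t))"
    by (rule continuous_on_compose2[OF G]) (auto intro!: continuous_intros)
  then have [measurable]: "(\<lambda>t. G (cis t)) \<in> borel_measurable borel" by (rule borel_measurable_continuous_onI)
  have "G \<in> borel_measurable (restrict_space borel (sphere 0 1))"
    using G by (rule borel_measurable_continuous_on_restrict)
  then have "(\<integral>\<^sup>+z. ennreal (G z) \<partial>circle_measure) = (\<integral>\<^sup>+t. ennreal (G (cis t)) * indicator {0..2*pi} t \<partial>lborel) / ennreal (2*pi)"
    by (intro nn_integral_circle) measurable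
  also have "(\<integral>\<^sup>+t. ennreal (G (cis t)) * indicator {0..2*pi} t \<partial>lborel) =
     ennreal \<bar>2*pi\<bar> * (\<integral>\<^sup>+t. ennreal (G (cis (0 + (2*pi) * t))) * indicator {0..2*pi} (0 + (2*pi) * t) \<partial>lborel)"
    by (rule nn_integral_real_affine) auto
  also have "(\<integral>\<^sup>+t. ennreal (G (cis (0 + (2*pi) * t))) * indicator {0..2*pi} (0 + (2*pi) * t) \<partial>lborel) =
     (\<integral>\<^sup>+t. ennreal (indicator {0..1} t * G (cis (2*pi*t))) \<partial>lborel)"
    by (intro nn_integral_cong) (auto simp: indicator_def zero_le_mult_iff pi0)
  also have "\<dots> = ennreal (LINT t|lborel. indicator {0..1} t * G (cis (2*pi*t)))"
    using borel_integrable_atLeastAtMost'[OF cont] G0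
    by (intro nn_integral_eq_integral) (auto simp: set_integrable_def)
  also have "(LINT t|lborel. indicator {0..1} t * G (cis (2*pi*t))) = integral {0..1} (\<lambda>t. G (cis (2*pi*t)))"
    using set_borel_integral_eq_integral(2)[OF borel_integrable_atLeastAtMost'[OF cont]]
    by (simp add: set_lebesgue_integral_def)
  also have "ennreal \<bar>2*pi\<bar> * ennreal (integral {0..1} (\<lambda>t. G (cis (2*pi*t)))) / ennreal (2*pi) = ennreal (integral {0..1} (\<lambda>t. G (cis (2*pi*t))))"
  proof -
    have "0 \<le> integral {0..1} (\<lambda>t. G (cis (2*pi*t)))"
      by (rule Henstock_Kurzweil_Integration.integral_nonneg[OF integrable_continuous_real[OF cont]]) (use G0 in auto)
    then show ?thesis by (simp add: ennreal_mult'[symmetric] divide_ennreal)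
  qed
  finally show ?thesis ..
qed

text \<open>As a function of one coordinate a character is a monomial. For \<open>n = 0\<close> the
  index set of the product is infinite and the product is 1, hence the exponent 0 in that
  case.\<close>

lemma torus_char_update:
  "torus_char (fun_upd \<eta> k z) n = torus_char (fun_upd \<eta> k 1) n * z ^ (if nth_prime k dvd n \<and> n \<noteq> 0 then multiplicity (nth_prime k) n else 0)"
proof (cases "n = 0")
  case True
  have "infinite {j::nat. nth_prime j dvd n}" using True by simp
  then show ?thesis using True by (simp add: torus_char_def)
next
  case False
  let ?J = "{j. nth_prime j dvd n}"
  have fin: "finite ?J" by (rule finite_prime_indices[OF False])
  have "torus_char (fun_upd \<eta> k z) n = (\<Prod>j\<in>?J. (fun_upd \<eta> k 1) j ^ multiplicity (nth_prime j) n * (if j = k then z ^ multiplicity (nth_prime j) n else 1))"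
    unfolding torus_char_def by (intro prod.cong) auto
  also have "\<dots> = torus_char (fun_upd \<eta> k 1) n * (\<Prod>j\<in>?J. if j = k then z ^ multiplicity (nth_prime j) n else 1)"
    by (simp add: prod.distrib torus_char_def)
  also have "(\<Prod>j\<in>?J. if j = k then z ^ multiplicity (nth_prime j) n else 1) = z ^ (if nth_prime k dvd n \<and> n \<noteq> 0 then multiplicity (nth_prime k) n else 0)"
    using fin False by (simp add: prod.delta)
  finally show ?thesis .
qed

text \<open>As the prime of index \<open>j\<close> is at least \<open>j + 2\<close>, the product is
  at most that of \<open>1 / (1 - 1 / (j+2)^2)\<close>, which telescopes to
  \<open>2 * (k + 1) / (k + 2)\<close>.\<close>

lemma prod_euler_bound: "(\<Prod>j<k. 1 / (1 - 1 / real (nth_prime j) ^ 2)) \<le> 2"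
proof -
  have 1: "(\<Prod>j<k. 1 / (1 - 1 / real (nth_prime j) ^ 2)) \<le> (\<Prod>j<k. 1 / (1 - 1 / real (j+2) ^ 2))"
  proof (rule prod_mono)
    fix j assume "j \<in> {..<k}"
    have "real (j + 2) \<le> real (nth_prime j)" using nth_prime_ge[of j] by (simp only: of_nat_le_iff)
    then have "1 / real (nth_prime j) ^ 2 \<le> 1 / real (j+2) ^ 2" by (intro divide_left_mono power_mono mult_pos_pos) auto
    moreover have "1 / real (j+2) ^ 2 < 1" by (simp add: power2_eq_square add_pos_nonneg field_simps)
    ultimately have le: "0 < 1 - 1 / real (j+2) ^ 2" "1 - 1 / real (j+2) ^ 2 \<le> 1 - 1 / real (nth_prime j) ^ 2"
      by linarith+
    then have "0 < 1 - 1 / real (nth_prime j) ^ 2" by linarith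
    with le show "0 \<le> 1 / (1 - 1 / real (nth_prime j) ^ 2) \<and> 1 / (1 - 1 / real (nth_prime j) ^ 2) \<le> 1 / (1 - 1 / real (j+2) ^ 2)"
      by (intro conjI divide_nonneg_pos divide_left_mono mult_pos_pos) linarith+
  qed
  have "(\<Prod>j<k. 1 / (1 - 1 / real (j+2) ^ 2)) = 2 * real (k + 1) / real (k + 2)"
  proof (induction k)
    case (Suc k)
    define x where "x = real k"
    have x: "0 \<le> x" by (simp add: x_def)
    have "(x + 2) ^ 2 \<noteq> 0" using x by auto
    then have "1 - 1 / (x + 2) ^ 2 = ((x + 2) ^ 2 - 1) / (x + 2) ^ 2" by (simp add: diff_divide_distrib)
    also have "(x + 2) ^ 2 - 1 = (x + 1) * (x + 3)" by (simp add: power2_eq_square algebra_simps)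
    finally have "1 - 1 / (x + 2) ^ 2 = (x + 1) * (x + 3) / (x + 2) ^ 2" .
    then have "1 / (1 - 1 / (x + 2) ^ 2) = (x + 2) * (x + 2) / ((x + 1) * (x + 3))"
      by (simp add: power2_eq_square)
    moreover have "2 * (x + 1) / (x + 2) * ((x + 2) * (x + 2) / ((x + 1) * (x + 3))) = 2 * (x + 2) / (x + 3)"
      using x by (simp add: divide_simps) (simp add: algebra_simps)
    moreover have "real (k + 2) = x + 2" "real (k + 1) = x + 1" "real (Suc k + 1) = x + 2" "real (Suc k + 2) = x + 3"
      by (simp_all add: x_def)
    ultimately show ?case unfolding prod.lessThan_Suc Suc.IH by (simp only:)
  qed simp
  also have "\<dots> \<le> 2" by (simp add: divide_le_eq)
  finally show ?thesis using 1 by linarith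
qed

context
  fixes P :: "nat \<Rightarrow> complex" and p :: real
  assumes P: "P \<in> dirichlet_polys" and p: "0 < p"
begin

text \<open>In a single coordinate the Bohr lift is a polynomial, whatever the other coordinates
  are, so \<open>circle_submean\<close> applies.\<close>

lemma dsum_coordinate_submean:
  assumes z: "cmod z < 1"
  shows "ennreal (cmod (dsum P (fun_upd \<eta> k z)) powr p) \<le>
    ennreal (1 / (1 - cmod z)) * (\<integral>\<^sup>+\<zeta>. ennreal (cmod (dsum P (fun_upd \<eta> k \<zeta>)) powr p) \<partial>circle_measure)"
proof -
  define F where "F = (\<lambda>\<zeta>. dsum P (fun_upd \<eta> k \<zeta>))"
  have hol: "F holomorphic_on A" for A
    unfolding F_def dsum_def by (subst torus_char_update) (intro holomorphic_intros)
  have "(1 - cmod z) * cmod (F z) powr p \<le> integral {0..1} (\<lambda>t. cmod (F (cis (2*pi*t))) powr p)"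
    by (rule circle_submean[OF hol, of 2]) (use p z in auto)
  then have "cmod (F z) powr p \<le> 1 / (1 - cmod z) * integral {0..1} (\<lambda>t. cmod (F (cis (2*pi*t))) powr p)"
    using z by (simp add: field_simps)
  then have "ennreal (cmod (F z) powr p) \<le> ennreal (1 / (1 - cmod z)) * ennreal (integral {0..1} (\<lambda>t. cmod (F (cis (2*pi*t))) powr p))"
    using z by (simp add: ennreal_mult'[symmetric] ennreal_leI)
  also have "ennreal (integral {0..1} (\<lambda>t. cmod (F (cis (2*pi*t))) powr p)) = (\<integral>\<^sup>+\<zeta>. ennreal (cmod (F \<zeta>) powr p) \<partial>circle_measure)"
    using p by (intro integral_circle continuous_on_powr' continuous_intros holomorphic_on_imp_continuous_on[OF hol]) auto
  finally show ?thesis by (simp add: F_def)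
qed

text \<open>The coordinates are moved one after another from the torus to points inside the disc
  whose modulus is the inverse square of the prime. With the coarse kernel of
  \<open>circle_submean\<close> each move costs one factor of an Euler product, and at
  \<open>s = 2\<close> this product converges.\<close>

lemma dpoly_pointwise_bound:
  assumes \<omega>: "\<omega> \<in> space torus_measure"
  shows "cmod (dpoly P \<omega> 2) powr p \<le> 2 * hmean p P 0"
proof -
  \<comment> \<open>A hybrid point: the first \<open>k\<close> coordinates have been moved already,
    the others are still random.\<close>
  define Z where "Z k \<xi> = (\<lambda>j. if j < k then shift 2 \<omega> j else \<xi> j)" for k :: nat and \<xi> :: "nat \<Rightarrow> complex"
  define z where "z k = shift 2 \<omega> k" for k
  have cz: "cmod (z k) = 1 / real (nth_prime k) ^ 2" for k
    using \<omega> nth_prime_pos[of k] unfolding z_def cmod_shift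
    by (simp add: space_torus powr_minus_divide powr_numeral)
  have z1: "cmod (z k) < 1" for k
  proof -
    have "1 < real (nth_prime k)" using nth_prime_ge[of k] by linarith
    then have "1 < real (nth_prime k) ^ 2" by simp
    then show ?thesis unfolding cz by (subst divide_less_eq_1_pos) linarith+
  qed
  define I where "I k = (\<integral>\<^sup>+\<xi>. ennreal (cmod (dsum P (Z k \<xi>)) powr p) \<partial>torus_measure)" for k
  have meas: "(\<lambda>\<xi>. ennreal (cmod (dsum P (Z k \<xi>)) powr p)) \<in> borel_measurable torus_measure" for k
    unfolding dsum_def torus_char_def Z_def by measurable
  have step: "I (Suc k) \<le> ennreal (1 / (1 - 1 / real (nth_prime k) ^ 2)) * I k" for k
  proof -
    have Zs: "Z (Suc k) \<xi> = fun_upd (Z k \<xi>) k (z k)" for \<xi> by (auto simp: Z_def z_def fun_eq_iff less_Suc_eq)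
    have Zu: "fun_upd (Z k \<xi>) k \<zeta> = Z k (fun_upd \<xi> k \<zeta>)" for \<xi> \<zeta> by (auto simp: Z_def fun_eq_iff)
    have "I (Suc k) \<le> (\<integral>\<^sup>+\<xi>. ennreal (1 / (1 - cmod (z k))) * (\<integral>\<^sup>+\<zeta>. ennreal (cmod (dsum P (fun_upd (Z k \<xi>) k \<zeta>)) powr p) \<partial>circle_measure) \<partial>torus_measure)"
      unfolding I_def Zs by (intro nn_integral_mono dsum_coordinate_submean z1)
    also have "\<dots> = ennreal (1 / (1 - cmod (z k))) * (\<integral>\<^sup>+\<xi>. (\<integral>\<^sup>+\<zeta>. ennreal (cmod (dsum P (Z k (fun_upd \<xi> k \<zeta>))) powr p) \<partial>circle_measure) \<partial>torus_measure)"
    proof -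
      have "(\<lambda>\<xi>. \<integral>\<^sup>+\<zeta>. ennreal (cmod (dsum P (Z k (fun_upd \<xi> k \<zeta>))) powr p) \<partial>circle_measure) \<in> borel_measurable torus_measure"
      proof (rule circle.borel_measurable_nn_integral)
        have "(\<lambda>x. ennreal (cmod (dsum P (Z k ((snd x)(k := fst x)))) powr p)) \<circ> (\<lambda>x. (snd x, fst x)) \<in> borel_measurable (torus_measure \<Otimes>\<^sub>M circle_measure)"
          by (rule measurable_comp[OF _ update_measurable[OF meas]]) measurable
        then show "(\<lambda>(\<xi>, \<zeta>). ennreal (cmod (dsum P (Z k (fun_upd \<xi> k \<zeta>))) powr p)) \<in> borel_measurable (torus_measure \<Otimes>\<^sub>M circle_measure)"
          by (simp add: o_def case_prod_unfold)
      qed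
      then show ?thesis unfolding Zu by (rule nn_integral_cmult)
    qed
    also have "(\<integral>\<^sup>+\<xi>. (\<integral>\<^sup>+\<zeta>. ennreal (cmod (dsum P (Z k (fun_upd \<xi> k \<zeta>))) powr p) \<partial>circle_measure) \<partial>torus_measure) = I k"
      unfolding I_def by (rule nn_integral_torus_coordinate[OF meas, symmetric])
    finally show ?thesis by (simp add: cz)
  qed
  have Ik: "I k \<le> ennreal (\<Prod>j<k. 1 / (1 - 1 / real (nth_prime j) ^ 2)) * I 0" for k
  proof (induction k)
    case (Suc k)
    have nn: "0 \<le> 1 / (1 - 1 / real (nth_prime j) ^ 2)" for j using z1[of j] unfolding cz by simp
    have "I (Suc k) \<le> ennreal (1 / (1 - 1 / real (nth_prime k) ^ 2)) * I k" by (rule step)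
    also have "\<dots> \<le> ennreal (1 / (1 - 1 / real (nth_prime k) ^ 2)) * (ennreal (\<Prod>j<k. 1 / (1 - 1 / real (nth_prime j) ^ 2)) * I 0)"
      using Suc.IH by (intro mult_left_mono) auto
    also have "\<dots> = ennreal (\<Prod>j<Suc k. 1 / (1 - 1 / real (nth_prime j) ^ 2)) * I 0"
      using nn by (simp only: prod.lessThan_Suc mult.assoc[symmetric]) (subst ennreal_mult'[symmetric], auto simp: mult.commute)
    finally show ?case .
  qed simp
  have I0: "I 0 = ennreal (hmean p P 0)"
    using nn_integral_dpoly[OF P p, of 0] by (simp add: I_def Z_def dpoly_0)
  \<comment> \<open>Beyond the largest prime that divides an index of the support, the hybrid point
    no longer depends on \<open>\<xi>\<close> as far as \<open>P\<close> is concerned, so finitely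
    many moves are enough.\<close>
  have "finite (\<Union>n\<in>{n. P n \<noteq> 0}. {j. nth_prime j dvd n})"
    using support[OF P] finite_prime_indices by auto
  then obtain k where k: "\<And>j n. P n \<noteq> 0 \<Longrightarrow> nth_prime j dvd n \<Longrightarrow> j < k"
    by (auto simp: finite_nat_set_iff_bounded)
  have "dsum P (Z k \<xi>) = dpoly P \<omega> 2" for \<xi>
    unfolding dpoly_def dsum_def torus_char_def Z_def
    by (intro sum.cong refl arg_cong2[where f="(*)"] prod.cong) (auto simp: k)
  then have "I k = ennreal (cmod (dpoly P \<omega> 2) powr p)"
    unfolding I_def by (simp add: torus.emeasure_space_1)
  then have "ennreal (cmod (dpoly P \<omega> 2) powr p) \<le> ennreal (\<Prod>j<k. 1 / (1 - 1 / real (nth_prime j) ^ 2)) * ennreal (hmean p P 0)"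
    using Ik[of k] by (simp add: I0)
  also have "\<dots> \<le> ennreal 2 * ennreal (hmean p P 0)"
    using prod_euler_bound by (intro mult_right_mono ennreal_leI) auto
  also have "\<dots> = ennreal (2 * hmean p P 0)" by (simp add: ennreal_mult')
  finally show ?thesis using hmean_nonneg[OF P, of p 0] by (subst (asm) ennreal_le_iff) auto
qed

end

lemma shift_space: "\<omega> \<in> space torus_measure \<Longrightarrow> shift (\<i> * of_real t) \<omega> \<in> space torus_measure"
  using nth_prime_pos by (simp add: space_torus cmod_shift)

lemma torus_char_cnj_measurable:
  "(\<lambda>\<omega>. torus_char \<omega> m * cnj (torus_char \<omega> n)) \<in> borel_measurable torus_measure"
proof -
  have "cnj \<in> borel_measurable borel" by (intro borel_measurable_continuous_onI continuous_intros)
  then show ?thesis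
    by (intro borel_measurable_times torus_char_measurable measurable_compose[OF torus_char_measurable])
qed

text \<open>For \<open>m \<noteq> n\<close> the flow time \<open>t\<close> is chosen so that the
  flow multiplies the integrand by -1; rotation invariance then equates the integral with its
  negative.\<close>

lemma torus_char_orthogonal:
  assumes m: "0 < m" and n: "0 < n"
  shows "(LINT \<omega>|torus_measure. torus_char \<omega> m * cnj (torus_char \<omega> n)) = (if m = n then 1 else 0)"
proof (cases "m = n")
  case True
  have "(LINT \<omega>|torus_measure. torus_char \<omega> m * cnj (torus_char \<omega> n)) = (LINT \<omega>|torus_measure. (1::complex))"
    by (rule Bochner_Integration.integral_cong) (auto simp: True complex_norm_square[symmetric] cmod_torus_char)
  then show ?thesis using True by (simp add: torus.prob_space)
next
  case False
  define t where "t = pi / (ln (real m) - ln (real n))"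
  have ne: "ln (real m) - ln (real n) \<noteq> 0" using False m n by simp
  have neg: "of_nat m powr (- (\<i> * of_real t)) * cnj (of_nat n powr (- (\<i> * of_real t))) = -1"
  proof -
    have "of_nat m powr (- (\<i> * of_real t)) * cnj (of_nat n powr (- (\<i> * of_real t))) = exp (- (\<i> * of_real (t * (ln (real m) - ln (real n)))))"
      using m n by (simp add: powr_def Ln_of_nat exp_cnj mult_exp_exp algebra_simps)
    also have "t * (ln (real m) - ln (real n)) = pi" using ne by (simp add: t_def)
    finally show ?thesis by (simp add: exp_minus mult.commute[of \<i>])
  qed
  let ?F = "\<lambda>\<omega>. torus_char \<omega> m * cnj (torus_char \<omega> n)"
  have d: "distr torus_measure torus_measure (shift (\<i> * of_real t)) = torus_measure"
    unfolding shift_def[abs_def] using nth_prime_pos by (intro torus_rotation) (auto simp: norm_powr_real_powr)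
  have ms: "shift (\<i> * of_real t) \<in> torus_measure \<rightarrow>\<^sub>M torus_measure"
    using shift_measurable[of "\<lambda>\<omega>. \<omega>" torus_measure "\<lambda>_. t"] by simp
  have "(LINT \<omega>|torus_measure. ?F \<omega>) = (LINT \<omega>|distr torus_measure torus_measure (shift (\<i> * of_real t)). ?F \<omega>)" by (simp add: d)
  also have "\<dots> = (LINT \<omega>|torus_measure. ?F (shift (\<i> * of_real t) \<omega>))"
    by (rule integral_distr[OF ms]) (rule torus_char_cnj_measurable)
  also have "\<dots> = (LINT \<omega>|torus_measure. (-1) * ?F \<omega>)"
  proof (rule Bochner_Integration.integral_cong)
    fix \<omega>
    have "?F (shift (\<i> * of_real t) \<omega>) = (of_nat m powr (- (\<i> * of_real t)) * cnj (of_nat n powr (- (\<i> * of_real t)))) * ?F \<omega>"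
      using m n by (simp add: torus_char_shift mult_ac)
    then show "?F (shift (\<i> * of_real t) \<omega>) = (-1) * ?F \<omega>" unfolding neg .
  qed simp
  also have "\<dots> = - (LINT \<omega>|torus_measure. ?F \<omega>)" by simp
  finally show ?thesis using False by simp
qed

text \<open>For \<open>p < 1\<close> the norm does not dominate the integral of the modulus, so
  coefficients are not read off on the torus itself. The translate by 2 is bounded by point
  evaluation, orthogonality extracts its n-th coefficient, and the factor \<open>real n ^ 2\<close>
  undoes the translation.\<close>

lemma coefficient_bound:
  assumes P: "P \<in> dirichlet_polys" and p: "0 < p"
  shows "cmod (P n) \<le> (2 * hmean p P 0) powr (1/p) * real n ^ 2"
proof (cases "P n = 0")
  case False
  then have n: "0 < n" using support(2)[OF P] by auto
  let ?S = "{m. P m \<noteq> 0}"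
  have bd: "cmod (dpoly P \<omega> 2) \<le> (2 * hmean p P 0) powr (1/p)" if "\<omega> \<in> space torus_measure" for \<omega>
  proof -
    have "(cmod (dpoly P \<omega> 2) powr p) powr (1/p) \<le> (2 * hmean p P 0) powr (1/p)"
      using dpoly_pointwise_bound[OF P p that] p by (intro powr_mono2) auto
    then show ?thesis using p by (simp add: powr_powr)
  qed
  have int: "integrable torus_measure (\<lambda>\<omega>. torus_char \<omega> m * cnj (torus_char \<omega> n))" for m
    by (rule torus.integrable_const_bound[of _ 1]) (auto simp: norm_mult cmod_torus_char torus_char_cnj_measurable)
  have "(LINT \<omega>|torus_measure. dpoly P \<omega> 2 * cnj (torus_char \<omega> n)) =
    (LINT \<omega>|torus_measure. (\<Sum>m\<in>?S. (P m * of_nat m powr (- 2)) * (torus_char \<omega> m * cnj (torus_char \<omega> n))))"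
    unfolding dpoly_eq[OF P] sum_distrib_right
    by (intro Bochner_Integration.integral_cong sum.cong refl) (simp only: mult_ac)
  also have "\<dots> = (\<Sum>m\<in>?S. (P m * of_nat m powr (- 2)) * (LINT \<omega>|torus_measure. torus_char \<omega> m * cnj (torus_char \<omega> n)))"
    by (subst Bochner_Integration.integral_sum) (use int in auto)
  also have "\<dots> = (\<Sum>m\<in>?S. if m = n then P m * of_nat m powr (- 2) else 0)"
    using support(2)[OF P] n by (intro sum.cong) (auto simp: torus_char_orthogonal)
  also have "\<dots> = P n * of_nat n powr (- 2)" using False support(1)[OF P] by (simp add: sum.delta)
  finally have eq: "P n * of_nat n powr (- 2) = (LINT \<omega>|torus_measure. dpoly P \<omega> 2 * cnj (torus_char \<omega> n))" ..
  have "cmod (LINT \<omega>|torus_measure. dpoly P \<omega> 2 * cnj (torus_char \<omega> n)) \<le> (LINT \<omega>|torus_measure. (2 * hmean p P 0) powr (1/p))"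
  proof -
    have i: "integrable torus_measure (\<lambda>\<omega>. dpoly P \<omega> 2 * cnj (torus_char \<omega> n))"
    proof (rule torus.integrable_const_bound[of _ "(2 * hmean p P 0) powr (1/p)"])
      have "cnj \<in> borel_measurable borel" by (intro borel_measurable_continuous_onI continuous_intros)
      then show "(\<lambda>\<omega>. dpoly P \<omega> 2 * cnj (torus_char \<omega> n)) \<in> borel_measurable torus_measure"
        using dpoly_measurable[OF P, of "\<lambda>\<omega>. \<omega>" torus_measure "\<lambda>_. 2"]
        by (intro borel_measurable_times measurable_compose[OF torus_char_measurable]) auto
    qed (auto simp: norm_mult cmod_torus_char bd)
    have "cmod (LINT \<omega>|torus_measure. dpoly P \<omega> 2 * cnj (torus_char \<omega> n)) \<le> (LINT \<omega>|torus_measure. cmod (dpoly P \<omega> 2 * cnj (torus_char \<omega> n)))"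
      by (rule integral_norm_bound)
    also have "\<dots> \<le> (LINT \<omega>|torus_measure. (2 * hmean p P 0) powr (1/p))"
      by (rule integral_mono[OF integrable_norm[OF i]]) (auto simp: norm_mult cmod_torus_char bd)
    finally show ?thesis .
  qed
  also have "\<dots> = (2 * hmean p P 0) powr (1/p)" by (simp add: torus.prob_space)
  finally have "cmod (P n * of_nat n powr (- 2)) \<le> (2 * hmean p P 0) powr (1/p)" unfolding eq .
  then have "cmod (P n) * (1 / real n ^ 2) \<le> (2 * hmean p P 0) powr (1/p)"
    using n by (simp add: norm_mult norm_divide norm_power norm_powr_real_powr powr_minus_divide powr_numeral)
  then show ?thesis using n by (simp add: field_simps)
qed auto

section \<open>Means on vertical lines: a three lines theorem and total boundedness\<close>

lemma powr_add_le:
  fixes a b p :: real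
  assumes "0 \<le> a" "0 \<le> b" "0 < p"
  shows "(a + b) powr p \<le> 2 powr p * (a powr p + b powr p)"
proof -
  have "(a + b) powr p \<le> (2 * max a b) powr p" using assms by (intro powr_mono2) auto
  also have "\<dots> = 2 powr p * max a b powr p" using assms by (simp add: powr_mult)
  also have "\<dots> \<le> 2 powr p * (a powr p + b powr p)" by (intro mult_left_mono) (auto simp: max_def)
  finally show ?thesis .
qed

lemma hmean_diff_le:
  assumes P: "P \<in> dirichlet_polys" "Q \<in> dirichlet_polys" and p: "0 < p" and \<sigma>: "0 \<le> \<sigma>"
  shows "hmean p (\<lambda>n. P n - Q n) \<sigma> \<le> 2 powr p * (hmean p P \<sigma> + hmean p Q \<sigma>)"
proof -
  note i = dpoly_integrable[OF _ less_imp_le[OF p], of _ "of_real \<sigma>"]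
  have "hmean p (\<lambda>n. P n - Q n) \<sigma> \<le> (LINT \<omega>|torus_measure. 2 powr p * (cmod (dpoly P \<omega> (of_real \<sigma>)) powr p + cmod (dpoly Q \<omega> (of_real \<sigma>)) powr p))"
    unfolding hmean_def
  proof (rule integral_mono)
    show "integrable torus_measure (\<lambda>\<omega>. cmod (dpoly (\<lambda>n. P n - Q n) \<omega> (of_real \<sigma>)) powr p)"
      using i[OF dirichlet_polys_diff[OF P]] \<sigma> by simp
    show "integrable torus_measure (\<lambda>\<omega>. 2 powr p * (cmod (dpoly P \<omega> (of_real \<sigma>)) powr p + cmod (dpoly Q \<omega> (of_real \<sigma>)) powr p))"
      using i[OF P(1)] i[OF P(2)] \<sigma> by simp
    fix \<omega>
    have "cmod (dpoly (\<lambda>n. P n - Q n) \<omega> (of_real \<sigma>)) powr p \<le> (cmod (dpoly P \<omega> (of_real \<sigma>)) + cmod (dpoly Q \<omega> (of_real \<sigma>))) powr p"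
      unfolding dpoly_diff[OF P] using p by (intro powr_mono2 norm_triangle_ineq4) auto
    also have "\<dots> \<le> 2 powr p * (cmod (dpoly P \<omega> (of_real \<sigma>)) powr p + cmod (dpoly Q \<omega> (of_real \<sigma>)) powr p)"
      using p by (intro powr_add_le) auto
    finally show "cmod (dpoly (\<lambda>n. P n - Q n) \<omega> (of_real \<sigma>)) powr p \<le> 2 powr p * (cmod (dpoly P \<omega> (of_real \<sigma>)) powr p + cmod (dpoly Q \<omega> (of_real \<sigma>)) powr p)" .
  qed
  also have "\<dots> = 2 powr p * (hmean p P \<sigma> + hmean p Q \<sigma>)"
    unfolding hmean_def using i[OF P(1)] i[OF P(2)] \<sigma> by simp
  finally show ?thesis .
qed

lemma hmean_continuous:
  assumes P: "P \<in> dirichlet_polys" and p: "0 < p"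
  shows "continuous_on {0..} (hmean p P)"
  unfolding continuous_on_sequentially o_def
proof (intro allI ballI impI, elim conjE)
  fix x :: "nat \<Rightarrow> real" and a assume x: "a \<in> {0..}" "\<forall>n. x n \<in> {0..}" "x \<longlonglongrightarrow> a"
  show "(\<lambda>n. hmean p P (x n)) \<longlonglongrightarrow> hmean p P a"
    unfolding hmean_def
  proof (rule integral_dominated_convergence)
    show "integrable torus_measure (\<lambda>\<omega>. (\<Sum>n | P n \<noteq> 0. cmod (P n)) powr p)" by simp
    show "(\<lambda>\<omega>. cmod (dpoly P \<omega> (of_real a)) powr p) \<in> borel_measurable torus_measure"
      using dpoly_measurable[OF P, of "\<lambda>\<omega>. \<omega>" torus_measure "\<lambda>_. of_real a"] by measurable
    show "(\<lambda>\<omega>. cmod (dpoly P \<omega> (of_real (x n))) powr p) \<in> borel_measurable torus_measure" for n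
      using dpoly_measurable[OF P, of "\<lambda>\<omega>. \<omega>" torus_measure "\<lambda>_. of_real (x n)"] by measurable
    show "AE \<omega> in torus_measure. (\<lambda>n. cmod (dpoly P \<omega> (of_real (x n))) powr p) \<longlonglongrightarrow> cmod (dpoly P \<omega> (of_real a)) powr p"
      using p x(3) by (intro AE_I2 tendsto_powr' tendsto_norm tendsto_const
          continuous_on_tendsto_compose[OF dpoly_continuous[OF P, of UNIV]] tendsto_of_real) auto
    show "AE \<omega> in torus_measure. norm (cmod (dpoly P \<omega> (of_real (x n))) powr p) \<le> (\<Sum>n | P n \<noteq> 0. cmod (P n)) powr p" for n
      using x(2) p by (intro AE_I2) (auto intro!: powr_mono2 dpoly_bound[OF P])
  qed
qed

text \<open>Multiplying a vertical limit by the exponential of \<open>L * s / p\<close> multiplies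
  the p-th power of its modulus by \<open>exp (L * \<sigma>)\<close>. The circle inequality for this
  product, integrated over the torus, depends on real parts alone. The free rate \<open>L\<close>
  prepares a three lines argument.\<close>

lemma hmean_exp_submean:
  fixes L :: real
  assumes P: "P \<in> dirichlet_polys" and p: "0 < p" and \<rho>: "0 < \<rho>" "\<rho> \<le> \<sigma>"
  defines "V \<equiv> \<lambda>\<sigma>. exp (L * \<sigma>) * hmean p P \<sigma>"
  shows "V \<sigma> \<le> integral {0..1} (\<lambda>t. V (\<sigma> + \<rho> * cos (2*pi*t)))"
proof -
  define F where "F = (\<lambda>\<omega> w. exp (of_real (L / p) * (of_real \<sigma> + of_real \<rho> * w)) * dpoly P \<omega> (of_real \<sigma> + of_real \<rho> * w))"
  have hol: "F \<omega> holomorphic_on A" for \<omega> A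
    unfolding F_def by (intro holomorphic_intros holomorphic_on_compose_gen[OF _ dpoly_holomorphic[OF P, of _ UNIV], unfolded o_def]) auto
  have cont: "continuous_on A (F \<omega>)" for \<omega> A by (rule holomorphic_on_imp_continuous_on[OF hol])
  have Fn: "cmod (F \<omega> w) powr p = exp (L * (\<sigma> + \<rho> * Re w)) * cmod (dpoly P \<omega> (of_real \<sigma> + of_real \<rho> * w)) powr p" for \<omega> w
  proof -
    have "exp (L / p * (\<sigma> + \<rho> * Re w)) powr p = exp (L * (\<sigma> + \<rho> * Re w))" using p by (simp add: powr_def)
    then show ?thesis by (simp add: F_def norm_mult powr_mult)
  qed
  have Re_w: "0 \<le> \<sigma> + \<rho> * Re w" if "cmod w \<le> 1" for w
  proof -
    have "\<bar>\<rho> * Re w\<bar> \<le> \<rho> * 1" unfolding abs_mult using \<rho> that abs_Re_le_cmod[of w] by (intro mult_mono) auto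
    then show ?thesis using \<rho> by linarith
  qed
  have int: "(\<integral>\<^sup>+\<omega>. ennreal (cmod (F \<omega> w) powr p) \<partial>torus_measure) = ennreal (V (\<sigma> + \<rho> * Re w))" if w: "cmod w \<le> 1" for w
  proof -
    have [measurable]: "(\<lambda>\<omega>. dpoly P \<omega> (of_real \<sigma> + of_real \<rho> * w)) \<in> borel_measurable torus_measure"
      using dpoly_measurable[OF P, of "\<lambda>\<omega>. \<omega>" torus_measure "\<lambda>_. of_real \<sigma> + of_real \<rho> * w"] by simp
    have "(\<integral>\<^sup>+\<omega>. ennreal (cmod (F \<omega> w) powr p) \<partial>torus_measure) =
      ennreal (exp (L * (\<sigma> + \<rho> * Re w))) * (\<integral>\<^sup>+\<omega>. ennreal (cmod (dpoly P \<omega> (of_real \<sigma> + of_real \<rho> * w)) powr p) \<partial>torus_measure)"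
      unfolding Fn by (subst nn_integral_cmult[symmetric]) (auto simp: ennreal_mult)
    also have "\<dots> = ennreal (exp (L * (\<sigma> + \<rho> * Re w))) * ennreal (hmean p P (\<sigma> + \<rho> * Re w))"
      using nn_integral_dpoly[OF P p, of "of_real \<sigma> + of_real \<rho> * w"] Re_w[OF w] by simp
    finally show ?thesis by (simp add: V_def ennreal_mult hmean_nonneg[OF P])
  qed
  interpret PS: pair_sigma_finite torus_measure circle_measure ..
  have "ennreal (V \<sigma>) = (\<integral>\<^sup>+\<omega>. ennreal (cmod (F \<omega> 0) powr p) \<partial>torus_measure)"
    using int[of 0] by simp
  also have "\<dots> \<le> (\<integral>\<^sup>+\<omega>. (\<integral>\<^sup>+z. ennreal (cmod (F \<omega> z) powr p) \<partial>circle_measure) \<partial>torus_measure)"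
  proof (rule nn_integral_mono)
    fix \<omega>
    have "(1 - cmod 0) * cmod (F \<omega> 0) powr p \<le> integral {0..1} (\<lambda>t. cmod (F \<omega> (cis (2*pi*t))) powr p)"
      by (rule circle_submean[OF hol, of 2]) (use p in auto)
    then have "ennreal (cmod (F \<omega> 0) powr p) \<le> ennreal (integral {0..1} (\<lambda>t. cmod (F \<omega> (cis (2*pi*t))) powr p))"
      by (intro ennreal_leI) simp
    also have "\<dots> = (\<integral>\<^sup>+z. ennreal (cmod (F \<omega> z) powr p) \<partial>circle_measure)"
      using p by (intro integral_circle continuous_on_powr' continuous_intros cont) auto
    finally show "ennreal (cmod (F \<omega> 0) powr p) \<le> (\<integral>\<^sup>+z. ennreal (cmod (F \<omega> z) powr p) \<partial>circle_measure)" .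
  qed
  also have "\<dots> = (\<integral>\<^sup>+z. (\<integral>\<^sup>+\<omega>. ennreal (cmod (F \<omega> z) powr p) \<partial>torus_measure) \<partial>circle_measure)"
  proof (rule PS.Fubini'[symmetric])
    have c: "(\<lambda>x. snd x) \<in> borel_measurable (torus_measure \<Otimes>\<^sub>M circle_measure)"
      using measurable_compose[OF measurable_snd circle_borel] .
    have [measurable]: "(\<lambda>x. dpoly P (fst x) (of_real \<sigma> + of_real \<rho> * snd x)) \<in> borel_measurable (torus_measure \<Otimes>\<^sub>M circle_measure)"
      using c by (intro dpoly_measurable[OF P]) auto
    have "(\<lambda>x. Re (snd x)) \<in> borel_measurable (torus_measure \<Otimes>\<^sub>M circle_measure)"
      using measurable_compose[OF c borel_measurable_Re] by simp
    note [measurable] = this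
    show "(\<lambda>(\<omega>, z). ennreal (cmod (F \<omega> z) powr p)) \<in> borel_measurable (torus_measure \<Otimes>\<^sub>M circle_measure)"
      unfolding Fn case_prod_unfold by measurable
  qed
  also have "\<dots> = (\<integral>\<^sup>+z. ennreal (V (\<sigma> + \<rho> * Re z)) \<partial>circle_measure)"
    by (intro nn_integral_cong int) (simp add: space_circle)
  also have "\<dots> = ennreal (integral {0..1} (\<lambda>t. V (\<sigma> + \<rho> * Re (cis (2*pi*t)))))"
  proof (rule integral_circle[symmetric])
    have "continuous_on (sphere 0 1) (\<lambda>z. hmean p P (\<sigma> + \<rho> * Re z))"
      by (rule continuous_on_compose2[OF hmean_continuous[OF P p]]) (auto intro!: continuous_intros Re_w)
    then show "continuous_on (sphere 0 1) (\<lambda>z. V (\<sigma> + \<rho> * Re z))"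
      unfolding V_def by (intro continuous_intros)
    show "0 \<le> V (\<sigma> + \<rho> * Re z)" for z by (simp add: V_def hmean_nonneg[OF P])
  qed
  finally have "ennreal (V \<sigma>) \<le> ennreal (integral {0..1} (\<lambda>t. V (\<sigma> + \<rho> * cos (2*pi*t))))" by simp
  moreover have "0 \<le> integral {0..1} (\<lambda>t. V (\<sigma> + \<rho> * cos (2*pi*t)))"
  proof (rule Henstock_Kurzweil_Integration.integral_nonneg)
    have "continuous_on {0..1} (\<lambda>t. hmean p P (\<sigma> + \<rho> * Re (cis (2*pi*t))))"
      by (rule continuous_on_compose2[OF hmean_continuous[OF P p]]) (auto intro!: continuous_intros simp del: cis.sel intro: Re_w)
    then show "(\<lambda>t. V (\<sigma> + \<rho> * cos (2*pi*t))) integrable_on {0..1}"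
      unfolding V_def by (intro integrable_continuous_real continuous_intros) simp
  qed (simp add: V_def hmean_nonneg[OF P])
  ultimately show ?thesis by (subst (asm) ennreal_le_iff)
qed

text \<open>The rightmost point \<open>s\<close> at which the maximum is attained cannot be
  interior: equality in the mean inequality would force the maximal value on the whole circle around
  it, in particular at \<open>s + \<rho>\<close>.\<close>

lemma submean_maximum_principle:
  fixes V :: "real \<Rightarrow> real"
  assumes cont: "continuous_on {0..b} V" and b: "0 < b"
    and sub: "\<And>\<sigma> \<rho>. 0 < \<rho> \<Longrightarrow> \<rho> \<le> \<sigma> \<Longrightarrow> \<sigma> + \<rho> \<le> b \<Longrightarrow> V \<sigma> \<le> integral {0..1} (\<lambda>t. V (\<sigma> + \<rho> * cos (2*pi*t)))"
    and x: "x \<in> {0..b}"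
  shows "V x \<le> max (V 0) (V b)"
proof -
  obtain m where m: "m \<in> {0..b}" "\<And>y. y \<in> {0..b} \<Longrightarrow> V y \<le> V m"
    using continuous_attains_sup[OF compact_Icc _ cont] b by auto
  define S where "S = {y \<in> {0..b}. V y = V m}"
  have "closed S" unfolding S_def using cont by (rule continuous_closed_preimage_constant) simp
  moreover have S: "S \<noteq> {}" "bdd_above S" "bounded S" using m by (auto simp: S_def bdd_above_def intro: bounded_subset[of "{0..b}"])
  ultimately have "Sup S \<in> S" by (intro closed_contains_Sup)
  define s where "s = Sup S"
  have s: "s \<in> {0..b}" "V s = V m" using \<open>Sup S \<in> S\<close> by (auto simp: S_def s_def)
  have s_max: "y \<le> s" if "y \<in> {0..b}" "V y = V m" for y
    unfolding s_def using that S by (intro cSup_upper) (auto simp: S_def)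
  have "s = 0 \<or> s = b"
  proof (rule ccontr)
    assume "\<not> (s = 0 \<or> s = b)"
    then have s': "0 < s" "s < b" using s by auto
    define \<rho> where "\<rho> = min s (b - s)"
    have \<rho>: "0 < \<rho>" "\<rho> \<le> s" "s + \<rho> \<le> b" using s' by (auto simp: \<rho>_def)
    have inn: "s + \<rho> * cos (2*pi*t) \<in> {0..b}" for t
    proof -
      have "\<bar>\<rho> * cos (2*pi*t)\<bar> \<le> \<rho> * 1" unfolding abs_mult using \<rho> by (intro mult_mono) auto
      then show ?thesis using \<rho> by auto
    qed
    have c: "continuous_on {0..1} (\<lambda>t. V (s + \<rho> * cos (2*pi*t)))"
      by (rule continuous_on_compose2[OF cont]) (use inn in \<open>auto intro!: continuous_intros\<close>)
    have "integral {0..1} (\<lambda>t. V m - V (s + \<rho> * cos (2*pi*t))) = V m - integral {0..1} (\<lambda>t. V (s + \<rho> * cos (2*pi*t)))"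
      using integrable_continuous_real[OF c] by (subst Henstock_Kurzweil_Integration.integral_diff) auto
    also have "\<dots> \<le> 0" using sub[OF \<rho>] s by simp
    finally have le: "integral {0..1} (\<lambda>t. V m - V (s + \<rho> * cos (2*pi*t))) \<le> 0" .
    have nn: "0 \<le> V m - V (s + \<rho> * cos (2*pi*t))" for t using m(2)[OF inn[of t]] by simp
    have c': "continuous_on {0..1} (\<lambda>t. V m - V (s + \<rho> * cos (2*pi*t)))" by (intro continuous_intros c)
    have "integral {0..1} (\<lambda>t. V m - V (s + \<rho> * cos (2*pi*t))) = 0"
      using le Henstock_Kurzweil_Integration.integral_nonneg[OF integrable_continuous_real[OF c']] nn by (intro antisym) auto
    then have "\<forall>t\<in>{0..1}. V m - V (s + \<rho> * cos (2*pi*t)) = 0"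
      using integral_eq_0_iff[OF c'] nn by auto
    then have "V (s + \<rho>) = V m" by (auto dest: bspec[of _ _ 0])
    then have "s + \<rho> \<le> s" using s_max[of "s + \<rho>"] \<rho> by auto
    then show False using \<rho> by simp
  qed
  then show ?thesis using m(2)[OF x] s by auto
qed

text \<open>The maximum principle for the exponentially weighted mean: a three lines theorem in
  which the rate \<open>L\<close> is left free instead of being optimized.\<close>

lemma hmean_three_lines:
  assumes P: "P \<in> dirichlet_polys" and p: "0 < p" and b: "0 < b" and x: "x \<in> {0..b}"
  shows "exp (L * x) * hmean p P x \<le> max (hmean p P 0) (exp (L * b) * hmean p P b)"
proof -
  have "continuous_on {0..b} (hmean p P)" by (rule continuous_on_subset[OF hmean_continuous[OF P p]]) auto
  then have "continuous_on {0..b} (\<lambda>\<sigma>. exp (L * \<sigma>) * hmean p P \<sigma>)" by (intro continuous_intros)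
  from submean_maximum_principle[OF this b _ x] hmean_exp_submean[OF P p]
  show ?thesis by simp
qed

lemma sum_inverse_squares_le:
  assumes "finite S" shows "(\<Sum>n\<in>S. 1 / real n ^ 2) \<le> (\<Sum>n. 1 / real n ^ 2)"
  by (rule sum_le_suminf) (use assms inverse_power_summable[of 2, where 'a=real] in \<open>auto simp: divide_inverse power_inverse\<close>)

text \<open>On a line far to the right the polynomial is small: low coefficients are at most
  \<open>\<eta>\<close> and the others obey \<open>coefficient_bound\<close>. The three lines
  theorem carries this back to the line \<open>\<delta>\<close>. The numbers \<open>N\<close> and
  \<open>\<eta>\<close> depend on the bound \<open>R\<close> but not on the polynomial.\<close>

lemma hmean_small:
  assumes p: "0 < p" and \<delta>: "0 < \<delta>" and \<epsilon>: "0 < \<epsilon>" and R: "0 \<le> R"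
  obtains N \<eta> where "0 < \<eta>" "\<And>D. D \<in> dirichlet_polys \<Longrightarrow> hmean p D 0 \<le> R \<Longrightarrow> (\<And>n. n \<le> N \<Longrightarrow> cmod (D n) \<le> \<eta>) \<Longrightarrow> hmean p D \<delta> \<le> \<epsilon>"
proof -
  \<comment> \<open>The 5 leaves decay n^(-3) after the growth n^2 of the coefficients: two powers
    for summation, one to make the tail beyond \<open>N\<close> small.\<close>
  define b where "b = \<delta> + 5"
  \<comment> \<open>With this rate \<open>exp (L * \<delta>)\<close> is at least
    \<open>R / \<epsilon>\<close>, which damps the contribution of the boundary line to
    \<open>\<epsilon>\<close>.\<close>
  define L where "L = R / \<epsilon> / \<delta>"
  have "R / \<epsilon> \<le> exp (R / \<epsilon>)" using exp_ge_add_one_self[of "R / \<epsilon>"] by linarith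
  then have R_le: "R \<le> \<epsilon> * exp (L * \<delta>)" using \<delta> \<epsilon> by (simp add: L_def field_simps)
  \<comment> \<open>The size on the line \<open>b\<close> that the quotient of the exponential
    weights turns into \<open>\<epsilon>\<close> on the line \<open>\<delta>\<close>.\<close>
  define \<kappa> where "\<kappa> = \<epsilon> * exp (L * \<delta>) / exp (L * b)"
  have \<kappa>: "0 < \<kappa>" using \<epsilon> by (simp add: \<kappa>_def)
  define Z where "Z = (\<Sum>n. 1 / real n ^ 2) + 1"
  have Z: "0 < Z" unfolding Z_def using sum_inverse_squares_le[of "{}"] by simp
  define K where "K = (2 * R) powr (1/p)"
  have K: "0 \<le> K" by (simp add: K_def)
  define \<eta> where "\<eta> = \<kappa> powr (1/p) / (2 * Z)"
  have \<eta>: "0 < \<eta>" using \<kappa> Z by (simp add: \<eta>_def)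
  obtain N :: nat where N: "K / \<eta> \<le> N" using real_arch_simple by blast
  show ?thesis
  proof (rule that[of \<eta> N])
    fix D assume D: "D \<in> dirichlet_polys" "hmean p D 0 \<le> R" and small: "\<And>n. n \<le> N \<Longrightarrow> cmod (D n) \<le> \<eta>"
    have coef: "cmod (D n) * real n powr (-b) \<le> 2 * \<eta> * (1 / real n ^ 2)" if "D n \<noteq> 0" for n
    proof -
      have n: "1 \<le> real n" using support(2)[OF D(1) that] by (auto simp: Suc_le_eq)
      show ?thesis
      proof (cases "n \<le> N")
        case True
        have "real n powr (-b) \<le> real n powr (-2)" using n \<delta> by (intro powr_mono) (auto simp: b_def)
        then have "real n powr (-b) \<le> 1 / real n ^ 2" using n by (simp add: powr_minus_divide powr_numeral)
        then have "cmod (D n) * real n powr (-b) \<le> \<eta> * (1 / real n ^ 2)"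
          using small[OF True] \<eta> by (intro mult_mono) auto
        also have "\<dots> \<le> 2 * \<eta> * (1 / real n ^ 2)" using \<eta> by (intro mult_right_mono) auto
        finally show ?thesis .
      next
        case False
        have "cmod (D n) \<le> (2 * hmean p D 0) powr (1/p) * real n ^ 2" by (rule coefficient_bound[OF D(1) p])
        also have "\<dots> \<le> K * real n ^ 2" unfolding K_def
          using D hmean_nonneg[OF D(1), of p 0] p by (intro mult_right_mono powr_mono2) auto
        finally have 1: "cmod (D n) \<le> K * real n ^ 2" .
        have "real n powr (-b) \<le> real n powr (-5)" using n \<delta> by (intro powr_mono) (auto simp: b_def)
        then have 2: "real n powr (-b) \<le> 1 / real n ^ 5" using n by (simp add: powr_minus_divide powr_numeral)
        have "cmod (D n) * real n powr (-b) \<le> (K * real n ^ 2) * (1 / real n ^ 5)"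
          using 1 2 K by (intro mult_mono) auto
        also have "\<dots> = (K / real n) * (1 / real n ^ 2)" using n by (simp add: field_simps eval_nat_numeral)
        also have "\<dots> \<le> \<eta> * (1 / real n ^ 2)"
        proof (rule mult_right_mono)
          have "K / \<eta> \<le> real n" using N False by linarith
          then show "K / real n \<le> \<eta>" using \<eta> n by (simp add: field_simps)
        qed simp
        also have "\<dots> \<le> 2 * \<eta> * (1 / real n ^ 2)" using \<eta> by (intro mult_right_mono) auto
        finally show ?thesis .
      qed
    qed
    have pt: "cmod (dpoly D \<omega> (of_real b)) \<le> \<kappa> powr (1/p)" if \<omega>: "\<omega> \<in> space torus_measure" for \<omega>
    proof -
      have "cmod (dpoly D \<omega> (of_real b)) \<le> (\<Sum>n | D n \<noteq> 0. 2 * \<eta> * (1 / real n ^ 2))"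
        unfolding dpoly_eq[OF D(1)]
        by (rule sum_norm_le) (use coef in \<open>auto simp: norm_mult cmod_torus_char[OF \<omega>] norm_powr_real_powr\<close>)
      also have "\<dots> = 2 * \<eta> * (\<Sum>n | D n \<noteq> 0. 1 / real n ^ 2)" by (simp add: sum_distrib_left)
      also have "\<dots> \<le> 2 * \<eta> * Z" unfolding Z_def
        using sum_inverse_squares_le[OF support(1)[OF D(1)]] \<eta> by (intro mult_left_mono) auto
      also have "\<dots> = \<kappa> powr (1/p)" using Z by (simp add: \<eta>_def)
      finally show ?thesis .
    qed
    have "hmean p D b \<le> (LINT \<omega>|torus_measure. \<kappa>)"
      unfolding hmean_def
    proof (rule integral_mono)
      show "integrable torus_measure (\<lambda>\<omega>. cmod (dpoly D \<omega> (of_real b)) powr p)"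
        using p \<delta> by (intro dpoly_integrable[OF D(1)]) (auto simp: b_def)
      fix \<omega> assume "\<omega> \<in> space torus_measure"
      then have "cmod (dpoly D \<omega> (of_real b)) powr p \<le> (\<kappa> powr (1/p)) powr p"
        using p pt by (intro powr_mono2) auto
      then show "cmod (dpoly D \<omega> (of_real b)) powr p \<le> \<kappa>" using p \<kappa> by (simp add: powr_powr)
    qed simp
    then have "hmean p D b \<le> \<kappa>" by (simp add: torus.prob_space)
    then have "exp (L * b) * hmean p D b \<le> exp (L * b) * \<kappa>" by (intro mult_left_mono) auto
    also have "\<dots> = \<epsilon> * exp (L * \<delta>)" by (simp add: \<kappa>_def)
    finally have "exp (L * b) * hmean p D b \<le> \<epsilon> * exp (L * \<delta>)" .
    moreover have "exp (L * \<delta>) * hmean p D \<delta> \<le> max (hmean p D 0) (exp (L * b) * hmean p D b)"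
      using \<delta> by (intro hmean_three_lines[OF D(1) p]) (auto simp: b_def)
    moreover have "hmean p D 0 \<le> \<epsilon> * exp (L * \<delta>)" using D(2) R_le by (rule order_trans)
    ultimately have "exp (L * \<delta>) * hmean p D \<delta> \<le> \<epsilon> * exp (L * \<delta>)"
      by (meson max.boundedI order_trans)
    then show "hmean p D \<delta> \<le> \<epsilon>" by (simp add: mult.commute)
  qed (rule \<eta>)
qed

text \<open>
  Montel's theorem: rounding finitely many coefficients gives a finite net for the unit ball with
  respect to the norm on a line inside the half-plane.
\<close>

lemma hmean_finite_net:
  assumes p: "0 < p" and \<delta>: "0 < \<delta>" and \<epsilon>: "0 < \<epsilon>" and R: "0 \<le> R"
  obtains \<Q> where "finite \<Q>" "\<Q> \<subseteq> {P \<in> dirichlet_polys. hmean p P 0 \<le> R}"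
    "\<And>P. P \<in> dirichlet_polys \<Longrightarrow> hmean p P 0 \<le> R \<Longrightarrow> \<exists>Q\<in>\<Q>. hmean p (\<lambda>n. P n - Q n) \<delta> \<le> \<epsilon>"
proof -
  define X where "X = {P \<in> dirichlet_polys. hmean p P 0 \<le> R}"
  obtain N \<eta> where \<eta>: "0 < \<eta>" and small: "\<And>D. D \<in> dirichlet_polys \<Longrightarrow> hmean p D 0 \<le> 2 powr p * (R + R) \<Longrightarrow>
      (\<And>n. n \<le> N \<Longrightarrow> cmod (D n) \<le> \<eta>) \<Longrightarrow> hmean p D \<delta> \<le> \<epsilon>"
  proof -
    have "0 \<le> 2 powr p * (R + R)" using R by simp
    from hmean_small[OF p \<delta> \<epsilon> this] show thesis using that by blast
  qed
  \<comment> \<open>With mesh \<open>\<eta>/2\<close> in both real and imaginary part, coefficients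
    with equal rounding differ by at most \<open>\<eta>\<close>.\<close>
  define r where "r x = \<lfloor>x / (\<eta>/2)\<rfloor>" for x :: real
  define \<phi> where "\<phi> P = (\<lambda>n\<in>{..N}. (r (Re (P n)), r (Im (P n))))" for P :: "nat \<Rightarrow> complex"
  \<comment> \<open>A common bound for the coefficients up to \<open>N\<close> on the whole ball, so
    only finitely many rounding patterns occur.\<close>
  define K where "K = (2 * R) powr (1/p) * real N ^ 2"
  define M where "M = \<lceil>K / (\<eta>/2)\<rceil> + 1"
  have r_bound: "r x \<in> {-M..M}" if "\<bar>x\<bar> \<le> K" for x
  proof -
    have "\<bar>x / (\<eta>/2)\<bar> \<le> K / (\<eta>/2)" unfolding abs_divide using that \<eta> by (simp add: divide_right_mono)
    then show ?thesis unfolding r_def M_def atLeastAtMost_iff by linarith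
  qed
  have "\<phi> ` X \<subseteq> (\<Pi>\<^sub>E n\<in>{..N}. {-M..M} \<times> {-M..M})"
  proof
    fix y assume "y \<in> \<phi> ` X"
    then obtain P where P: "P \<in> dirichlet_polys" "hmean p P 0 \<le> R" "y = \<phi> P" by (auto simp: X_def)
    have "cmod (P n) \<le> K" if "n \<le> N" for n
    proof -
      have "cmod (P n) \<le> (2 * hmean p P 0) powr (1/p) * real n ^ 2" by (rule coefficient_bound[OF P(1) p])
      also have "\<dots> \<le> K" unfolding K_def
        using P hmean_nonneg[OF P(1), of p 0] p that by (intro mult_mono powr_mono2 power_mono) auto
      finally show ?thesis .
    qed
    then have "\<bar>Re (P n)\<bar> \<le> K" "\<bar>Im (P n)\<bar> \<le> K" if "n \<le> N" for n
      using that abs_Re_le_cmod[of "P n"] abs_Im_le_cmod[of "P n"] order_trans by blast+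
    then show "y \<in> (\<Pi>\<^sub>E n\<in>{..N}. {-M..M} \<times> {-M..M})"
      unfolding P(3) \<phi>_def using r_bound by auto
  qed
  moreover have "finite (\<Pi>\<^sub>E n\<in>{..N}. {-M..M} \<times> {-M..M})" by (intro finite_PiE) auto
  ultimately have "finite (\<phi> ` X)" by (rule finite_subset)
  \<comment> \<open>One representative for each pattern that occurs: the net consists of elements of
    the ball itself.\<close>
  then obtain \<Q> where \<Q>: "\<Q> \<subseteq> X" "finite \<Q>" "\<phi> ` X = \<phi> ` \<Q>"
    using finite_subset_image[of "\<phi> ` X" \<phi> X] by auto
  show ?thesis
  proof (rule that[OF \<Q>(2) \<Q>(1)[unfolded X_def]])
    fix P assume P: "P \<in> dirichlet_polys" "hmean p P 0 \<le> R"
    then have "\<phi> P \<in> \<phi> ` \<Q>" using \<Q>(3) by (auto simp: X_def)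
    then obtain Q where Q: "Q \<in> \<Q>" "\<phi> P = \<phi> Q" by auto
    have Q': "Q \<in> dirichlet_polys" "hmean p Q 0 \<le> R" using Q \<Q>(1) by (auto simp: X_def)
    have r_close: "\<bar>x - y\<bar> \<le> \<eta>/2" if "r x = r y" for x y
    proof -
      have "\<bar>x / (\<eta>/2) - y / (\<eta>/2)\<bar> \<le> 1" using that unfolding r_def by linarith
      then have "\<bar>(x - y) / (\<eta>/2)\<bar> \<le> 1" by (simp only: diff_divide_distrib)
      then have "\<bar>x - y\<bar> / (\<eta>/2) \<le> 1" using \<eta> unfolding abs_divide by simp
      then show ?thesis using \<eta> by (subst (asm) pos_divide_le_eq) auto
    qed
    have "cmod (P n - Q n) \<le> \<eta>" if "n \<le> N" for n
    proof -
      have "\<phi> P n = \<phi> Q n" using Q by simp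
      then have "r (Re (P n)) = r (Re (Q n))" "r (Im (P n)) = r (Im (Q n))" using that by (auto simp: \<phi>_def)
      then have "\<bar>Re (P n - Q n)\<bar> \<le> \<eta>/2" "\<bar>Im (P n - Q n)\<bar> \<le> \<eta>/2" using r_close by auto
      then show ?thesis using cmod_le[of "P n - Q n"] by linarith
    qed
    moreover have "hmean p (\<lambda>n. P n - Q n) 0 \<le> 2 powr p * (R + R)"
    proof -
      have "hmean p (\<lambda>n. P n - Q n) 0 \<le> 2 powr p * (hmean p P 0 + hmean p Q 0)"
        by (rule hmean_diff_le[OF P(1) Q'(1) p]) simp
      also have "\<dots> \<le> 2 powr p * (R + R)" using P Q' by (intro mult_left_mono add_mono) auto
      finally show ?thesis .
    qed
    ultimately have "hmean p (\<lambda>n. P n - Q n) \<delta> \<le> \<epsilon>"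
      by (intro small dirichlet_polys_diff[OF P(1) Q'(1)])
    then show "\<exists>Q\<in>\<Q>. hmean p (\<lambda>n. P n - Q n) \<delta> \<le> \<epsilon>" using Q by blast
  qed
qed


section \<open>A maximal function for the Kronecker flow\<close>

definition flow_avg :: "real \<Rightarrow> ((nat \<Rightarrow> complex) \<Rightarrow> ennreal) \<Rightarrow> (nat \<Rightarrow> complex) \<Rightarrow> ennreal" where
  "flow_avg \<sigma> F \<omega> = (\<integral>\<^sup>+x. ennreal (poisson \<sigma> x) * F (shift (\<i> * of_real x) \<omega>) \<partial>lborel)"

interpretation torus_line: pair_sigma_finite torus_measure "lborel :: real measure" ..
interpretation line_torus: pair_sigma_finite "lborel :: real measure" torus_measure ..

lemma nn_integral_poisson': "0 < \<sigma> \<Longrightarrow> (\<integral>\<^sup>+x. ennreal (poisson \<sigma> x) \<partial>lborel) = 1"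
  using nn_integral_poisson[of \<sigma> 0] by simp

lemma flow_measurable [measurable]:
  assumes F: "F \<in> borel_measurable torus_measure" and [measurable]: "f \<in> M \<rightarrow>\<^sub>M torus_measure" "t \<in> borel_measurable M"
  shows "(\<lambda>x. F (shift (\<i> * of_real (t x)) (f x))) \<in> borel_measurable M"
  by (rule measurable_compose[OF shift_measurable F]) measurable

lemma flow_avg_measurable [measurable]:
  assumes [measurable]: "F \<in> borel_measurable torus_measure"
  shows "flow_avg \<sigma> F \<in> borel_measurable torus_measure"
  unfolding flow_avg_def[abs_def] by measurable

lemma flow_avg_sum:
  assumes "\<And>i. i \<in> I \<Longrightarrow> F i \<in> borel_measurable torus_measure" "\<omega> \<in> space torus_measure"
  shows "flow_avg \<sigma> (\<lambda>\<omega>. \<Sum>i\<in>I. F i \<omega>) \<omega> = (\<Sum>i\<in>I. flow_avg \<sigma> (F i) \<omega>)"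
proof -
  have m: "(\<lambda>x. F i (shift (\<i> * of_real x) \<omega>)) \<in> borel_measurable lborel" if "i \<in> I" for i
    using assms(1)[OF that] by (rule flow_measurable) (use assms(2) in auto)
  show ?thesis unfolding flow_avg_def sum_distrib_left
    by (rule nn_integral_sum) (use m in auto)
qed

lemma nn_integral_flow_avg:
  assumes F [measurable]: "F \<in> borel_measurable torus_measure" and \<sigma>: "0 < \<sigma>"
  shows "(\<integral>\<^sup>+\<omega>. flow_avg \<sigma> F \<omega> \<partial>torus_measure) = (\<integral>\<^sup>+\<omega>. F \<omega> \<partial>torus_measure)"
proof -
  have "(\<integral>\<^sup>+\<omega>. flow_avg \<sigma> F \<omega> \<partial>torus_measure) = (\<integral>\<^sup>+x. (\<integral>\<^sup>+\<omega>. ennreal (poisson \<sigma> x) * F (shift (\<i> * of_real x) \<omega>) \<partial>torus_measure) \<partial>lborel)"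
    unfolding flow_avg_def by (rule torus_line.Fubini'[symmetric]) measurable
  also have "\<dots> = (\<integral>\<^sup>+x. ennreal (poisson \<sigma> x) * (\<integral>\<^sup>+\<omega>. F \<omega> \<partial>torus_measure) \<partial>lborel)"
    by (intro nn_integral_cong) (simp add: nn_integral_cmult nn_integral_torus_shift[OF F])
  also have "\<dots> = (\<integral>\<^sup>+\<omega>. F \<omega> \<partial>torus_measure)"
    by (simp add: nn_integral_multc nn_integral_poisson'[OF \<sigma>])
  finally show ?thesis .
qed

text \<open>The flow preserves the measure, so a shift by \<open>x\<close> of one factor is a shift
  by \<open>- x\<close> of the other, and the Poisson kernel is even.\<close>

lemma flow_avg_selfadjoint:
  assumes F [measurable]: "F \<in> borel_measurable torus_measure" and G [measurable]: "G \<in> borel_measurable torus_measure"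
  shows "(\<integral>\<^sup>+\<omega>. G \<omega> * flow_avg \<sigma> F \<omega> \<partial>torus_measure) = (\<integral>\<^sup>+\<omega>. F \<omega> * flow_avg \<sigma> G \<omega> \<partial>torus_measure)"
proof -
  have expand: "(\<integral>\<^sup>+\<omega>. G \<omega> * flow_avg \<sigma> F \<omega> \<partial>torus_measure) =
      (\<integral>\<^sup>+x. ennreal (poisson \<sigma> x) * (\<integral>\<^sup>+\<omega>. G \<omega> * F (shift (\<i> * of_real x) \<omega>) \<partial>torus_measure) \<partial>lborel)"
    if [measurable]: "F \<in> borel_measurable torus_measure" "G \<in> borel_measurable torus_measure" for F G
  proof -
    have "(\<integral>\<^sup>+\<omega>. G \<omega> * flow_avg \<sigma> F \<omega> \<partial>torus_measure) =
      (\<integral>\<^sup>+\<omega>. (\<integral>\<^sup>+x. ennreal (poisson \<sigma> x) * (G \<omega> * F (shift (\<i> * of_real x) \<omega>)) \<partial>lborel) \<partial>torus_measure)"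
      unfolding flow_avg_def
    proof (rule nn_integral_cong)
      fix \<omega> assume \<omega>: "\<omega> \<in> space torus_measure"
      have "(\<lambda>x. F (shift (\<i> * of_real x) \<omega>)) \<in> borel_measurable lborel"
        by (rule flow_measurable) (use \<omega> in auto)
      then have "(\<lambda>x. ennreal (poisson \<sigma> x) * F (shift (\<i> * of_real x) \<omega>)) \<in> borel_measurable lborel" by measurable
      from nn_integral_cmult[OF this, of "G \<omega>", symmetric]
      show "G \<omega> * (\<integral>\<^sup>+x. ennreal (poisson \<sigma> x) * F (shift (\<i> * of_real x) \<omega>) \<partial>lborel) =
        (\<integral>\<^sup>+x. ennreal (poisson \<sigma> x) * (G \<omega> * F (shift (\<i> * of_real x) \<omega>)) \<partial>lborel)"
        by (simp add: mult_ac)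
    qed
    also have "\<dots> = (\<integral>\<^sup>+x. (\<integral>\<^sup>+\<omega>. ennreal (poisson \<sigma> x) * (G \<omega> * F (shift (\<i> * of_real x) \<omega>)) \<partial>torus_measure) \<partial>lborel)"
      by (rule torus_line.Fubini'[symmetric]) measurable
    also have "\<dots> = (\<integral>\<^sup>+x. ennreal (poisson \<sigma> x) * (\<integral>\<^sup>+\<omega>. G \<omega> * F (shift (\<i> * of_real x) \<omega>) \<partial>torus_measure) \<partial>lborel)"
      by (intro nn_integral_cong nn_integral_cmult) measurable
    finally show ?thesis .
  qed
  have flip: "(\<integral>\<^sup>+\<omega>. G \<omega> * F (shift (\<i> * of_real x) \<omega>) \<partial>torus_measure) = (\<integral>\<^sup>+\<omega>. F \<omega> * G (shift (\<i> * of_real (- x)) \<omega>) \<partial>torus_measure)" for x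
  proof -
    have m: "(\<lambda>\<omega>. F \<omega> * G (shift (\<i> * of_real (- x)) \<omega>)) \<in> borel_measurable torus_measure" by measurable
    have "shift (\<i> * of_real (- x)) (shift (\<i> * of_real x) \<omega>) = \<omega>" for \<omega>
      by (simp add: shift_add[symmetric])
    then show ?thesis
      using nn_integral_torus_shift[OF m, of x] by (simp add: mult.commute)
  qed
  have "(\<integral>\<^sup>+\<omega>. G \<omega> * flow_avg \<sigma> F \<omega> \<partial>torus_measure) =
    (\<integral>\<^sup>+x. ennreal (poisson \<sigma> x) * (\<integral>\<^sup>+\<omega>. F \<omega> * G (shift (\<i> * of_real (- x)) \<omega>) \<partial>torus_measure) \<partial>lborel)"
    unfolding expand[OF F G] flip ..
  also have "\<dots> = (\<integral>\<^sup>+x. ennreal (poisson \<sigma> (- x)) * (\<integral>\<^sup>+\<omega>. F \<omega> * G (shift (\<i> * of_real (- (- x))) \<omega>) \<partial>torus_measure) \<partial>lborel)"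
  proof -
    have "(\<lambda>x. ennreal (poisson \<sigma> x) * (\<integral>\<^sup>+\<omega>. F \<omega> * G (shift (\<i> * of_real (- x)) \<omega>) \<partial>torus_measure)) \<in> borel_measurable borel"
    proof -
      have "(\<lambda>x. \<integral>\<^sup>+\<omega>. F \<omega> * G (shift (\<i> * of_real (- x)) \<omega>) \<partial>torus_measure) \<in> borel_measurable (borel :: real measure)"
        by (rule torus.borel_measurable_nn_integral) measurable
      then show ?thesis by measurable
    qed
    from nn_integral_real_affine[OF this, of "-1" 0] show ?thesis by simp
  qed
  also have "\<dots> = (\<integral>\<^sup>+\<omega>. F \<omega> * flow_avg \<sigma> G \<omega> \<partial>torus_measure)"
    unfolding expand[OF G F] by simp
  finally show ?thesis .
qed

lemma poisson_half: "0 < \<sigma> \<Longrightarrow> \<bar>z\<bar> \<le> 2 * \<bar>x\<bar> \<Longrightarrow> poisson \<sigma> x \<le> 4 * poisson \<sigma> z"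
proof -
  assume \<sigma>: "0 < \<sigma>" and z: "\<bar>z\<bar> \<le> 2 * \<bar>x\<bar>"
  have "\<bar>z\<bar> \<le> \<bar>2 * x\<bar>" using z by simp
  then have "z\<^sup>2 \<le> (2 * x)\<^sup>2" by (simp only: abs_le_square_iff)
  then have "z\<^sup>2 \<le> 4 * x\<^sup>2" by (simp add: power_mult_distrib)
  moreover have "0 \<le> \<sigma>\<^sup>2" by simp
  ultimately have le: "\<sigma>\<^sup>2 + z\<^sup>2 \<le> 4 * (\<sigma>\<^sup>2 + x\<^sup>2)" unfolding distrib_left by linarith
  have le': "pi * (\<sigma>\<^sup>2 + z\<^sup>2) \<le> pi * (\<sigma>\<^sup>2 + x\<^sup>2) * 4"
    using mult_left_mono[OF le, of pi] by (simp only: mult_ac pi_ge_zero)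
  have pos: "0 < \<sigma>\<^sup>2 + z\<^sup>2" "0 < \<sigma>\<^sup>2 + x\<^sup>2"
    using \<sigma> by (auto intro!: add_pos_nonneg)
  have "poisson \<sigma> x / 4 \<le> poisson \<sigma> z"
    unfolding poisson_def divide_divide_eq_left using \<sigma> pos
    by (intro divide_left_mono le' mult_pos_pos) auto
  then show ?thesis by simp
qed

text \<open>One of \<open>\<bar>x\<bar>\<close> and \<open>\<bar>z - x\<bar>\<close> is at least
  half of \<open>\<bar>z\<bar>\<close>. The kernel at that point is at most 4 times its value at
  \<open>z\<close>, and the other kernel has mass 1.\<close>

lemma poisson_convolution_le:
  assumes "0 < \<sigma>" "0 < \<sigma>'"
  shows "(\<integral>\<^sup>+x. ennreal (poisson \<sigma> x) * ennreal (poisson \<sigma>' (z - x)) \<partial>lborel) \<le> ennreal (4 * (poisson \<sigma> z + poisson \<sigma>' z))"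
proof -
  note nn = poisson_nonneg[OF less_imp_le[OF assms(1)]] poisson_nonneg[OF less_imp_le[OF assms(2)]]
  have "(\<integral>\<^sup>+x. ennreal (poisson \<sigma> x) * ennreal (poisson \<sigma>' (z - x)) \<partial>lborel) \<le>
    (\<integral>\<^sup>+x. ennreal (4 * poisson \<sigma> z) * ennreal (poisson \<sigma>' (x - z)) + ennreal (4 * poisson \<sigma>' z) * ennreal (poisson \<sigma> x) \<partial>lborel)"
  proof (rule nn_integral_mono)
    fix x
    have even: "poisson \<sigma>' (z - x) = poisson \<sigma>' (x - z)" using poisson_minus[of \<sigma>' "x - z"] by simp
    have "poisson \<sigma> x * poisson \<sigma>' (z - x) \<le> 4 * poisson \<sigma> z * poisson \<sigma>' (z - x) + 4 * poisson \<sigma>' z * poisson \<sigma> x"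
    proof (cases "\<bar>z\<bar> \<le> 2 * \<bar>x\<bar>")
      case True
      then have "poisson \<sigma> x * poisson \<sigma>' (z - x) \<le> (4 * poisson \<sigma> z) * poisson \<sigma>' (z - x)"
        using poisson_half[OF assms(1) True] nn by (intro mult_right_mono) auto
      moreover have "0 \<le> 4 * poisson \<sigma>' z * poisson \<sigma> x" using nn by simp
      ultimately show ?thesis by linarith
    next
      case False
      then have "\<bar>z\<bar> \<le> 2 * \<bar>z - x\<bar>" using abs_triangle_ineq[of "z - x" x] by simp
      then have "poisson \<sigma> x * poisson \<sigma>' (z - x) \<le> poisson \<sigma> x * (4 * poisson \<sigma>' z)"
        using poisson_half[OF assms(2)] nn by (intro mult_left_mono) auto
      moreover have "poisson \<sigma> x * (4 * poisson \<sigma>' z) = 4 * poisson \<sigma>' z * poisson \<sigma> x" by simp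
      moreover have "0 \<le> 4 * poisson \<sigma> z * poisson \<sigma>' (z - x)" using nn by simp
      ultimately show ?thesis by linarith
    qed
    then have "ennreal (poisson \<sigma> x * poisson \<sigma>' (z - x)) \<le> ennreal (4 * poisson \<sigma> z * poisson \<sigma>' (x - z) + 4 * poisson \<sigma>' z * poisson \<sigma> x)"
      unfolding even by (rule ennreal_leI)
    then show "ennreal (poisson \<sigma> x) * ennreal (poisson \<sigma>' (z - x)) \<le> ennreal (4 * poisson \<sigma> z) * ennreal (poisson \<sigma>' (x - z)) + ennreal (4 * poisson \<sigma>' z) * ennreal (poisson \<sigma> x)"
      using nn by (simp add: ennreal_mult ennreal_plus)
  qed
  also have "\<dots> = ennreal (4 * poisson \<sigma> z) * 1 + ennreal (4 * poisson \<sigma>' z) * 1"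
    using nn_integral_poisson[OF assms(2), of z] nn_integral_poisson'[OF assms(1)]
    by (subst nn_integral_add) (auto simp: nn_integral_cmult)
  also have "\<dots> = ennreal (4 * (poisson \<sigma> z + poisson \<sigma>' z))"
    using nn by (simp add: ennreal_plus[symmetric] del: ennreal_plus)
  finally show ?thesis .
qed

text \<open>
  This replaces the semigroup law; it is all that the \<open>T T\<^sup>*\<close> argument for the maximal function needs.
\<close>

lemma flow_avg_flow_avg_le:
  assumes F [measurable]: "F \<in> borel_measurable torus_measure" and \<sigma>: "0 < \<sigma>" "0 < \<sigma>'" and \<omega>: "\<omega> \<in> space torus_measure"
  shows "flow_avg \<sigma> (flow_avg \<sigma>' F) \<omega> \<le> 4 * (flow_avg \<sigma> F \<omega> + flow_avg \<sigma>' F \<omega>)"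
proof -
  note nn = poisson_nonneg[OF less_imp_le[OF \<sigma>(1)]] poisson_nonneg[OF less_imp_le[OF \<sigma>(2)]]
  have Fm [measurable]: "(\<lambda>z. F (shift (\<i> * of_real z) \<omega>)) \<in> borel_measurable borel"
    by (rule flow_measurable) (use \<omega> in auto)
  have "flow_avg \<sigma> (flow_avg \<sigma>' F) \<omega> = (\<integral>\<^sup>+x. (\<integral>\<^sup>+y. ennreal (poisson \<sigma> x) * (ennreal (poisson \<sigma>' y) * F (shift (\<i> * of_real (x + y)) \<omega>)) \<partial>lborel) \<partial>lborel)"
    unfolding flow_avg_def
  proof (rule nn_integral_cong)
    fix x :: real
    have "shift (\<i> * of_real y) (shift (\<i> * of_real x) \<omega>) = shift (\<i> * of_real (x + y)) \<omega>" for y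
      by (simp add: shift_add[symmetric] algebra_simps)
    moreover have "(\<lambda>y. ennreal (poisson \<sigma>' y) * F (shift (\<i> * of_real (x + y)) \<omega>)) \<in> borel_measurable lborel"
    proof -
      have "(\<lambda>y. F (shift (\<i> * of_real (x + y)) \<omega>)) \<in> borel_measurable borel"
        using measurable_compose[OF _ Fm, of "\<lambda>y. x + y" borel] by simp
      then show ?thesis by measurable
    qed
    ultimately show "ennreal (poisson \<sigma> x) * (\<integral>\<^sup>+y. ennreal (poisson \<sigma>' y) * F (shift (\<i> * of_real y) (shift (\<i> * of_real x) \<omega>)) \<partial>lborel)
      = (\<integral>\<^sup>+y. ennreal (poisson \<sigma> x) * (ennreal (poisson \<sigma>' y) * F (shift (\<i> * of_real (x + y)) \<omega>)) \<partial>lborel)"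
      by (simp add: nn_integral_cmult)
  qed
  also have "\<dots> = (\<integral>\<^sup>+x. (\<integral>\<^sup>+z. ennreal (poisson \<sigma> x) * (ennreal (poisson \<sigma>' (z - x)) * F (shift (\<i> * of_real z) \<omega>)) \<partial>lborel) \<partial>lborel)"
  proof (rule nn_integral_cong)
    fix x :: real
    have "(\<lambda>z. ennreal (poisson \<sigma> x) * (ennreal (poisson \<sigma>' (z - x)) * F (shift (\<i> * of_real z) \<omega>))) \<in> borel_measurable borel" by measurable
    from nn_integral_real_affine[OF this, of 1 x]
    show "(\<integral>\<^sup>+y. ennreal (poisson \<sigma> x) * (ennreal (poisson \<sigma>' y) * F (shift (\<i> * of_real (x + y)) \<omega>)) \<partial>lborel) =
      (\<integral>\<^sup>+z. ennreal (poisson \<sigma> x) * (ennreal (poisson \<sigma>' (z - x)) * F (shift (\<i> * of_real z) \<omega>)) \<partial>lborel)" by simp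
  qed
  also have "\<dots> = (\<integral>\<^sup>+z. (\<integral>\<^sup>+x. ennreal (poisson \<sigma> x) * (ennreal (poisson \<sigma>' (z - x)) * F (shift (\<i> * of_real z) \<omega>)) \<partial>lborel) \<partial>lborel)"
    by (rule lborel_pair.Fubini'[symmetric]) measurable
  also have "\<dots> = (\<integral>\<^sup>+z. (\<integral>\<^sup>+x. ennreal (poisson \<sigma> x) * ennreal (poisson \<sigma>' (z - x)) \<partial>lborel) * F (shift (\<i> * of_real z) \<omega>) \<partial>lborel)"
    by (intro nn_integral_cong) (simp add: nn_integral_multc[symmetric] mult.assoc)
  also have "\<dots> \<le> (\<integral>\<^sup>+z. ennreal (4 * (poisson \<sigma> z + poisson \<sigma>' z)) * F (shift (\<i> * of_real z) \<omega>) \<partial>lborel)"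
    by (intro nn_integral_mono mult_right_mono poisson_convolution_le \<sigma>) auto
  also have "\<dots> = (\<integral>\<^sup>+z. 4 * (ennreal (poisson \<sigma> z) * F (shift (\<i> * of_real z) \<omega>) + ennreal (poisson \<sigma>' z) * F (shift (\<i> * of_real z) \<omega>)) \<partial>lborel)"
    using nn by (intro nn_integral_cong) (simp add: ennreal_mult ennreal_plus algebra_simps)
  also have "\<dots> = 4 * (flow_avg \<sigma> F \<omega> + flow_avg \<sigma>' F \<omega>)"
    unfolding flow_avg_def by (subst nn_integral_cmult, measurable, subst nn_integral_add) auto
  finally show ?thesis .
qed

text \<open>The Cauchy-Schwarz inequality for the Poisson probability measure.\<close>

lemma flow_avg_square_le:
  assumes F [measurable]: "F \<in> borel_measurable torus_measure" and \<sigma>: "0 < \<sigma>" and \<omega>: "\<omega> \<in> space torus_measure"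
  shows "(flow_avg \<sigma> F \<omega>)\<^sup>2 \<le> flow_avg \<sigma> (\<lambda>\<omega>. (F \<omega>)\<^sup>2) \<omega>"
proof -
  have Fm [measurable]: "(\<lambda>z. F (shift (\<i> * of_real z) \<omega>)) \<in> borel_measurable borel"
    by (rule flow_measurable) (use \<omega> in auto)
  define M where "M = density lborel (\<lambda>x. ennreal (poisson \<sigma> x))"
  have M: "(\<integral>\<^sup>+x. G x \<partial>M) = (\<integral>\<^sup>+x. ennreal (poisson \<sigma> x) * G x \<partial>lborel)" if "G \<in> borel_measurable borel" for G
    unfolding M_def using that by (subst nn_integral_density) auto
  have "(\<integral>\<^sup>+x. 1 * F (shift (\<i> * of_real x) \<omega>) \<partial>M)\<^sup>2 \<le> (\<integral>\<^sup>+x. 1\<^sup>2 \<partial>M) * (\<integral>\<^sup>+x. (F (shift (\<i> * of_real x) \<omega>))\<^sup>2 \<partial>M)"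
    by (rule Cauchy_Schwarz_nn_integral) (auto simp: M_def)
  also have "(\<integral>\<^sup>+x. 1\<^sup>2 \<partial>M) = 1" using M[of "\<lambda>_. 1"] nn_integral_poisson'[OF \<sigma>] by simp
  finally show ?thesis by (simp add: M flow_avg_def)
qed

section \<open>Bounds for the linearized maximal operator that do not depend on the number of
  scales\<close>

context
  fixes n :: nat and \<sigma> :: "nat \<Rightarrow> real" and E :: "nat \<Rightarrow> (nat \<Rightarrow> complex) set"
  assumes \<sigma>: "\<And>i. i < n \<Longrightarrow> 0 < \<sigma> i"
    and E [measurable]: "\<And>i. i < n \<Longrightarrow> E i \<in> sets torus_measure"
    and disj: "disjoint_family_on E {..<n}"
    and cover: "\<And>\<omega>. \<omega> \<in> space torus_measure \<Longrightarrow> \<exists>i<n. \<omega> \<in> E i"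
begin

text \<open>The maximal function with its scale selected by the partition \<open>E\<close>. For a
  fixed selection the operator is linear, and a bound uniform in the selection controls the
  supremum.\<close>

definition "lin_max h \<omega> = (\<Sum>i<n. indicator (E i) \<omega> * flow_avg (\<sigma> i) h \<omega>)"

lemma lin_max_measurable [measurable]:
  assumes [measurable]: "h \<in> borel_measurable torus_measure"
  shows "lin_max h \<in> borel_measurable torus_measure"
  unfolding lin_max_def[abs_def]
  by (intro borel_measurable_sum borel_measurable_times_ennreal borel_measurable_indicator E flow_avg_measurable assms) auto

lemma lin_max_eq:
  assumes "i < n" "\<omega> \<in> E i" shows "lin_max h \<omega> = flow_avg (\<sigma> i) h \<omega>"
proof -
  have "indicator (E j) \<omega> * flow_avg (\<sigma> j) h \<omega> = (if j = i then flow_avg (\<sigma> i) h \<omega> else 0)" if "j < n" for j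
    using disj assms that by (auto simp: disjoint_family_on_def indicator_def)
  then show ?thesis unfolding lin_max_def using assms by (simp add: sum.delta)
qed

text \<open>The constant grows with \<open>n\<close>; it serves to provide some finite constant,
  which is then improved.\<close>

lemma lin_max_apriori:
  assumes h [measurable]: "h \<in> borel_measurable torus_measure"
  shows "(\<integral>\<^sup>+\<omega>. (lin_max h \<omega>)\<^sup>2 \<partial>torus_measure) \<le> of_nat n * (\<integral>\<^sup>+\<omega>. (h \<omega>)\<^sup>2 \<partial>torus_measure)"
proof -
  have "(\<integral>\<^sup>+\<omega>. (lin_max h \<omega>)\<^sup>2 \<partial>torus_measure) \<le> (\<integral>\<^sup>+\<omega>. (\<Sum>i<n. flow_avg (\<sigma> i) (\<lambda>\<omega>. (h \<omega>)\<^sup>2) \<omega>) \<partial>torus_measure)"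
  proof (rule nn_integral_mono)
    fix \<omega> assume \<omega>: "\<omega> \<in> space torus_measure"
    then obtain i where i: "i < n" "\<omega> \<in> E i" using cover by blast
    have "(lin_max h \<omega>)\<^sup>2 \<le> flow_avg (\<sigma> i) (\<lambda>\<omega>. (h \<omega>)\<^sup>2) \<omega>"
      unfolding lin_max_eq[OF i] by (rule flow_avg_square_le[OF h \<sigma>[OF i(1)] \<omega>])
    also have "\<dots> \<le> (\<Sum>i<n. flow_avg (\<sigma> i) (\<lambda>\<omega>. (h \<omega>)\<^sup>2) \<omega>)" using i by (intro member_le_sum) auto
    finally show "(lin_max h \<omega>)\<^sup>2 \<le> (\<Sum>i<n. flow_avg (\<sigma> i) (\<lambda>\<omega>. (h \<omega>)\<^sup>2) \<omega>)" .
  qed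
  also have "\<dots> = (\<Sum>i<n. \<integral>\<^sup>+\<omega>. flow_avg (\<sigma> i) (\<lambda>\<omega>. (h \<omega>)\<^sup>2) \<omega> \<partial>torus_measure)"
    by (rule nn_integral_sum) measurable
  also have "\<dots> = (\<Sum>i<n. \<integral>\<^sup>+\<omega>. (h \<omega>)\<^sup>2 \<partial>torus_measure)"
    using \<sigma> by (intro sum.cong refl nn_integral_flow_avg) auto
  finally show ?thesis by simp
qed

text \<open>The \<open>T T\<^sup>*\<close> argument: with \<open>T = lin_max\<close> one has \<open>T\<^sup>* g = V\<close> and \<open>\<parallel>V\<parallel>\<^sup>2 \<le> 8 \<langle>g, T g\<rangle>\<close>.\<close>

lemma lin_max_TT:
  assumes h [measurable]: "h \<in> borel_measurable torus_measure" and g [measurable]: "g \<in> borel_measurable torus_measure"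
  shows "(\<integral>\<^sup>+\<omega>. g \<omega> * lin_max h \<omega> \<partial>torus_measure)\<^sup>2 \<le> (\<integral>\<^sup>+\<omega>. (h \<omega>)\<^sup>2 \<partial>torus_measure) * (8 * (\<integral>\<^sup>+\<omega>. g \<omega> * lin_max g \<omega> \<partial>torus_measure))"
proof -
  define gi where "gi i \<omega> = g \<omega> * indicator (E i) \<omega>" for i \<omega>
  have gi [measurable]: "gi i \<in> borel_measurable torus_measure" if "i < n" for i
    unfolding gi_def[abs_def] using E[OF that] by measurable
  define V where "V \<omega> = (\<Sum>i<n. flow_avg (\<sigma> i) (gi i) \<omega>)" for \<omega>
  have V [measurable]: "V \<in> borel_measurable torus_measure"
    unfolding V_def[abs_def] by (intro borel_measurable_sum flow_avg_measurable gi) auto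
  have sum_gi: "(\<Sum>i<n. gi i \<omega>) = g \<omega>" if \<omega>: "\<omega> \<in> space torus_measure" for \<omega>
  proof -
    obtain i where i: "i < n" "\<omega> \<in> E i" using cover \<omega> by blast
    have "gi j \<omega> = (if j = i then g \<omega> else 0)" if "j < n" for j
      using disj i that by (auto simp: gi_def disjoint_family_on_def indicator_def)
    then show ?thesis using i by (simp add: sum.delta)
  qed
  have flow_space: "shift (\<i> * of_real x) \<omega> \<in> space torus_measure" if "\<omega> \<in> space torus_measure" for x \<omega>
    by (rule shift_space[OF that])
  have avg_sum: "(\<Sum>j<n. flow_avg s (gi j) \<omega>) = flow_avg s g \<omega>" if \<omega>: "\<omega> \<in> space torus_measure" for s \<omega>
  proof -
    have "flow_avg s (\<lambda>\<omega>. \<Sum>j<n. gi j \<omega>) \<omega> = (\<Sum>j<n. flow_avg s (gi j) \<omega>)"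
      using gi \<omega> by (intro flow_avg_sum) auto
    moreover have "flow_avg s (\<lambda>\<omega>. \<Sum>j<n. gi j \<omega>) \<omega> = flow_avg s g \<omega>"
      unfolding flow_avg_def by (intro nn_integral_cong) (simp add: sum_gi[OF flow_space[OF \<omega>]])
    ultimately show ?thesis by simp
  qed
  have adj: "(\<integral>\<^sup>+\<omega>. g \<omega> * lin_max f \<omega> \<partial>torus_measure) = (\<Sum>i<n. \<integral>\<^sup>+\<omega>. gi i \<omega> * flow_avg (\<sigma> i) f \<omega> \<partial>torus_measure)"
    if f [measurable]: "f \<in> borel_measurable torus_measure" for f
  proof -
    have "(\<integral>\<^sup>+\<omega>. g \<omega> * lin_max f \<omega> \<partial>torus_measure) = (\<integral>\<^sup>+\<omega>. (\<Sum>i<n. gi i \<omega> * flow_avg (\<sigma> i) f \<omega>) \<partial>torus_measure)"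
      by (simp only: lin_max_def gi_def sum_distrib_left mult.assoc)
    also have "\<dots> = (\<Sum>i<n. \<integral>\<^sup>+\<omega>. gi i \<omega> * flow_avg (\<sigma> i) f \<omega> \<partial>torus_measure)"
      using gi by (intro nn_integral_sum borel_measurable_times_ennreal flow_avg_measurable f) auto
    finally show ?thesis .
  qed
  have "(\<integral>\<^sup>+\<omega>. g \<omega> * lin_max h \<omega> \<partial>torus_measure) = (\<Sum>i<n. \<integral>\<^sup>+\<omega>. h \<omega> * flow_avg (\<sigma> i) (gi i) \<omega> \<partial>torus_measure)"
    unfolding adj[OF h] using gi by (intro sum.cong refl flow_avg_selfadjoint h) auto
  also have "\<dots> = (\<integral>\<^sup>+\<omega>. (\<Sum>i<n. h \<omega> * flow_avg (\<sigma> i) (gi i) \<omega>) \<partial>torus_measure)"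
    using gi by (intro nn_integral_sum[symmetric] borel_measurable_times_ennreal flow_avg_measurable h) auto
  also have "\<dots> = (\<integral>\<^sup>+\<omega>. h \<omega> * V \<omega> \<partial>torus_measure)" by (simp add: V_def sum_distrib_left)
  finally have gT: "(\<integral>\<^sup>+\<omega>. g \<omega> * lin_max h \<omega> \<partial>torus_measure) = (\<integral>\<^sup>+\<omega>. h \<omega> * V \<omega> \<partial>torus_measure)" .
  have "(\<integral>\<^sup>+\<omega>. (V \<omega>)\<^sup>2 \<partial>torus_measure) = (\<integral>\<^sup>+\<omega>. (\<Sum>i<n. \<Sum>j<n. flow_avg (\<sigma> i) (gi i) \<omega> * flow_avg (\<sigma> j) (gi j) \<omega>) \<partial>torus_measure)"
    by (simp add: V_def power2_eq_square sum_product)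
  also have "\<dots> = (\<Sum>i<n. \<Sum>j<n. \<integral>\<^sup>+\<omega>. flow_avg (\<sigma> i) (gi i) \<omega> * flow_avg (\<sigma> j) (gi j) \<omega> \<partial>torus_measure)"
    using gi by (subst nn_integral_sum; (intro sum.cong refl nn_integral_sum)?)
       (auto intro!: borel_measurable_sum borel_measurable_times_ennreal flow_avg_measurable)
  \<comment> \<open>Self-adjointness moves one average onto the other, and the convolution bound
    splits the composition into two single averages. The second is moved back by self-adjointness,
    after which the two halves agree up to exchanging \<open>i\<close> and \<open>j\<close>.\<close>
  also have "\<dots> \<le> (\<Sum>i<n. \<Sum>j<n. 4 * ((\<integral>\<^sup>+\<omega>. gi i \<omega> * flow_avg (\<sigma> i) (gi j) \<omega> \<partial>torus_measure) + (\<integral>\<^sup>+\<omega>. gi j \<omega> * flow_avg (\<sigma> j) (gi i) \<omega> \<partial>torus_measure)))"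
  proof (intro sum_mono)
    fix i j assume ij: "i \<in> {..<n}" "j \<in> {..<n}"
    then have [measurable]: "gi i \<in> borel_measurable torus_measure" "gi j \<in> borel_measurable torus_measure" using gi by auto
    have "(\<integral>\<^sup>+\<omega>. flow_avg (\<sigma> i) (gi i) \<omega> * flow_avg (\<sigma> j) (gi j) \<omega> \<partial>torus_measure) =
       (\<integral>\<^sup>+\<omega>. flow_avg (\<sigma> j) (gi j) \<omega> * flow_avg (\<sigma> i) (gi i) \<omega> \<partial>torus_measure)" by (simp add: mult.commute)
    also have "\<dots> = (\<integral>\<^sup>+\<omega>. gi i \<omega> * flow_avg (\<sigma> i) (flow_avg (\<sigma> j) (gi j)) \<omega> \<partial>torus_measure)"
      by (rule flow_avg_selfadjoint) measurable
    also have "\<dots> \<le> (\<integral>\<^sup>+\<omega>. gi i \<omega> * (4 * (flow_avg (\<sigma> i) (gi j) \<omega> + flow_avg (\<sigma> j) (gi j) \<omega>)) \<partial>torus_measure)"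
      using ij \<sigma> by (intro nn_integral_mono mult_left_mono flow_avg_flow_avg_le) auto
    also have "\<dots> = (\<integral>\<^sup>+\<omega>. 4 * (gi i \<omega> * flow_avg (\<sigma> i) (gi j) \<omega> + gi i \<omega> * flow_avg (\<sigma> j) (gi j) \<omega>) \<partial>torus_measure)"
      by (simp add: algebra_simps)
    also have "\<dots> = 4 * ((\<integral>\<^sup>+\<omega>. gi i \<omega> * flow_avg (\<sigma> i) (gi j) \<omega> \<partial>torus_measure) + (\<integral>\<^sup>+\<omega>. gi i \<omega> * flow_avg (\<sigma> j) (gi j) \<omega> \<partial>torus_measure))"
      by (subst nn_integral_cmult, measurable, subst nn_integral_add) auto
    also have "(\<integral>\<^sup>+\<omega>. gi i \<omega> * flow_avg (\<sigma> j) (gi j) \<omega> \<partial>torus_measure) = (\<integral>\<^sup>+\<omega>. gi j \<omega> * flow_avg (\<sigma> j) (gi i) \<omega> \<partial>torus_measure)"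
      by (rule flow_avg_selfadjoint) measurable
    finally show "(\<integral>\<^sup>+\<omega>. flow_avg (\<sigma> i) (gi i) \<omega> * flow_avg (\<sigma> j) (gi j) \<omega> \<partial>torus_measure) \<le>
      4 * ((\<integral>\<^sup>+\<omega>. gi i \<omega> * flow_avg (\<sigma> i) (gi j) \<omega> \<partial>torus_measure) + (\<integral>\<^sup>+\<omega>. gi j \<omega> * flow_avg (\<sigma> j) (gi i) \<omega> \<partial>torus_measure))" .
  qed
  also have "\<dots> = 8 * (\<Sum>i<n. \<Sum>j<n. \<integral>\<^sup>+\<omega>. gi i \<omega> * flow_avg (\<sigma> i) (gi j) \<omega> \<partial>torus_measure)"
  proof -
    define a where "a i j = (\<integral>\<^sup>+\<omega>. gi i \<omega> * flow_avg (\<sigma> i) (gi j) \<omega> \<partial>torus_measure)" for i j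
    have "(\<Sum>i<n. \<Sum>j<n. 4 * (a i j + a j i)) = 4 * ((\<Sum>i<n. \<Sum>j<n. a i j) + (\<Sum>i<n. \<Sum>j<n. a j i))"
      by (simp add: sum_distrib_left[symmetric] sum.distrib)
    also have "(\<Sum>i<n. \<Sum>j<n. a j i) = (\<Sum>i<n. \<Sum>j<n. a i j)" by (rule sum.swap)
    also have "4 * ((\<Sum>i<n. \<Sum>j<n. a i j) + (\<Sum>i<n. \<Sum>j<n. a i j)) = 8 * (\<Sum>i<n. \<Sum>j<n. a i j)"
      by (simp add: mult_2[symmetric] mult.assoc[symmetric])
    finally show ?thesis by (simp add: a_def)
  qed
  also have "(\<Sum>i<n. \<Sum>j<n. \<integral>\<^sup>+\<omega>. gi i \<omega> * flow_avg (\<sigma> i) (gi j) \<omega> \<partial>torus_measure) = (\<Sum>i<n. \<integral>\<^sup>+\<omega>. gi i \<omega> * flow_avg (\<sigma> i) g \<omega> \<partial>torus_measure)"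
  proof (rule sum.cong[OF refl])
    fix i assume i: "i \<in> {..<n}"
    have "(\<Sum>j<n. \<integral>\<^sup>+\<omega>. gi i \<omega> * flow_avg (\<sigma> i) (gi j) \<omega> \<partial>torus_measure) = (\<integral>\<^sup>+\<omega>. (\<Sum>j<n. gi i \<omega> * flow_avg (\<sigma> i) (gi j) \<omega>) \<partial>torus_measure)"
      using gi i by (intro nn_integral_sum[symmetric] borel_measurable_times_ennreal flow_avg_measurable) auto
    also have "\<dots> = (\<integral>\<^sup>+\<omega>. gi i \<omega> * flow_avg (\<sigma> i) g \<omega> \<partial>torus_measure)"
      by (intro nn_integral_cong) (simp add: sum_distrib_left[symmetric] avg_sum)
    finally show "(\<Sum>j<n. \<integral>\<^sup>+\<omega>. gi i \<omega> * flow_avg (\<sigma> i) (gi j) \<omega> \<partial>torus_measure) = (\<integral>\<^sup>+\<omega>. gi i \<omega> * flow_avg (\<sigma> i) g \<omega> \<partial>torus_measure)" .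
  qed
  also have "\<dots> = (\<integral>\<^sup>+\<omega>. g \<omega> * lin_max g \<omega> \<partial>torus_measure)" by (rule adj[OF g, symmetric])
  finally have V2: "(\<integral>\<^sup>+\<omega>. (V \<omega>)\<^sup>2 \<partial>torus_measure) \<le> 8 * (\<integral>\<^sup>+\<omega>. g \<omega> * lin_max g \<omega> \<partial>torus_measure)" .
  have "(\<integral>\<^sup>+\<omega>. h \<omega> * V \<omega> \<partial>torus_measure)\<^sup>2 \<le> (\<integral>\<^sup>+\<omega>. (h \<omega>)\<^sup>2 \<partial>torus_measure) * (\<integral>\<^sup>+\<omega>. (V \<omega>)\<^sup>2 \<partial>torus_measure)"
    by (rule Cauchy_Schwarz_nn_integral) measurable
  also have "\<dots> \<le> (\<integral>\<^sup>+\<omega>. (h \<omega>)\<^sup>2 \<partial>torus_measure) * (8 * (\<integral>\<^sup>+\<omega>. g \<omega> * lin_max g \<omega> \<partial>torus_measure))"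
    by (intro mult_left_mono V2) auto
  finally show ?thesis unfolding gT .
qed

definition "lin_max_bounds = {c::real. 0 \<le> c \<and> (\<forall>h\<in>borel_measurable torus_measure.
   (\<integral>\<^sup>+\<omega>. (lin_max h \<omega>)\<^sup>2 \<partial>torus_measure) \<le> ennreal c * (\<integral>\<^sup>+\<omega>. (h \<omega>)\<^sup>2 \<partial>torus_measure))}"

text \<open>With \<open>T = lin_max\<close>, taking \<open>g = T h\<close> in
  \<open>lin_max_TT\<close> gives \<parallel>T h\<parallel>^4 \<le> 8 \<parallel>h\<parallel>^2 <T
  h, T T h>, and Cauchy-Schwarz with the constant \<open>c\<close> gives <T h, T T h> \<le> sqrt c
  \<parallel>T h\<parallel>^2. Division by \<parallel>T h\<parallel>^2 leaves the constant
  \<open>8 * sqrt c\<close>.\<close>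

lemma lin_max_improve:
  assumes c: "c \<in> lin_max_bounds"
  shows "8 * sqrt c \<in> lin_max_bounds"
  unfolding lin_max_bounds_def
proof (intro CollectI conjI ballI)
  have c0: "0 \<le> c" using c by (simp add: lin_max_bounds_def)
  then show "0 \<le> 8 * sqrt c" by simp
  fix h :: "(nat \<Rightarrow> complex) \<Rightarrow> ennreal" assume h [measurable]: "h \<in> borel_measurable torus_measure"
  define a where "a = (\<integral>\<^sup>+\<omega>. (h \<omega>)\<^sup>2 \<partial>torus_measure)"
  define b where "b = (\<integral>\<^sup>+\<omega>. (lin_max h \<omega>)\<^sup>2 \<partial>torus_measure)"
  have b_le: "b \<le> ennreal c * a" using c h by (simp add: lin_max_bounds_def a_def b_def)
  show "b \<le> ennreal (8 * sqrt c) * a"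
  proof (cases "a = \<top>")
    case True
    show ?thesis
    proof (cases "c = 0")
      case True
      then show ?thesis using b_le by simp
    next
      case False
      then show ?thesis using c0 \<open>a = \<top>\<close> by (simp add: ennreal_mult_top)
    qed
  next
    case False
    \<comment> \<open>The constant \<open>c\<close> guarantees that \<open>b\<close> is finite,
      which permits the division at the end.\<close>
    then have "ennreal c * a < \<top>" by (simp add: ennreal_mult_less_top less_top)
    then have "b \<noteq> \<top>" using b_le by auto
    then obtain a' b' where ab: "0 \<le> a'" "a = ennreal a'" "0 \<le> b'" "b = ennreal b'" using False by (cases a; cases b) auto
    define m where "m = (\<integral>\<^sup>+\<omega>. lin_max h \<omega> * lin_max (lin_max h) \<omega> \<partial>torus_measure)"
    have "m\<^sup>2 \<le> (\<integral>\<^sup>+\<omega>. (lin_max h \<omega>)\<^sup>2 \<partial>torus_measure) * (\<integral>\<^sup>+\<omega>. (lin_max (lin_max h) \<omega>)\<^sup>2 \<partial>torus_measure)"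
      unfolding m_def by (rule Cauchy_Schwarz_nn_integral) measurable
    also have "\<dots> \<le> b * (ennreal c * b)"
      unfolding b_def[symmetric] using c lin_max_measurable[OF h] unfolding lin_max_bounds_def b_def by (intro mult_left_mono) auto
    also have "\<dots> = ennreal ((sqrt c * b')\<^sup>2)" using ab c0 by (simp add: ennreal_mult'[symmetric] ennreal_mult''[symmetric] power_mult_distrib power2_eq_square mult_ac)
    finally have m2: "m\<^sup>2 \<le> ennreal ((sqrt c * b')\<^sup>2)" .
    have m: "m \<le> ennreal (sqrt c * b')"
    proof (rule ccontr)
      assume "\<not> m \<le> ennreal (sqrt c * b')"
      then have lt: "ennreal (sqrt c * b') < m" by simp
      have "(ennreal (sqrt c * b'))\<^sup>2 < m\<^sup>2"
        using lt by (cases m) (auto simp: ennreal_power ennreal_less_iff ab c0 power_strict_mono ennreal_top_mult power2_eq_square[of \<top>] intro!: power_strict_mono)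
      then show False using m2 c0 ab by (simp add: ennreal_power)
    qed
    have "b\<^sup>2 = (\<integral>\<^sup>+\<omega>. lin_max h \<omega> * lin_max h \<omega> \<partial>torus_measure)\<^sup>2" by (simp add: b_def power2_eq_square)
    also have "\<dots> \<le> a * (8 * m)" unfolding a_def m_def by (rule lin_max_TT[OF h lin_max_measurable[OF h]])
    also have "\<dots> \<le> a * (8 * ennreal (sqrt c * b'))" using m by (intro mult_left_mono) auto
    also have "\<dots> = ennreal (a' * (8 * (sqrt c * b')))"
    proof -
      have "8 * ennreal (sqrt c * b') = ennreal (8 * (sqrt c * b'))" by (subst ennreal_mult') simp_all
      moreover have "ennreal a' * ennreal (8 * (sqrt c * b')) = ennreal (a' * (8 * (sqrt c * b')))"
        using ab by (intro ennreal_mult'[symmetric]) auto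
      ultimately show ?thesis unfolding ab(2) by (simp only:)
    qed
    finally have "ennreal (b'\<^sup>2) \<le> ennreal (a' * (8 * (sqrt c * b')))" using ab by (simp add: ennreal_power)
    then have "b'\<^sup>2 \<le> a' * (8 * (sqrt c * b'))" using ab c0 by (subst (asm) ennreal_le_iff) auto
    then have "b' * b' \<le> (8 * sqrt c * a') * b'" by (simp add: power2_eq_square mult_ac)
    then have "b' \<le> 8 * sqrt c * a'" using ab c0 by (cases "b' = 0") (auto simp: mult_le_cancel_right)
    then show ?thesis using ab c0 by (simp add: ennreal_mult'[symmetric] ennreal_leI)
  qed
qed

text \<open>By \<open>lin_max_improve\<close> the infimum \<open>C\<close> of the admissible
  constants satisfies \<open>C \<le> 8 * sqrt C\<close>, hence \<open>C \<le> 64\<close>, whatever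
  the scales and the partition are.\<close>

lemma lin_max_bound:
  assumes h: "h \<in> borel_measurable torus_measure"
  shows "(\<integral>\<^sup>+\<omega>. (lin_max h \<omega>)\<^sup>2 \<partial>torus_measure) \<le> 64 * (\<integral>\<^sup>+\<omega>. (h \<omega>)\<^sup>2 \<partial>torus_measure)"
proof -
  have ne: "lin_max_bounds \<noteq> {}"
    using lin_max_apriori by (auto simp: lin_max_bounds_def ennreal_of_nat_eq_real_of_nat intro!: exI[of _ "real n"])
  have bdd: "bdd_below lin_max_bounds" by (auto simp: lin_max_bounds_def bdd_below_def)
  define C where "C = Inf lin_max_bounds"
  have C0: "0 \<le> C" unfolding C_def using ne by (intro cInf_greatest) (auto simp: lin_max_bounds_def)
  have "C \<le> 64"
  proof (rule ccontr)
    assume "\<not> C \<le> 64"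
    then have C: "64 < C" by simp
    have "8 * sqrt C < C"
    proof -
      have "8 < sqrt C" using C by (intro real_less_rsqrt) simp
      then have "8 * sqrt C < sqrt C * sqrt C" using C by (intro mult_strict_right_mono) auto
      then show ?thesis using C by simp
    qed
    moreover have "C \<le> 8 * sqrt C"
    proof -
      have "continuous_on UNIV (\<lambda>c::real. 8 * sqrt c)" by (intro continuous_intros)
      have le: "C \<le> 8 * sqrt c" if "c \<in> lin_max_bounds" for c
        unfolding C_def using lin_max_improve[OF that] bdd by (intro cInf_lower)
      have "(C / 8)\<^sup>2 \<le> c" if "c \<in> lin_max_bounds" for c
      proof -
        have "0 \<le> c" using that by (simp add: lin_max_bounds_def)
        have "(C / 8)\<^sup>2 \<le> (sqrt c)\<^sup>2" using le[OF that] C0 by (intro power_mono) auto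
        then show ?thesis using \<open>0 \<le> c\<close> by simp
      qed
      then have "(C / 8)\<^sup>2 \<le> C" unfolding C_def[symmetric] using ne by (subst (2) C_def) (intro cInf_greatest)
      then have "C / 8 \<le> sqrt C" by (rule real_le_rsqrt)
      then show ?thesis by simp
    qed
    ultimately show False by simp
  qed
  show ?thesis
  proof (cases "(\<integral>\<^sup>+\<omega>. (h \<omega>)\<^sup>2 \<partial>torus_measure) = \<top>")
    case True
    then show ?thesis by (simp add: ennreal_mult_top)
  next
    case False
    then obtain a where a: "0 \<le> a" "(\<integral>\<^sup>+\<omega>. (h \<omega>)\<^sup>2 \<partial>torus_measure) = ennreal a" by (cases "(\<integral>\<^sup>+\<omega>. (h \<omega>)\<^sup>2 \<partial>torus_measure)") auto
    show ?thesis unfolding a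
    proof (rule ennreal_le_epsilon)
      fix e :: real assume e: "0 < e"
      have "C < 64 + e / (a + 1)" using \<open>C \<le> 64\<close> e a by (intro order.strict_trans1[of C 64]) auto
      then obtain c where c: "c \<in> lin_max_bounds" "c < 64 + e / (a + 1)"
        using cInf_lessD[OF ne] by (auto simp: C_def)
      have "(\<integral>\<^sup>+\<omega>. (lin_max h \<omega>)\<^sup>2 \<partial>torus_measure) \<le> ennreal c * ennreal a"
        using c(1) h unfolding a(2)[symmetric] lin_max_bounds_def by blast
      also have "\<dots> \<le> ennreal ((64 + e / (a + 1)) * a)"
        using c a by (subst ennreal_mult''[symmetric]) (auto intro!: ennreal_leI mult_right_mono)
      also have "\<dots> \<le> ennreal (64 * a + e)"
      proof (rule ennreal_leI)
        have "e / (a + 1) * a \<le> e" using e a by (simp add: field_simps)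
        then show "(64 + e / (a + 1)) * a \<le> 64 * a + e" by (simp add: distrib_right)
      qed
      also have "\<dots> = 64 * ennreal a + ennreal e" using a e by (simp add: ennreal_mult)
      finally show "(\<integral>\<^sup>+\<omega>. (lin_max h \<omega>)\<^sup>2 \<partial>torus_measure) \<le> 64 * ennreal a + ennreal e" .
    qed
  qed
qed

end

text \<open>The partition is by the first index at which the maximum is attained, so the linearized
  operator reproduces the maximal function of \<open>F\<close>.\<close>

lemma flow_avg_maximal_finite:
  fixes n :: nat and \<sigma> :: "nat \<Rightarrow> real"
  assumes n: "0 < n" and \<sigma>: "\<And>i. i < n \<Longrightarrow> 0 < \<sigma> i" and F [measurable]: "F \<in> borel_measurable torus_measure"
  shows "(\<integral>\<^sup>+\<omega>. (SUP i\<in>{..<n}. flow_avg (\<sigma> i) F \<omega>)\<^sup>2 \<partial>torus_measure) \<le> 64 * (\<integral>\<^sup>+\<omega>. (F \<omega>)\<^sup>2 \<partial>torus_measure)"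
proof -
  define M where "M \<omega> = (SUP i\<in>{..<n}. flow_avg (\<sigma> i) F \<omega>)" for \<omega>
  have M [measurable]: "M \<in> borel_measurable torus_measure" unfolding M_def[abs_def]
    by (rule borel_measurable_SUP[OF countable_finite[OF finite_lessThan]]) (rule flow_avg_measurable[OF F])
  define A where "A i = {\<omega> \<in> space torus_measure. flow_avg (\<sigma> i) F \<omega> = M \<omega>}" for i
  have A: "A i \<in> sets torus_measure" for i unfolding A_def by measurable
  define E where "E = disjointed A"
  have E: "E i \<in> sets torus_measure" for i unfolding E_def disjointed_def using A by auto
  have disj: "disjoint_family_on E {..<n}"
    using disjoint_family_disjointed[of A] by (auto simp: E_def disjoint_family_on_def)
  have cover: "\<exists>i<n. \<omega> \<in> E i" if \<omega>: "\<omega> \<in> space torus_measure" for \<omega>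
  proof -
    have "M \<omega> \<in> (\<lambda>i. flow_avg (\<sigma> i) F \<omega>) ` {..<n}"
      unfolding M_def using n by (subst Max_Sup[symmetric]) (auto intro!: Max_in)
    then obtain i where "i < n" "\<omega> \<in> A i" using \<omega> by (auto simp: A_def)
    then have "\<omega> \<in> (\<Union>i\<in>{0..<n}. A i)" by auto
    then have "\<omega> \<in> (\<Union>i\<in>{0..<n}. E i)" unfolding E_def finite_UN_disjointed_eq .
    then show ?thesis by auto
  qed
  have eq: "lin_max n \<sigma> E F \<omega> = M \<omega>" if \<omega>: "\<omega> \<in> space torus_measure" for \<omega>
  proof -
    obtain i where i: "i < n" "\<omega> \<in> E i" using cover[OF \<omega>] by blast
    have "\<omega> \<in> A i" using i disjointed_subset[of A i] by (auto simp: E_def)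
    then show ?thesis using lin_max_eq[OF \<sigma> E disj cover i] by (simp add: A_def)
  qed
  have "(\<integral>\<^sup>+\<omega>. (M \<omega>)\<^sup>2 \<partial>torus_measure) = (\<integral>\<^sup>+\<omega>. (lin_max n \<sigma> E F \<omega>)\<^sup>2 \<partial>torus_measure)"
    by (intro nn_integral_cong) (simp add: eq)
  also have "\<dots> \<le> 64 * (\<integral>\<^sup>+\<omega>. (F \<omega>)\<^sup>2 \<partial>torus_measure)"
    by (rule lin_max_bound[OF \<sigma> E disj cover F])
  finally show ?thesis by (simp add: M_def)
qed

text \<open>\<open>int_decode\<close> enumerates all integers, so these are all integral powers of
  2. A countable set of scales keeps the supremum measurable.\<close>

definition dyadic :: "nat \<Rightarrow> real" where
  "dyadic i = 2 powr real_of_int (int_decode i)"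

definition flow_max :: "((nat \<Rightarrow> complex) \<Rightarrow> ennreal) \<Rightarrow> (nat \<Rightarrow> complex) \<Rightarrow> ennreal" where
  "flow_max F \<omega> = (SUP i. flow_avg (dyadic i) F \<omega>)"

lemma flow_max_measurable [measurable]:
  assumes [measurable]: "F \<in> borel_measurable torus_measure"
  shows "flow_max F \<in> borel_measurable torus_measure"
  unfolding flow_max_def[abs_def] by measurable

theorem flow_max_L2:
  assumes F [measurable]: "F \<in> borel_measurable torus_measure"
  shows "(\<integral>\<^sup>+\<omega>. (flow_max F \<omega>)\<^sup>2 \<partial>torus_measure) \<le> 64 * (\<integral>\<^sup>+\<omega>. (F \<omega>)\<^sup>2 \<partial>torus_measure)"
proof -
  define M where "M n \<omega> = (SUP i\<in>{..<Suc n}. flow_avg (dyadic i) F \<omega>)" for n \<omega>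
  have M [measurable]: "M n \<in> borel_measurable torus_measure" for n unfolding M_def[abs_def]
    by (rule borel_measurable_SUP[OF countable_finite[OF finite_lessThan]]) (rule flow_avg_measurable[OF F])
  have mono: "M n \<omega> \<le> M (Suc n) \<omega>" for n \<omega> unfolding M_def by (intro SUP_subset_mono) auto
  have sup: "flow_max F \<omega> = (SUP n. M n \<omega>)" for \<omega>
  proof (rule antisym)
    show "flow_max F \<omega> \<le> (SUP n. M n \<omega>)" unfolding flow_max_def
    proof (rule SUP_mono)
      fix i show "\<exists>n\<in>UNIV. flow_avg (dyadic i) F \<omega> \<le> M n \<omega>"
        unfolding M_def by (intro bexI[of _ i] SUP_upper) auto
    qed
    show "(SUP n. M n \<omega>) \<le> flow_max F \<omega>"
      unfolding M_def flow_max_def by (intro SUP_least SUP_upper) auto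
  qed
  have "(\<lambda>n. \<integral>\<^sup>+\<omega>. (M n \<omega>)\<^sup>2 \<partial>torus_measure) \<longlonglongrightarrow> (\<integral>\<^sup>+\<omega>. (flow_max F \<omega>)\<^sup>2 \<partial>torus_measure)"
  proof (rule nn_integral_LIMSEQ)
    show "incseq (\<lambda>n \<omega>. (M n \<omega>)\<^sup>2)" by (intro incseq_SucI le_funI power_mono mono) auto
    show "(\<lambda>n. (M n \<omega>)\<^sup>2) \<longlonglongrightarrow> (flow_max F \<omega>)\<^sup>2" for \<omega>
    proof -
      have "(\<lambda>n. M n \<omega>) \<longlonglongrightarrow> flow_max F \<omega>" unfolding sup by (intro LIMSEQ_SUP incseq_SucI mono)
      then show ?thesis unfolding power2_eq_square by (intro tendsto_mult_ennreal) auto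
    qed
  qed measurable
  then show ?thesis
    by (rule LIMSEQ_le_const2)
       (use flow_avg_maximal_finite[of "Suc _" dyadic F] F in \<open>auto simp: M_def dyadic_def\<close>)
qed

text \<open>The scale is rounded up to a power of 2 between \<open>\<sigma>\<close> and
  \<open>2 * \<sigma>\<close>, and the kernel is recentred at 0. As
  \<open>\<bar>t\<bar> \<le> \<sigma>\<close>, the denominator grows at most by the factor 12, while
  the numerator does not decrease.\<close>

lemma poisson_le_dyadic:
  assumes \<sigma>: "0 < \<sigma>" and t: "\<bar>t\<bar> \<le> \<sigma>"
  obtains i where "\<And>x. poisson \<sigma> (x - t) \<le> 12 * poisson (dyadic i) x"
proof -
  define k where "k = \<lceil>log 2 \<sigma>\<rceil>"
  define \<sigma>' where "\<sigma>' = dyadic (int_encode k)"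
  have \<sigma>'_eq: "\<sigma>' = 2 powr k" by (simp add: \<sigma>'_def dyadic_def)
  have "\<sigma> = 2 powr log 2 \<sigma>" using \<sigma> by simp
  also have "\<dots> \<le> \<sigma>'" unfolding \<sigma>'_eq k_def by (intro powr_mono) auto
  finally have 1: "\<sigma> \<le> \<sigma>'" .
  have "\<sigma>' \<le> 2 powr (log 2 \<sigma> + 1)" unfolding \<sigma>'_eq k_def by (intro powr_mono) linarith+
  also have "\<dots> = 2 * \<sigma>" using \<sigma> by (simp add: powr_add)
  finally have 2: "\<sigma>' \<le> 2 * \<sigma>" .
  have "poisson \<sigma> (x - t) \<le> 12 * poisson \<sigma>' x" for x
  proof -
    have "t\<^sup>2 \<le> \<sigma>\<^sup>2" using t \<sigma> by (simp add: abs_le_square_iff[symmetric])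
    have "x\<^sup>2 \<le> 2 * (x - t)\<^sup>2 + 2 * t\<^sup>2" using zero_le_power2[of "x - 2 * t"] by (simp add: power2_eq_square algebra_simps)
    have "\<sigma>'\<^sup>2 \<le> (2 * \<sigma>)\<^sup>2" using 1 2 \<sigma> by (intro power_mono) auto
    have le: "\<sigma>'\<^sup>2 + x\<^sup>2 \<le> 12 * (\<sigma>\<^sup>2 + (x - t)\<^sup>2)" 
    proof -
      have "(2 * \<sigma>)\<^sup>2 = 4 * \<sigma>\<^sup>2" by (simp add: power_mult_distrib)
      moreover have "0 \<le> (x - t)\<^sup>2" "0 \<le> \<sigma>\<^sup>2" by simp_all
      moreover have arith: "a + d \<le> 12 * (b + e)" if "a \<le> f" "f = 4 * b" "c \<le> b" "d \<le> 2 * e + 2 * c" "0 \<le> e" "0 \<le> b" for a b c d e f :: real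
        using that unfolding distrib_left by linarith
      ultimately show ?thesis
        by (intro arith[of _ "(2 * \<sigma>)\<^sup>2" _ "t\<^sup>2"]) (use \<open>\<sigma>'\<^sup>2 \<le> (2 * \<sigma>)\<^sup>2\<close> \<open>t\<^sup>2 \<le> \<sigma>\<^sup>2\<close> \<open>x\<^sup>2 \<le> 2 * (x - t)\<^sup>2 + 2 * t\<^sup>2\<close> in auto)
    qed
    have le': "pi * (\<sigma>'\<^sup>2 + x\<^sup>2) \<le> pi * (\<sigma>\<^sup>2 + (x - t)\<^sup>2) * 12"
      using mult_left_mono[OF le, of pi] by (simp only: mult_ac pi_ge_zero)
    have pos: "0 < \<sigma>\<^sup>2 + (x - t)\<^sup>2" "0 < \<sigma>'\<^sup>2 + x\<^sup>2"
      using \<sigma> 1 by (auto intro!: add_pos_nonneg)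
    have "poisson \<sigma> (x - t) / 12 \<le> poisson \<sigma>' x"
      unfolding poisson_def divide_divide_eq_left using \<sigma> 1 pos
      by (intro frac_le le') auto
    then show ?thesis by simp
  qed
  then show ?thesis using that \<sigma>'_def by blast
qed

text \<open>For all points of a cone the kernels of the sub-mean value inequality are dominated by
  dyadic kernels centred at the vertex, so a single value of \<open>flow_max\<close> bounds the
  function on the whole cone.\<close>

theorem dpoly_le_flow_max:
  assumes P: "P \<in> dirichlet_polys" and q: "0 < q" and \<omega>: "\<omega> \<in> space torus_measure" and s: "s \<in> cone \<tau>"
  shows "ennreal (cmod (dpoly P \<omega> s) powr q) \<le> 12 * flow_max (\<lambda>\<omega>. ennreal (cmod (dsum P \<omega>) powr q)) (shift (\<i> * of_real \<tau>) \<omega>)"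
proof -
  define \<sigma> where "\<sigma> = Re s"
  define t where "t = Im s - \<tau>"
  have \<sigma>: "0 < \<sigma>" "\<bar>t\<bar> \<le> \<sigma>" using s by (auto simp: cone_def half_plane_def \<sigma>_def t_def)
  define \<omega>' where "\<omega>' = shift (\<i> * of_real \<tau>) \<omega>"
  have \<omega>': "\<omega>' \<in> space torus_measure" unfolding \<omega>'_def by (rule shift_space[OF \<omega>])
  have "dpoly P \<omega> s = dpoly P \<omega>' (Complex \<sigma> t)"
    unfolding \<omega>'_def dpoly_shift by (rule arg_cong[of _ _ "dpoly P \<omega>"]) (simp add: \<sigma>_def t_def complex_eq_iff)
  obtain i where i: "\<And>x. poisson \<sigma> (x - t) \<le> 12 * poisson (dyadic i) x" using poisson_le_dyadic[OF \<sigma>] by blast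
  define F where "F = (\<lambda>\<omega>. ennreal (cmod (dsum P \<omega>) powr q))"
  have [measurable]: "F \<in> borel_measurable torus_measure"
    unfolding F_def using dsum_measurable[OF P, of "\<lambda>\<omega>. \<omega>" torus_measure] by measurable
  have m [measurable]: "(\<lambda>x. F (shift (\<i> * of_real x) \<omega>')) \<in> borel_measurable borel"
    by (rule flow_measurable) (use \<omega>' in auto)
  have "ennreal (cmod (dpoly P \<omega> s) powr q) \<le> (\<integral>\<^sup>+x. ennreal (poisson \<sigma> (x - t)) * F (shift (\<i> * of_real x) \<omega>') \<partial>lborel)"
    unfolding \<open>dpoly P \<omega> s = dpoly P \<omega>' (Complex \<sigma> t)\<close> F_def by (rule dpoly_submean[OF P \<omega>' q \<sigma>(1)])
  also have "\<dots> \<le> (\<integral>\<^sup>+x. 12 * (ennreal (poisson (dyadic i) x) * F (shift (\<i> * of_real x) \<omega>')) \<partial>lborel)"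
  proof (rule nn_integral_mono)
    fix x
    have "ennreal (poisson \<sigma> (x - t)) \<le> ennreal (12 * poisson (dyadic i) x)" by (rule ennreal_leI[OF i])
    also have "\<dots> = 12 * ennreal (poisson (dyadic i) x)" by (simp add: ennreal_mult')
    finally show "ennreal (poisson \<sigma> (x - t)) * F (shift (\<i> * of_real x) \<omega>') \<le> 12 * (ennreal (poisson (dyadic i) x) * F (shift (\<i> * of_real x) \<omega>'))"
      unfolding mult.assoc[symmetric] by (rule mult_right_mono) simp
  qed
  also have "\<dots> = 12 * flow_avg (dyadic i) F \<omega>'"
    unfolding flow_avg_def by (rule nn_integral_cmult) measurable
  also have "\<dots> \<le> 12 * flow_max F \<omega>'" unfolding flow_max_def by (intro mult_left_mono SUP_upper) auto
  finally show ?thesis by (simp add: F_def \<omega>'_def)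
qed


section \<open>Area functions of Dirichlet polynomials\<close>

definition area :: "complex measure \<Rightarrow> real \<Rightarrow> (complex \<Rightarrow> complex) \<Rightarrow> real \<Rightarrow> ennreal" where
  "area \<mu> l f \<tau> = (\<integral>\<^sup>+s\<in>cone \<tau>. ennreal (cmod (f s) powr l / Re s) \<partial>\<mu>)"

definition cauchy_weight :: "real \<Rightarrow> ennreal" where
  "cauchy_weight \<tau> = ennreal (1 / (1 + \<tau>\<^sup>2))"

text \<open>The p-th power of the norm of an area function as an iterated integral; the exponent
  \<open>p / l\<close> contains the l-th root that \<open>area\<close> leaves out.\<close>

definition area_pow :: "complex measure \<Rightarrow> real \<Rightarrow> real \<Rightarrow> ((nat \<Rightarrow> complex) \<Rightarrow> complex \<Rightarrow> complex) \<Rightarrow> ennreal" where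
  "area_pow \<mu> l p f = (\<integral>\<^sup>+\<omega>. (\<integral>\<^sup>+\<tau>. epow (area \<mu> l (f \<omega>) \<tau>) (p / l) * cauchy_weight \<tau> \<partial>lborel) \<partial>torus_measure)"

lemma cauchy_weight_measurable [measurable]: "cauchy_weight \<in> borel_measurable borel"
  unfolding cauchy_weight_def[abs_def] by measurable

lemma nn_integral_cauchy_weight: "(\<integral>\<^sup>+\<tau>. cauchy_weight \<tau> \<partial>lborel) = ennreal pi"
proof -
  have "(\<integral>\<^sup>+\<tau>. cauchy_weight \<tau> \<partial>lborel) = (\<integral>\<^sup>+\<tau>. ennreal pi * ennreal (poisson 1 \<tau>) \<partial>lborel)"
    by (intro nn_integral_cong) (simp add: cauchy_weight_def poisson_def ennreal_mult'[symmetric])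
  also have "\<dots> = ennreal pi" by (subst nn_integral_cmult) (auto simp: nn_integral_poisson')
  finally show ?thesis .
qed

lemma epow_Liminf:
  assumes "0 < r" shows "epow (liminf x) r = liminf (\<lambda>n. epow (x n) r)"
proof -
  have "mono (\<lambda>x. epow x r)" using assms by (intro monoI epow_mono) auto
  then show ?thesis
    using Liminf_compose_continuous_mono[OF continuous_epow[OF assms], of sequentially x] by simp
qed

context
  fixes \<mu> :: "complex measure"
  assumes fin: "finite_measure \<mu>" and sets: "sets \<mu> = sets (restrict_space borel half_plane)"
begin

lemma space_mu: "space \<mu> = half_plane"
  using sets_eq_imp_space_eq[OF sets] by (simp add: space_restrict_space)

lemma borel_mu: "f \<in> borel_measurable borel \<Longrightarrow> f \<in> borel_measurable \<mu>"
  unfolding measurable_cong_sets[OF sets refl] by (rule measurable_restrict_space1)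

lemma cone_indicator_measurable: "(indicator (cone \<tau>) :: complex \<Rightarrow> ennreal) \<in> borel_measurable \<mu>"
proof -
  have [measurable]: "Re \<in> borel_measurable \<mu>" "Im \<in> borel_measurable \<mu>" by (auto intro: borel_mu)
  have "{s \<in> space \<mu>. \<bar>Im s - \<tau>\<bar> < Re s} \<in> sets \<mu>" by measurable
  moreover have "{s \<in> space \<mu>. \<bar>Im s - \<tau>\<bar> < Re s} = cone \<tau> \<inter> space \<mu>"
    by (auto simp: space_mu cone_def)
  ultimately show ?thesis by (subst borel_measurable_indicator_iff) simp
qed

lemma area_measurable:
  fixes g :: "'a \<Rightarrow> complex \<Rightarrow> complex"
  assumes g [measurable]: "(\<lambda>x. g (fst x) (snd x)) \<in> borel_measurable (N \<Otimes>\<^sub>M \<mu>)"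
  shows "(\<lambda>x. area \<mu> l (g (fst x)) (snd x)) \<in> borel_measurable (N \<Otimes>\<^sub>M borel)"
proof -
  interpret finite_measure \<mu> by (rule fin)
  have [measurable]: "Re \<in> borel_measurable \<mu>" "Im \<in> borel_measurable \<mu>" by (auto intro: borel_mu)
  have g' [measurable]: "(\<lambda>x. g (fst (fst x)) (snd x)) \<in> borel_measurable ((N \<Otimes>\<^sub>M borel) \<Otimes>\<^sub>M \<mu>)"
  proof -
    have "(\<lambda>x. (fst (fst x), snd x)) \<in> (N \<Otimes>\<^sub>M borel) \<Otimes>\<^sub>M \<mu> \<rightarrow>\<^sub>M N \<Otimes>\<^sub>M \<mu>" by measurable
    from measurable_compose[OF this g] show ?thesis by simp
  qed
  have "(\<lambda>x. \<integral>\<^sup>+s. ennreal (cmod (g (fst x) s) powr l / Re s) * indicator {s. 0 < Re s \<and> \<bar>Im s - snd x\<bar> < Re s} s \<partial>\<mu>) \<in> borel_measurable (N \<Otimes>\<^sub>M borel)"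
  proof (rule borel_measurable_nn_integral)
    show "(\<lambda>(x, s). ennreal (cmod (g (fst x) s) powr l / Re s) * indicator {s. 0 < Re s \<and> \<bar>Im s - snd x\<bar> < Re s} s) \<in> borel_measurable ((N \<Otimes>\<^sub>M borel) \<Otimes>\<^sub>M \<mu>)"
      unfolding case_prod_unfold indicator_def by measurable
  qed
  then show ?thesis unfolding area_def cone_def half_plane_def by simp
qed

lemma area_measurable1:
  assumes g: "f \<in> borel_measurable \<mu>"
  shows "area \<mu> l f \<in> borel_measurable borel"
proof -
  have m: "(\<lambda>x. (\<lambda>_::unit. f) (fst x) (snd x)) \<in> borel_measurable (count_space UNIV \<Otimes>\<^sub>M \<mu>)"
    by (rule measurable_compose[OF measurable_snd g])
  have "(\<lambda>\<tau>. ((), \<tau>)) \<in> borel \<rightarrow>\<^sub>M count_space UNIV \<Otimes>\<^sub>M (borel :: real measure)" by measurable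
  from measurable_compose[OF this area_measurable[OF m, of l]] show ?thesis by simp
qed

lemma area_Liminf_le:
  assumes m: "\<And>k. f k \<in> borel_measurable \<mu>" and lim: "\<And>s. s \<in> half_plane \<Longrightarrow> (\<lambda>k. f k s) \<longlonglongrightarrow> g s" and l: "0 < l"
  shows "area \<mu> l g \<tau> \<le> liminf (\<lambda>k. area \<mu> l (f k) \<tau>)"
proof -
  have [measurable]: "Re \<in> borel_measurable \<mu>" "Im \<in> borel_measurable \<mu>" by (auto intro: borel_mu)
  note m [measurable]
  note cone_indicator_measurable [measurable]
  have "area \<mu> l g \<tau> = (\<integral>\<^sup>+s. liminf (\<lambda>k. ennreal (cmod (f k s) powr l / Re s) * indicator (cone \<tau>) s) \<partial>\<mu>)"
    unfolding area_def
  proof (rule nn_integral_cong)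
    fix s assume s: "s \<in> space \<mu>"
    then have "Re s \<noteq> 0" by (simp add: space_mu half_plane_def)
    then have "(\<lambda>k. ennreal (cmod (f k s) powr l / Re s)) \<longlonglongrightarrow> ennreal (cmod (g s) powr l / Re s)"
      using s l by (intro tendsto_intros tendsto_powr' lim) (auto simp: space_mu)
    then have "(\<lambda>k. ennreal (cmod (f k s) powr l / Re s) * indicator (cone \<tau>) s) \<longlonglongrightarrow> ennreal (cmod (g s) powr l / Re s) * indicator (cone \<tau>) s"
      by (cases "s \<in> cone \<tau>") auto
    then show "ennreal (cmod (g s) powr l / Re s) * indicator (cone \<tau>) s = liminf (\<lambda>k. ennreal (cmod (f k s) powr l / Re s) * indicator (cone \<tau>) s)"
      by (simp add: lim_imp_Liminf)
  qed
  also have "\<dots> \<le> liminf (\<lambda>k. area \<mu> l (f k) \<tau>)"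
    unfolding area_def by (rule nn_integral_liminf) measurable
  finally show ?thesis .
qed

text \<open>A triangle inequality that keeps the constant of one summand near 1. With a difference
  as the other summand, it compares the area functions of two close functions in both
  directions.\<close>

lemma area_add_le:
  assumes f: "f \<in> borel_measurable \<mu>" and g: "g \<in> borel_measurable \<mu>" and h: "\<And>s. s \<in> half_plane \<Longrightarrow> cmod (h s) \<le> cmod (f s) + cmod (g s)"
    and l: "0 < l" and k: "0 < k"
  shows "area \<mu> l h \<tau> \<le> ennreal ((1 + k) powr l) * area \<mu> l f \<tau> + ennreal ((1 + 1/k) powr l) * area \<mu> l g \<tau>"
proof -
  have [measurable]: "Re \<in> borel_measurable \<mu>" "Im \<in> borel_measurable \<mu>" by (auto intro: borel_mu)
  note f [measurable] g [measurable]
  note cone_indicator_measurable [measurable]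
  have "area \<mu> l h \<tau> \<le> (\<integral>\<^sup>+s. ennreal ((1 + k) powr l) * (ennreal (cmod (f s) powr l / Re s) * indicator (cone \<tau>) s)
      + ennreal ((1 + 1/k) powr l) * (ennreal (cmod (g s) powr l / Re s) * indicator (cone \<tau>) s) \<partial>\<mu>)"
    unfolding area_def
  proof (rule nn_integral_mono)
    fix s assume "s \<in> space \<mu>"
    then have s: "s \<in> half_plane" "0 < Re s" by (auto simp: space_mu half_plane_def)
    have "ennreal (cmod (h s) powr l) \<le> epow (ennreal (cmod (f s)) + ennreal (cmod (g s))) l"
      using h[OF s(1)] l by (simp add: ennreal_plus[symmetric] del: ennreal_plus) (intro ennreal_leI powr_mono2, auto)
    also have "\<dots> \<le> ennreal ((1 + k) powr l) * epow (ennreal (cmod (f s))) l + ennreal ((1 + 1/k) powr l) * epow (ennreal (cmod (g s))) l"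
      by (rule epow_add_le[OF l k])
    also have "\<dots> = ennreal ((1 + k) powr l * cmod (f s) powr l + (1 + 1/k) powr l * cmod (g s) powr l)"
      by (simp add: ennreal_mult ennreal_plus)
    finally have "cmod (h s) powr l \<le> (1 + k) powr l * cmod (f s) powr l + (1 + 1/k) powr l * cmod (g s) powr l"
      by (subst (asm) ennreal_le_iff) auto
    then have "cmod (h s) powr l / Re s \<le> ((1 + k) powr l * cmod (f s) powr l + (1 + 1/k) powr l * cmod (g s) powr l) / Re s"
      using s by (intro divide_right_mono) auto
    also have "\<dots> = (1 + k) powr l * (cmod (f s) powr l / Re s) + (1 + 1/k) powr l * (cmod (g s) powr l / Re s)"
      by (simp add: add_divide_distrib)
    finally have "ennreal (cmod (h s) powr l / Re s) \<le> ennreal ((1 + k) powr l * (cmod (f s) powr l / Re s) + (1 + 1/k) powr l * (cmod (g s) powr l / Re s))"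
      by (rule ennreal_leI)
    also have "\<dots> = ennreal ((1 + k) powr l) * ennreal (cmod (f s) powr l / Re s) + ennreal ((1 + 1/k) powr l) * ennreal (cmod (g s) powr l / Re s)"
    proof -
      have "0 \<le> (1 + k) powr l * (cmod (f s) powr l / Re s)" "0 \<le> (1 + 1/k) powr l * (cmod (g s) powr l / Re s)"
        using s by simp_all
      then show ?thesis by (simp only: ennreal_plus ennreal_mult'[OF powr_ge_zero])
    qed
    finally have "ennreal (cmod (h s) powr l / Re s) \<le> ennreal ((1 + k) powr l) * ennreal (cmod (f s) powr l / Re s) + ennreal ((1 + 1/k) powr l) * ennreal (cmod (g s) powr l / Re s)" .
    then show "ennreal (cmod (h s) powr l / Re s) * indicator (cone \<tau>) s \<le> ennreal ((1 + k) powr l) * (ennreal (cmod (f s) powr l / Re s) * indicator (cone \<tau>) s)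
      + ennreal ((1 + 1/k) powr l) * (ennreal (cmod (g s) powr l / Re s) * indicator (cone \<tau>) s)"
      by (auto simp: indicator_def)
  qed
  also have "\<dots> = ennreal ((1 + k) powr l) * area \<mu> l f \<tau> + ennreal ((1 + 1/k) powr l) * area \<mu> l g \<tau>"
    unfolding area_def by (subst nn_integral_add) (auto simp: nn_integral_cmult)
  finally show ?thesis .
qed

section \<open>The key estimate\<close>

lemma dpoly_measurable_mu: "P \<in> dirichlet_polys \<Longrightarrow> dpoly P \<omega> \<in> borel_measurable \<mu>"
  by (intro borel_mu borel_measurable_continuous_onI dpoly_continuous)

lemma dpoly_measurable_mu_pair:
  assumes "P \<in> dirichlet_polys"
  shows "(\<lambda>x. dpoly P (fst x) (snd x)) \<in> borel_measurable (torus_measure \<Otimes>\<^sub>M \<mu>)"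
proof -
  have "(\<lambda>x. snd x) \<in> borel_measurable (torus_measure \<Otimes>\<^sub>M \<mu>)"
    using measurable_compose[OF measurable_snd borel_mu[of "\<lambda>x. x"]] by simp
  then show ?thesis by (rule dpoly_measurable[OF assms measurable_fst])
qed

text \<open>The power \<open>l - l0\<close> of the modulus is bounded on the cone by its value at
  the vertex. As \<open>flow_max\<close> is taken of the power \<open>p/2\<close>, the exponent has
  to be \<open>(l - l0) / (p/2)\<close>.\<close>

lemma cone_le_area:
  assumes P: "P \<in> dirichlet_polys" and p: "0 < p" and l: "0 < l0" "l0 < l" and \<omega>: "\<omega> \<in> space torus_measure"
  shows "area \<mu> l (dpoly P \<omega>) \<tau> \<le>
    epow (12 * flow_max (\<lambda>\<omega>. ennreal (cmod (dsum P \<omega>) powr (p/2))) (shift (\<i> * of_real \<tau>) \<omega>)) ((l - l0) / (p/2)) * area \<mu> l0 (dpoly P \<omega>) \<tau>"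
    (is "_ \<le> ?M * _")
proof -
  have [measurable]: "Re \<in> borel_measurable \<mu>" "Im \<in> borel_measurable \<mu>" by (auto intro: borel_mu)
  note dpoly_measurable_mu[OF P, measurable]
  note cone_indicator_measurable [measurable]
  have "area \<mu> l (dpoly P \<omega>) \<tau> \<le> (\<integral>\<^sup>+s. ?M * (ennreal (cmod (dpoly P \<omega> s) powr l0 / Re s) * indicator (cone \<tau>) s) \<partial>\<mu>)"
    unfolding area_def
  proof (rule nn_integral_mono)
    fix s assume "s \<in> space \<mu>"
    then have s: "0 < Re s" by (auto simp: space_mu half_plane_def)
    show "ennreal (cmod (dpoly P \<omega> s) powr l / Re s) * indicator (cone \<tau>) s \<le> ?M * (ennreal (cmod (dpoly P \<omega> s) powr l0 / Re s) * indicator (cone \<tau>) s)"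
    proof (cases "s \<in> cone \<tau>")
      case True
      have "ennreal (cmod (dpoly P \<omega> s) powr (l - l0)) = epow (ennreal (cmod (dpoly P \<omega> s) powr (p/2))) ((l - l0) / (p/2))"
      proof -
        have e: "p / 2 * ((l - l0) / (p / 2)) = l - l0" using p by (simp add: field_simps)
        show ?thesis by (simp only: epow_ennreal powr_ge_zero powr_powr e)
      qed
      also have "\<dots> \<le> ?M" using p l by (intro epow_mono dpoly_le_flow_max[OF P _ \<omega> True]) auto
      finally have *: "ennreal (cmod (dpoly P \<omega> s) powr (l - l0)) \<le> ?M" .
      have "cmod (dpoly P \<omega> s) powr l = cmod (dpoly P \<omega> s) powr (l - l0) * cmod (dpoly P \<omega> s) powr l0"
        by (simp add: powr_add[symmetric])
      then have "ennreal (cmod (dpoly P \<omega> s) powr l / Re s) = ennreal (cmod (dpoly P \<omega> s) powr (l - l0)) * ennreal (cmod (dpoly P \<omega> s) powr l0 / Re s)"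
        by (simp add: ennreal_mult'[symmetric])
      also have "\<dots> \<le> ?M * ennreal (cmod (dpoly P \<omega> s) powr l0 / Re s)" using * by (intro mult_right_mono) auto
      finally show ?thesis using True by simp
    qed simp
  qed
  also have "\<dots> = ?M * area \<mu> l0 (dpoly P \<omega>) \<tau>"
    unfolding area_def by (rule nn_integral_cmult) measurable
  finally show ?thesis .
qed

text \<open>With \<open>r = p / l0\<close> and \<open>\<theta> = (l - l0) / l\<close>, the power
  \<open>p / l\<close> of \<open>cone_le_area\<close> is
  \<open>epow (X\<^sup>2) \<theta> * epow B (1 - \<theta>)\<close>. The factor
  \<open>X\<^sup>2\<close> is integrated by the maximal theorem and \<open>B\<close> by the dual
  estimate, and \<open>epow_interpolation\<close> separates the two.\<close>

theorem area_pow_estimate: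
  assumes p: "0 < p" and l: "0 < l" and C: "0 \<le> C"
    and carleson: "\<And>f. f \<in> hpi_space p \<Longrightarrow> (\<integral>\<^sup>+s. ennreal (cmod (f s) powr p) \<partial>\<mu>) \<le> ennreal C * hpi_integral p f"
    and \<kappa>: "0 < \<kappa>"
  obtains K where "0 \<le> K" "\<And>P. P \<in> dirichlet_polys \<Longrightarrow>
    area_pow \<mu> l p (dpoly P) \<le> ennreal (\<kappa> * hmean p P 0) + ennreal K * (\<integral>\<^sup>+s. ennreal (hmean p P (Re s)) \<partial>\<mu>)"
proof -
  interpret finite_measure \<mu> by (rule fin)
  interpret TM: pair_sigma_finite torus_measure \<mu> ..
  \<comment> \<open>Below \<open>l\<close>, to leave a positive power to the maximal function, and
    at most \<open>p / 2\<close>, to have \<open>r \<ge> 2\<close>.\<close>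
  define l0 where "l0 = min l p / 2"
  have l0: "0 < l0" "l0 < l" using p l by (auto simp: l0_def)
  define r where "r = p / l0"
  have r: "2 \<le> r"
  proof -
    have "2 * l0 \<le> p" by (simp add: l0_def)
    then show ?thesis using l0 by (simp add: r_def le_divide_eq)
  qed
  define \<theta> where "\<theta> = (l - l0) / l"
  have \<theta>: "0 < \<theta>" "\<theta> < 1" "1 - \<theta> = l0 / l" using l0 l by (auto simp: \<theta>_def field_simps)
  \<comment> \<open>The constant 144 is the square of the factor 12 of the cone bound, 64 comes from
    the maximal theorem, and pi is the mass of the weight.\<close>
  define \<kappa>' where "\<kappa>' = \<kappa> / (144 * 64 * pi)"
  have \<kappa>': "0 < \<kappa>'" using \<kappa> by (simp add: \<kappa>'_def)
  define k where "k = \<kappa>' powr (1 / (1 - \<theta>))"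
  have k: "0 < k" "k powr (1 - \<theta>) = \<kappa>'" using \<kappa>' \<theta> by (auto simp: k_def powr_powr)
  define K1 where "K1 = k powr (- \<theta>)"
  obtain C' where C': "0 \<le> C'" "\<And>F. F \<in> borel_measurable \<mu> \<Longrightarrow> (\<And>s. 0 \<le> F s) \<Longrightarrow>
    (\<integral>\<^sup>+\<tau>. epow (\<integral>\<^sup>+s\<in>cone \<tau>. ennreal (F s / Re s) \<partial>\<mu>) r * ennreal (1 / (1 + \<tau>\<^sup>2)) \<partial>lborel)
      \<le> ennreal C' * (\<integral>\<^sup>+s. ennreal (F s powr r) \<partial>\<mu>)"
    using dual_carleson[OF fin sets p C carleson r] by blast
  define K where "K = K1 * C'"
  have K: "0 \<le> K" using C' by (simp add: K_def K1_def)
  have "area_pow \<mu> l p (dpoly P) \<le> ennreal (\<kappa> * hmean p P 0) + ennreal K * (\<integral>\<^sup>+s. ennreal (hmean p P (Re s)) \<partial>\<mu>)"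
    if P: "P \<in> dirichlet_polys" for P
  proof -
    define F where "F = (\<lambda>\<omega>. ennreal (cmod (dsum P \<omega>) powr (p/2)))"
    have F [measurable]: "F \<in> borel_measurable torus_measure"
      unfolding F_def using dsum_measurable[OF P, of "\<lambda>\<omega>. \<omega>" torus_measure] by measurable
    define Mx where "Mx = (\<lambda>\<omega> \<tau>. (12 * flow_max F (shift (\<i> * of_real \<tau>) \<omega>))\<^sup>2)"
    define B where "B = (\<lambda>\<omega> \<tau>. epow (area \<mu> l0 (dpoly P \<omega>) \<tau>) r)"
    have am: "(\<lambda>x. area \<mu> l0 (dpoly P (fst x)) (snd x)) \<in> borel_measurable (torus_measure \<Otimes>\<^sub>M borel)"
      by (rule area_measurable[OF dpoly_measurable_mu_pair[OF P]])
    have B_m [measurable]: "(\<lambda>x. B (fst x) (snd x)) \<in> borel_measurable (torus_measure \<Otimes>\<^sub>M lborel)"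
      unfolding B_def using am by measurable
    have B_m1 [measurable]: "B \<omega> \<in> borel_measurable borel" for \<omega>
      unfolding B_def using area_measurable1[OF dpoly_measurable_mu[OF P]] by measurable
    have Mx_m [measurable]: "(\<lambda>x. Mx (fst x) (snd x)) \<in> borel_measurable (torus_measure \<Otimes>\<^sub>M lborel)"
      unfolding Mx_def by measurable
    have Mx_m1 [measurable]: "Mx \<omega> \<in> borel_measurable borel" if "\<omega> \<in> space torus_measure" for \<omega>
    proof -
      have "(\<lambda>\<tau>. flow_max F (shift (\<i> * of_real \<tau>) \<omega>)) \<in> borel_measurable borel"
        by (rule flow_measurable) (use that in auto)
      then show ?thesis unfolding Mx_def by measurable
    qed
    have pt: "epow (area \<mu> l (dpoly P \<omega>) \<tau>) (p / l) * cauchy_weight \<tau> \<le>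
        ennreal \<kappa>' * (Mx \<omega> \<tau> * cauchy_weight \<tau>) + ennreal K1 * (B \<omega> \<tau> * cauchy_weight \<tau>)"
      if \<omega>: "\<omega> \<in> space torus_measure" for \<omega> \<tau>
    proof -
      define X where "X = 12 * flow_max F (shift (\<i> * of_real \<tau>) \<omega>)"
      have "area \<mu> l (dpoly P \<omega>) \<tau> \<le> epow X ((l - l0) / (p/2)) * area \<mu> l0 (dpoly P \<omega>) \<tau>"
        unfolding X_def F_def by (rule cone_le_area[OF P p l0 \<omega>])
      then have "epow (area \<mu> l (dpoly P \<omega>) \<tau>) (p / l) \<le> epow (epow X ((l - l0) / (p/2)) * area \<mu> l0 (dpoly P \<omega>) \<tau>) (p / l)"
        using p l by (intro epow_mono) auto
      also have "\<dots> = epow X ((l - l0) / (p/2) * (p / l)) * epow (area \<mu> l0 (dpoly P \<omega>) \<tau>) (p / l)"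
        using p l l0 by (simp add: epow_mult epow_epow)
      also have "(l - l0) / (p/2) * (p / l) = 2 * \<theta>" using p l by (simp add: \<theta>_def field_simps)
      also have "epow X (2 * \<theta>) = epow (X\<^sup>2) \<theta>"
      proof -
        have "X\<^sup>2 = epow X 2" by (cases X) (auto simp: power2_eq_square ennreal_mult'[symmetric] powr_numeral ennreal_top_mult)
        then show ?thesis by (simp add: epow_epow)
      qed
      also have "epow (area \<mu> l0 (dpoly P \<omega>) \<tau>) (p / l) = epow (B \<omega> \<tau>) (1 - \<theta>)"
      proof -
        have "p / l = r * (1 - \<theta>)" using l0 l by (simp add: \<theta>(3) r_def)
        then show ?thesis using r by (simp only: B_def epow_epow)
      qed
      also have "epow (X\<^sup>2) \<theta> * epow (B \<omega> \<tau>) (1 - \<theta>) \<le> ennreal (k powr (1 - \<theta>)) * X\<^sup>2 + ennreal (k powr (- \<theta>)) * B \<omega> \<tau>"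
        by (rule epow_interpolation[OF \<theta>(1,2) k(1)])
      finally have "epow (area \<mu> l (dpoly P \<omega>) \<tau>) (p / l) \<le> ennreal \<kappa>' * Mx \<omega> \<tau> + ennreal K1 * B \<omega> \<tau>"
        unfolding k(2) K1_def Mx_def X_def .
      then have "epow (area \<mu> l (dpoly P \<omega>) \<tau>) (p / l) * cauchy_weight \<tau> \<le> (ennreal \<kappa>' * Mx \<omega> \<tau> + ennreal K1 * B \<omega> \<tau>) * cauchy_weight \<tau>"
        by (rule mult_right_mono) simp
      then show ?thesis by (simp add: distrib_right mult.assoc)
    qed
    have "area_pow \<mu> l p (dpoly P) \<le> (\<integral>\<^sup>+\<omega>. (\<integral>\<^sup>+\<tau>. ennreal \<kappa>' * (Mx \<omega> \<tau> * cauchy_weight \<tau>) + ennreal K1 * (B \<omega> \<tau> * cauchy_weight \<tau>) \<partial>lborel) \<partial>torus_measure)"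
      unfolding area_pow_def by (intro nn_integral_mono pt)
    also have "\<dots> = (\<integral>\<^sup>+\<omega>. ennreal \<kappa>' * (\<integral>\<^sup>+\<tau>. Mx \<omega> \<tau> * cauchy_weight \<tau> \<partial>lborel) + ennreal K1 * (\<integral>\<^sup>+\<tau>. B \<omega> \<tau> * cauchy_weight \<tau> \<partial>lborel) \<partial>torus_measure)"
      by (intro nn_integral_cong) (simp add: nn_integral_add nn_integral_cmult)
    also have "\<dots> = ennreal \<kappa>' * (\<integral>\<^sup>+\<omega>. (\<integral>\<^sup>+\<tau>. Mx \<omega> \<tau> * cauchy_weight \<tau> \<partial>lborel) \<partial>torus_measure) + ennreal K1 * (\<integral>\<^sup>+\<omega>. (\<integral>\<^sup>+\<tau>. B \<omega> \<tau> * cauchy_weight \<tau> \<partial>lborel) \<partial>torus_measure)"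
    proof -
      have "(\<lambda>\<omega>. \<integral>\<^sup>+\<tau>. Mx \<omega> \<tau> * cauchy_weight \<tau> \<partial>lborel) \<in> borel_measurable torus_measure"
        by (rule lborel.borel_measurable_nn_integral) (simp add: case_prod_unfold)
      moreover have "(\<lambda>\<omega>. \<integral>\<^sup>+\<tau>. B \<omega> \<tau> * cauchy_weight \<tau> \<partial>lborel) \<in> borel_measurable torus_measure"
        by (rule lborel.borel_measurable_nn_integral) (simp add: case_prod_unfold)
      ultimately show ?thesis by (simp add: nn_integral_add nn_integral_cmult)
    qed
    also have "\<dots> \<le> ennreal (\<kappa> * hmean p P 0) + ennreal K * (\<integral>\<^sup>+s. ennreal (hmean p P (Re s)) \<partial>\<mu>)"
    proof (rule add_mono)
      have "(\<integral>\<^sup>+\<omega>. (\<integral>\<^sup>+\<tau>. Mx \<omega> \<tau> * cauchy_weight \<tau> \<partial>lborel) \<partial>torus_measure) = (\<integral>\<^sup>+\<tau>. (\<integral>\<^sup>+\<omega>. Mx \<omega> \<tau> * cauchy_weight \<tau> \<partial>torus_measure) \<partial>lborel)"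
        by (rule torus_line.Fubini'[symmetric]) (simp add: case_prod_unfold)
      also have "\<dots> = (\<integral>\<^sup>+\<tau>. (\<integral>\<^sup>+\<omega>. (12 * flow_max F \<omega>)\<^sup>2 \<partial>torus_measure) * cauchy_weight \<tau> \<partial>lborel)"
      proof (rule nn_integral_cong)
        fix \<tau> :: real
        have m: "(\<lambda>\<omega>. (12 * flow_max F \<omega>)\<^sup>2) \<in> borel_measurable torus_measure" by measurable
        have m': "(\<lambda>\<omega>. Mx \<omega> \<tau>) \<in> borel_measurable torus_measure" unfolding Mx_def by measurable
        have "(\<integral>\<^sup>+\<omega>. Mx \<omega> \<tau> * cauchy_weight \<tau> \<partial>torus_measure) = (\<integral>\<^sup>+\<omega>. Mx \<omega> \<tau> \<partial>torus_measure) * cauchy_weight \<tau>"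
          by (rule nn_integral_multc[OF m'])
        also have "(\<integral>\<^sup>+\<omega>. Mx \<omega> \<tau> \<partial>torus_measure) = (\<integral>\<^sup>+\<omega>. (12 * flow_max F \<omega>)\<^sup>2 \<partial>torus_measure)"
          unfolding Mx_def by (rule nn_integral_torus_shift[OF m])
        finally show "(\<integral>\<^sup>+\<omega>. Mx \<omega> \<tau> * cauchy_weight \<tau> \<partial>torus_measure) = (\<integral>\<^sup>+\<omega>. (12 * flow_max F \<omega>)\<^sup>2 \<partial>torus_measure) * cauchy_weight \<tau>" .
      qed
      also have "\<dots> = (\<integral>\<^sup>+\<omega>. (12 * flow_max F \<omega>)\<^sup>2 \<partial>torus_measure) * ennreal pi"
        by (simp add: nn_integral_cmult nn_integral_cauchy_weight)
      also have "(\<integral>\<^sup>+\<omega>. (12 * flow_max F \<omega>)\<^sup>2 \<partial>torus_measure) = 144 * (\<integral>\<^sup>+\<omega>. (flow_max F \<omega>)\<^sup>2 \<partial>torus_measure)"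
        by (simp add: power_mult_distrib nn_integral_cmult)
      also have "\<dots> \<le> 144 * (64 * (\<integral>\<^sup>+\<omega>. (F \<omega>)\<^sup>2 \<partial>torus_measure))"
        by (intro mult_left_mono flow_max_L2 F) auto
      also have "(\<integral>\<^sup>+\<omega>. (F \<omega>)\<^sup>2 \<partial>torus_measure) = ennreal (hmean p P 0)"
      proof -
        have "(F \<omega>)\<^sup>2 = ennreal (cmod (dpoly P \<omega> 0) powr p)" for \<omega>
          by (simp add: F_def dpoly_0 power2_eq_square ennreal_mult'[symmetric] powr_add[symmetric])
        then show ?thesis using nn_integral_dpoly[OF P p, of 0] by simp
      qed
      finally have "(\<integral>\<^sup>+\<omega>. (\<integral>\<^sup>+\<tau>. Mx \<omega> \<tau> * cauchy_weight \<tau> \<partial>lborel) \<partial>torus_measure) \<le> 144 * (64 * ennreal (hmean p P 0)) * ennreal pi"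
        by (simp add: mult_right_mono)
      also have "144 * (64 * ennreal (hmean p P 0)) * ennreal pi = ennreal (144 * 64 * pi * hmean p P 0)"
        using hmean_nonneg[OF P, of p 0] by (simp add: ennreal_mult mult_ac)
      finally have "(\<integral>\<^sup>+\<omega>. (\<integral>\<^sup>+\<tau>. Mx \<omega> \<tau> * cauchy_weight \<tau> \<partial>lborel) \<partial>torus_measure) \<le> ennreal (144 * 64 * pi * hmean p P 0)" .
      then have "ennreal \<kappa>' * (\<integral>\<^sup>+\<omega>. (\<integral>\<^sup>+\<tau>. Mx \<omega> \<tau> * cauchy_weight \<tau> \<partial>lborel) \<partial>torus_measure) \<le> ennreal \<kappa>' * ennreal (144 * 64 * pi * hmean p P 0)"
        by (intro mult_left_mono) auto
      also have "\<dots> = ennreal (\<kappa>' * (144 * 64 * pi * hmean p P 0))" using \<kappa>' by (simp add: ennreal_mult')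
      also have "\<kappa>' * (144 * 64 * pi * hmean p P 0) = \<kappa> * hmean p P 0" by (simp add: \<kappa>'_def)
      finally show "ennreal \<kappa>' * (\<integral>\<^sup>+\<omega>. (\<integral>\<^sup>+\<tau>. Mx \<omega> \<tau> * cauchy_weight \<tau> \<partial>lborel) \<partial>torus_measure) \<le> ennreal (\<kappa> * hmean p P 0)" .
      have "(\<integral>\<^sup>+\<omega>. (\<integral>\<^sup>+\<tau>. B \<omega> \<tau> * cauchy_weight \<tau> \<partial>lborel) \<partial>torus_measure) \<le> (\<integral>\<^sup>+\<omega>. ennreal C' * (\<integral>\<^sup>+s. ennreal (cmod (dpoly P \<omega> s) powr p) \<partial>\<mu>) \<partial>torus_measure)"
      proof (rule nn_integral_mono)
        fix \<omega>
        have "(\<lambda>s. cmod (dpoly P \<omega> s) powr l0) \<in> borel_measurable \<mu>" using dpoly_measurable_mu[OF P] by measurable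
        from C'(2)[OF this] have "(\<integral>\<^sup>+\<tau>. B \<omega> \<tau> * cauchy_weight \<tau> \<partial>lborel) \<le> ennreal C' * (\<integral>\<^sup>+s. ennreal ((cmod (dpoly P \<omega> s) powr l0) powr r) \<partial>\<mu>)"
          by (simp add: B_def area_def cauchy_weight_def)
        then show "(\<integral>\<^sup>+\<tau>. B \<omega> \<tau> * cauchy_weight \<tau> \<partial>lborel) \<le> ennreal C' * (\<integral>\<^sup>+s. ennreal (cmod (dpoly P \<omega> s) powr p) \<partial>\<mu>)"
          using l0 by (simp add: powr_powr r_def)
      qed
      also have "\<dots> = ennreal C' * (\<integral>\<^sup>+\<omega>. (\<integral>\<^sup>+s. ennreal (cmod (dpoly P \<omega> s) powr p) \<partial>\<mu>) \<partial>torus_measure)"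
      proof (rule nn_integral_cmult)
        show "(\<lambda>\<omega>. \<integral>\<^sup>+s. ennreal (cmod (dpoly P \<omega> s) powr p) \<partial>\<mu>) \<in> borel_measurable torus_measure"
          using dpoly_measurable_mu_pair[OF P] by (intro borel_measurable_nn_integral) (simp add: case_prod_unfold)
      qed
      also have "(\<integral>\<^sup>+\<omega>. (\<integral>\<^sup>+s. ennreal (cmod (dpoly P \<omega> s) powr p) \<partial>\<mu>) \<partial>torus_measure) = (\<integral>\<^sup>+s. (\<integral>\<^sup>+\<omega>. ennreal (cmod (dpoly P \<omega> s) powr p) \<partial>torus_measure) \<partial>\<mu>)"
        using dpoly_measurable_mu_pair[OF P] by (intro TM.Fubini'[symmetric]) (simp add: case_prod_unfold)
      also have "\<dots> = (\<integral>\<^sup>+s. ennreal (hmean p P (Re s)) \<partial>\<mu>)"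
        by (intro nn_integral_cong nn_integral_dpoly[OF P p]) (simp add: space_mu half_plane_def)
      finally have "ennreal K1 * (\<integral>\<^sup>+\<omega>. (\<integral>\<^sup>+\<tau>. B \<omega> \<tau> * cauchy_weight \<tau> \<partial>lborel) \<partial>torus_measure) \<le> ennreal K1 * (ennreal C' * (\<integral>\<^sup>+s. ennreal (hmean p P (Re s)) \<partial>\<mu>))"
        by (intro mult_left_mono) auto
      then show "ennreal K1 * (\<integral>\<^sup>+\<omega>. (\<integral>\<^sup>+\<tau>. B \<omega> \<tau> * cauchy_weight \<tau> \<partial>lborel) \<partial>torus_measure) \<le> ennreal K * (\<integral>\<^sup>+s. ennreal (hmean p P (Re s)) \<partial>\<mu>)"
        using C' by (simp add: K_def K1_def ennreal_mult mult.assoc)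
    qed
    finally show ?thesis .
  qed
  with K show ?thesis by (rule that)
qed

end


section \<open>Bounded embeddings\<close>

lemma hpi_integral_scale:
  assumes p: "0 < p" and c: "0 \<le> c" and f: "f holomorphic_on half_plane"
  shows "hpi_integral p (\<lambda>s. of_real c * f s) = ennreal (c powr p) * hpi_integral p f"
proof -
  have "ennreal (1 / pi) * (\<integral>\<^sup>+t. ennreal (cmod (of_real c * f (Complex \<sigma> t)) powr p / (1 + t\<^sup>2)) \<partial>lborel) =
    ennreal (c powr p) * (ennreal (1 / pi) * (\<integral>\<^sup>+t. ennreal (cmod (f (Complex \<sigma> t)) powr p / (1 + t\<^sup>2)) \<partial>lborel))"
    if \<sigma>: "\<sigma> \<in> {0<..}" for \<sigma>
  proof -
    have "continuous_on UNIV (\<lambda>t. f (Complex \<sigma> t))"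
      by (rule continuous_on_compose2[OF holomorphic_on_imp_continuous_on[OF f]])
         (use \<sigma> in \<open>auto simp: half_plane_def Complex_eq intro!: continuous_intros\<close>)
    then have [measurable]: "(\<lambda>t. f (Complex \<sigma> t)) \<in> borel_measurable borel"
      by (rule borel_measurable_continuous_onI)
    have "(\<integral>\<^sup>+t. ennreal (cmod (of_real c * f (Complex \<sigma> t)) powr p / (1 + t\<^sup>2)) \<partial>lborel) =
      (\<integral>\<^sup>+t. ennreal (c powr p) * ennreal (cmod (f (Complex \<sigma> t)) powr p / (1 + t\<^sup>2)) \<partial>lborel)"
      using c by (intro nn_integral_cong) (simp add: norm_mult powr_mult ennreal_mult'[symmetric])
    also have "\<dots> = ennreal (c powr p) * (\<integral>\<^sup>+t. ennreal (cmod (f (Complex \<sigma> t)) powr p / (1 + t\<^sup>2)) \<partial>lborel)"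
      by (rule nn_integral_cmult) measurable
    finally show ?thesis by (simp add: mult_ac)
  qed
  then show ?thesis
    unfolding hpi_integral_def by (subst SUP_mult_left_ennreal) (intro SUP_cong refl)
qed

text \<open>The open balls around 0 with integral radii cover the compact closure of the unit ball;
  finitely many of them suffice, so the unit ball is bounded in the target.\<close>

lemma compact_embedding_unit_ball:
  assumes p: "0 < p" and cm: "compact_map (hpi_space p) (hpi_norm p) (lp_topology \<mu> p) (\<lambda>f. f)"
  obtains C where "0 < C" "\<And>f. f \<in> hpi_space p \<Longrightarrow> hpi_integral p f \<le> 1 \<Longrightarrow> f \<in> lp_space \<mu> p \<and> lp_pow \<mu> p f \<le> ennreal C"
proof -
  define B where "B = {f \<in> hpi_space p. hpi_integral p f \<le> 1}"
  have "hpi_norm p f \<le> 1" if "f \<in> B" for f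
  proof -
    have "enn2real (hpi_integral p f) \<le> 1" using that enn2real_mono[of "hpi_integral p f" 1] by (simp add: B_def)
    then show ?thesis using p powr_mono2[of "1/p" "enn2real (hpi_integral p f)" 1] by (simp add: hpi_norm_def)
  qed
  moreover have "B \<subseteq> hpi_space p" by (auto simp: B_def)
  ultimately have "relatively_compact_in (lp_topology \<mu> p) B"
    using cm unfolding compact_map_def by (metis image_ident)
  then have BX: "B \<subseteq> lp_space \<mu> p" and cpt: "compactin (lp_topology \<mu> p) (lp_topology \<mu> p closure_of B)"
    by (auto simp: relatively_compact_in_def)
  have Bcl: "B \<subseteq> lp_topology \<mu> p closure_of B" using BX by (simp add: closure_of_subset)
  define U where "U n = lp_ball \<mu> p (\<lambda>_. 0) (real n + 1)" for n :: nat
  have zero: "(\<lambda>_. 0) \<in> lp_space \<mu> p" using p by (simp add: lp_space_iff[OF p] lp_pow_def)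
  have U: "F \<in> U n \<longleftrightarrow> F \<in> lp_space \<mu> p \<and> lp_norm \<mu> p F < real n + 1" for F n by (simp add: U_def lp_ball_def)
  have "openin (lp_topology \<mu> p) (U n)" for n unfolding U_def by (rule openin_lp_ball[OF p zero]) simp
  moreover have "lp_topology \<mu> p closure_of B \<subseteq> \<Union> (range U)"
  proof
    fix F assume "F \<in> lp_topology \<mu> p closure_of B"
    then have F: "F \<in> lp_space \<mu> p" using closure_of_subset_topspace[of "lp_topology \<mu> p" B] by auto
    obtain n :: nat where "lp_norm \<mu> p F < real n" using reals_Archimedean2 by blast
    then have "F \<in> U n" using F by (simp add: U)
    then show "F \<in> \<Union> (range U)" by blast
  qed
  ultimately obtain \<F> where \<F>: "finite \<F>" "\<F> \<subseteq> range U" "lp_topology \<mu> p closure_of B \<subseteq> \<Union> \<F>"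
    using compactinD[OF cpt, of "range U"] by (metis (no_types, lifting) rangeE)
  then obtain I where I: "finite I" "\<F> = U ` I" by (meson finite_subset_image)
  define n where "n = Max (insert 0 I)"
  show ?thesis
  proof (rule that)
    show "0 < (real n + 1) powr p" by (simp add: add_nonneg_eq_0_iff)
    fix f assume "f \<in> hpi_space p" "hpi_integral p f \<le> 1"
    then have f: "f \<in> B" by (simp add: B_def)
    then obtain i where i: "i \<in> I" "f \<in> U i" using \<F>(3) Bcl unfolding I by blast
    have "i \<le> n" using I i by (simp add: n_def)
    then have "lp_norm \<mu> p f < real n + 1" using i by (simp add: U)
    moreover have fl: "f \<in> lp_space \<mu> p" using f BX by blast
    ultimately have "lp_pow \<mu> p f < ennreal ((real n + 1) powr p)" by (subst (asm) lp_norm_less_iff[OF p]) auto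
    then show "f \<in> lp_space \<mu> p \<and> lp_pow \<mu> p f \<le> ennreal ((real n + 1) powr p)" using fl by simp
  qed
qed

text \<open>Homogeneity extends the bound on the unit ball to the whole space.\<close>

theorem compact_embedding_bounded:
  assumes p: "0 < p" and cm: "compact_map (hpi_space p) (hpi_norm p) (lp_topology \<mu> p) (\<lambda>f. f)"
  obtains C where "0 \<le> C" "\<And>f. f \<in> hpi_space p \<Longrightarrow> (\<integral>\<^sup>+s. ennreal (cmod (f s) powr p) \<partial>\<mu>) \<le> ennreal C * hpi_integral p f"
proof -
  obtain C where C: "0 < C" "\<And>f. f \<in> hpi_space p \<Longrightarrow> hpi_integral p f \<le> 1 \<Longrightarrow> f \<in> lp_space \<mu> p \<and> lp_pow \<mu> p f \<le> ennreal C"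
    using compact_embedding_unit_ball[OF assms] by metis
  have "(\<integral>\<^sup>+s. ennreal (cmod (f s) powr p) \<partial>\<mu>) \<le> ennreal C * hpi_integral p f" if f: "f \<in> hpi_space p" for f
  proof -
    have fin: "hpi_integral p f < \<infinity>" and hol: "f holomorphic_on half_plane" using f by (auto simp: hpi_space_def)
    then obtain h where h: "0 \<le> h" "hpi_integral p f = ennreal h" by (cases "hpi_integral p f") auto
    \<comment> \<open>Scaling by a positive \<open>t \<ge> h\<close> instead of \<open>h\<close>
      itself covers the case \<open>h = 0\<close>; afterwards \<open>t\<close> decreases to
      \<open>h\<close>.\<close>
    have key: "lp_pow \<mu> p f \<le> ennreal (C * t)" if t: "0 < t" "h \<le> t" for t
    proof -
      have sc: "(t powr (- (1/p))) powr p = 1 / t" using p t by (simp add: powr_powr powr_minus_divide powr_divide)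
      define g where "g s = of_real (t powr (- (1/p))) * f s" for s
      have "hpi_integral p g = ennreal ((t powr (- (1/p))) powr p) * hpi_integral p f"
        unfolding g_def by (rule hpi_integral_scale[OF p _ hol]) simp
      also have "\<dots> = ennreal (h / t)"
        using t h by (simp add: sc ennreal_mult'[symmetric])
      finally have gi: "hpi_integral p g = ennreal (h / t)" .
      moreover have "ennreal (h / t) \<le> 1" using t h by (simp add: ennreal_le_1)
      moreover have "g \<in> hpi_space p"
        unfolding hpi_space_def using gi hol by (auto simp: g_def[abs_def] intro!: holomorphic_intros)
      ultimately have g: "g \<in> lp_space \<mu> p" "lp_pow \<mu> p g \<le> ennreal C" using C(2) by auto
      note lp_space_measurable[OF p g(1), measurable]
      have "cmod (f s) powr p = t * cmod (g s) powr p" for s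
        using t unfolding g_def norm_mult by (simp add: powr_mult sc)
      then have "lp_pow \<mu> p f = (\<integral>\<^sup>+s. ennreal t * ennreal (cmod (g s) powr p) \<partial>\<mu>)"
        unfolding lp_pow_def using t by (intro nn_integral_cong) (simp add: ennreal_mult'[symmetric])
      also have "\<dots> = ennreal t * lp_pow \<mu> p g" unfolding lp_pow_def by (rule nn_integral_cmult) measurable
      also have "\<dots> \<le> ennreal t * ennreal C" by (intro mult_left_mono g) simp
      finally show ?thesis using t C by (simp add: ennreal_mult'[symmetric] mult.commute)
    qed
    have "lp_pow \<mu> p f \<le> ennreal (C * h)"
    proof (rule ennreal_le_epsilon)
      fix e :: real assume e: "0 < e"
      have "lp_pow \<mu> p f \<le> ennreal (C * (h + e / C))" using C e h by (intro key) (auto intro!: add_nonneg_pos)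
      also have "C * (h + e / C) = C * h + e" using C by (simp add: field_simps)
      finally show "lp_pow \<mu> p f \<le> ennreal (C * h) + ennreal e" using C h e by simp
    qed
    then show ?thesis using h C by (simp add: lp_pow_def ennreal_mult)
  qed
  then show ?thesis using that[of C] C(1) by simp
qed

text \<open>The constant function 1 has norm 1, because \<open>1 / (1 + t\<^sup>2)\<close> has
  integral pi.\<close>

lemma compact_embedding_finite_measure:
  assumes p: "0 < p" and C: "0 \<le> C"
    and carleson: "\<And>f. f \<in> hpi_space p \<Longrightarrow> (\<integral>\<^sup>+s. ennreal (cmod (f s) powr p) \<partial>\<mu>) \<le> ennreal C * hpi_integral p f"
  shows "finite_measure \<mu>"
proof (rule finite_measureI)
  have i: "hpi_integral p (\<lambda>_. 1) = 1"
    using nn_integral_cauchy_weight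
    by (simp add: hpi_integral_def cauchy_weight_def ennreal_mult'[symmetric])
  then have "(\<lambda>_. 1) \<in> hpi_space p" by (simp add: hpi_space_def)
  from carleson[OF this] have "emeasure \<mu> (space \<mu>) \<le> ennreal C" by (simp add: i)
  then show "emeasure \<mu> (space \<mu>) \<noteq> \<infinity>" by (auto simp: top_unique)
qed

text \<open>The horizontal translate by \<open>\<delta>\<close> is again a Dirichlet polynomial, to
  which \<open>hmean_le\<close> applies.\<close>

lemma hmean_antimono:
  assumes D: "D \<in> dirichlet_polys" and p: "0 < p" and \<sigma>: "0 \<le> \<delta>" "\<delta> \<le> \<sigma>"
  shows "hmean p D \<sigma> \<le> hmean p D \<delta>"
proof -
  define D' where "D' n = D n * of_nat n powr (- of_real \<delta>)" for n
  have nz: "D' n \<noteq> 0 \<longleftrightarrow> D n \<noteq> 0" for n using support(2)[OF D, of n] by (auto simp: D'_def)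
  then have D': "D' \<in> dirichlet_polys" using D nz[of 0] by (auto simp: dirichlet_polys_def)
  have "dpoly D' \<omega> s = dpoly D \<omega> (s + of_real \<delta>)" for \<omega> s
    unfolding dpoly_eq[OF D] dpoly_eq[OF D'] nz by (simp add: D'_def powr_add powr_diff mult_ac)
      (simp add: powr_minus_divide)
  then have eq: "hmean p D' x = hmean p D (x + \<delta>)" for x by (simp add: hmean_def)
  show ?thesis using hmean_le[OF D' p, of "\<sigma> - \<delta>"] \<sigma> by (simp add: eq)
qed


section \<open>Vertical limits\<close>

lemma cone_open: "open (cone \<tau>)"
proof -
  have "cone \<tau> = {s. 0 < Re s} \<inter> {s. \<bar>Im s - \<tau>\<bar> < Re s}" by (auto simp: cone_def half_plane_def)
  then show ?thesis by (auto intro!: open_Int open_Collect_less continuous_intros)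
qed

lemma half_plane_open: "open half_plane"
  unfolding half_plane_def by (intro open_Collect_less continuous_intros)

text \<open>Countably many cones exhaust the half-plane, so bounds that hold for almost every
  character on one cone hold for almost every character on all of these cones at once.\<close>

lemma half_plane_in_rational_cone:
  assumes "s \<in> half_plane" obtains \<tau> where "\<tau> \<in> \<rat>" "s \<in> cone \<tau>"
proof -
  have "Im s - Re s < Im s + Re s" using assms by (simp add: half_plane_def)
  from Rats_dense_in_real[OF this] obtain \<tau> where \<tau>: "\<tau> \<in> \<rat>" "Im s - Re s < \<tau>" "\<tau> < Im s + Re s" by blast
  moreover have "s \<in> cone \<tau>" using assms \<tau> by (auto simp: cone_def)
  ultimately show ?thesis using that by blast
qed

text \<open>Two extensions agree where both series converge, hence everywhere by the identity
  theorem. The choice in \<open>vertical_limit\<close> therefore does not affect its values on the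
  half-plane.\<close>

lemma vertical_limit_eq:
  assumes g: "is_vertical_limit a \<omega> g" and s: "s \<in> half_plane"
  shows "vertical_limit a \<omega> s = g s"
proof -
  define h where "h = (SOME g. is_vertical_limit a \<omega> g)"
  have h: "is_vertical_limit a \<omega> h" unfolding h_def by (rule someI[of "is_vertical_limit a \<omega>" g, OF g])
  obtain x where x: "0 < x" "\<And>s. x < Re s \<Longrightarrow> (\<lambda>n. a n * torus_char \<omega> n * of_nat n powr (- s)) sums g s"
    using g by (auto simp: is_vertical_limit_def)
  obtain y where y: "0 < y" "\<And>s. y < Re s \<Longrightarrow> (\<lambda>n. a n * torus_char \<omega> n * of_nat n powr (- s)) sums h s"
    using h by (auto simp: is_vertical_limit_def)
  have "h s = g s"
  proof (rule analytic_continuation_open[of "{s. max x y < Re s}" half_plane h g])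
    show "open {s. max x y < Re s}" by (intro open_Collect_less continuous_intros)
    have "of_real (max x y + 1) \<in> {s. max x y < Re s}" by (simp del: max_less_iff_conj)
    then show "{s. max x y < Re s} \<noteq> {}" by blast
    show "connected half_plane"
      using convex_halfspace_Re_gt[of 0] by (intro convex_connected) (simp add: half_plane_def)
    show "{s. max x y < Re s} \<subseteq> half_plane" using x by (auto simp: half_plane_def)
    show "h z = g z" if "z \<in> {s. max x y < Re s}" for z
      using that by (intro sums_unique2[OF y(2) x(2)]) auto
  qed (use g h s half_plane_open in \<open>auto simp: is_vertical_limit_def\<close>)
  then show ?thesis using g by (auto simp: vertical_limit_def h_def)
qed

section \<open>Sequences of polynomials that represent an element of the completion\<close>

context
  fixes p :: real and P :: "nat \<Rightarrow> nat \<Rightarrow> complex" and a :: "nat \<Rightarrow> complex"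
  assumes p: "0 < p" and repr: "completion_repr p P a"
begin

lemma completion_repr_poly: "P k \<in> dirichlet_polys"
  using repr by (simp add: completion_repr_def)

lemma completion_repr_coeff: "(\<lambda>k. P k n) \<longlonglongrightarrow> a n"
  using repr by (simp add: completion_repr_def)

lemma completion_repr_cauchy:
  assumes \<epsilon>: "0 < \<epsilon>"
  shows "\<exists>K. \<forall>j\<ge>K. \<forall>k\<ge>K. hmean p (\<lambda>n. P j n - P k n) 0 < \<epsilon>"
proof -
  have "0 < \<epsilon> powr (1/p)" using \<epsilon> by simp
  then obtain K where K: "\<And>j k. K \<le> j \<Longrightarrow> K \<le> k \<Longrightarrow> dirichlet_poly_norm p (\<lambda>n. P j n - P k n) < \<epsilon> powr (1/p)"
    using repr unfolding completion_repr_def by meson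
  have "hmean p (\<lambda>n. P j n - P k n) 0 < \<epsilon>" if "K \<le> j" "K \<le> k" for j k
  proof -
    have "dirichlet_poly_norm p (\<lambda>n. P j n - P k n) powr p < (\<epsilon> powr (1/p)) powr p"
      by (intro powr_less_mono2 p K that) (simp add: dirichlet_poly_norm_def lp_norm_def)
    then show ?thesis
      using p \<epsilon> by (simp add: dirichlet_poly_norm_powr[OF dirichlet_polys_diff[OF completion_repr_poly completion_repr_poly] p] powr_powr)
  qed
  then show ?thesis by blast
qed

text \<open>Beyond some index \<open>K\<close> all members stay close to \<open>P K\<close>; the
  finitely many earlier ones are simply added to the bound.\<close>

lemma completion_repr_bounded:
  obtains R where "0 \<le> R" "\<And>k. hmean p (P k) 0 \<le> R"
proof -
  obtain K where K: "\<And>j k. K \<le> j \<Longrightarrow> K \<le> k \<Longrightarrow> hmean p (\<lambda>n. P j n - P k n) 0 < 1"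
    using completion_repr_cauchy[of 1] by auto
  define z :: "nat \<Rightarrow> complex" where "z = (\<lambda>_. 0)"
  have z: "z \<in> dirichlet_polys" by (simp add: z_def dirichlet_polys_def)
  have hz: "hmean p z 0 = 0" using p by (simp add: hmean_def dpoly_0 dsum_def z_def)
  have neg: "hmean p (\<lambda>n. z n - Q n) 0 = hmean p Q 0" if Q: "Q \<in> dirichlet_polys" for Q
  proof -
    have "dsum z \<omega> = 0" for \<omega> by (simp add: z_def dsum_def)
    then show ?thesis by (simp add: hmean_def dpoly_0 dsum_diff[OF z Q])
  qed
  define R0 where "R0 = 2 powr p * (1 + hmean p (P K) 0)"
  define R where "R = R0 + (\<Sum>k<K. hmean p (P k) 0)"
  have h: "0 \<le> hmean p (P k) 0" for k by (rule hmean_nonneg[OF completion_repr_poly])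
  have R0: "0 \<le> R0" using h[of K] by (simp add: R0_def)
  have S: "0 \<le> (\<Sum>k<K. hmean p (P k) 0)" by (intro sum_nonneg h)
  show ?thesis
  proof (rule that)
    show "0 \<le> R" using R0 S by (simp add: R_def)
    fix k
    show "hmean p (P k) 0 \<le> R"
    proof (cases "k < K")
      case True
      then have "hmean p (P k) 0 \<le> (\<Sum>k<K. hmean p (P k) 0)" by (intro member_le_sum h) auto
      then show ?thesis using R0 by (simp add: R_def)
    next
      case False
      have d: "(\<lambda>n. P K n - P k n) \<in> dirichlet_polys" by (intro dirichlet_polys_diff completion_repr_poly)
      have "(\<lambda>n. (P K n - P k n) - P K n) = (\<lambda>n. z n - P k n)" by (simp add: z_def)
      then have "hmean p (P k) 0 = hmean p (\<lambda>n. (P K n - P k n) - P K n) 0"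
        by (simp add: neg[OF completion_repr_poly])
      also have "\<dots> \<le> 2 powr p * (hmean p (\<lambda>n. P K n - P k n) 0 + hmean p (P K) 0)"
        by (rule hmean_diff_le[OF d completion_repr_poly p]) simp
      also have "\<dots> \<le> R0" unfolding R0_def using K[of K k] False by (intro mult_left_mono) auto
      finally show ?thesis using S by (simp add: R_def)
    qed
  qed
qed

text \<open>Indices are chosen recursively beyond the Cauchy thresholds. The rate
  \<open>(1/4) ^ k\<close> still leaves a convergent geometric series after half of it has been
  spent on an almost sure bound.\<close>

lemma completion_repr_fast:
  obtains \<phi> :: "nat \<Rightarrow> nat" where "strict_mono \<phi>" "\<And>k. hmean p (\<lambda>n. P (\<phi> (Suc k)) n - P (\<phi> k) n) 0 \<le> (1/4) ^ k"
proof -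
  have "\<exists>K. \<forall>j\<ge>K. \<forall>k\<ge>K. hmean p (\<lambda>n. P j n - P k n) 0 < (1/4) ^ m" for m :: nat
    by (rule completion_repr_cauchy) simp
  then obtain K where K: "\<And>m j k. K m \<le> j \<Longrightarrow> K m \<le> k \<Longrightarrow> hmean p (\<lambda>n. P j n - P k n) 0 < (1/4) ^ m"
    by metis
  define \<phi> where "\<phi> = rec_nat (K 0) (\<lambda>m x. max (Suc x) (K (Suc m)))"
  have \<phi>: "\<phi> 0 = K 0" "\<phi> (Suc m) = max (Suc (\<phi> m)) (K (Suc m))" for m by (simp_all add: \<phi>_def)
  have ge: "K m \<le> \<phi> m" for m by (cases m) (simp_all add: \<phi>)
  have "\<phi> m < \<phi> (Suc m)" for m by (simp add: \<phi>)
  then have "strict_mono \<phi>" by (simp add: strict_mono_Suc_iff)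
  moreover have "hmean p (\<lambda>n. P (\<phi> (Suc k)) n - P (\<phi> k) n) 0 \<le> (1/4) ^ k" for k
  proof -
    have "K k \<le> \<phi> (Suc k)" using ge[of k] by (simp add: \<phi>)
    then show ?thesis using K[of k "\<phi> (Suc k)" "\<phi> k"] ge[of k] by simp
  qed
  ultimately show ?thesis by (rule that)
qed

end

text \<open>By the maximal theorem the squared maximal functions have integrals that decay like
  \<open>(1/4) ^ k\<close>, so at the vertex they are almost surely bounded by multiples of
  \<open>(1/2) ^ k\<close>. Taking p-th roots gives the bound on the cone.\<close>

lemma fast_sequence_cone_bound:
  assumes p: "0 < p" and D: "\<And>k. D k \<in> dirichlet_polys" and fast: "\<And>k. hmean p (D k) 0 \<le> (1/4) ^ k"
  shows "AE \<omega> in torus_measure. \<exists>B\<ge>0. \<forall>k. \<forall>s\<in>cone \<tau>. cmod (dpoly (D k) \<omega> s) \<le> B * ((1/2) powr (1/p)) ^ k"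
proof -
  define F where "F k = (\<lambda>\<omega>. ennreal (cmod (dsum (D k) \<omega>) powr (p/2)))" for k
  have F [measurable]: "F k \<in> borel_measurable torus_measure" for k
    unfolding F_def using dsum_measurable[OF D, of "\<lambda>\<omega>. \<omega>" torus_measure] by measurable
  define f where "f k \<omega> = (12 * flow_max (F k) (shift (\<i> * of_real \<tau>) \<omega>))\<^sup>2" for k \<omega>
  have sh: "shift (\<i> * of_real \<tau>) \<in> torus_measure \<rightarrow>\<^sub>M torus_measure"
    using shift_measurable[of "\<lambda>\<omega>. \<omega>" torus_measure "\<lambda>_. \<tau>"] by simp
  have "AE \<omega> in torus_measure. \<exists>B\<ge>0. \<forall>k. f k \<omega> \<le> ennreal (B * (1/2) ^ k)"
  proof (rule geometric_AE_bound[OF p, of _ _ "144 * 64"])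
    show "f k \<in> borel_measurable torus_measure" for k
      unfolding f_def[abs_def] using measurable_compose[OF sh flow_max_measurable[OF F]] by measurable
    fix k
    have "(\<integral>\<^sup>+\<omega>. f k \<omega> \<partial>torus_measure) = (\<integral>\<^sup>+\<omega>. (12 * flow_max (F k) \<omega>)\<^sup>2 \<partial>torus_measure)"
      unfolding f_def by (rule nn_integral_torus_shift) measurable
    also have "\<dots> = 144 * (\<integral>\<^sup>+\<omega>. (flow_max (F k) \<omega>)\<^sup>2 \<partial>torus_measure)"
      by (simp add: power_mult_distrib nn_integral_cmult)
    also have "\<dots> \<le> 144 * (64 * (\<integral>\<^sup>+\<omega>. (F k \<omega>)\<^sup>2 \<partial>torus_measure))"
      by (intro mult_left_mono flow_max_L2 F) auto
    also have "(\<integral>\<^sup>+\<omega>. (F k \<omega>)\<^sup>2 \<partial>torus_measure) = ennreal (hmean p (D k) 0)"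
    proof -
      have "(F k \<omega>)\<^sup>2 = ennreal (cmod (dpoly (D k) \<omega> 0) powr p)" for \<omega>
        by (simp add: F_def dpoly_0 power2_eq_square ennreal_mult'[symmetric] powr_add[symmetric])
      then show ?thesis using nn_integral_dpoly[OF D p, of 0] by simp
    qed
    also have "144 * (64 * ennreal (hmean p (D k) 0)) = ennreal (144 * 64 * hmean p (D k) 0)"
      by (simp add: ennreal_mult' mult.assoc[symmetric])
    also have "\<dots> \<le> ennreal (144 * 64 * (1/4) ^ k)" using fast[of k] by (intro ennreal_leI) simp
    finally show "(\<integral>\<^sup>+\<omega>. f k \<omega> \<partial>torus_measure) \<le> ennreal (144 * 64 * (1/4) ^ k)" .
  qed simp
  with AE_space show ?thesis
  proof eventually_elim
    case (elim \<omega>)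
    then obtain B where B: "0 \<le> B" "\<And>k. f k \<omega> \<le> ennreal (B * (1/2) ^ k)" by blast
    have "cmod (dpoly (D k) \<omega> s) \<le> B powr (1/p) * ((1/2) powr (1/p)) ^ k" if s: "s \<in> cone \<tau>" for k s
    proof -
      have "ennreal (cmod (dpoly (D k) \<omega> s) powr p) = (ennreal (cmod (dpoly (D k) \<omega> s) powr (p/2)))\<^sup>2"
        by (simp add: power2_eq_square ennreal_mult'[symmetric] powr_add[symmetric])
      also have "\<dots> \<le> f k \<omega>"
        unfolding f_def F_def using p by (intro power_mono dpoly_le_flow_max[OF D _ elim(1) s]) auto
      also have "\<dots> \<le> ennreal (B * (1/2) ^ k)" by (rule B)
      finally have "cmod (dpoly (D k) \<omega> s) powr p \<le> B * (1/2) ^ k" using B by (subst (asm) ennreal_le_iff) auto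
      then have "(cmod (dpoly (D k) \<omega> s) powr p) powr (1/p) \<le> (B * (1/2) ^ k) powr (1/p)"
        using p by (intro powr_mono2) auto
      also have "\<dots> = B powr (1/p) * ((1/2) powr (1/p)) ^ k"
        using B by (simp add: powr_mult powr_power powr_realpow[symmetric] powr_powr mult.commute del: powr_realpow)
      finally show ?thesis using p by (simp add: powr_powr)
    qed
    then show ?case by (intro exI[of _ "B powr (1/p)"]) auto
  qed
qed

text \<open>The Weierstrass test on each cone with rational vertex. Every point has a closed disc
  inside such an open cone, so the convergence is locally uniform.\<close>

lemma locally_uniform_limit:
  assumes P: "\<And>k. P k \<in> dirichlet_polys" and q: "0 \<le> q" "q < 1"
    and bd: "\<And>\<tau>. \<tau> \<in> \<rat> \<Longrightarrow> \<exists>B\<ge>0. \<forall>k. \<forall>s\<in>cone \<tau>. cmod (dpoly (\<lambda>n. P (Suc k) n - P k n) \<omega> s) \<le> B * q ^ k"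
  obtains g where "g holomorphic_on half_plane" "\<And>s. s \<in> half_plane \<Longrightarrow> (\<lambda>k. dpoly (P k) \<omega> s) \<longlonglongrightarrow> g s"
proof -
  define D where "D k s = dpoly (P (Suc k)) \<omega> s - dpoly (P k) \<omega> s" for k s
  define g where "g s = dpoly (P 0) \<omega> s + suminf (\<lambda>k. D k s)" for s
  have D: "dpoly (\<lambda>n. P (Suc k) n - P k n) \<omega> s = D k s" for k s by (simp add: D_def dpoly_diff[OF P P])
  have tele: "dpoly (P 0) \<omega> s + (\<Sum>i<n. D i s) = dpoly (P n) \<omega> s" for n s
    using sum_lessThan_telescope[of "\<lambda>i. dpoly (P i) \<omega> s" n] by (simp add: D_def)
  have ul: "uniform_limit (cone \<tau>) (\<lambda>k. dpoly (P k) \<omega>) g sequentially" if \<tau>: "\<tau> \<in> \<rat>" for \<tau>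
  proof -
    obtain B where B: "0 \<le> B" "\<And>k s. s \<in> cone \<tau> \<Longrightarrow> cmod (D k s) \<le> B * q ^ k" using bd[OF \<tau>] by (auto simp: D)
    have "summable (\<lambda>k. B * q ^ k)" using q by (intro summable_mult summable_geometric) auto
    with B(2) have "uniform_limit (cone \<tau>) (\<lambda>n s. \<Sum>i<n. D i s) (\<lambda>s. suminf (\<lambda>i. D i s)) sequentially"
      by (intro Weierstrass_m_test[where M = "\<lambda>k. B * q ^ k"]) auto
    then have "uniform_limit (cone \<tau>) (\<lambda>n s. dpoly (P 0) \<omega> s + (\<Sum>i<n. D i s)) g sequentially"
      unfolding g_def[abs_def] by (intro uniform_limit_add uniform_limit_const)
    then show ?thesis by (simp add: tele)
  qed
  show ?thesis
  proof (rule that)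
    show "g holomorphic_on half_plane"
    proof (rule holomorphic_uniform_sequence[OF half_plane_open])
      show "dpoly (P n) \<omega> holomorphic_on half_plane" for n by (rule dpoly_holomorphic[OF P])
      fix x assume "x \<in> half_plane"
      then obtain \<tau> where \<tau>: "\<tau> \<in> \<rat>" "x \<in> cone \<tau>" by (rule half_plane_in_rational_cone)
      then obtain d where d: "0 < d" "cball x d \<subseteq> cone \<tau>" using cone_open open_contains_cball by metis
      then show "\<exists>d>0. cball x d \<subseteq> half_plane \<and> uniform_limit (cball x d) (\<lambda>k. dpoly (P k) \<omega>) g sequentially"
        using uniform_limit_on_subset[OF ul[OF \<tau>(1)] d(2)] by (auto simp: cone_def)
    qed
    fix s assume "s \<in> half_plane"
    then obtain \<tau> where \<tau>: "\<tau> \<in> \<rat>" "s \<in> cone \<tau>" by (rule half_plane_in_rational_cone)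
    show "(\<lambda>k. dpoly (P k) \<omega> s) \<longlonglongrightarrow> g s" by (rule tendsto_uniform_limitI[OF ul[OF \<tau>(1)] \<tau>(2)])
  qed
qed

text \<open>Coefficients of a bounded sequence of polynomials grow at most like n^2, uniformly along
  the sequence. For \<open>Re s > 3\<close> this gives a summable majorant, and Tannery's theorem
  exchanges the limit with the sum.\<close>

lemma dirichlet_series_sums:
  assumes p: "0 < p" and P: "\<And>k. P k \<in> dirichlet_polys" and R: "\<And>k. hmean p (P k) 0 \<le> R"
    and lim: "\<And>n. (\<lambda>k. P k n) \<longlonglongrightarrow> a n" and \<omega>: "\<omega> \<in> space torus_measure" and s: "3 < Re s"
    and g: "(\<lambda>k. dpoly (P k) \<omega> s) \<longlonglongrightarrow> g"
  shows "(\<lambda>n. a n * torus_char \<omega> n * of_nat n powr (- s)) sums g"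
proof -
  define b where "b n = a n * torus_char \<omega> n * of_nat n powr (- s)" for n
  define M where "M n = (2 * R) powr (1/p) * real n powr (2 - Re s)" for n :: nat
  have "summable (\<lambda>n. real n powr (2 - Re s))" using s by (subst summable_real_powr_iff) simp
  then have M: "summable M" unfolding M_def by (rule summable_mult)
  have le: "norm (P k n * torus_char \<omega> n * of_nat n powr (- s)) \<le> M n" for n k
  proof (cases "n = 0")
    case False
    have h: "0 \<le> hmean p (P k) 0" by (rule hmean_nonneg[OF P])
    have "cmod (P k n) \<le> (2 * hmean p (P k) 0) powr (1/p) * real n ^ 2" by (rule coefficient_bound[OF P p])
    also have "\<dots> \<le> (2 * R) powr (1/p) * real n ^ 2"
      using p R[of k] h by (intro mult_right_mono powr_mono2) auto
    finally have "cmod (P k n) * real n powr (- Re s) \<le> (2 * R) powr (1/p) * real n ^ 2 * real n powr (- Re s)"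
      by (rule mult_right_mono) simp
    also have "\<dots> = M n"
      using powr_add[of "real n" 2 "- Re s"] False by (simp add: M_def)
    finally show ?thesis using \<omega> by (simp add: norm_mult cmod_torus_char norm_powr_real_powr)
  qed (simp add: M_def)
  have T: "eventually (\<lambda>k. summable (\<lambda>n. norm (P k n * torus_char \<omega> n * of_nat n powr (- s)))) sequentially \<and>
    summable (\<lambda>n. norm (b n)) \<and> (\<lambda>k. \<Sum>n. P k n * torus_char \<omega> n * of_nat n powr (- s)) \<longlonglongrightarrow> suminf b"
  proof (rule tannerys_theorem[OF _ _ M])
    show "(\<lambda>k. P k n * torus_char \<omega> n * of_nat n powr (- s)) \<longlonglongrightarrow> b n" for n
      unfolding b_def by (intro tendsto_intros lim)
    show "\<forall>\<^sub>F (n, k) in sequentially \<times>\<^sub>F sequentially. norm (P k n * torus_char \<omega> n * of_nat n powr (- s)) \<le> M n"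
      by (rule always_eventually) (use le in auto)
  qed simp
  have "(\<Sum>n. P k n * torus_char \<omega> n * of_nat n powr (- s)) = dpoly (P k) \<omega> s" for k
    unfolding dpoly_eq[OF P] by (rule suminf_finite[OF support(1)[OF P]]) auto
  with T have "suminf b = g" using LIMSEQ_unique[OF _ g] by simp
  moreover have "summable b" using T summable_norm_cancel by blast
  ultimately show ?thesis unfolding b_def by (metis summable_sums)
qed

text \<open>For almost every character the fast subsequence has an analytic limit on the half-plane.
  Far to the right this limit is the sum of the Dirichlet series, so it is an extension and
  coincides with \<open>vertical_limit\<close>.\<close>

theorem vertical_limit_approximation:
  assumes p: "0 < p" and repr: "completion_repr p P a"
  obtains \<phi> :: "nat \<Rightarrow> nat" where "strict_mono \<phi>"
    "AE \<omega> in torus_measure. \<forall>s\<in>half_plane. (\<lambda>k. dpoly (P (\<phi> k)) \<omega> s) \<longlonglongrightarrow> vertical_limit a \<omega> s"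
proof -
  obtain \<phi> where \<phi>: "strict_mono \<phi>" "\<And>k. hmean p (\<lambda>n. P (\<phi> (Suc k)) n - P (\<phi> k) n) 0 \<le> (1/4) ^ k"
    using completion_repr_fast[OF p repr] by blast
  obtain R where R: "\<And>k. hmean p (P k) 0 \<le> R" using completion_repr_bounded[OF p repr] by blast
  define Q where "Q k = P (\<phi> k)" for k
  note poly = completion_repr_poly[OF p repr]
  have Q: "Q k \<in> dirichlet_polys" for k unfolding Q_def by (rule poly)
  define q where "q = (1/2::real) powr (1/p)"
  have q: "0 \<le> q" "q < 1" using p powr_less_mono2[of "1/p" "1/2::real" 1] by (auto simp: q_def)
  have "AE \<omega> in torus_measure. \<forall>\<tau>\<in>\<rat>. \<exists>B\<ge>0. \<forall>k. \<forall>s\<in>cone \<tau>. cmod (dpoly (\<lambda>n. Q (Suc k) n - Q k n) \<omega> s) \<le> B * q ^ k"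
    unfolding AE_ball_countable[OF countable_rat] q_def
    using fast_sequence_cone_bound[OF p, of "\<lambda>k n. Q (Suc k) n - Q k n"] dirichlet_polys_diff[OF Q Q] \<phi>(2)
    by (simp add: Q_def)
  with AE_space have "AE \<omega> in torus_measure. \<forall>s\<in>half_plane. (\<lambda>k. dpoly (Q k) \<omega> s) \<longlonglongrightarrow> vertical_limit a \<omega> s"
  proof eventually_elim
    case (elim \<omega>)
    obtain g where g: "g holomorphic_on half_plane" "\<And>s. s \<in> half_plane \<Longrightarrow> (\<lambda>k. dpoly (Q k) \<omega> s) \<longlonglongrightarrow> g s"
      using locally_uniform_limit[of Q q \<omega>, OF Q q] elim(2) by blast
    have "(\<lambda>n. a n * torus_char \<omega> n * of_nat n powr (- s)) sums g s" if s: "3 < Re s" for s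
    proof (rule dirichlet_series_sums[of p Q R a \<omega> s, OF p Q _ _ elim(1) s])
      show "hmean p (Q k) 0 \<le> R" for k unfolding Q_def by (rule R)
      show "(\<lambda>k. Q k n) \<longlonglongrightarrow> a n" for n
        using LIMSEQ_subseq_LIMSEQ[OF completion_repr_coeff[OF p repr] \<phi>(1)] by (simp add: Q_def o_def)
      show "(\<lambda>k. dpoly (Q k) \<omega> s) \<longlonglongrightarrow> g s" using s by (intro g) (simp add: half_plane_def)
    qed
    then have "is_vertical_limit a \<omega> g"
      unfolding is_vertical_limit_def using g(1) by (intro conjI exI[of _ 3]) auto
    then show ?case using g(2) vertical_limit_eq by simp
  qed
  then show ?thesis using that \<phi>(1) by (simp add: Q_def)
qed


section \<open>The area operator\<close>

lemma measurable_completion_AE: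
  assumes f: "f \<in> completion M \<rightarrow>\<^sub>M N" and ae: "AE x in completion M. f x = g x" and g: "g \<in> space M \<rightarrow> space N"
  shows "g \<in> completion M \<rightarrow>\<^sub>M N"
proof (rule measurableI)
  fix A assume A: "A \<in> sets N"
  show "g -` A \<inter> space (completion M) \<in> sets (completion M)"
  proof (rule completion.in_sets_AE[OF _ measurable_sets[OF f A]])
    show "AE x in completion M. (x \<in> f -` A \<inter> space (completion M)) \<longleftrightarrow> (x \<in> g -` A \<inter> space (completion M))"
      using ae by eventually_elim auto
  qed auto
qed (use g in auto)

abbreviation torus_line_borel :: "((nat \<Rightarrow> complex) \<times> real) measure" where
  "torus_line_borel \<equiv> torus_measure \<Otimes>\<^sub>M density lborel cauchy_weight"

lemma torus_line_measure_eq: "torus_line_measure = completion torus_line_borel"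
  by (simp add: torus_line_measure_def cauchy_weight_def[abs_def])

lemma finite_measure_cauchy: "finite_measure (density lborel cauchy_weight)"
  by (rule finite_measureI) (simp add: emeasure_density nn_integral_cauchy_weight)

interpretation cauchy: finite_measure "density lborel cauchy_weight"
  by (rule finite_measure_cauchy)

interpretation torus_cauchy: pair_sigma_finite torus_measure "density lborel cauchy_weight" ..

text \<open>The exceptional set need not be measurable; it is enclosed in a measurable null set,
  whose product with the line is again null.\<close>

lemma AE_torus_line:
  assumes "AE \<omega> in torus_measure. P \<omega>"
  shows "AE x in torus_line_measure. P (fst x)"
proof -
  obtain N where N: "{\<omega> \<in> space torus_measure. \<not> P \<omega>} \<subseteq> N" "emeasure torus_measure N = 0" "N \<in> sets torus_measure"
    using AE_E[OF assms] by blast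
  have NN: "AE \<omega> in torus_measure. \<omega> \<notin> N" using N by (intro AE_not_in) (simp add: null_sets_def)
  have "AE x in torus_line_borel. fst x \<notin> N"
  proof (rule torus_cauchy.AE_pair_measure)
    have "{x \<in> space torus_line_borel. fst x \<notin> N} = (space torus_measure - N) \<times> space (density lborel cauchy_weight)"
      by (auto simp: space_pair_measure)
    also have "\<dots> \<in> sets torus_line_borel" using N by (intro pair_measureI sets.Diff sets.top) auto
    finally show "{x \<in> space torus_line_borel. fst x \<notin> N} \<in> sets torus_line_borel" .
    show "AE x in torus_measure. AE y in density lborel cauchy_weight. fst (x, y) \<notin> N"
      using NN by eventually_elim simp
  qed
  with AE_space have "AE x in torus_line_borel. P (fst x)"
    by eventually_elim (use N in \<open>auto simp: space_pair_measure\<close>)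
  then show ?thesis unfolding torus_line_measure_eq by (rule AE_completion)
qed

lemma torus_line_measurable:
  assumes "F \<in> borel_measurable (torus_measure \<Otimes>\<^sub>M borel)"
  shows "F \<in> borel_measurable torus_line_borel" "F \<in> borel_measurable torus_line_measure"
proof -
  have "sets torus_line_borel = sets (torus_measure \<Otimes>\<^sub>M borel)"
    by (intro sets_pair_measure_cong) simp_all
  then show *: "F \<in> borel_measurable torus_line_borel" using assms measurable_cong_sets by blast
  show "F \<in> borel_measurable torus_line_measure"
    unfolding torus_line_measure_eq by (rule measurable_completion[OF *])
qed

lemma nn_integral_torus_line:
  assumes F: "F \<in> borel_measurable (torus_measure \<Otimes>\<^sub>M borel)"
  shows "(\<integral>\<^sup>+x. F x \<partial>torus_line_measure) = (\<integral>\<^sup>+\<omega>. (\<integral>\<^sup>+\<tau>. F (\<omega>, \<tau>) * cauchy_weight \<tau> \<partial>lborel) \<partial>torus_measure)"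
proof -
  have "(\<integral>\<^sup>+x. F x \<partial>torus_line_measure) = (\<integral>\<^sup>+x. F x \<partial>torus_line_borel)"
    unfolding torus_line_measure_eq by (rule nn_integral_completion)
  also have "\<dots> = (\<integral>\<^sup>+\<omega>. (\<integral>\<^sup>+\<tau>. F (\<omega>, \<tau>) \<partial>density lborel cauchy_weight) \<partial>torus_measure)"
    by (rule cauchy.nn_integral_fst[symmetric, OF torus_line_measurable(1)[OF F]])
  also have "\<dots> = (\<integral>\<^sup>+\<omega>. (\<integral>\<^sup>+\<tau>. F (\<omega>, \<tau>) * cauchy_weight \<tau> \<partial>lborel) \<partial>torus_measure)"
  proof (rule nn_integral_cong)
    fix \<omega> assume \<omega>: "\<omega> \<in> space torus_measure"
    have "(\<lambda>\<tau>. (\<omega>, \<tau>)) \<in> borel \<rightarrow>\<^sub>M torus_measure \<Otimes>\<^sub>M borel" using \<omega> by measurable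
    from measurable_compose[OF this F] have "(\<lambda>\<tau>. F (\<omega>, \<tau>)) \<in> borel_measurable borel" .
    then show "(\<integral>\<^sup>+\<tau>. F (\<omega>, \<tau>) \<partial>density lborel cauchy_weight) = (\<integral>\<^sup>+\<tau>. F (\<omega>, \<tau>) * cauchy_weight \<tau> \<partial>lborel)"
      by (subst nn_integral_density) (auto simp: mult.commute)
  qed
  finally show ?thesis .
qed

text \<open>As \<open>l\<close> may be small, roots are compared through the two quasi-triangle
  inequalities: each root is at most the other times a factor close to 1, plus a large multiple of
  the root of \<open>Z\<close>. Infinite values are covered because the right side is then infinite,
  although \<open>enn2real\<close> turns them into 0 on the left.\<close>

lemma root_diff_le:
  fixes X Y Z :: ennreal
  assumes p: "0 < p" and l: "0 < l" and k: "0 < k"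
    and X: "X \<le> ennreal ((1 + k) powr l) * Y + ennreal ((1 + 1/k) powr l) * Z"
    and Y: "Y \<le> ennreal ((1 + k) powr l) * X + ennreal ((1 + 1/k) powr l) * Z"
  shows "ennreal (\<bar>enn2real X powr (1/l) - enn2real Y powr (1/l)\<bar> powr p) \<le>
    ennreal (2 powr p) * (ennreal (((1 + k) powr (1 + 1/l) - 1) powr p) * (epow X (p/l) + epow Y (p/l))
      + ennreal (((1 + 1/k) powr (1 + 1/l)) powr p) * epow Z (p/l))"
proof -
  \<comment> \<open>One factor \<open>1 + k\<close> is the l-th root of the constant in the
    hypothesis, the factor \<open>(1 + k) powr (1/l)\<close> comes from \<open>epow_add_le\<close>
    with exponent \<open>1/l\<close>.\<close>
  define c where "c = (1 + k) powr (1 + 1/l)"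
  define c' where "c' = (1 + 1/k) powr (1 + 1/l)"
  have k': "0 < 1/k" using k by simp
  have c: "1 < c" using k l powr_less_mono[of 0 "1 + 1/l" "1 + k"] by (simp add: c_def add_pos_pos)
  have c': "0 < c'" using k' by (simp add: c'_def add_nonneg_eq_0_iff)
  show ?thesis unfolding c_def[symmetric] c'_def[symmetric]
  proof (cases "X = \<top> \<or> Y = \<top> \<or> Z = \<top>")
    case True
    have "(c - 1) powr p \<noteq> 0" "c' powr p \<noteq> 0" using c c' by auto
    then have S: "ennreal ((c - 1) powr p) * (epow X (p/l) + epow Y (p/l)) + ennreal (c' powr p) * epow Z (p/l) = \<top>"
      using True by (auto simp: ennreal_mult_top ennreal_mult_eq_top_iff)
    show "ennreal (\<bar>enn2real X powr (1/l) - enn2real Y powr (1/l)\<bar> powr p) \<le>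
      ennreal (2 powr p) * (ennreal ((c - 1) powr p) * (epow X (p/l) + epow Y (p/l)) + ennreal (c' powr p) * epow Z (p/l))"
      unfolding S by (simp add: ennreal_mult_top)
  next
    case False
    then obtain a b z where abz: "0 \<le> a" "X = ennreal a" "0 \<le> b" "Y = ennreal b" "0 \<le> z" "Z = ennreal z"
      by (metis ennreal_cases)
    have step: "a powr (1/l) \<le> c * b powr (1/l) + c' * z powr (1/l)"
      if h: "ennreal a \<le> ennreal ((1 + k) powr l) * ennreal b + ennreal ((1 + 1/k) powr l) * ennreal z" and pos: "0 \<le> a" "0 \<le> b" for a b
    proof -
      have ex: "(x powr l * y) powr (1/l) = x * y powr (1/l)" if "0 \<le> x" "0 \<le> y" for x y
        using l that by (simp add: powr_mult powr_powr)
      have ex2: "x powr (1/l) * (x * y) = x powr (1 + 1/l) * y" if "0 < x" for x y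
        using that by (simp add: powr_add)
      have "ennreal (a powr (1/l)) = epow (ennreal a) (1/l)" using pos by simp
      also have "\<dots> \<le> epow (ennreal ((1 + k) powr l * b) + ennreal ((1 + 1/k) powr l * z)) (1/l)"
        using h l abz pos by (intro epow_mono) (auto simp: ennreal_mult')
      also have "\<dots> \<le> ennreal ((1 + k) powr (1/l)) * epow (ennreal ((1 + k) powr l * b)) (1/l) + ennreal ((1 + 1/k) powr (1/l)) * epow (ennreal ((1 + 1/k) powr l * z)) (1/l)"
        using l k by (intro epow_add_le) auto
      also have "\<dots> = ennreal ((1 + k) powr (1/l) * ((1 + k) * b powr (1/l)) + (1 + 1/k) powr (1/l) * ((1 + 1/k) * z powr (1/l)))"
      proof -
        have "epow (ennreal (x powr l * y)) (1/l) = ennreal (x * y powr (1/l))" if "0 \<le> x" "0 \<le> y" for x y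
          using epow_ennreal[of "x powr l * y" "1/l"] ex[OF that] that by simp
        note e = this[of "1 + k" b] this[of "1 + 1/k" z]
        have nn: "0 \<le> (1 + k) powr (1/l) * ((1 + k) * b powr (1/l))" "0 \<le> (1 + 1/k) powr (1/l) * ((1 + 1/k) * z powr (1/l))"
          using k k' by auto
        have k0: "0 \<le> 1 + k" "0 \<le> 1 + 1/k" using k k' by simp_all
        show ?thesis
          unfolding e(1)[OF k0(1) pos(2)] e(2)[OF k0(2) abz(5)]
          unfolding ennreal_plus[OF nn] ennreal_mult'[OF powr_ge_zero] ..
      qed
      also have "\<dots> = ennreal (c * b powr (1/l) + c' * z powr (1/l))"
        using k k' by (simp only: ex2 c_def c'_def add_pos_pos zero_less_one)
      finally show ?thesis using c c' by (subst (asm) ennreal_le_iff) auto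
    qed
    define x where "x = a powr (1/l)"
    define y where "y = b powr (1/l)"
    define w where "w = z powr (1/l)"
    have nn: "0 \<le> x" "0 \<le> y" "0 \<le> w" by (auto simp: x_def y_def w_def)
    have xy: "x \<le> c * y + c' * w" unfolding x_def y_def w_def by (rule step) (use X abz in auto)
    have yx: "y \<le> c * x + c' * w" unfolding x_def y_def w_def by (rule step) (use Y abz in auto)
    define m where "m = max x y"
    have m: "0 \<le> m" "m powr p \<le> x powr p + y powr p" using nn by (auto simp: m_def max_def)
    have "\<bar>x - y\<bar> \<le> (c - 1) * m + c' * w"
    proof -
      have "(c - 1) * x \<le> (c - 1) * m" "(c - 1) * y \<le> (c - 1) * m" using c by (auto simp: m_def)
      then show ?thesis using xy yx by (simp add: left_diff_distrib abs_le_iff)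
    qed
    then have "\<bar>x - y\<bar> powr p \<le> ((c - 1) * m + c' * w) powr p" using p by (intro powr_mono2) auto
    also have "\<dots> \<le> 2 powr p * (((c - 1) * m) powr p + (c' * w) powr p)"
      using p c c' m nn by (intro powr_add_le) auto
    also have "\<dots> \<le> 2 powr p * ((c - 1) powr p * (x powr p + y powr p) + c' powr p * w powr p)"
      using m c c' nn by (intro mult_left_mono add_mono) (auto simp: powr_mult intro: mult_left_mono)
    finally have le: "\<bar>x - y\<bar> powr p \<le> 2 powr p * ((c - 1) powr p * (x powr p + y powr p) + c' powr p * w powr p)" .
    have pw: "x powr p = a powr (p/l)" "y powr p = b powr (p/l)" "w powr p = z powr (p/l)"
      by (simp_all add: x_def y_def w_def powr_powr)
    have "ennreal (\<bar>x - y\<bar> powr p) \<le> ennreal (2 powr p * ((c - 1) powr p * (x powr p + y powr p) + c' powr p * w powr p))"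
      by (rule ennreal_leI[OF le])
    also have "\<dots> = ennreal (2 powr p) * (ennreal ((c - 1) powr p) * (ennreal (x powr p) + ennreal (y powr p)) + ennreal (c' powr p) * ennreal (w powr p))"
      by (simp add: ennreal_mult' ennreal_plus)
    finally show "ennreal (\<bar>enn2real X powr (1/l) - enn2real Y powr (1/l)\<bar> powr p) \<le>
      ennreal (2 powr p) * (ennreal ((c - 1) powr p) * (epow X (p/l) + epow Y (p/l)) + ennreal (c' powr p) * epow Z (p/l))"
      unfolding pw using abz by (simp add: x_def y_def)
  qed
qed

section \<open>Measurable versions, differences and limits of area functions\<close>

context
  fixes \<mu> :: "complex measure"
  assumes fin: "finite_measure \<mu>" and sets: "sets \<mu> = sets (restrict_space borel half_plane)"
begin

text \<open>
  \<open>vertical_limit\<close> chooses an arbitrary function for each character, so it is not known to be jointly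
  measurable and has to be replaced by an almost everywhere equal function.
\<close>

definition version :: "(nat \<Rightarrow> complex) \<Rightarrow> ((nat \<Rightarrow> complex) \<Rightarrow> complex \<Rightarrow> complex) \<Rightarrow> bool" where
  "version a g \<longleftrightarrow> (\<lambda>x. g (fst x) (snd x)) \<in> borel_measurable (torus_measure \<Otimes>\<^sub>M \<mu>) \<and>
    (AE \<omega> in torus_measure. \<forall>s\<in>half_plane. vertical_limit a \<omega> s = g \<omega> s)"

lemma version_section:
  assumes "(\<lambda>x. g (fst x) (snd x)) \<in> borel_measurable (torus_measure \<Otimes>\<^sub>M \<mu>)" and \<omega>: "\<omega> \<in> space torus_measure"
  shows "g \<omega> \<in> borel_measurable \<mu>"
proof -
  have "(\<lambda>s. (\<omega>, s)) \<in> \<mu> \<rightarrow>\<^sub>M torus_measure \<Otimes>\<^sub>M \<mu>" using \<omega> by measurable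
  from measurable_compose[OF this assms(1)] show ?thesis by simp
qed

text \<open>Taking \<open>lim\<close> of the jointly measurable polynomials gives a jointly
  measurable function, also where the sequence diverges.\<close>

lemma version_exists:
  assumes p: "0 < p" and repr: "completion_repr p P a"
  obtains \<phi> :: "nat \<Rightarrow> nat" and g where "strict_mono \<phi>" "version a g"
    "AE \<omega> in torus_measure. \<forall>s\<in>half_plane. (\<lambda>k. dpoly (P (\<phi> k)) \<omega> s) \<longlonglongrightarrow> g \<omega> s"
proof -
  obtain \<phi> where \<phi>: "strict_mono \<phi>" and lim:
    "AE \<omega> in torus_measure. \<forall>s\<in>half_plane. (\<lambda>k. dpoly (P (\<phi> k)) \<omega> s) \<longlonglongrightarrow> vertical_limit a \<omega> s"
    using vertical_limit_approximation[OF p repr] by blast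
  define g where "g \<omega> s = lim (\<lambda>k. dpoly (P (\<phi> k)) \<omega> s)" for \<omega> s
  have eq: "AE \<omega> in torus_measure. \<forall>s\<in>half_plane. vertical_limit a \<omega> s = g \<omega> s"
    using lim by eventually_elim (auto simp: g_def limI)
  have "(\<lambda>x. g (fst x) (snd x)) \<in> borel_measurable (torus_measure \<Otimes>\<^sub>M \<mu>)"
    unfolding g_def
    by (intro borel_measurable_lim_metric dpoly_measurable_mu_pair[OF fin sets] completion_repr_poly[OF p repr])
  with eq have "version a g" by (simp add: version_def)
  moreover have "AE \<omega> in torus_measure. \<forall>s\<in>half_plane. (\<lambda>k. dpoly (P (\<phi> k)) \<omega> s) \<longlonglongrightarrow> g \<omega> s"
    using lim eq by eventually_elim auto
  ultimately show ?thesis using that \<phi> by blast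
qed

text \<open>A polynomial is represented by its constant sequence, so the approximation theorem
  identifies its vertical limits.\<close>

lemma version_poly:
  fixes p :: real
  assumes p: "0 < p" and Q: "Q \<in> dirichlet_polys"
  shows "version Q (dpoly Q)"
proof -
  have "dirichlet_poly_norm p (\<lambda>n. Q n - Q n) = 0"
    using p by (simp add: dirichlet_poly_norm_def lp_norm_def)
  then have "completion_repr p (\<lambda>_. Q) Q" using Q by (simp add: completion_repr_def)
  then obtain \<phi> :: "nat \<Rightarrow> nat" where
    "AE \<omega> in torus_measure. \<forall>s\<in>half_plane. (\<lambda>k. dpoly Q \<omega> s) \<longlonglongrightarrow> vertical_limit Q \<omega> s"
    by (rule vertical_limit_approximation[OF p])
  then have "AE \<omega> in torus_measure. \<forall>s\<in>half_plane. vertical_limit Q \<omega> s = dpoly Q \<omega> s"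
    by eventually_elim (auto simp: LIMSEQ_const_iff)
  then show ?thesis using dpoly_measurable_mu_pair[OF fin sets Q] by (simp add: version_def)
qed

lemma version_area:
  assumes g: "version a g"
  shows "AE x in torus_line_measure. area_integral \<mu> l a x = area \<mu> l (g (fst x)) (snd x)"
proof -
  have "AE x in torus_line_measure. \<forall>s\<in>half_plane. vertical_limit a (fst x) s = g (fst x) s"
    using g by (intro AE_torus_line) (simp add: version_def)
  then show ?thesis
  proof eventually_elim
    case (elim x)
    show ?case
      unfolding area_integral_def area_def case_prod_unfold
      by (intro nn_integral_cong) (use elim in \<open>simp add: space_mu[OF fin sets]\<close>)
  qed
qed

lemma area_epow_measurable:
  assumes "(\<lambda>x. g (fst x) (snd x)) \<in> borel_measurable (torus_measure \<Otimes>\<^sub>M \<mu>)" "0 < r"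
  shows "(\<lambda>x. epow (area \<mu> l (g (fst x)) (snd x)) r) \<in> borel_measurable (torus_measure \<Otimes>\<^sub>M borel)"
  using area_measurable[OF fin sets assms(1), where l = l] assms(2) by (intro epow_measurable)

lemma area_pow_eq:
  assumes "(\<lambda>x. g (fst x) (snd x)) \<in> borel_measurable (torus_measure \<Otimes>\<^sub>M \<mu>)" "0 < p" "0 < l"
  shows "(\<integral>\<^sup>+x. epow (area \<mu> l (g (fst x)) (snd x)) (p/l) \<partial>torus_line_measure) = area_pow \<mu> l p g"
  using nn_integral_torus_line[OF area_epow_measurable[OF assms(1), where r = "p/l" and l = l]] assms by (simp add: area_pow_def)

lemma version_measurable:
  assumes g: "version a g"
  shows "area_operator \<mu> l a \<in> borel_measurable torus_line_measure"
proof -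
  have "(\<lambda>x. complex_of_real (enn2real (area \<mu> l (g (fst x)) (snd x)) powr (1 / l))) \<in> borel_measurable torus_line_measure"
  proof -
    have "(\<lambda>x. g (fst x) (snd x)) \<in> borel_measurable (torus_measure \<Otimes>\<^sub>M \<mu>)" using g by (simp add: version_def)
    from torus_line_measurable(2)[OF area_measurable[OF fin sets this]]
    have *: "(\<lambda>x. area \<mu> l (g (fst x)) (snd x)) \<in> borel_measurable torus_line_measure" .
    have "(\<lambda>y. complex_of_real (enn2real y powr (1 / l))) \<in> borel_measurable borel" by measurable
    from measurable_compose[OF * this] show ?thesis .
  qed
  then show ?thesis unfolding torus_line_measure_eq
  proof (rule measurable_completion_AE)
    show "AE x in completion torus_line_borel. complex_of_real (enn2real (area \<mu> l (g (fst x)) (snd x)) powr (1 / l)) = area_operator \<mu> l a x"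
      using version_area[OF g, where l = l] unfolding torus_line_measure_eq area_operator_def by eventually_elim simp
  qed auto
qed

lemma area_operator_lp_space:
  assumes p: "0 < p" and l: "0 < l" and g: "version a g" and fin_pow: "area_pow \<mu> l p g < \<infinity>"
  shows "area_operator \<mu> l a \<in> lp_space torus_line_measure p"
    and "AE x in torus_line_measure. area_integral \<mu> l a x < \<infinity>"
proof -
  have gm: "(\<lambda>x. g (fst x) (snd x)) \<in> borel_measurable (torus_measure \<Otimes>\<^sub>M \<mu>)" using g by (simp add: version_def)
  have "lp_pow torus_line_measure p (area_operator \<mu> l a) \<le> (\<integral>\<^sup>+x. epow (area \<mu> l (g (fst x)) (snd x)) (p/l) \<partial>torus_line_measure)"
    unfolding lp_pow_def
  proof (rule nn_integral_mono_AE)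
    show "AE x in torus_line_measure. ennreal (cmod (area_operator \<mu> l a x) powr p) \<le> epow (area \<mu> l (g (fst x)) (snd x)) (p/l)"
      using version_area[OF g, where l = l]
    proof eventually_elim
      case (elim x)
      show ?case unfolding area_operator_def elim
        by (cases "area \<mu> l (g (fst x)) (snd x)") (auto simp: powr_powr)
    qed
  qed
  also have "\<dots> < \<infinity>" using fin_pow area_pow_eq[OF gm p l] by simp
  finally show "area_operator \<mu> l a \<in> lp_space torus_line_measure p"
    using version_measurable[OF g] by (simp add: lp_space_iff[OF p])
  have "AE x in torus_line_measure. epow (area \<mu> l (g (fst x)) (snd x)) (p/l) \<noteq> \<infinity>"
  proof (rule nn_integral_PInf_AE)
    show "(\<lambda>x. epow (area \<mu> l (g (fst x)) (snd x)) (p/l)) \<in> borel_measurable torus_line_measure"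
      using p l by (intro torus_line_measurable(2) area_epow_measurable[OF gm]) simp
  qed (use fin_pow area_pow_eq[OF gm p l] in simp)
  then show "AE x in torus_line_measure. area_integral \<mu> l a x < \<infinity>"
    using version_area[OF g, where l = l]
  proof eventually_elim
    case (elim x)
    then show ?case by (cases "area \<mu> l (g (fst x)) (snd x)") auto
  qed
qed

text \<open>The integrated form of \<open>root_diff_le\<close>, which stands in for linearity. One
  term involves only the sizes of the two area functions, with a constant that vanishes with
  \<open>k\<close>; the other involves only the area function of the difference.\<close>

lemma area_operator_diff_le:
  assumes p: "0 < p" and l: "0 < l" and k: "0 < k" and f: "version a f" and g: "version b g"
  shows "lp_pow torus_line_measure p (\<lambda>x. area_operator \<mu> l a x - area_operator \<mu> l b x) \<le>
    ennreal (2 powr p) * (ennreal (((1 + k) powr (1 + 1/l) - 1) powr p) * (area_pow \<mu> l p f + area_pow \<mu> l p g)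
      + ennreal (((1 + 1/k) powr (1 + 1/l)) powr p) * area_pow \<mu> l p (\<lambda>\<omega> s. f \<omega> s - g \<omega> s))"
proof -
  have fm: "(\<lambda>x. f (fst x) (snd x)) \<in> borel_measurable (torus_measure \<Otimes>\<^sub>M \<mu>)"
    and gm: "(\<lambda>x. g (fst x) (snd x)) \<in> borel_measurable (torus_measure \<Otimes>\<^sub>M \<mu>)"
    using f g by (auto simp: version_def)
  then have hm: "(\<lambda>x. (\<lambda>\<omega> s. f \<omega> s - g \<omega> s) (fst x) (snd x)) \<in> borel_measurable (torus_measure \<Otimes>\<^sub>M \<mu>)" by simp
  let ?X = "\<lambda>x. epow (area \<mu> l (f (fst x)) (snd x)) (p/l)"
  let ?Y = "\<lambda>x. epow (area \<mu> l (g (fst x)) (snd x)) (p/l)"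
  let ?Z = "\<lambda>x. epow (area \<mu> l (\<lambda>s. f (fst x) s - g (fst x) s) (snd x)) (p/l)"
  have pl: "0 < p / l" using p l by simp
  note m = torus_line_measurable(2)[OF area_epow_measurable[OF _ pl]]
  have Xm [measurable]: "?X \<in> borel_measurable torus_line_measure" by (rule m[OF fm])
  have Ym [measurable]: "?Y \<in> borel_measurable torus_line_measure" by (rule m[OF gm])
  have Zm [measurable]: "?Z \<in> borel_measurable torus_line_measure" using m[OF hm] by simp
  define A where "A = ennreal (((1 + k) powr (1 + 1/l) - 1) powr p)"
  define B where "B = ennreal (((1 + 1/k) powr (1 + 1/l)) powr p)"
  have "lp_pow torus_line_measure p (\<lambda>x. area_operator \<mu> l a x - area_operator \<mu> l b x) \<le>
    (\<integral>\<^sup>+x. ennreal (2 powr p) * (A * (?X x + ?Y x) + B * ?Z x) \<partial>torus_line_measure)"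
    unfolding lp_pow_def
  proof (rule nn_integral_mono_AE)
    have "AE x in torus_line_measure. x \<in> space torus_line_measure" by (rule AE_space)
    with version_area[OF f, where l = l] version_area[OF g, where l = l]
    show "AE x in torus_line_measure. ennreal (cmod (area_operator \<mu> l a x - area_operator \<mu> l b x) powr p) \<le>
      ennreal (2 powr p) * (A * (?X x + ?Y x) + B * ?Z x)"
    proof eventually_elim
      case (elim x)
      have \<omega>: "fst x \<in> space torus_measure" using elim(3) by (auto simp: torus_line_measure_eq space_pair_measure)
      note sec = version_section[OF fm \<omega>] version_section[OF gm \<omega>]
      have dm: "(\<lambda>s. f (fst x) s - g (fst x) s) \<in> borel_measurable \<mu>" using sec by simp
      have 1: "area \<mu> l (f (fst x)) (snd x) \<le> ennreal ((1 + k) powr l) * area \<mu> l (g (fst x)) (snd x)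
        + ennreal ((1 + 1/k) powr l) * area \<mu> l (\<lambda>s. f (fst x) s - g (fst x) s) (snd x)"
        by (rule area_add_le[OF fin sets sec(2) dm _ l k]) (rule norm_triangle_sub)
      have 2: "area \<mu> l (g (fst x)) (snd x) \<le> ennreal ((1 + k) powr l) * area \<mu> l (f (fst x)) (snd x)
        + ennreal ((1 + 1/k) powr l) * area \<mu> l (\<lambda>s. f (fst x) s - g (fst x) s) (snd x)"
        by (rule area_add_le[OF fin sets sec(1) dm _ l k]) (subst norm_minus_commute, rule norm_triangle_sub)
      have "cmod (area_operator \<mu> l a x - area_operator \<mu> l b x) =
        \<bar>enn2real (area \<mu> l (f (fst x)) (snd x)) powr (1/l) - enn2real (area \<mu> l (g (fst x)) (snd x)) powr (1/l)\<bar>"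
        unfolding area_operator_def elim(1,2) of_real_diff[symmetric] norm_of_real ..
      then show ?case unfolding A_def B_def using root_diff_le[OF p l k 1 2] by simp
    qed
  qed
  also have "\<dots> = ennreal (2 powr p) * (A * ((\<integral>\<^sup>+x. ?X x \<partial>torus_line_measure) + (\<integral>\<^sup>+x. ?Y x \<partial>torus_line_measure))
      + B * (\<integral>\<^sup>+x. ?Z x \<partial>torus_line_measure))"
    by (simp add: nn_integral_cmult nn_integral_add)
  also have "\<dots> = ennreal (2 powr p) * (A * (area_pow \<mu> l p f + area_pow \<mu> l p g) + B * area_pow \<mu> l p (\<lambda>\<omega> s. f \<omega> s - g \<omega> s))"
    using area_pow_eq[OF fm p l] area_pow_eq[OF gm p l] area_pow_eq[OF hm p l] by simp
  finally show ?thesis unfolding A_def B_def .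
qed

text \<open>Lower semicontinuity passes through three integrations, over the cone, in
  \<open>\<tau>\<close> and over the torus. Between the first two, \<open>epow\<close> commutes with
  \<open>liminf\<close> because it is continuous and monotone.\<close>

lemma area_pow_Fatou:
  assumes p: "0 < p" and l: "0 < l" and P: "\<And>k. P k \<in> dirichlet_polys" and Q: "Q \<in> dirichlet_polys"
    and lim: "AE \<omega> in torus_measure. \<forall>s\<in>half_plane. (\<lambda>k. dpoly (P k) \<omega> s) \<longlonglongrightarrow> g \<omega> s"
    and le: "\<forall>\<^sub>F k in sequentially. area_pow \<mu> l p (dpoly (\<lambda>n. P k n - Q n)) \<le> b"
  shows "area_pow \<mu> l p (\<lambda>\<omega> s. g \<omega> s - dpoly Q \<omega> s) \<le> b"
proof -
  have pl: "0 < p / l" using p l by simp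
  define D where "D k = (\<lambda>n. P k n - Q n)" for k
  have D: "D k \<in> dirichlet_polys" for k unfolding D_def by (rule dirichlet_polys_diff[OF P Q])
  let ?A = "\<lambda>k \<omega> \<tau>. epow (area \<mu> l (dpoly (D k) \<omega>) \<tau>) (p/l) * cauchy_weight \<tau>"
  have Am: "(\<lambda>(\<omega>, \<tau>). ?A k \<omega> \<tau>) \<in> borel_measurable (torus_measure \<Otimes>\<^sub>M lborel)" for k
  proof -
    have "(\<lambda>x. epow (area \<mu> l (dpoly (D k) (fst x)) (snd x)) (p/l)) \<in> borel_measurable (torus_measure \<Otimes>\<^sub>M lborel)"
      using area_epow_measurable[OF dpoly_measurable_mu_pair[OF fin sets D] pl, where l = l] by simp
    then show ?thesis by (simp add: case_prod_unfold)
  qed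
  have "area_pow \<mu> l p (\<lambda>\<omega> s. g \<omega> s - dpoly Q \<omega> s) \<le> (\<integral>\<^sup>+\<omega>. (\<integral>\<^sup>+\<tau>. liminf (\<lambda>k. ?A k \<omega> \<tau>) \<partial>lborel) \<partial>torus_measure)"
    unfolding area_pow_def
  proof (rule nn_integral_mono_AE)
    show "AE \<omega> in torus_measure. (\<integral>\<^sup>+\<tau>. epow (area \<mu> l (\<lambda>s. g \<omega> s - dpoly Q \<omega> s) \<tau>) (p/l) * cauchy_weight \<tau> \<partial>lborel) \<le> (\<integral>\<^sup>+\<tau>. liminf (\<lambda>k. ?A k \<omega> \<tau>) \<partial>lborel)"
      using lim
    proof eventually_elim
      case (elim \<omega>)
      show ?case
      proof (rule nn_integral_mono)
        fix \<tau>
        have "area \<mu> l (\<lambda>s. g \<omega> s - dpoly Q \<omega> s) \<tau> \<le> liminf (\<lambda>k. area \<mu> l (dpoly (D k) \<omega>) \<tau>)"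
        proof (rule area_Liminf_le[OF fin sets _ _ l])
          show "dpoly (D k) \<omega> \<in> borel_measurable \<mu>" for k by (rule dpoly_measurable_mu[OF fin sets D])
          show "(\<lambda>k. dpoly (D k) \<omega> s) \<longlonglongrightarrow> g \<omega> s - dpoly Q \<omega> s" if "s \<in> half_plane" for s
            unfolding D_def dpoly_diff[OF P Q] using elim that by (intro tendsto_intros) auto
        qed
        then have "epow (area \<mu> l (\<lambda>s. g \<omega> s - dpoly Q \<omega> s) \<tau>) (p/l) \<le> epow (liminf (\<lambda>k. area \<mu> l (dpoly (D k) \<omega>) \<tau>)) (p/l)"
          using pl by (intro epow_mono) auto
        also have "\<dots> = liminf (\<lambda>k. epow (area \<mu> l (dpoly (D k) \<omega>) \<tau>) (p/l))" by (rule epow_Liminf[OF pl])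
        finally have "epow (area \<mu> l (\<lambda>s. g \<omega> s - dpoly Q \<omega> s) \<tau>) (p/l) * cauchy_weight \<tau> \<le> cauchy_weight \<tau> * liminf (\<lambda>k. epow (area \<mu> l (dpoly (D k) \<omega>) \<tau>) (p/l))"
          by (simp add: mult.commute mult_left_mono)
        also have "\<dots> \<le> liminf (\<lambda>k. ?A k \<omega> \<tau>)"
        proof -
          have "cauchy_weight \<tau> * (INF k\<in>{n..}. epow (area \<mu> l (dpoly (D k) \<omega>) \<tau>) (p/l)) \<le> (INF k\<in>{n..}. ?A k \<omega> \<tau>)" for n
          proof (rule INF_greatest)
            fix k assume "k \<in> {n..}"
            then have "(INF k\<in>{n..}. epow (area \<mu> l (dpoly (D k) \<omega>) \<tau>) (p/l)) \<le> epow (area \<mu> l (dpoly (D k) \<omega>) \<tau>) (p/l)"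
              by (rule INF_lower)
            then have "cauchy_weight \<tau> * (INF k\<in>{n..}. epow (area \<mu> l (dpoly (D k) \<omega>) \<tau>) (p/l)) \<le> cauchy_weight \<tau> * epow (area \<mu> l (dpoly (D k) \<omega>) \<tau>) (p/l)"
              by (rule mult_left_mono) simp
            then show "cauchy_weight \<tau> * (INF k\<in>{n..}. epow (area \<mu> l (dpoly (D k) \<omega>) \<tau>) (p/l)) \<le> ?A k \<omega> \<tau>"
              by (simp only: mult.commute)
          qed
          then show ?thesis unfolding liminf_SUP_INF SUP_mult_left_ennreal by (intro SUP_mono) blast
        qed
        finally show "epow (area \<mu> l (\<lambda>s. g \<omega> s - dpoly Q \<omega> s) \<tau>) (p/l) * cauchy_weight \<tau> \<le> liminf (\<lambda>k. ?A k \<omega> \<tau>)" .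
      qed
    qed
  qed
  also have "\<dots> \<le> (\<integral>\<^sup>+\<omega>. liminf (\<lambda>k. \<integral>\<^sup>+\<tau>. ?A k \<omega> \<tau> \<partial>lborel) \<partial>torus_measure)"
  proof (rule nn_integral_mono)
    fix \<omega> assume \<omega>: "\<omega> \<in> space torus_measure"
    have "(\<lambda>\<tau>. ?A k \<omega> \<tau>) \<in> borel_measurable lborel" for k
    proof -
      have "(\<lambda>\<tau>. (\<omega>, \<tau>)) \<in> lborel \<rightarrow>\<^sub>M torus_measure \<Otimes>\<^sub>M lborel" using \<omega> by measurable
      from measurable_compose[OF this Am[of k]] show ?thesis by simp
    qed
    then show "(\<integral>\<^sup>+\<tau>. liminf (\<lambda>k. ?A k \<omega> \<tau>) \<partial>lborel) \<le> liminf (\<lambda>k. \<integral>\<^sup>+\<tau>. ?A k \<omega> \<tau> \<partial>lborel)"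
      by (rule nn_integral_liminf)
  qed
  also have "\<dots> \<le> liminf (\<lambda>k. \<integral>\<^sup>+\<omega>. (\<integral>\<^sup>+\<tau>. ?A k \<omega> \<tau> \<partial>lborel) \<partial>torus_measure)"
    by (rule nn_integral_liminf) (rule lborel.borel_measurable_nn_integral[OF Am])
  also have "\<dots> \<le> limsup (\<lambda>k. \<integral>\<^sup>+\<omega>. (\<integral>\<^sup>+\<tau>. ?A k \<omega> \<tau> \<partial>lborel) \<partial>torus_measure)"
    by (rule Liminf_le_Limsup) simp
  also have "\<dots> \<le> b" using le by (intro Limsup_bounded) (simp add: area_pow_def D_def)
  finally show ?thesis .
qed

end

section \<open>Representatives with controlled norm\<close>

lemma hmean_commute:
  assumes "P \<in> dirichlet_polys" "Q \<in> dirichlet_polys"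
  shows "hmean p (\<lambda>n. P n - Q n) \<sigma> = hmean p (\<lambda>n. Q n - P n) \<sigma>"
  by (simp add: hmean_def dpoly_diff[OF assms] dpoly_diff[OF assms(2,1)] norm_minus_commute)

lemma completion_repr_subseq:
  assumes repr: "completion_repr p P a" and \<phi>: "strict_mono \<phi>"
  shows "completion_repr p (P \<circ> \<phi>) a"
  unfolding completion_repr_def o_apply
proof (intro conjI allI impI)
  show "P (\<phi> k) \<in> dirichlet_polys" for k using repr by (simp add: completion_repr_def)
  show "(\<lambda>k. P (\<phi> k) n) \<longlonglongrightarrow> a n" for n
    using LIMSEQ_subseq_LIMSEQ[of "\<lambda>k. P k n", OF _ \<phi>] repr by (simp add: completion_repr_def o_def)
  fix e :: real assume "0 < e"
  then obtain K where K: "\<And>j k. K \<le> j \<Longrightarrow> K \<le> k \<Longrightarrow> dirichlet_poly_norm p (\<lambda>n. P j n - P k n) < e"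
    using repr unfolding completion_repr_def by meson
  then show "\<exists>K. \<forall>j\<ge>K. \<forall>k\<ge>K. dirichlet_poly_norm p (\<lambda>n. P (\<phi> j) n - P (\<phi> k) n) < e"
    using le_trans[OF _ seq_suble[OF \<phi>]] by blast
qed

lemma dirichlet_poly_norm_eq:
  assumes p: "0 < p" and P: "P \<in> dirichlet_polys"
  shows "dirichlet_poly_norm p P = hmean p P 0 powr (1/p)"
proof -
  have "0 \<le> dirichlet_poly_norm p P" by (simp add: dirichlet_poly_norm_def lp_norm_def)
  then show ?thesis using p by (simp add: dirichlet_poly_norm_powr[OF P p, symmetric] powr_powr)
qed

text \<open>
  The set whose infimum is the norm is nonempty because bounded sequences of norms have convergent
  subsequences.
\<close>

lemma bounded_representative:
  assumes p: "0 < p" and a: "a \<in> dirichlet_hardy p" and C: "dirichlet_hardy_norm p a < C"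
  obtains P where "completion_repr p P a" "\<And>k. hmean p (P k) 0 \<le> C powr p"
proof -
  define N where "N = {r. \<exists>P. completion_repr p P a \<and> (\<lambda>k. dirichlet_poly_norm p (P k)) \<longlonglongrightarrow> r}"
  obtain P0 where P0: "completion_repr p P0 a" using a by (auto simp: dirichlet_hardy_def)
  note poly0 = completion_repr_poly[OF p P0]
  obtain R where R: "0 \<le> R" "\<And>k. hmean p (P0 k) 0 \<le> R" using completion_repr_bounded[OF p P0] by blast
  have "dirichlet_poly_norm p (P0 k) \<in> {0..R powr (1/p)}" for k
    using p R hmean_nonneg[OF poly0] by (auto simp: dirichlet_poly_norm_eq[OF p poly0] intro!: powr_mono2)
  then obtain r \<phi> where r: "strict_mono (\<phi> :: nat \<Rightarrow> nat)" "((\<lambda>k. dirichlet_poly_norm p (P0 k)) \<circ> \<phi>) \<longlonglongrightarrow> r"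
    using seq_compactE[OF compact_imp_seq_compact[OF compact_Icc[of 0 "R powr (1/p)"]], of "\<lambda>k. dirichlet_poly_norm p (P0 k)"] by metis
  have "r \<in> N" using completion_repr_subseq[OF P0 r(1)] r(2) unfolding N_def by (auto simp: o_def)
  then have "N \<noteq> {}" by blast
  moreover have "Inf N < C" using C by (simp add: dirichlet_hardy_norm_def N_def)
  ultimately obtain r where r: "r \<in> N" "r < C" using cInf_lessD by blast
  then obtain P where P: "completion_repr p P a" "(\<lambda>k. dirichlet_poly_norm p (P k)) \<longlonglongrightarrow> r"
    by (auto simp: N_def)
  from order_tendstoD(2)[OF P(2) r(2)] obtain K where K: "\<And>k. K \<le> k \<Longrightarrow> dirichlet_poly_norm p (P k) < C"
    by (auto simp: eventually_sequentially)
  have "strict_mono (\<lambda>k. k + K)" by (simp add: strict_mono_def)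
  from completion_repr_subseq[OF P(1) this] have "completion_repr p (\<lambda>k. P (k + K)) a" by (simp add: o_def)
  moreover have "hmean p (P (k + K)) 0 \<le> C powr p" for k
  proof -
    have "dirichlet_poly_norm p (P (k + K)) powr p \<le> C powr p"
      using K[of "k + K"] p by (intro powr_mono2) (auto simp: dirichlet_poly_norm_def lp_norm_def)
    then show ?thesis by (simp add: dirichlet_poly_norm_powr[OF completion_repr_poly[OF p P(1)] p])
  qed
  ultimately show ?thesis by (rule that)
qed

section \<open>Boundedness, finite nets and compactness of the area operator\<close>

context
  fixes \<mu> :: "complex measure" and p l C :: real
  assumes fin: "finite_measure \<mu>" and sets: "sets \<mu> = sets (restrict_space borel half_plane)"
    and p: "0 < p" and l: "0 < l" and C: "0 \<le> C"
    and carleson: "\<And>f. f \<in> hpi_space p \<Longrightarrow> (\<integral>\<^sup>+s. ennreal (cmod (f s) powr p) \<partial>\<mu>) \<le> ennreal C * hpi_integral p f"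
begin

lemma area_pow_estimate_ex:
  assumes \<kappa>: "0 < \<kappa>"
  shows "\<exists>K\<ge>0. \<forall>P\<in>dirichlet_polys. area_pow \<mu> l p (dpoly P) \<le> ennreal (\<kappa> * hmean p P 0) + ennreal K * (\<integral>\<^sup>+s. ennreal (hmean p P (Re s)) \<partial>\<mu>)"
proof (rule area_pow_estimate[OF fin sets p l C _ \<kappa>])
  fix f assume "f \<in> hpi_space p"
  then show "(\<integral>\<^sup>+s. ennreal (cmod (f s) powr p) \<partial>\<mu>) \<le> ennreal C * hpi_integral p f" by (rule carleson)
qed blast

lemma area_pow_bounded:
  assumes R: "0 \<le> R"
  obtains B where "0 \<le> B" "\<And>D. D \<in> dirichlet_polys \<Longrightarrow> hmean p D 0 \<le> R \<Longrightarrow> area_pow \<mu> l p (dpoly D) \<le> ennreal B"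
proof -
  interpret finite_measure \<mu> by (rule fin)
  obtain K where K: "0 \<le> K" "\<And>P. P \<in> dirichlet_polys \<Longrightarrow>
    area_pow \<mu> l p (dpoly P) \<le> ennreal (1 * hmean p P 0) + ennreal K * (\<integral>\<^sup>+s. ennreal (hmean p P (Re s)) \<partial>\<mu>)"
    using area_pow_estimate_ex[OF zero_less_one] by blast
  define m where "m = measure \<mu> (space \<mu>)"
  have m: "0 \<le> m" by (simp add: m_def)
  show ?thesis
  proof (rule that)
    show "0 \<le> R + K * (R * m)" using R K m by simp
    fix D assume D: "D \<in> dirichlet_polys" "hmean p D 0 \<le> R"
    have "(\<integral>\<^sup>+s. ennreal (hmean p D (Re s)) \<partial>\<mu>) \<le> (\<integral>\<^sup>+s. ennreal R \<partial>\<mu>)"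
    proof (rule nn_integral_mono)
      fix s assume "s \<in> space \<mu>"
      then have "0 \<le> Re s" by (simp add: space_mu[OF fin sets] half_plane_def)
      then show "ennreal (hmean p D (Re s)) \<le> ennreal R" using hmean_le[OF D(1) p, of "Re s"] D(2) by (intro ennreal_leI) simp
    qed
    also have "\<dots> = ennreal (R * m)" using R by (simp add: m_def emeasure_eq_measure ennreal_mult')
    finally have "ennreal K * (\<integral>\<^sup>+s. ennreal (hmean p D (Re s)) \<partial>\<mu>) \<le> ennreal K * ennreal (R * m)"
      by (intro mult_left_mono) auto
    then have "area_pow \<mu> l p (dpoly D) \<le> ennreal R + ennreal K * ennreal (R * m)"
      using D by (intro order_trans[OF K(2)[OF D(1)]] add_mono) (auto intro: ennreal_leI)
    also have "\<dots> = ennreal (R + K * (R * m))" using R K m by (simp add: ennreal_plus ennreal_mult)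
    finally show "area_pow \<mu> l p (dpoly D) \<le> ennreal (R + K * (R * m))" .
  qed
qed

text \<open>The strips decrease to the empty set, since \<open>\<mu>\<close> lives on the open
  half-plane, and \<open>\<mu>\<close> is finite.\<close>

lemma strip_measure_small:
  assumes "0 < \<epsilon>"
  obtains \<delta> where "0 < \<delta>" "{s \<in> space \<mu>. Re s < \<delta>} \<in> sets \<mu>" "measure \<mu> {s \<in> space \<mu>. Re s < \<delta>} < \<epsilon>"
proof -
  interpret finite_measure \<mu> by (rule fin)
  define A where "A n = {s \<in> space \<mu>. Re s < 1 / real (Suc n)}" for n
  have [measurable]: "Re \<in> borel_measurable \<mu>" by (rule borel_mu[OF fin sets]) simp
  have A: "A n \<in> sets \<mu>" for n unfolding A_def by measurable
  have "A n \<subseteq> A m" if "m \<le> n" for m n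
  proof -
    have "1 / real (Suc n) \<le> 1 / real (Suc m)" using that by (intro divide_left_mono) auto
    then show ?thesis by (auto simp: A_def)
  qed
  then have "decseq A" by (simp add: decseq_def)
  then have "(\<lambda>n. measure \<mu> (A n)) \<longlonglongrightarrow> measure \<mu> (\<Inter>n. A n)"
    using A by (intro finite_Lim_measure_decseq) auto
  moreover have "(\<Inter>n. A n) = {}"
  proof -
    have False if "s \<in> (\<Inter>n. A n)" for s
    proof -
      have s: "s \<in> space \<mu>" "\<And>n. Re s < 1 / real (Suc n)" using that by (auto simp: A_def)
      then have "0 < Re s" by (simp add: space_mu[OF fin sets] half_plane_def)
      then obtain n where "1 / real (Suc n) < Re s" using nat_approx_posE by blast
      then show False using s(2)[of n] by simp
    qed
    then show ?thesis by blast
  qed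
  ultimately have "(\<lambda>n. measure \<mu> (A n)) \<longlonglongrightarrow> 0" by simp
  from order_tendstoD(2)[OF this assms] obtain n where "measure \<mu> (A n) < \<epsilon>"
    by (auto simp: eventually_sequentially)
  then show ?thesis using that[of "1 / real (Suc n)"] A[of n] by (simp add: A_def)
qed

text \<open>One third of \<open>\<epsilon>\<close> goes to the term with \<open>\<kappa>\<close>,
  one to the strip \<open>Re s < \<delta>\<close>, where the mean is at most \<open>R\<close>, and
  one to the rest, where by monotonicity the mean is at most its value \<open>\<eta>\<close> on the
  line \<open>\<delta>\<close>.\<close>

lemma area_pow_small:
  assumes R: "0 \<le> R" and \<epsilon>: "0 < \<epsilon>"
  obtains \<delta> \<eta> where "0 < \<delta>" "0 < \<eta>"
    "\<And>D. D \<in> dirichlet_polys \<Longrightarrow> hmean p D 0 \<le> R \<Longrightarrow> hmean p D \<delta> \<le> \<eta> \<Longrightarrow> area_pow \<mu> l p (dpoly D) \<le> ennreal \<epsilon>"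
proof -
  interpret finite_measure \<mu> by (rule fin)
  \<comment> \<open>The summand 1 in this denominator and in those below avoids division by
    0.\<close>
  define \<kappa> where "\<kappa> = \<epsilon> / (3 * (R + 1))"
  have \<kappa>: "0 < \<kappa>" using \<epsilon> R by (simp add: \<kappa>_def)
  obtain K where K: "0 \<le> K" "\<And>P. P \<in> dirichlet_polys \<Longrightarrow>
    area_pow \<mu> l p (dpoly P) \<le> ennreal (\<kappa> * hmean p P 0) + ennreal K * (\<integral>\<^sup>+s. ennreal (hmean p P (Re s)) \<partial>\<mu>)"
    using area_pow_estimate_ex[OF \<kappa>] by blast
  define m where "m = measure \<mu> (space \<mu>)"
  have m: "0 \<le> m" by (simp add: m_def)
  have KR: "0 < 3 * (K * R + 1)" using K R by (simp add: add_nonneg_pos)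
  then have "0 < \<epsilon> / (3 * (K * R + 1))" using \<epsilon> by (rule divide_pos_pos[rotated])
  then obtain \<delta> where \<delta>: "0 < \<delta>" "{s \<in> space \<mu>. Re s < \<delta>} \<in> sets \<mu>" "measure \<mu> {s \<in> space \<mu>. Re s < \<delta>} < \<epsilon> / (3 * (K * R + 1))"
    by (rule strip_measure_small)
  define A where "A = {s \<in> space \<mu>. Re s < \<delta>}"
  have A [measurable]: "A \<in> sets \<mu>" unfolding A_def by (rule \<delta>(2))
  define \<eta> where "\<eta> = \<epsilon> / (3 * (K * m + 1))"
  have "0 < 3 * (K * m + 1)" using K m by (simp add: add_nonneg_pos)
  then have \<eta>: "0 < \<eta>" unfolding \<eta>_def using \<epsilon> by (rule divide_pos_pos[rotated])
  have frac: "x * (\<epsilon> / (3 * (x + 1))) \<le> \<epsilon> / 3" if "0 \<le> x" for x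
  proof -
    have "x / (x + 1) \<le> 1" using that by simp
    then have "(\<epsilon> / 3) * (x / (x + 1)) \<le> (\<epsilon> / 3) * 1" using \<epsilon> by (intro mult_left_mono) auto
    then show ?thesis by (simp add: mult_ac)
  qed
  show ?thesis
  proof (rule that[OF \<delta>(1) \<eta>])
    fix D assume D: "D \<in> dirichlet_polys" "hmean p D 0 \<le> R" "hmean p D \<delta> \<le> \<eta>"
    have h0: "0 \<le> hmean p D 0" by (rule hmean_nonneg[OF D(1)])
    have "(\<integral>\<^sup>+s. ennreal (hmean p D (Re s)) \<partial>\<mu>) \<le> (\<integral>\<^sup>+s. ennreal R * indicator A s + ennreal \<eta> \<partial>\<mu>)"
    proof (rule nn_integral_mono)
      fix s assume s: "s \<in> space \<mu>"
      then have pos: "0 \<le> Re s" by (simp add: space_mu[OF fin sets] half_plane_def)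
      show "ennreal (hmean p D (Re s)) \<le> ennreal R * indicator A s + ennreal \<eta>"
      proof (cases "Re s < \<delta>")
        case True
        have "ennreal (hmean p D (Re s)) \<le> ennreal R" using hmean_le[OF D(1) p pos] D(2) by (intro ennreal_leI) simp
        then show ?thesis using True s by (simp add: A_def add_increasing2)
      next
        case False
        have "ennreal (hmean p D (Re s)) \<le> ennreal \<eta>"
          using hmean_antimono[OF D(1) p, of \<delta> "Re s"] False D(3) \<delta>(1) by (intro ennreal_leI) simp
        then show ?thesis by (simp add: add_increasing)
      qed
    qed
    also have "\<dots> = ennreal R * emeasure \<mu> A + ennreal \<eta> * emeasure \<mu> (space \<mu>)"
      by (subst nn_integral_add) (auto simp: nn_integral_cmult_indicator)
    also have "\<dots> = ennreal (R * measure \<mu> A + \<eta> * m)"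
      using R \<eta> m by (simp add: emeasure_eq_measure m_def ennreal_plus ennreal_mult)
    finally have "ennreal K * (\<integral>\<^sup>+s. ennreal (hmean p D (Re s)) \<partial>\<mu>) \<le> ennreal K * ennreal (R * measure \<mu> A + \<eta> * m)"
      by (intro mult_left_mono) auto
    also have "\<dots> = ennreal (K * R * measure \<mu> A + K * m * \<eta>)"
      using K by (simp add: ennreal_mult'[symmetric] distrib_left mult_ac)
    also have "\<dots> \<le> ennreal (\<epsilon> / 3 + \<epsilon> / 3)"
    proof (intro ennreal_leI add_mono)
      have "K * R * measure \<mu> A \<le> K * R * (\<epsilon> / (3 * (K * R + 1)))"
        using \<delta>(3) K R by (intro mult_left_mono) (auto simp: A_def)
      also have "\<dots> \<le> \<epsilon> / 3" using K R by (intro frac) simp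
      finally show "K * R * measure \<mu> A \<le> \<epsilon> / 3" .
      show "K * m * \<eta> \<le> \<epsilon> / 3" unfolding \<eta>_def using K m by (intro frac) simp
    qed
    finally have 1: "ennreal K * (\<integral>\<^sup>+s. ennreal (hmean p D (Re s)) \<partial>\<mu>) \<le> ennreal (\<epsilon> / 3 + \<epsilon> / 3)" .
    have "\<kappa> * hmean p D 0 \<le> \<kappa> * R" using D \<kappa> by (intro mult_left_mono) auto
    also have "\<dots> \<le> \<epsilon> / 3" using frac[OF R] by (simp add: \<kappa>_def mult.commute)
    finally have 2: "ennreal (\<kappa> * hmean p D 0) \<le> ennreal (\<epsilon> / 3)" by (rule ennreal_leI)
    have "area_pow \<mu> l p (dpoly D) \<le> ennreal (\<epsilon> / 3) + ennreal (\<epsilon> / 3 + \<epsilon> / 3)"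
      by (rule order_trans[OF K(2)[OF D(1)] add_mono[OF 2 1]])
    also have "\<dots> = ennreal (\<epsilon> / 3 + (\<epsilon> / 3 + \<epsilon> / 3))" using \<epsilon> by (intro ennreal_plus[symmetric]) auto
    finally show "area_pow \<mu> l p (dpoly D) \<le> ennreal \<epsilon>" by simp
  qed
qed

lemma version_area_pow_le:
  assumes repr: "completion_repr p P a" and le: "\<And>k. area_pow \<mu> l p (dpoly (P k)) \<le> b"
  obtains \<phi> :: "nat \<Rightarrow> nat" and g where "strict_mono \<phi>" "version \<mu> a g" "area_pow \<mu> l p g \<le> b"
    "AE \<omega> in torus_measure. \<forall>s\<in>half_plane. (\<lambda>k. dpoly (P (\<phi> k)) \<omega> s) \<longlonglongrightarrow> g \<omega> s"
proof -
  obtain \<phi> g where g: "strict_mono \<phi>" "version \<mu> a g"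
    "AE \<omega> in torus_measure. \<forall>s\<in>half_plane. (\<lambda>k. dpoly (P (\<phi> k)) \<omega> s) \<longlonglongrightarrow> g \<omega> s"
    by (rule version_exists[OF fin sets p repr])
  have z: "(\<lambda>_. 0) \<in> dirichlet_polys" by (simp add: dirichlet_polys_def)
  have "area_pow \<mu> l p (\<lambda>\<omega> s. g \<omega> s - dpoly (\<lambda>_. 0) \<omega> s) \<le> b"
    by (rule area_pow_Fatou[OF fin sets p l _ z g(3)]) (use le completion_repr_poly[OF p repr] in auto)
  moreover have "dpoly (\<lambda>_. 0) \<omega> s = 0" for \<omega> s by (simp add: dpoly_def dsum_def)
  ultimately show ?thesis using that g by simp
qed

lemma area_operator_in_lp_space:
  assumes "a \<in> dirichlet_hardy p"
  shows "area_operator \<mu> l a \<in> lp_space torus_line_measure p"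
    and "AE x in torus_line_measure. area_integral \<mu> l a x < \<infinity>"
proof -
  obtain P where P: "completion_repr p P a" using assms by (auto simp: dirichlet_hardy_def)
  obtain R where R: "0 \<le> R" "\<And>k. hmean p (P k) 0 \<le> R" using completion_repr_bounded[OF p P] by blast
  obtain B where B: "0 \<le> B" "\<And>D. D \<in> dirichlet_polys \<Longrightarrow> hmean p D 0 \<le> R \<Longrightarrow> area_pow \<mu> l p (dpoly D) \<le> ennreal B"
    by (rule area_pow_bounded[OF R(1)]) (rule that; blast)
  have "area_pow \<mu> l p (dpoly (P k)) \<le> ennreal B" for k by (intro B(2) completion_repr_poly[OF p P] R)
  then obtain \<phi> :: "nat \<Rightarrow> nat" and g where g: "version \<mu> a g" "area_pow \<mu> l p g \<le> ennreal B"
    by (rule version_area_pow_le[OF P])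
  then have "area_pow \<mu> l p g < \<infinity>" using le_less_trans by fastforce
  then show "area_operator \<mu> l a \<in> lp_space torus_line_measure p" "AE x in torus_line_measure. area_integral \<mu> l a x < \<infinity>"
    using area_operator_lp_space[OF fin sets p l g(1)] by auto
qed

lemma poly_in_dirichlet_hardy:
  assumes Q: "Q \<in> dirichlet_polys" shows "Q \<in> dirichlet_hardy p"
proof -
  have "dirichlet_poly_norm p (\<lambda>n. Q n - Q n) = 0"
    using p by (simp add: dirichlet_poly_norm_def lp_norm_def)
  then have "completion_repr p (\<lambda>_. Q) Q" using Q by (simp add: completion_repr_def)
  then show ?thesis by (auto simp: dirichlet_hardy_def)
qed

text \<open>The order of the choices matters: \<open>B\<close> bounds the area functions on the
  ball, \<open>k\<close> makes the nonlinear term small compared with \<open>B\<close>,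
  \<open>\<epsilon>'\<close> compensates the constant \<open>A2\<close>, which is large when
  \<open>k\<close> is small, and only then are the line \<open>\<delta>\<close> and the net on it
  chosen.\<close>

lemma area_operator_net:
  assumes R: "0 \<le> R" and \<epsilon>: "0 < \<epsilon>"
  obtains \<Q> where "finite \<Q>" "\<Q> \<subseteq> dirichlet_polys"
    "\<And>P a. completion_repr p P a \<Longrightarrow> (\<And>k. hmean p (P k) 0 \<le> R) \<Longrightarrow>
      \<exists>Q\<in>\<Q>. lp_pow torus_line_measure p (\<lambda>x. area_operator \<mu> l a x - area_operator \<mu> l Q x) \<le> ennreal \<epsilon>"
proof -
  define c where "c = 2 powr p"
  have c: "0 < c" by (simp add: c_def)
  obtain B where B: "0 \<le> B" "\<And>D. D \<in> dirichlet_polys \<Longrightarrow> hmean p D 0 \<le> R \<Longrightarrow> area_pow \<mu> l p (dpoly D) \<le> ennreal B"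
    by (rule area_pow_bounded[OF R]) (rule that; blast)
  \<comment> \<open>The constant in front of the sizes of the two area functions vanishes as
    \<open>k\<close> decreases to 0.\<close>
  have "((\<lambda>k. (1 + k) powr (1 + 1/l) - 1) \<longlongrightarrow> (1 + 0) powr (1 + 1/l) - 1) (at_right 0)"
    by (intro tendsto_intros) auto
  then have "((\<lambda>k. (1 + k) powr (1 + 1/l) - 1) \<longlongrightarrow> 0) (at_right 0)" by simp
  moreover have "\<forall>\<^sub>F k in at_right 0. 0 \<le> (1 + k) powr (1 + 1/l) - 1"
    using eventually_at_right_less[of 0] by eventually_elim (use l in \<open>simp add: ge_one_powr_ge_zero\<close>)
  ultimately have "((\<lambda>k. ((1 + k) powr (1 + 1/l) - 1) powr p) \<longlongrightarrow> 0 powr p) (at_right 0)"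
    using p by (intro tendsto_powr'[OF _ tendsto_const]) auto
  then have "((\<lambda>k. c * (((1 + k) powr (1 + 1/l) - 1) powr p * (2 * B))) \<longlongrightarrow> c * (0 powr p * (2 * B))) (at_right 0)"
    by (intro tendsto_mult[OF tendsto_const] tendsto_mult[OF _ tendsto_const])
  then have "\<forall>\<^sub>F k in at_right 0. c * (((1 + k) powr (1 + 1/l) - 1) powr p * (2 * B)) < \<epsilon> / 2"
    using p \<epsilon> by (intro order_tendstoD(2)) auto
  then have "\<forall>\<^sub>F k in at_right 0. c * (((1 + k) powr (1 + 1/l) - 1) powr p * (2 * B)) < \<epsilon> / 2 \<and> (0::real) < k"
    by (intro eventually_conj eventually_at_right_less)
  then obtain k where k: "c * (((1 + k) powr (1 + 1/l) - 1) powr p * (2 * B)) < \<epsilon> / 2" "0 < k"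
    using eventually_happens'[OF trivial_limit_at_right_real[of 0]] by blast
  define A1 where "A1 = ((1 + k) powr (1 + 1/l) - 1) powr p"
  define A2 where "A2 = ((1 + 1/k) powr (1 + 1/l)) powr p"
  have "0 < 1/k" using k by simp
  then have A: "0 \<le> A1" "0 < A2" by (simp_all add: A1_def A2_def add_nonneg_eq_0_iff)
  define \<epsilon>' where "\<epsilon>' = \<epsilon> / (2 * c * A2)"
  have \<epsilon>': "0 < \<epsilon>'" using \<epsilon> c A by (simp add: \<epsilon>'_def)
  have "0 \<le> c * (R + R)" using c R by simp
  then obtain \<delta> \<eta> where d: "0 < \<delta>" "0 < \<eta>"
    "\<And>D. D \<in> dirichlet_polys \<Longrightarrow> hmean p D 0 \<le> c * (R + R) \<Longrightarrow> hmean p D \<delta> \<le> \<eta> \<Longrightarrow> area_pow \<mu> l p (dpoly D) \<le> ennreal \<epsilon>'"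
    by (rule area_pow_small[OF _ \<epsilon>']) (rule that; blast)
  \<comment> \<open>One share for the net and one for the Cauchy property, combined by the
    quasi-triangle inequality with constant \<open>c\<close>.\<close>
  define \<eta>' where "\<eta>' = \<eta> / (2 * c)"
  have \<eta>': "0 < \<eta>'" "c * (\<eta>' + \<eta>') = \<eta>" using d c by (auto simp: \<eta>'_def)
  obtain \<Q> where \<Q>: "finite \<Q>" "\<Q> \<subseteq> {P \<in> dirichlet_polys. hmean p P 0 \<le> R}"
    "\<And>P. P \<in> dirichlet_polys \<Longrightarrow> hmean p P 0 \<le> R \<Longrightarrow> \<exists>Q\<in>\<Q>. hmean p (\<lambda>n. P n - Q n) \<delta> \<le> \<eta>'"
    by (rule hmean_finite_net[OF p d(1) \<eta>'(1) R]) (rule that; blast)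
  show ?thesis
  proof (rule that[OF \<Q>(1)])
    show "\<Q> \<subseteq> dirichlet_polys" using \<Q>(2) by blast
    fix P a assume P: "completion_repr p P a" "\<And>k. hmean p (P k) 0 \<le> R"
    note poly = completion_repr_poly[OF p P(1)]
    obtain K where K: "\<And>j k. K \<le> j \<Longrightarrow> K \<le> k \<Longrightarrow> hmean p (\<lambda>n. P j n - P k n) 0 < \<eta>'"
      using completion_repr_cauchy[OF p P(1) \<eta>'(1)] by blast
    \<comment> \<open>The element of the net is chosen for the single polynomial \<open>P K\<close>.
      The Cauchy property makes it serve all later members of the sequence, and Fatou's lemma the
      limit.\<close>
    obtain Q where Q: "Q \<in> \<Q>" "hmean p (\<lambda>n. P K n - Q n) \<delta> \<le> \<eta>'" using \<Q>(3)[OF poly P(2)] by blast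
    have Qp: "Q \<in> dirichlet_polys" and QR: "hmean p Q 0 \<le> R" using Q(1) \<Q>(2) by auto
    have near: "area_pow \<mu> l p (dpoly (\<lambda>n. P j n - Q n)) \<le> ennreal \<epsilon>'" if j: "K \<le> j" for j
    proof (rule d(3)[OF dirichlet_polys_diff[OF poly Qp]])
      show "hmean p (\<lambda>n. P j n - Q n) 0 \<le> c * (R + R)"
        using hmean_diff_le[OF poly Qp p order_refl, of j] P(2)[of j] QR c
        by (smt (verit) mult_left_mono c_def)
      have D1: "(\<lambda>n. P j n - P K n) \<in> dirichlet_polys" "(\<lambda>n. Q n - P K n) \<in> dirichlet_polys"
        by (intro dirichlet_polys_diff poly Qp)+
      have "hmean p (\<lambda>n. P j n - Q n) \<delta> = hmean p (\<lambda>n. (P j n - P K n) - (Q n - P K n)) \<delta>"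
        by (rule arg_cong[of _ _ "\<lambda>D. hmean p D \<delta>"]) (simp add: fun_eq_iff)
      also have "\<dots> \<le> c * (hmean p (\<lambda>n. P j n - P K n) \<delta> + hmean p (\<lambda>n. Q n - P K n) \<delta>)"
        unfolding c_def using d(1) by (intro hmean_diff_le[OF D1 p]) simp
      also have "\<dots> \<le> c * (\<eta>' + \<eta>')"
      proof (intro mult_left_mono add_mono)
        show "hmean p (\<lambda>n. P j n - P K n) \<delta> \<le> \<eta>'"
          using hmean_le[OF D1(1) p, of \<delta>] d(1) K[OF j order_refl] by simp
        show "hmean p (\<lambda>n. Q n - P K n) \<delta> \<le> \<eta>'" using Q(2) hmean_commute[OF Qp poly] by simp
      qed (use c in simp)
      finally show "hmean p (\<lambda>n. P j n - Q n) \<delta> \<le> \<eta>" unfolding \<eta>'(2) .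
    qed
    have "area_pow \<mu> l p (dpoly (P j)) \<le> ennreal B" for j by (intro B poly P(2))
    then obtain \<phi> g where g: "strict_mono \<phi>" "version \<mu> a g" "area_pow \<mu> l p g \<le> ennreal B"
      "AE \<omega> in torus_measure. \<forall>s\<in>half_plane. (\<lambda>k. dpoly (P (\<phi> k)) \<omega> s) \<longlonglongrightarrow> g \<omega> s"
      by (rule version_area_pow_le[OF P(1)])
    have diff: "area_pow \<mu> l p (\<lambda>\<omega> s. g \<omega> s - dpoly Q \<omega> s) \<le> ennreal \<epsilon>'"
    proof (rule area_pow_Fatou[OF fin sets p l poly Qp g(4)])
      show "\<forall>\<^sub>F k in sequentially. area_pow \<mu> l p (dpoly (\<lambda>n. P (\<phi> k) n - Q n)) \<le> ennreal \<epsilon>'"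
        using near le_trans[OF _ seq_suble[OF g(1)]] by (auto simp: eventually_sequentially intro!: exI[of _ K])
    qed
    have "lp_pow torus_line_measure p (\<lambda>x. area_operator \<mu> l a x - area_operator \<mu> l Q x) \<le>
      ennreal c * (ennreal A1 * (area_pow \<mu> l p g + area_pow \<mu> l p (dpoly Q)) + ennreal A2 * area_pow \<mu> l p (\<lambda>\<omega> s. g \<omega> s - dpoly Q \<omega> s))"
      unfolding c_def A1_def A2_def by (rule area_operator_diff_le[OF fin sets p l k(2) g(2) version_poly[OF fin sets p Qp]])
    also have "\<dots> \<le> ennreal c * (ennreal A1 * (ennreal B + ennreal B) + ennreal A2 * ennreal \<epsilon>')"
      by (intro mult_left_mono add_mono g diff B(2)[OF Qp QR]) auto
    also have "\<dots> = ennreal (c * (A1 * (2 * B)) + c * (A2 * \<epsilon>'))"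
      using c A B(1) \<epsilon>' by (simp add: ennreal_mult'[symmetric] ennreal_plus[symmetric] distrib_left del: ennreal_plus)
    also have "\<dots> \<le> ennreal \<epsilon>"
    proof (rule ennreal_leI)
      have "c * (A2 * \<epsilon>') = \<epsilon> / 2" using c A by (simp add: \<epsilon>'_def)
      then show "c * (A1 * (2 * B)) + c * (A2 * \<epsilon>') \<le> \<epsilon>" using k(1) by (simp add: A1_def)
    qed
    finally show "\<exists>Q\<in>\<Q>. lp_pow torus_line_measure p (\<lambda>x. area_operator \<mu> l a x - area_operator \<mu> l Q x) \<le> ennreal \<epsilon>"
      using Q(1) by blast
  qed
qed

lemma area_operator_compact:
  "compact_map (dirichlet_hardy p) (dirichlet_hardy_norm p) (lp_topology torus_line_measure p) (area_operator \<mu> l)"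
  unfolding compact_map_def
proof (intro allI impI, elim exE)
  fix B M assume B: "B \<subseteq> dirichlet_hardy p" and M: "\<forall>a\<in>B. dirichlet_hardy_norm p a \<le> M"
  show "relatively_compact_in (lp_topology torus_line_measure p) (area_operator \<mu> l ` B)"
  proof (rule lp_relatively_compact[OF p])
    show "area_operator \<mu> l ` B \<subseteq> lp_space torus_line_measure p" using area_operator_in_lp_space(1) B by blast
    fix \<epsilon> :: real assume \<epsilon>: "0 < \<epsilon>"
    \<comment> \<open>Replacing \<open>M\<close> by \<open>M + 1\<close> provides the strict
      inequality that \<open>bounded_representative\<close> asks for.\<close>
    have R: "0 \<le> (M + 1) powr p" by simp
    obtain \<Q> where \<Q>: "finite \<Q>" "\<Q> \<subseteq> dirichlet_polys"
      "\<And>P a. completion_repr p P a \<Longrightarrow> (\<And>k. hmean p (P k) 0 \<le> (M + 1) powr p) \<Longrightarrow>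
        \<exists>Q\<in>\<Q>. lp_pow torus_line_measure p (\<lambda>x. area_operator \<mu> l a x - area_operator \<mu> l Q x) \<le> ennreal \<epsilon>"
      by (rule area_operator_net[OF R \<epsilon>]) (rule that; blast)
    have "\<exists>G\<in>area_operator \<mu> l ` \<Q>. lp_pow torus_line_measure p (\<lambda>x. F x - G x) \<le> ennreal \<epsilon>"
      if "F \<in> area_operator \<mu> l ` B" for F
    proof -
      obtain a where a: "a \<in> B" "F = area_operator \<mu> l a" using \<open>F \<in> area_operator \<mu> l ` B\<close> by blast
      have "dirichlet_hardy_norm p a < M + 1" using M a(1) by force
      then obtain P where "completion_repr p P a" "\<And>k. hmean p (P k) 0 \<le> (M + 1) powr p"
        using bounded_representative[OF p] a B by blast
      from \<Q>(3)[OF this] show ?thesis unfolding a(2) by blast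
    qed
    moreover have "area_operator \<mu> l ` \<Q> \<subseteq> lp_space torus_line_measure p"
      using \<Q>(2) poly_in_dirichlet_hardy area_operator_in_lp_space(1) by blast
    ultimately show "\<exists>Y. finite Y \<and> Y \<subseteq> lp_space torus_line_measure p \<and>
      (\<forall>F\<in>area_operator \<mu> l ` B. \<exists>G\<in>Y. lp_pow torus_line_measure p (\<lambda>x. F x - G x) \<le> ennreal \<epsilon>)"
      using \<Q>(1) by blast
  qed
qed

end

theorem theorem5p5:
  fixes p l :: real and \<mu> :: "complex measure"
  assumes "0 < p" and "0 < l"
    and "sets \<mu> = sets (restrict_space borel half_plane)"
    and "compact_map (hpi_space p) (hpi_norm p) (lp_topology \<mu> p) (\<lambda>f. f)"
  shows "(\<forall>a\<in>dirichlet_hardy p. AE x in torus_line_measure. area_integral \<mu> l a x < \<infinity>) \<and>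
    compact_map (dirichlet_hardy p) (dirichlet_hardy_norm p)
      (lp_topology torus_line_measure p) (area_operator \<mu> l)"
proof -
  obtain C where C: "0 \<le> C" "\<And>f. f \<in> hpi_space p \<Longrightarrow> (\<integral>\<^sup>+s. ennreal (cmod (f s) powr p) \<partial>\<mu>) \<le> ennreal C * hpi_integral p f"
    by (rule compact_embedding_bounded[OF assms(1,4)]) (rule that; blast)
  note fin = compact_embedding_finite_measure[OF assms(1) C]
  show ?thesis
    using area_operator_in_lp_space(2)[OF fin assms(3,1,2) C] area_operator_compact[OF fin assms(3,1,2) C] by blast
qed

end
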